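(* For every fixed integer $s\geq 1$, the problems $s$-Diamond-free Edge Deletion and $s$-Diamond-free Edge Editing are NP-complete even when the input graph is $K_4$-free. Further, unless the Exponential Time Hypothesis fails, these problems restricted to $K_4$-free input graphs can be solved neither in time $2^{o(|G|)}$ nor in time $2^{o(k)}\cdot |G|^{O(1)}$.
   Context: All graphs are finite, simple and undirected; $|G|$ denotes the size (number of vertices) of the input graph $G$. For $s\geq 1$, the $s$-diamond is the graph $K_2\times (s+1)K_1$: two adjacent vertices, each adjacent to every vertex of an independent set of $s+1$ further vertices (the $1$-diamond is $K_4$ minus an edge). $s$-Diamond-free Edge Deletion: given a graph $G$ and an integer $k$, decide whether there is $F\subseteq E(G)$ with $|F|\leq k$ such that $G-F$ contains no induced $s$-diamond. $s$-Diamond-free Edge Editing: decide whether there is a set $F$ of at most $k$ unordered pairs of distinct vertices of $G$ such that the graph $G\triangle F$ (toggle adjacency of each pair in $F$) contains no induced $s$-diamond. The Exponential Time Hypothesis (ETH) asserts that 3-SAT on $n$ variables cannot be solved in time $2^{o(n)}$. *)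

theory Defs
  imports Complex_Main "HOL-Library.Landau_Symbols"
begin

section \<open>Turing machines\<close>

text \<open>
  Deterministic multi-tape machines with two-way infinite tapes. States and tape symbols are
  initial segments of the naturals. Symbol 0 is the blank, symbols 1 and 2 stand for the bits
  \<open>False\<close> and \<open>True\<close>. State 0 is initial; the only halting states are 1 (accept) and 2 (reject).
\<close>

datatype move = MoveLeft | MoveStay | MoveRight

record tm =
  tm_tapes :: nat
  tm_symbols :: nat
  tm_states :: nat
  tm_delta :: "nat \<Rightarrow> nat list \<Rightarrow> nat \<times> (nat \<times> move) list"

definition turing_machine :: "tm \<Rightarrow> bool" where
  "turing_machine M \<longleftrightarrow>
     tm_tapes M \<ge> 1 \<and> tm_symbols M \<ge> 3 \<and> tm_states M \<ge> 3 \<and>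
     (\<forall>q < tm_states M. \<forall>rs. length rs = tm_tapes M \<and> set rs \<subseteq> {..<tm_symbols M} \<longrightarrow>
        (case tm_delta M q rs of (q', as) \<Rightarrow>
           q' < tm_states M \<and> length as = tm_tapes M \<and> fst ` set as \<subseteq> {..<tm_symbols M}))"

type_synonym tape = "(int \<Rightarrow> nat) \<times> int"
type_synonym config = "nat \<times> tape list"

abbreviation (input) accept_state :: nat where "accept_state \<equiv> 1"
abbreviation (input) reject_state :: nat where "reject_state \<equiv> 2"

fun move_offset :: "move \<Rightarrow> int" where
  "move_offset MoveLeft = -1"
| "move_offset MoveStay = 0"
| "move_offset MoveRight = 1"

definition tape_act :: "tape \<Rightarrow> nat \<times> move \<Rightarrow> tape" where
  "tape_act = (\<lambda>(c, h) (a, d). (c(h := a), h + move_offset d))"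

definition tm_step :: "tm \<Rightarrow> config \<Rightarrow> config" where
  "tm_step M = (\<lambda>(q, ts).
     if q = accept_state \<or> q = reject_state then (q, ts)
     else (case tm_delta M q (map (\<lambda>(c, h). c h) ts) of (q', as) \<Rightarrow> (q', map2 tape_act ts as)))"

definition string_tape :: "bool list \<Rightarrow> int \<Rightarrow> nat" where
  "string_tape x i =
     (if 0 \<le> i \<and> i < int (length x) then (if x ! nat i then 2 else 1) else 0)"

definition tm_init :: "tm \<Rightarrow> bool list \<Rightarrow> config" where
  "tm_init M x = (0, (string_tape x, 0) # replicate (tm_tapes M - 1) (\<lambda>_. 0, 0))"

definition tm_run :: "tm \<Rightarrow> bool list \<Rightarrow> nat \<Rightarrow> config" where
  "tm_run M x t = (tm_step M ^^ t) (tm_init M x)"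

section \<open>Solvability within a time bound, NP-completeness\<close>

text \<open>
  \<open>I\<close> is the set of admissible instances: nothing is required of the machine on strings that do
  not encode an element of \<open>I\<close>.
\<close>

definition solvable_within ::
    "('a \<Rightarrow> bool list) \<Rightarrow> 'a set \<Rightarrow> ('a \<Rightarrow> bool) \<Rightarrow> ('a \<Rightarrow> real) \<Rightarrow> bool" where
  "solvable_within enc I Y T \<longleftrightarrow>
     (\<exists>M. turing_machine M \<and>
       (\<forall>x\<in>I. \<exists>t. real t \<le> T x \<and>
          fst (tm_run M (enc x) t) = (if Y x then accept_state else reject_state)))"

definition polytime_decidable :: "bool list set \<Rightarrow> bool" where
  "polytime_decidable L \<longleftrightarrow>
     (\<exists>c. solvable_within (\<lambda>x. x) UNIV (\<lambda>x. x \<in> L) (\<lambda>x. real (length x ^ c + c)))"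

text \<open>The output of a function-computing machine is the content of its last tape.\<close>

definition polytime_computable :: "(bool list \<Rightarrow> bool list) \<Rightarrow> bool" where
  "polytime_computable f \<longleftrightarrow>
     (\<exists>M c. turing_machine M \<and>
       (\<forall>x. \<exists>t \<le> length x ^ c + c.
          fst (tm_run M x t) = accept_state \<and>
          fst (last (snd (tm_run M x t))) = string_tape (f x)))"

definition string_pair :: "bool list \<Rightarrow> bool list \<Rightarrow> bool list" where
  "string_pair x w = concat (map (\<lambda>b. [True, b]) x) @ False # w"

definition in_NP :: "bool list set \<Rightarrow> bool" where
  "in_NP L \<longleftrightarrow>
     (\<exists>V c. polytime_decidable V \<and>
       (\<forall>x. x \<in> L \<longleftrightarrow> (\<exists>w. length w \<le> length x ^ c + c \<and> string_pair x w \<in> V)))"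

definition polytime_reducible :: "bool list set \<Rightarrow> bool list set \<Rightarrow> bool" where
  "polytime_reducible A B \<longleftrightarrow> (\<exists>f. polytime_computable f \<and> (\<forall>x. x \<in> A \<longleftrightarrow> f x \<in> B))"

definition NP_hard :: "bool list set \<Rightarrow> bool" where
  "NP_hard L \<longleftrightarrow> (\<forall>A. in_NP A \<longrightarrow> polytime_reducible A L)"

definition NP_complete :: "bool list set \<Rightarrow> bool" where
  "NP_complete L \<longleftrightarrow> in_NP L \<and> NP_hard L"

section \<open>3-SAT and the Exponential Time Hypothesis\<close>

text \<open>
  A literal is a variable with a sign. Clauses of a formula are not repeated, so the size of a
  formula on \<open>n\<close> variables is polynomial in \<open>n\<close>; with repetitions allowed, no machine could even
  read its input in time depending on \<open>n\<close> alone and the hypothesis below would hold trivially.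
\<close>

type_synonym cnf = "(nat \<times> bool) list list"

definition three_sat_instances :: "(nat \<times> cnf) set" where
  "three_sat_instances =
     {(n, \<phi>). distinct \<phi> \<and> (\<forall>C\<in>set \<phi>. length C \<le> 3 \<and> (\<forall>(v, b)\<in>set C. v < n))}"

definition satisfiable :: "cnf \<Rightarrow> bool" where
  "satisfiable \<phi> \<longleftrightarrow> (\<exists>\<alpha> :: nat \<Rightarrow> bool. \<forall>C\<in>set \<phi>. \<exists>(v, b)\<in>set C. \<alpha> v = b)"

definition encode_unary :: "nat \<Rightarrow> bool list" where
  "encode_unary n = replicate n True @ [False]"

definition encode_clause :: "(nat \<times> bool) list \<Rightarrow> bool list" where
  "encode_clause C = concat (map (\<lambda>(v, b). True # b # encode_unary v) C) @ [False]"

fun encode_cnf :: "nat \<times> cnf \<Rightarrow> bool list" where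
  "encode_cnf (n, \<phi>) = encode_unary n @ concat (map encode_clause \<phi>)"

definition ETH :: bool where
  "ETH \<longleftrightarrow>
     \<not> (\<exists>f :: nat \<Rightarrow> real. f \<in> o(\<lambda>n. real n) \<and>
          solvable_within encode_cnf three_sat_instances (\<lambda>(n, \<phi>). satisfiable \<phi>)
            (\<lambda>(n, \<phi>). 2 powr f n))"

section \<open>Graphs and edge modification problems\<close>

type_synonym 'a graph = "'a set \<times> 'a set set"

abbreviation verts :: "'a graph \<Rightarrow> 'a set" where "verts \<equiv> fst"
abbreviation edges :: "'a graph \<Rightarrow> 'a set set" where "edges \<equiv> snd"

definition vertex_pairs :: "'a set \<Rightarrow> 'a set set" where
  "vertex_pairs V = {e. e \<subseteq> V \<and> card e = 2}"

definition simple_graph :: "'a graph \<Rightarrow> bool" where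
  "simple_graph G \<longleftrightarrow> finite (verts G) \<and> edges G \<subseteq> vertex_pairs (verts G)"

definition has_induced :: "'a graph \<Rightarrow> 'b graph \<Rightarrow> bool" where
  "has_induced G H \<longleftrightarrow>
     (\<exists>g. inj_on g (verts H) \<and> g ` verts H \<subseteq> verts G \<and>
        (\<forall>u\<in>verts H. \<forall>v\<in>verts H. {g u, g v} \<in> edges G \<longleftrightarrow> {u, v} \<in> edges H))"

definition complete_graph :: "nat \<Rightarrow> nat graph" where
  "complete_graph n = ({..<n}, vertex_pairs {..<n})"

definition diamond :: "nat \<Rightarrow> nat graph" where
  "diamond s = ({..<s + 3}, insert {0, 1} {{i, j} | i j. i < 2 \<and> 2 \<le> j \<and> j < s + 3})"

definition diamond_free_edge_deletion :: "nat \<Rightarrow> 'a graph \<times> nat \<Rightarrow> bool" where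
  "diamond_free_edge_deletion s = (\<lambda>(G, k).
     \<exists>F. F \<subseteq> edges G \<and> card F \<le> k \<and> \<not> has_induced (verts G, edges G - F) (diamond s))"

definition diamond_free_edge_editing :: "nat \<Rightarrow> 'a graph \<times> nat \<Rightarrow> bool" where
  "diamond_free_edge_editing s = (\<lambda>(G, k).
     \<exists>F. F \<subseteq> vertex_pairs (verts G) \<and> card F \<le> k \<and>
         \<not> has_induced (verts G, (edges G - F) \<union> (F - edges G)) (diamond s))"

text \<open>Input graphs have vertex set \<open>{0, \<dots>, n - 1}\<close>.\<close>

definition K4_free_instances :: "(nat graph \<times> nat) set" where
  "K4_free_instances =
     {(G, k). simple_graph G \<and> (\<exists>n. verts G = {..<n}) \<and> \<not> has_induced G (complete_graph 4)}"

fun encode_binary :: "nat \<Rightarrow> bool list" where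
  "encode_binary n = (if n = 0 then [] else odd n # encode_binary (n div 2))"

declare encode_binary.simps [simp del]

text \<open>The number of vertices in unary, the adjacency matrix row by row, and \<open>k\<close> in binary.\<close>

fun encode_instance :: "nat graph \<times> nat \<Rightarrow> bool list" where
  "encode_instance (G, k) =
     (let n = card (verts G) in
        encode_unary n @ [{i, j} \<in> edges G. i \<leftarrow> [0..<n], j \<leftarrow> [0..<n]] @ encode_binary k)"

definition K4_free_language :: "(nat graph \<times> nat \<Rightarrow> bool) \<Rightarrow> bool list set" where
  "K4_free_language Y = encode_instance ` {x \<in> K4_free_instances. Y x}"

definition subexp_size_solvable :: "(nat graph \<times> nat \<Rightarrow> bool) \<Rightarrow> bool" where
  "subexp_size_solvable Y \<longleftrightarrow>
     (\<exists>f :: nat \<Rightarrow> real. f \<in> o(\<lambda>n. real n) \<and>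
        solvable_within encode_instance K4_free_instances Y
          (\<lambda>(G, k). 2 powr f (card (verts G))))"

text \<open>
  The base of the polynomial factor is \<open>|G| + 1\<close>, since \<open>|G|\<close> itself would force running time 0
  on the graph without vertices, which no machine meets.
\<close>

definition subexp_param_solvable :: "(nat graph \<times> nat \<Rightarrow> bool) \<Rightarrow> bool" where
  "subexp_param_solvable Y \<longleftrightarrow>
     (\<exists>(f :: nat \<Rightarrow> real) (c :: nat). f \<in> o(\<lambda>k. real k) \<and>
        solvable_within encode_instance K4_free_instances Y
          (\<lambda>(G, k). 2 powr f k * real (card (verts G) + 1) ^ c))"

end

theory Submission
  imports Defs
begin

text \<open>
  The strip of a variable is a cyclic sequence of triangles in which consecutive triangles share an
  edge. The third edge of each triangle has \<open>s\<close> further common neighbours, so every triangle spans an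
  \<open>s\<close>-diamond that has to be destroyed. A cheapest solution deletes every second shared edge of the
  cycle, which can be done in two ways: these are the truth values. A clause is another such triangle,
  each edge of which is also a shared edge of the strip of one of its literals, at a position whose
  parity is the sign of the literal. It is hit at no extra cost iff one of its literals is true. The
  graph is 3-colourable and hence \<open>K\<^sub>4\<close>-free, counting modified pairs shows that editing is no cheaper
  than deletion, and the number of vertices and the budget are linear in the number of clauses.

  NP-hardness follows by composing this with the tableau formula of a verifier. For the lower bounds,
  branching on sunflowers of clauses as in the sparsification lemma turns a 3-CNF formula on \<open>n\<close>
  variables into \<open>2\<close> to the \<open>\<epsilon>n\<close> formulas with \<open>O(n)\<close> clauses, each of which is reduced and given to the
  assumed algorithm.
\<close>

section \<open>Structured tape programs\<close>

text \<open>Two obstacles shape the development. Machines are concrete, so each map used in a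
  reduction has to be executed by one. Programs on stacks that hold binary trees yield a class
  \<open>pt\<close> of functions on encodable types, closed under composition, case distinction and
  iteration with bounded intermediate sizes; afterwards machines are met only through
  \<open>pt\<close>. The search of the lower bound takes exponential time and is run by one machine
  that loops over a polynomial body.

  The counting behind editing: the diamonds at even positions of the strips, and likewise those at
  odd positions, pairwise share no pair of vertices, and each family has as many members as the
  budget. A solution therefore spends exactly one pair on each diamond of both families, so each of
  its pairs lies in two diamonds, and only shared edges do.

  A block of a strip has 18 positions: the length must be even for the alternation of truth values
  and divisible by 3 for the colouring, and identified positions must stay away from both ends of
  the block.\<close>

datatype com = Mv nat move | Wr nat nat | Seq com com (infixr ";;" 60)
  | Cond nat "nat \<Rightarrow> bool" com com | Loop nat "nat \<Rightarrow> bool" com | Stop bool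

text \<open>Control is a stack of pending commands. A loop puts itself back below its body, so
  returning from the body needs no jump.\<close>

fun next_code :: "com list \<Rightarrow> nat list \<Rightarrow> com list" where
  "next_code (Seq a b # k) rs = a # b # k"
| "next_code (Cond i P a b # k) rs = (if P (rs ! i) then a # k else b # k)"
| "next_code (Loop i P c # k) rs = (if P (rs ! i) then c # Loop i P c # k else k)"
| "next_code (c # k) rs = k"
| "next_code [] rs = []"

fun code_acts :: "com list \<Rightarrow> nat list \<Rightarrow> (nat \<times> move) list" where
  "code_acts (Mv i d # k) rs = (map (\<lambda>a. (a, MoveStay)) rs)[i := (rs ! i, d)]"
| "code_acts (Wr i a # k) rs = (map (\<lambda>a. (a, MoveStay)) rs)[i := (a, MoveStay)]"
| "code_acts k rs = map (\<lambda>a. (a, MoveStay)) rs"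

fun stopped :: "com list \<Rightarrow> bool" where
  "stopped (Stop b # k) = True"
| "stopped k = False"

definition reads :: "tape list \<Rightarrow> nat list" where
  "reads ts = map (\<lambda>(c, h). c h) ts"

fun cstep :: "com list \<times> tape list \<Rightarrow> com list \<times> tape list" where
  "cstep (k, ts) = (if stopped k then (k, ts)
     else (next_code k (reads ts), map2 tape_act ts (code_acts k (reads ts))))"

text \<open>An upper bound for the control stacks that arise while \<open>c\<close> runs on top of
  \<open>k\<close>. The body of a loop runs on the same stack in every round, which keeps the set
  finite; its elements become the states of a machine.\<close>

fun conts :: "com \<Rightarrow> com list \<Rightarrow> com list set" where
  "conts (Seq a b) k = insert (Seq a b # k) (conts a (b # k) \<union> conts b k)"
| "conts (Cond i P a b) k = insert (Cond i P a b # k) (conts a k \<union> conts b k)"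
| "conts (Loop i P c) k = insert k (insert (Loop i P c # k) (conts c (Loop i P c # k)))"
| "conts c k = {c # k, k}"

fun max_sym :: "com \<Rightarrow> nat" where
  "max_sym (Wr i a) = a"
| "max_sym (Seq a b) = max (max_sym a) (max_sym b)"
| "max_sym (Cond i P a b) = max (max_sym a) (max_sym b)"
| "max_sym (Loop i P c) = max_sym c"
| "max_sym _ = 0"

lemma finite_conts: "finite (conts c k)"
  by (induction c k rule: conts.induct) auto

lemma conts_self: "c # k \<in> conts c k" "k \<in> conts c k"
  by (induction c k rule: conts.induct) auto

lemma conts_closed:
  "cs \<in> conts c k \<Longrightarrow> cs = k \<or> stopped cs \<or> next_code cs rs \<in> conts c k"
proof (induction c k rule: conts.induct)
  case (1 a b k)
  then show ?case using conts_self(1)[of b k] conts_self(2)[of k b] conts_self(1)[of a "b # k"] by auto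
next
  case (2 i P a b k)
  then show ?case using conts_self(1)[of b k] conts_self(1)[of a k] by auto
next
  case (3 i P c k)
  then show ?case using conts_self(1)[of c "Loop i P c # k"] by (auto split: if_splits)
qed auto

lemma conts_max_sym:
  "cs \<in> conts c k \<Longrightarrow> max_sym c \<le> m \<Longrightarrow> \<forall>d\<in>set k. max_sym d \<le> m \<Longrightarrow> \<forall>d\<in>set cs. max_sym d \<le> m"
  by (induction c k rule: conts.induct) auto

lemma code_acts_valid:
  assumes "\<forall>d\<in>set cs. max_sym d < S" "set rs \<subseteq> {..<S}"
  shows "length (code_acts cs rs) = length rs" "fst ` set (code_acts cs rs) \<subseteq> {..<S}"
proof -
  have *: "fst ` set (ps[i := p]) \<subseteq> {..<S}"
    if "fst ` set ps \<subseteq> {..<S}" "i < length ps \<longrightarrow> fst p < S" for ps :: "(nat \<times> move) list" and i p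
  proof (cases "i < length ps")
    case True
    then show ?thesis using that set_update_subset_insert[of ps i p] by auto
  qed (use that in \<open>auto simp: list_update_beyond\<close>)
  have m: "fst ` set (map (\<lambda>a. (a, MoveStay)) rs) \<subseteq> {..<S}"
    using assms(2) by auto
  show "length (code_acts cs rs) = length rs"
    by (induction cs rs rule: code_acts.induct) auto
  show "fst ` set (code_acts cs rs) \<subseteq> {..<S}"
    using assms m
    by (induction cs rs rule: code_acts.induct)
       (simp_all only: code_acts.simps, (rule *; force simp: subset_iff)+)
qed

definition init_tapes :: "nat \<Rightarrow> bool list \<Rightarrow> tape list" where
  "init_tapes K x = (string_tape x, 0) # replicate (K - 1) (\<lambda>_. 0, 0)"

text \<open>The control stacks are numbered to serve as states. A \<open>Stop\<close> on top halts
  whatever lies below it, so all such stacks are merged into the states 1 and 2; the hypothesis on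
  \<open>c\<close> keeps them apart from the initial state 0.\<close>

lemma program_machine:
  assumes K: "K \<ge> 1" and c: "\<not> stopped [c]"
  shows "\<exists>M. turing_machine M \<and> (\<forall>x t b k ts.
      (cstep ^^ t) ([c], init_tapes K x) = (Stop b # k, ts) \<longrightarrow>
      tm_run M x t = (if b then accept_state else reject_state, ts))"
proof -
  define S where "S = conts c []"
  obtain g where g: "bij_betw g S {0..<card S}"
    using ex_bij_betw_finite_nat finite_conts S_def by blast
  \<comment> \<open>The initial stack is state 0 also when it is reached again; all other running
    stacks are shifted past the three reserved numbers.\<close>
  define num where "num cs = (if cs = [c] then 0 else case cs of Stop b # _ \<Rightarrow> (if b then 1 else 2)
     | _ \<Rightarrow> 3 + g cs)" for cs
  define NS where "NS = {cs \<in> S. \<not> stopped cs}"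
  have num_ns: "num cs = (if cs = [c] then 0 else 3 + g cs)" if "\<not> stopped cs" for cs
    using that by (auto simp: num_def split: list.split com.split)
  have num_s: "num (Stop b # k) = (if b then 1 else 2)" for b k
    using c by (auto simp: num_def)
  have inj: "inj_on num NS"
    using g by (auto simp: inj_on_def NS_def num_ns bij_betw_def)
  have num_less: "num cs < 3 + card S" if "cs \<in> S" for cs
  proof (cases "stopped cs")
    case True
    then show ?thesis by (cases cs rule: stopped.cases) (auto simp: num_s)
  next
    case False
    then show ?thesis using g that by (auto simp: num_ns bij_betw_def)
  qed
  define dec where "dec = inv_into NS num"
  have dec: "dec (num cs) = cs" if "cs \<in> NS" for cs
    using inj that by (simp add: dec_def)
  have step_S: "next_code cs rs \<in> S" if "cs \<in> NS" for cs rs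
    using conts_closed[of cs c "[]" rs] that conts_self(2)[of "[]" c] by (auto simp: S_def NS_def)
  \<comment> \<open>Numbers that belong to no running stack idle, because
    \<open>turing_machine\<close> constrains the transition function at every state.\<close>
  define M where "M = \<lparr>tm_tapes = K, tm_symbols = 3 + max_sym c, tm_states = 3 + card S,
     tm_delta = (\<lambda>q rs. if q \<in> num ` NS then (num (next_code (dec q) rs), code_acts (dec q) rs)
        else (q, map (\<lambda>a. (a, MoveStay)) rs))\<rparr>"
  have "turing_machine M"
  proof -
    have "case tm_delta M q rs of (q', as) \<Rightarrow> q' < tm_states M \<and> length as = tm_tapes M
        \<and> fst ` set as \<subseteq> {..<tm_symbols M}"
      if "q < tm_states M" "length rs = tm_tapes M" "set rs \<subseteq> {..<tm_symbols M}" for q rs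
    proof (cases "q \<in> num ` NS")
      case True
      then obtain cs where cs: "cs \<in> NS" "q = num cs" by auto
      have "\<forall>d\<in>set cs. max_sym d < 3 + max_sym c"
        using conts_max_sym[of cs c "[]" "max_sym c"] cs by (fastforce simp: NS_def S_def)
      note v = code_acts_valid[OF this]
      show ?thesis
        using True that v[of rs] num_less[OF step_S[OF cs(1)]] cs dec[OF cs(1)] by (auto simp: M_def)
    qed (use that in \<open>auto simp: M_def\<close>)
    then show ?thesis using K unfolding turing_machine_def by (auto simp: M_def)
  qed
  moreover have "tm_run M x t = (if b then accept_state else reject_state, ts)"
    if run: "(cstep ^^ t) ([c], init_tapes K x) = (Stop b # k, ts)" for x t b k ts
  proof -
    have sim: "fst (cstep (cs, us)) \<in> S \<and>
        tm_step M (num cs, us) = (num (fst (cstep (cs, us))), snd (cstep (cs, us)))"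
      if "cs \<in> S" for cs us
    proof (cases "stopped cs")
      case True
      then show ?thesis using that
        by (cases cs rule: stopped.cases) (auto simp: num_s tm_step_def)
    next
      case False
      then have ns: "cs \<in> NS" using that by (simp add: NS_def)
      have "num cs \<noteq> 1" "num cs \<noteq> 2" using False by (auto simp: num_ns)
      then show ?thesis using False ns dec[OF ns] step_S[OF ns]
        by (auto simp: tm_step_def M_def reads_def)
    qed
    have "fst ((cstep ^^ n) ([c], us)) \<in> S \<and> (tm_step M ^^ n) (num [c], us) =
        (num (fst ((cstep ^^ n) ([c], us))), snd ((cstep ^^ n) ([c], us)))" for n us
    proof (induction n)
      case 0
      then show ?case using conts_self(1)[of c "[]"] by (simp add: S_def)
    next
      case (Suc n)
      obtain cs' us' where e: "(cstep ^^ n) ([c], us) = (cs', us')" by fastforce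
      then show ?case using Suc sim[of cs' us'] by (simp del: cstep.simps)
    qed
    from this[of t "init_tapes K x"] have
      "(tm_step M ^^ t) (num [c], init_tapes K x) = (num (Stop b # k), ts)"
      using run by simp
    moreover have "num [c] = 0" by (simp add: num_def)
    moreover have "tm_init M x = (0, init_tapes K x)"
      by (simp add: tm_init_def init_tapes_def M_def)
    ultimately show ?thesis by (simp add: tm_run_def num_s)
  qed
  ultimately show ?thesis by blast
qed

section \<open>Time bounds for running commands\<close>

lemma tape_act_stay: "map2 tape_act ts (map (\<lambda>a. (a, MoveStay)) (reads ts)) = ts"
  by (induction ts) (auto simp: reads_def tape_act_def)

lemma tape_act_update:
  "i < length ts \<Longrightarrow> map2 tape_act ts ((map (\<lambda>a. (a, MoveStay)) (reads ts))[i := p]) =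
     ts[i := tape_act (ts ! i) p]"
proof -
  assume i: "i < length ts"
  have "zip ts ((map (\<lambda>a. (a, MoveStay)) (reads ts))[i := p]) =
      (zip ts (map (\<lambda>a. (a, MoveStay)) (reads ts)))[i := (ts ! i, p)]"
    using zip_update[of ts i "ts ! i" "map (\<lambda>a. (a, MoveStay)) (reads ts)" p] by simp
  then show ?thesis using tape_act_stay[of ts] i
    by (simp add: map_update)
qed

lemma reads_nth: "i < length ts \<Longrightarrow> reads ts ! i = fst (ts ! i) (snd (ts ! i))"
  by (simp add: reads_def case_prod_beta)

text \<open>The quantification over the pending commands \<open>k\<close> is what makes sequences
  and loops compose.\<close>

definition runs :: "com \<Rightarrow> tape list \<Rightarrow> nat \<Rightarrow> tape list \<Rightarrow> bool" where
  "runs c ts n ts' \<longleftrightarrow> (\<exists>n'\<le>n. \<forall>k. (cstep ^^ n') (c # k, ts) = (k, ts'))"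

lemma runs_mono: "runs c ts n ts' \<Longrightarrow> n \<le> m \<Longrightarrow> runs c ts m ts'"
  unfolding runs_def by (meson le_trans)

lemma funpow_add_apply: "(f ^^ n) x = y \<Longrightarrow> (f ^^ m) y = z \<Longrightarrow> (f ^^ (n + m)) x = z"
  by (subst add.commute, simp add: funpow_add)

lemma funpow_Suc_apply: "f x = y \<Longrightarrow> (f ^^ n) y = z \<Longrightarrow> (f ^^ Suc n) x = z"
  by (simp add: funpow_swap1)

lemma runs_Mv: "i < length ts \<Longrightarrow> runs (Mv i d) ts 1 (ts[i := (fst (ts ! i), snd (ts ! i) + move_offset d)])"
  unfolding runs_def
  by (intro exI[of _ 1]) (auto simp: tape_act_update reads_nth, simp_all add: tape_act_def case_prod_beta)

lemma runs_Wr: "i < length ts \<Longrightarrow> runs (Wr i a) ts 1 (ts[i := ((fst (ts ! i))(snd (ts ! i) := a), snd (ts ! i))])"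
  unfolding runs_def
  by (intro exI[of _ 1]) (auto simp: tape_act_update reads_nth, simp_all add: tape_act_def case_prod_beta)

lemma runs_Seq:
  assumes "runs a ts n us" "runs b us m vs"
  shows "runs (a ;; b) ts (n + m + 1) vs"
proof -
  from assms obtain n' m' where n: "n' \<le> n" "\<forall>k. (cstep ^^ n') (a # k, ts) = (k, us)"
    and m: "m' \<le> m" "\<forall>k. (cstep ^^ m') (b # k, us) = (k, vs)"
    by (auto simp: runs_def)
  have "(cstep ^^ Suc (n' + m')) ((a ;; b) # k, ts) = (k, vs)" for k
    by (rule funpow_Suc_apply[OF _ funpow_add_apply])
       (use n(2) m(2) in \<open>auto simp: tape_act_stay\<close>)
  then show ?thesis unfolding runs_def using n m by (intro exI[of _ "Suc (n' + m')"]) auto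
qed

lemma runs_two: "runs a ts 1 us \<Longrightarrow> runs b us 1 vs \<Longrightarrow> vs = ws \<Longrightarrow> runs (a ;; b) ts 3 ws"
  using runs_Seq[of a ts 1 us b 1 vs] by (simp add: numeral_3_eq_3)

lemma runs_prefix:
  assumes "\<And>k. cstep (c # k, ts) = (d # k, ts)" "runs d ts n us"
  shows "runs c ts (Suc n) us"
proof -
  from assms obtain n' where n: "n' \<le> n" "\<forall>k. (cstep ^^ n') (d # k, ts) = (k, us)"
    by (auto simp: runs_def)
  have "(cstep ^^ Suc n') (c # k, ts) = (k, us)" for k
    by (rule funpow_Suc_apply) (use n assms in auto)
  then show ?thesis unfolding runs_def using n by (intro exI[of _ "Suc n'"]) auto
qed

lemma runs_Cond:
  "runs (if P (reads ts ! i) then a else b) ts n us \<Longrightarrow> runs (Cond i P a b) ts (Suc n) us"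
  by (rule runs_prefix) (auto simp: tape_act_stay)

lemma runs_Loop_exit: "\<not> P (reads ts ! i) \<Longrightarrow> runs (Loop i P c) ts 1 ts"
  unfolding runs_def by (intro exI[of _ 1]) (auto simp: tape_act_stay)

lemma runs_Loop_enter:
  assumes "P (reads ts ! i)" "runs c ts n us" "runs (Loop i P c) us m vs"
  shows "runs (Loop i P c) ts (n + m + 1) vs"
proof -
  from assms obtain n' m' where n: "n' \<le> n" "\<forall>k. (cstep ^^ n') (c # k, ts) = (k, us)"
    and m: "m' \<le> m" "\<forall>k. (cstep ^^ m') (Loop i P c # k, us) = (k, vs)"
    by (auto simp: runs_def)
  have "(cstep ^^ Suc (n' + m')) (Loop i P c # k, ts) = (k, vs)" for k
    by (rule funpow_Suc_apply[OF _ funpow_add_apply])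
       (use n(2) m(2) assms(1) in \<open>auto simp: tape_act_stay\<close>)
  then show ?thesis unfolding runs_def using n m by (intro exI[of _ "Suc (n' + m')"]) auto
qed

section \<open>Stack programs\<close>

text \<open>The tapes are: 0 input, 1 main stack, 2 save stack, 3 temporary stack, 4 unary counter,
  5 output. A stack has its top under the head and extends to the right, as the input does; the
  output tape is written from left to right and never read.\<close>

fun is_stack :: "nat list \<Rightarrow> tape \<Rightarrow> bool" where
  "is_stack xs (c, h) \<longleftrightarrow>
     (\<forall>j. c j = (if h \<le> j \<and> j < h + int (length xs) then xs ! nat (j - h) else 0))"

text \<open>The output is pinned to absolute positions starting at 0, since it has to become a
  \<open>string_tape\<close>; a stack is located only relative to its head.\<close>

fun is_output :: "nat list \<Rightarrow> tape \<Rightarrow> bool" where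
  "is_output ys (c, h) \<longleftrightarrow> h = int (length ys) \<and>
     (\<forall>j. c j = (if 0 \<le> j \<and> j < int (length ys) then ys ! nat j else 0))"

definition reps :: "nat list list \<Rightarrow> tape list \<Rightarrow> bool" where
  "reps \<sigma> ts \<longleftrightarrow> length \<sigma> = 6 \<and> length ts = 6 \<and> (\<forall>i<5. is_stack (\<sigma> ! i) (ts ! i)) \<and>
     is_output (\<sigma> ! 5) (ts ! 5)"

text \<open>Every choice of tapes with the given contents is covered, because a stack may sit
  anywhere on its tape.\<close>

definition exs :: "com \<Rightarrow> nat list list \<Rightarrow> nat \<Rightarrow> nat list list \<Rightarrow> bool" where
  "exs c \<sigma> n \<sigma>' \<longleftrightarrow> (\<forall>ts. reps \<sigma> ts \<longrightarrow> (\<exists>ts'. reps \<sigma>' ts' \<and> runs c ts n ts'))"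

text \<open>The value 0 for the empty stack is the blank that the head sees there.\<close>

fun top :: "nat list \<Rightarrow> nat" where
  "top [] = 0"
| "top (a # _) = a"

definition push :: "nat \<Rightarrow> nat \<Rightarrow> com" where "push i a = Mv i MoveLeft ;; Wr i a"
definition pop :: "nat \<Rightarrow> com" where "pop i = Wr i 0 ;; Mv i MoveRight"
definition emit :: "nat \<Rightarrow> com" where "emit a = Wr 5 a ;; Mv 5 MoveRight"

lemma reads_top: "reps \<sigma> ts \<Longrightarrow> i < 5 \<Longrightarrow> reads ts ! i = top (\<sigma> ! i)"
proof -
  assume "reps \<sigma> ts" "i < 5"
  then have "is_stack (\<sigma> ! i) (ts ! i)" "i < length ts" by (auto simp: reps_def)
  then show ?thesis
    by (cases "ts ! i"; cases "\<sigma> ! i") (auto simp: reads_nth)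
qed

lemma exs_mono: "exs c \<sigma> n \<sigma>' \<Longrightarrow> n \<le> m \<Longrightarrow> exs c \<sigma> m \<sigma>'"
  unfolding exs_def using runs_mono by blast

lemma exs_Seq:
  "exs a \<sigma> n \<sigma>1 \<Longrightarrow> exs b \<sigma>1 m \<sigma>2 \<Longrightarrow> n + m + 1 \<le> N \<Longrightarrow> exs (a ;; b) \<sigma> N \<sigma>2"
  unfolding exs_def using runs_Seq runs_mono by metis

lemma exs_Cond:
  "i < 5 \<Longrightarrow> exs (if P (top (\<sigma> ! i)) then a else b) \<sigma> n \<sigma>' \<Longrightarrow> n + 1 \<le> N \<Longrightarrow> exs (Cond i P a b) \<sigma> N \<sigma>'"
  unfolding exs_def using runs_Cond runs_mono by (metis Suc_eq_plus1 reads_top)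

lemma exs_Loop_exit: "i < 5 \<Longrightarrow> \<not> P (top (\<sigma> ! i)) \<Longrightarrow> exs (Loop i P c) \<sigma> 1 \<sigma>"
  unfolding exs_def using runs_Loop_exit by (metis reads_top)

lemma exs_Loop_enter:
  "i < 5 \<Longrightarrow> P (top (\<sigma> ! i)) \<Longrightarrow> exs c \<sigma> n \<sigma>1 \<Longrightarrow> exs (Loop i P c) \<sigma>1 m \<sigma>2 \<Longrightarrow> n + m + 1 \<le> N \<Longrightarrow>
   exs (Loop i P c) \<sigma> N \<sigma>2"
  unfolding exs_def using runs_Loop_enter runs_mono by (metis reads_top)

lemma reps_update:
  assumes "reps \<sigma> ts" "i < 5" "is_stack xs t"
  shows "reps (\<sigma>[i := xs]) (ts[i := t])"
  using assms by (auto simp: reps_def nth_list_update)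

lemma exs_push: "i < 5 \<Longrightarrow> exs (push i a) \<sigma> 3 (\<sigma>[i := a # \<sigma> ! i])"
  unfolding exs_def
proof (intro allI impI)
  fix ts assume a: "i < 5" "reps \<sigma> ts"
  obtain c h where t: "ts ! i = (c, h)" by fastforce
  have l: "i < length ts" and s: "is_stack (\<sigma> ! i) (c, h)" using a t by (auto simp: reps_def)
  let ?us = "ts[i := (c, h - 1)]"
  have "runs (Mv i MoveLeft) ts 1 ?us"
    using runs_Mv[OF l, of MoveLeft] t by simp
  moreover have "runs (Wr i a) ?us 1 (?us[i := (c(h - 1 := a), h - 1)])"
    using runs_Wr[of i ?us a] l by simp
  ultimately have "runs (push i a) ts 3 (ts[i := (c(h - 1 := a), h - 1)])"
    unfolding push_def by (rule runs_two) simp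
  moreover have "is_stack (a # \<sigma> ! i) (c(h - 1 := a), h - 1)"
    using s by (auto simp: nth_Cons' intro!: arg_cong[where f = "nth (\<sigma> ! i)"])
  ultimately show "\<exists>ts'. reps (\<sigma>[i := a # \<sigma> ! i]) ts' \<and> runs (push i a) ts 3 ts'"
    using reps_update[OF a(2,1)] by blast
qed

lemma exs_pop: "i < 5 \<Longrightarrow> \<sigma> ! i = b # xs \<Longrightarrow> exs (pop i) \<sigma> 3 (\<sigma>[i := xs])"
  unfolding exs_def
proof (intro allI impI)
  fix ts assume a: "i < 5" "\<sigma> ! i = b # xs" "reps \<sigma> ts"
  obtain c h where t: "ts ! i = (c, h)" by fastforce
  have l: "i < length ts" and s: "is_stack (b # xs) (c, h)" using a t
    by (auto simp: reps_def simp del: is_stack.simps dest!: spec[of _ i])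
  let ?us = "ts[i := (c(h := 0), h)]"
  have "runs (Wr i 0) ts 1 ?us"
    using runs_Wr[OF l, of 0] t by simp
  moreover have "runs (Mv i MoveRight) ?us 1 (?us[i := (c(h := 0), h + 1)])"
    using runs_Mv[of i ?us MoveRight] l by simp
  ultimately have "runs (pop i) ts 3 (ts[i := (c(h := 0), h + 1)])"
    unfolding pop_def by (rule runs_two) simp
  moreover have "is_stack xs (c(h := 0), h + 1)"
    using s by (auto simp: nth_Cons' intro!: arg_cong[where f = "nth xs"])
  ultimately show "\<exists>ts'. reps (\<sigma>[i := xs]) ts' \<and> runs (pop i) ts 3 ts'"
    using reps_update[OF a(3,1)] by blast
qed

lemma exs_emit: "exs (emit a) \<sigma> 3 (\<sigma>[5 := \<sigma> ! 5 @ [a]])"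
  unfolding exs_def
proof (intro allI impI)
  fix ts assume a: "reps \<sigma> ts"
  obtain c h where t: "ts ! 5 = (c, h)" by fastforce
  have l: "5 < length ts" and s: "is_output (\<sigma> ! 5) (c, h)" using a t by (auto simp: reps_def)
  let ?us = "ts[5 := (c(h := a), h)]"
  have "runs (Wr 5 a) ts 1 ?us"
    using runs_Wr[OF l, of a] t by simp
  moreover have "runs (Mv 5 MoveRight) ?us 1 (?us[5 := (c(h := a), h + 1)])"
    using runs_Mv[of 5 ?us MoveRight] l by simp
  ultimately have r: "runs (emit a) ts 3 (ts[5 := (c(h := a), h + 1)])"
    unfolding emit_def by (rule runs_two) simp
  have "is_output (\<sigma> ! 5 @ [a]) (c(h := a), h + 1)"
    using s by (auto simp: nth_append)
  then have "reps (\<sigma>[5 := \<sigma> ! 5 @ [a]]) (ts[5 := (c(h := a), h + 1)])"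
    using a by (auto simp: reps_def simp del: is_output.simps)
  with r show "\<exists>ts'. reps (\<sigma>[5 := \<sigma> ! 5 @ [a]]) ts' \<and> runs (emit a) ts 3 ts'"
    by blast
qed

section \<open>Trees on stacks\<close>

declare One_nat_def [simp del]

datatype D = L | N D D

text \<open>Prefix notation is self-delimiting, so trees can lie directly on top of each other;
  symbol 3 stays free as a marker.\<close>

fun ser :: "D \<Rightarrow> nat list" where
  "ser L = [1]"
| "ser (N a b) = 2 # ser a @ ser b"

abbreviation dsize :: "D \<Rightarrow> nat" where "dsize x \<equiv> length (ser x)"

lemma set_ser: "set (ser x) \<subseteq> {1, 2}"
  by (induction x) auto

lemma dsize_pos: "dsize x \<ge> 1"
  by (induction x) auto

lemma list_update_Cons_numeral: "(x # xs)[numeral v := y] = x # xs[pred_numeral v := y]"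
  by (simp add: numeral_eq_Suc)

lemma nth_Cons_one: "(x # xs) ! 1 = xs ! 0"
  by (simp add: One_nat_def)

lemmas stack_simps = list_update_Cons_numeral nth_Cons_one

lemma exs_push1: "exs (push 1 a) [i, m, v, t, c, u] 3 [i, a # m, v, t, c, u]"
  using exs_push[of 1 a "[i, m, v, t, c, u]"] by (simp add: list_update_Cons_numeral One_nat_def)
lemma exs_push2: "exs (push 2 a) [i, m, v, t, c, u] 3 [i, m, a # v, t, c, u]"
  using exs_push[of 2 a "[i, m, v, t, c, u]"] by (simp add: list_update_Cons_numeral One_nat_def)
lemma exs_push3: "exs (push 3 a) [i, m, v, t, c, u] 3 [i, m, v, a # t, c, u]"
  using exs_push[of 3 a "[i, m, v, t, c, u]"] by (simp add: list_update_Cons_numeral One_nat_def)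
lemma exs_push4: "exs (push 4 a) [i, m, v, t, c, u] 3 [i, m, v, t, a # c, u]"
  using exs_push[of 4 a "[i, m, v, t, c, u]"] by (simp add: list_update_Cons_numeral One_nat_def)
lemma exs_pop0: "exs (pop 0) [a # i, m, v, t, c, u] 3 [i, m, v, t, c, u]"
  using exs_pop[of 0 "[a # i, m, v, t, c, u]"] by (simp add: list_update_Cons_numeral One_nat_def)
lemma exs_pop1: "exs (pop 1) [i, a # m, v, t, c, u] 3 [i, m, v, t, c, u]"
  using exs_pop[of 1 "[i, a # m, v, t, c, u]"] by (simp add: list_update_Cons_numeral One_nat_def)
lemma exs_pop2: "exs (pop 2) [i, m, a # v, t, c, u] 3 [i, m, v, t, c, u]"
  using exs_pop[of 2 "[i, m, a # v, t, c, u]"] by (simp add: list_update_Cons_numeral One_nat_def)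
lemma exs_pop3: "exs (pop 3) [i, m, v, a # t, c, u] 3 [i, m, v, t, c, u]"
  using exs_pop[of 3 "[i, m, v, a # t, c, u]"] by (simp add: list_update_Cons_numeral One_nat_def)
lemma exs_pop4: "exs (pop 4) [i, m, v, t, a # c, u] 3 [i, m, v, t, c, u]"
  using exs_pop[of 4 "[i, m, v, t, a # c, u]"] by (simp add: list_update_Cons_numeral One_nat_def)
lemma exs_emit': "exs (emit a) [i, m, v, t, c, u] 3 [i, m, v, t, c, u @ [a]]"
  using exs_emit[of a "[i, m, v, t, c, u]"] by (simp add: list_update_Cons_numeral One_nat_def)

lemmas exs_Seq' = exs_Seq[OF _ _ order_refl]

definition grab_loop :: com where
  "grab_loop = Loop 4 (\<lambda>z. z = 1) (Cond 1 (\<lambda>z. z = 1)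
     (pop 1 ;; push 3 1 ;; pop 4) (pop 1 ;; push 3 2 ;; push 4 1))"

text \<open>The counter holds the number of subtrees still to be read.\<close>

lemma exs_grab_loop:
  "exs grab_loop [i, r, v, rev (ser x) @ t, c, u] n \<sigma> \<Longrightarrow>
   exs grab_loop [i, ser x @ r, v, t, 1 # c, u] (n + 14 * dsize x) \<sigma>"
proof (induction x arbitrary: r t c n)
  case L
  have "exs (Cond 1 (\<lambda>z. z = 1) (pop 1 ;; push 3 1 ;; pop 4) (pop 1 ;; push 3 2 ;; push 4 1))
      [i, ser L @ r, v, t, 1 # c, u] 12 [i, r, v, 1 # t, c, u]"
    by (rule exs_Cond, simp, simp add: stack_simps, rule exs_Seq'[OF exs_pop1 exs_Seq'[OF exs_push3 exs_pop4]]) simp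
  then show ?case using L unfolding grab_loop_def
    by - (rule exs_Loop_enter, simp, simp, assumption, simp, auto)
next
  case (N a b)
  have "exs (Cond 1 (\<lambda>z. z = 1) (pop 1 ;; push 3 1 ;; pop 4) (pop 1 ;; push 3 2 ;; push 4 1))
      [i, ser (N a b) @ r, v, t, 1 # c, u] 12 [i, ser a @ ser b @ r, v, 2 # t, 1 # 1 # c, u]"
    by (rule exs_Cond, simp, simp add: stack_simps, rule exs_Seq'[OF exs_pop1 exs_Seq'[OF exs_push3 exs_push4]]) simp
  moreover have "exs grab_loop [i, ser b @ r, v, rev (ser a) @ 2 # t, 1 # c, u]
      (n + 14 * dsize b) \<sigma>"
    using N by simp
  then have "exs grab_loop [i, ser a @ ser b @ r, v, 2 # t, 1 # 1 # c, u]
      (n + 14 * dsize b + 14 * dsize a) \<sigma>"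
    by (rule N.IH)
  ultimately show ?case unfolding grab_loop_def
    by - (rule exs_Loop_enter, simp, simp, assumption, simp, auto)
qed

text \<open>The tree arrives reversed on top of a marker 3; moving it on to another stack restores
  its order.\<close>

definition lift :: com where "lift = push 3 3 ;; push 4 1 ;; grab_loop"

lemma exs_lift:
  "exs lift [i, ser x @ r, v, t, [], u] (14 * dsize x + 9) [i, r, v, rev (ser x) @ 3 # t, [], u]"
proof -
  have "exs grab_loop [i, r, v, rev (ser x) @ 3 # t, [], u] 1 [i, r, v, rev (ser x) @ 3 # t, [], u]"
    unfolding grab_loop_def by (rule exs_Loop_exit) auto
  note exs_grab_loop[OF this]
  then show ?thesis unfolding lift_def
    by - (rule exs_Seq[OF exs_push3 exs_Seq'[OF exs_push4]], assumption, simp)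
qed

definition xfer :: "nat \<Rightarrow> nat \<Rightarrow> com" where
  "xfer i j = Loop i (\<lambda>z. z \<noteq> 3) (Cond i (\<lambda>z. z = 1) (pop i ;; push j 1) (pop i ;; push j 2))"

lemma exs_xfer31: "set xs \<subseteq> {1, 2} \<Longrightarrow>
  exs (xfer 3 1) [i, m, v, xs @ 3 # t, c, u] (9 * length xs + 1) [i, rev xs @ m, v, 3 # t, c, u]"
proof (induction xs arbitrary: m)
  case Nil
  show ?case unfolding xfer_def by (simp, rule exs_Loop_exit) (auto simp: stack_simps)
next
  case (Cons x xs)
  have "exs (Cond 3 (\<lambda>z. z = 1) (pop 3 ;; push 1 1) (pop 3 ;; push 1 2))
      [i, m, v, (x # xs) @ 3 # t, c, u] 8 [i, x # m, v, xs @ 3 # t, c, u]"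
    by (rule exs_Cond, simp, use Cons.prems in \<open>auto intro!: exs_Seq'[OF exs_pop3 exs_push1]
      exs_Seq[OF exs_pop3 exs_push1]\<close>)
  then show ?case using Cons.IH[of "x # m"] Cons.prems unfolding xfer_def
    by - (rule exs_Loop_enter, simp, force, assumption, auto simp: stack_simps)
qed

lemma exs_xfer32: "set xs \<subseteq> {1, 2} \<Longrightarrow>
  exs (xfer 3 2) [i, m, v, xs @ 3 # t, c, u] (9 * length xs + 1) [i, m, rev xs @ v, 3 # t, c, u]"
proof (induction xs arbitrary: v)
  case Nil
  show ?case unfolding xfer_def by (simp, rule exs_Loop_exit) (auto simp: stack_simps)
next
  case (Cons x xs)
  have "exs (Cond 3 (\<lambda>z. z = 1) (pop 3 ;; push 2 1) (pop 3 ;; push 2 2))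
      [i, m, v, (x # xs) @ 3 # t, c, u] 8 [i, m, x # v, xs @ 3 # t, c, u]"
    by (rule exs_Cond, simp, use Cons.prems in \<open>auto intro!: exs_Seq[OF exs_pop3 exs_push2]\<close>)
  then show ?case using Cons.IH[of "x # v"] Cons.prems unfolding xfer_def
    by - (rule exs_Loop_enter, simp, force, assumption, auto simp: stack_simps)
qed

lemma exs_xfer23: "set xs \<subseteq> {1, 2} \<Longrightarrow>
  exs (xfer 2 3) [i, m, xs @ 3 # v, t, c, u] (9 * length xs + 1) [i, m, 3 # v, rev xs @ t, c, u]"
proof (induction xs arbitrary: t)
  case Nil
  show ?case unfolding xfer_def by (simp, rule exs_Loop_exit) (auto simp: stack_simps)
next
  case (Cons x xs)
  have "exs (Cond 2 (\<lambda>z. z = 1) (pop 2 ;; push 3 1) (pop 2 ;; push 3 2))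
      [i, m, (x # xs) @ 3 # v, t, c, u] 8 [i, m, xs @ 3 # v, x # t, c, u]"
    by (rule exs_Cond, simp, use Cons.prems in \<open>auto intro!: exs_Seq[OF exs_pop2 exs_push3]\<close>)
  then show ?case using Cons.IH[of "x # t"] Cons.prems unfolding xfer_def
    by - (rule exs_Loop_enter, simp, force, assumption, auto simp: stack_simps)
qed

definition xfer_both :: com where
  "xfer_both = Loop 3 (\<lambda>z. z \<noteq> 3) (Cond 3 (\<lambda>z. z = 1) (pop 3 ;; push 1 1 ;; push 2 1)
     (pop 3 ;; push 1 2 ;; push 2 2))"

lemma exs_xfer_both: "set xs \<subseteq> {1, 2} \<Longrightarrow>
  exs xfer_both [i, m, v, xs @ 3 # t, c, u] (13 * length xs + 1) [i, rev xs @ m, rev xs @ v, 3 # t, c, u]"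
proof (induction xs arbitrary: m v)
  case Nil
  show ?case unfolding xfer_both_def by (simp, rule exs_Loop_exit) (auto simp: stack_simps)
next
  case (Cons x xs)
  have "exs (Cond 3 (\<lambda>z. z = 1) (pop 3 ;; push 1 1 ;; push 2 1) (pop 3 ;; push 1 2 ;; push 2 2))
      [i, m, v, (x # xs) @ 3 # t, c, u] 12 [i, x # m, x # v, xs @ 3 # t, c, u]"
    by (rule exs_Cond, simp, use Cons.prems in
      \<open>auto intro!: exs_Seq[OF exs_pop3 exs_Seq'[OF exs_push1 exs_push2]]\<close>)
  then show ?case using Cons.IH[of "x # m" "x # v"] Cons.prems unfolding xfer_both_def
    by - (rule exs_Loop_enter, simp, force, assumption, auto simp: stack_simps)
qed

definition discard :: com where "discard = Loop 3 (\<lambda>z. z \<noteq> 3) (pop 3)"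

lemma exs_discard: "set xs \<subseteq> {1, 2} \<Longrightarrow>
  exs discard [i, m, v, xs @ 3 # t, c, u] (4 * length xs + 1) [i, m, v, 3 # t, c, u]"
proof (induction xs)
  case Nil
  show ?case unfolding discard_def by (simp, rule exs_Loop_exit) (auto simp: stack_simps)
next
  case (Cons x xs)
  then show ?case using exs_pop3[of i m v x "xs @ 3 # t" c u] unfolding discard_def
    by - (rule exs_Loop_enter, simp, force, simp, auto)
qed

text \<open>Each copy on the save stack stands on its own marker 3, so \<open>restore\<close> sees
  where it ends without the counter, also when saves are nested.\<close>

definition dup :: com where "dup = push 2 3 ;; lift ;; xfer_both ;; pop 3"
definition save :: com where "save = push 2 3 ;; lift ;; xfer 3 2 ;; pop 3"
definition restore :: com where "restore = push 3 3 ;; xfer 2 3 ;; pop 2 ;; xfer 3 1 ;; pop 3"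
definition drop_tree :: com where "drop_tree = lift ;; discard ;; pop 3"

lemma set_rev_ser: "set (rev (ser x)) \<subseteq> {1, 2}" using set_ser by simp

lemma exs_dup: "exs dup [i, ser x @ r, v, t, [], u] (27 * dsize x + 20)
    [i, ser x @ r, ser x @ 3 # v, t, [], u]"
  unfolding dup_def
  by (rule exs_Seq'[OF exs_push2 exs_Seq'[OF exs_lift exs_Seq'[OF exs_xfer_both[OF set_rev_ser] exs_pop3]],
    simplified rev_rev_ident length_rev, THEN exs_mono]) simp

lemma exs_save: "exs save [i, ser x @ r, v, t, [], u] (23 * dsize x + 20)
    [i, r, ser x @ 3 # v, t, [], u]"
  unfolding save_def
  by (rule exs_Seq'[OF exs_push2 exs_Seq'[OF exs_lift exs_Seq'[OF exs_xfer32[OF set_rev_ser] exs_pop3]],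
    simplified rev_rev_ident length_rev, THEN exs_mono]) simp

lemma exs_restore: "exs restore [i, r, ser x @ 3 # v, t, c, u] (18 * dsize x + 20)
    [i, ser x @ r, v, t, c, u]"
  unfolding restore_def
  by (rule exs_Seq'[OF exs_push3 exs_Seq'[OF exs_xfer23[OF set_ser] exs_Seq'[OF exs_pop2
    exs_Seq'[OF exs_xfer31[OF set_rev_ser] exs_pop3]]],
    simplified rev_rev_ident length_rev, THEN exs_mono]) simp

lemma exs_drop: "exs drop_tree [i, ser x @ r, v, t, [], u] (18 * dsize x + 20) [i, r, v, t, [], u]"
  unfolding drop_tree_def
  by (rule exs_Seq'[OF exs_lift exs_Seq'[OF exs_discard[OF set_rev_ser] exs_pop3],
    simplified rev_rev_ident length_rev, THEN exs_mono]) simp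

text \<open>Only the topmost tree changes and everything else is arbitrary, apart from the empty
  counter; hence such programs can be used inside each other.\<close>

definition computes :: "com \<Rightarrow> D \<Rightarrow> nat \<Rightarrow> D \<Rightarrow> bool" where
  "computes c x n y \<longleftrightarrow> (\<forall>i r v t u. exs c [i, ser x @ r, v, t, [], u] n [i, ser y @ r, v, t, [], u])"

lemma computes_mono: "computes c x n y \<Longrightarrow> n \<le> m \<Longrightarrow> computes c x m y"
  unfolding computes_def using exs_mono by blast

lemma computes_Seq: "computes a x n y \<Longrightarrow> computes b y m z \<Longrightarrow> computes (a ;; b) x (n + m + 1) z"
  unfolding computes_def using exs_Seq' by blast

lemma computes_id: "computes (push 1 1 ;; pop 1) x 7 x"
  unfolding computes_def by (intro allI, rule exs_Seq'[OF exs_push1 exs_pop1, THEN exs_mono]) simp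

lemma computes_leaf: "computes (drop_tree ;; push 1 1) x (18 * dsize x + 30) L"
  unfolding computes_def ser.simps append.simps
  by (intro allI, rule exs_Seq'[OF exs_drop exs_push1, THEN exs_mono]) simp

text \<open>The second component is computed first, since prefix notation puts the first component
  above it.\<close>

definition pair_com :: "com \<Rightarrow> com \<Rightarrow> com" where
  "pair_com f g = dup ;; g ;; restore ;; f ;; push 1 2"

lemma computes_pair:
  assumes "computes f x n y" "computes g x m z"
  shows "computes (pair_com f g) x (n + m + 45 * dsize x + 50) (N y z)"
  unfolding computes_def
proof (intro allI)
  fix i r v t u
  have "exs (pair_com f g) [i, ser x @ r, v, t, [], u] (n + m + 45 * dsize x + 50)
    [i, 2 # ser y @ ser z @ r, v, t, [], u]"
    unfolding pair_com_def
    by (rule exs_Seq[OF exs_dup exs_Seq'[OF assms(2)[unfolded computes_def, rule_format]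
      exs_Seq'[OF exs_restore exs_Seq'[OF assms(1)[unfolded computes_def, rule_format] exs_push1]]]]) simp
  then show "exs (pair_com f g) [i, ser x @ r, v, t, [], u] (n + m + 45 * dsize x + 50)
    [i, ser (N y z) @ r, v, t, [], u]" by simp
qed

lemma computes_fst: "computes (pop 1 ;; save ;; drop_tree ;; restore) (N x y) (41 * dsize (N x y) + 70) x"
  unfolding computes_def
proof (intro allI)
  fix i r v t u
  show "exs (pop 1 ;; save ;; drop_tree ;; restore) [i, ser (N x y) @ r, v, t, [], u] (41 * dsize (N x y) + 70)
    [i, ser x @ r, v, t, [], u]"
    unfolding ser.simps append.simps append_assoc
    by (rule exs_Seq'[OF exs_pop1 exs_Seq'[OF exs_save exs_Seq'[OF exs_drop exs_restore]], THEN exs_mono]) simp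
qed

lemma computes_snd: "computes (pop 1 ;; drop_tree) (N x y) (18 * dsize (N x y) + 70) y"
  unfolding computes_def
proof (intro allI)
  fix i r v t u
  show "exs (pop 1 ;; drop_tree) [i, ser (N x y) @ r, v, t, [], u] (18 * dsize (N x y) + 70)
    [i, ser y @ r, v, t, [], u]"
    unfolding ser.simps append.simps append_assoc
    by (rule exs_Seq'[OF exs_pop1 exs_drop, THEN exs_mono]) simp
qed

definition if_com :: "com \<Rightarrow> com \<Rightarrow> com \<Rightarrow> com" where
  "if_com b f g = dup ;; b ;; Cond 1 (\<lambda>z. z = 1) (drop_tree ;; restore ;; g) (drop_tree ;; restore ;; f)"

lemma computes_if:
  assumes "computes b x n y" "computes (if y = L then g else f) x m z"
  shows "computes (if_com b f g) x (n + m + 18 * dsize y + 45 * dsize x + 80) z"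
  unfolding computes_def
proof (intro allI)
  fix i r v t u
  let ?\<sigma> = "[i, ser y @ ser x @ r, v, t, [], u]"
  have top: "top (ser y @ w) = 1 \<longleftrightarrow> y = L" for w by (cases y) auto
  let ?h = "if y = L then g else f"
  have h: "exs (drop_tree ;; restore ;; ?h) [i, ser y @ r, ser x @ 3 # v, t, [], u]
     (m + 18 * dsize y + 18 * dsize x + 50) [i, ser z @ r, v, t, [], u]"
    by (rule exs_Seq[OF exs_drop exs_Seq'[OF exs_restore assms(2)[unfolded computes_def, rule_format]]]) simp
  have "exs (Cond 1 (\<lambda>z. z = 1) (drop_tree ;; restore ;; g) (drop_tree ;; restore ;; f))
     [i, ser y @ r, ser x @ 3 # v, t, [], u]
     (m + 18 * dsize y + 18 * dsize x + 51) [i, ser z @ r, v, t, [], u]"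
    by (rule exs_Cond) (use h in \<open>auto simp: top split: if_splits\<close>)
  then show "exs (if_com b f g) [i, ser x @ r, v, t, [], u]
    (n + m + 18 * dsize y + 45 * dsize x + 80) [i, ser z @ r, v, t, [], u]"
    unfolding if_com_def
    by - (rule exs_Seq[OF exs_dup exs_Seq'[OF assms(1)[unfolded computes_def, rule_format]]], assumption, simp)
qed

text \<open>The first component of the argument, parked on the temporary stack, is a unary clock:
  each round consumes one of its symbols. Its marker shields it from the use of that stack by
  \<open>g\<close>.\<close>

definition iter_com :: "com \<Rightarrow> com" where
  "iter_com g = pop 1 ;; lift ;; Loop 3 (\<lambda>z. z \<noteq> 3) (pop 3 ;; g) ;; pop 3"

lemma computes_iter:
  assumes "\<And>j. j < dsize k \<Longrightarrow> computes g ((F ^^ j) x) n ((F ^^ Suc j) x)"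
  shows "computes (iter_com g) (N k x) ((n + 20) * dsize k + 40) ((F ^^ dsize k) x)"
  unfolding computes_def
proof (intro allI)
  fix i r v t u
  have loop: "exs (Loop 3 (\<lambda>z. z \<noteq> 3) (pop 3 ;; g)) [i, ser ((F ^^ j) x) @ r, v, xs @ 3 # t, [], u]
     ((n + 6) * length xs + 1) [i, ser ((F ^^ dsize k) x) @ r, v, 3 # t, [], u]"
    if "set xs \<subseteq> {1, 2}" "j + length xs = dsize k" for j xs
    using that
  proof (induction xs arbitrary: j)
    case Nil
    have "exs (Loop 3 (\<lambda>z. z \<noteq> 3) (pop 3 ;; g)) [i, ser ((F ^^ dsize k) x) @ r, v, 3 # t, [], u] 1
       [i, ser ((F ^^ dsize k) x) @ r, v, 3 # t, [], u]"
      by (rule exs_Loop_exit) auto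
    then show ?case using Nil by simp
  next
    case (Cons a xs)
    \<comment> \<open>The round number \<open>j\<close> is what the clock has lost so far, so the
      hypothesis is needed only below \<open>dsize k\<close>.\<close>
    have "computes g ((F ^^ j) x) n ((F ^^ Suc j) x)" using assms Cons.prems by auto
    then have g: "exs g [i, ser ((F ^^ j) x) @ r, v, xs @ 3 # t, [], u] n
       [i, ser ((F ^^ Suc j) x) @ r, v, xs @ 3 # t, [], u]" by (simp add: computes_def)
    show ?case
      by (rule exs_Loop_enter[OF _ _ exs_Seq'[OF _ g] Cons.IH])
         (use Cons.prems exs_pop3 in \<open>force+\<close>)
  qed
  from loop[OF set_rev_ser[of k], of 0]
  have "exs (iter_com g) [i, 2 # ser k @ ser x @ r, v, t, [], u] ((n + 20) * dsize k + 40)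
    [i, ser ((F ^^ dsize k) x) @ r, v, t, [], u]"
    unfolding iter_com_def
    by - (rule exs_Seq[OF exs_pop1 exs_Seq'[OF exs_lift exs_Seq'[OF _ exs_pop3]]],
          auto simp: algebra_simps)
  then show "exs (iter_com g) [i, ser (N k x) @ r, v, t, [], u] ((n + 20) * dsize k + 40)
    [i, ser ((F ^^ dsize k) x) @ r, v, t, [], u]" by simp
qed

declare One_nat_def [simp]

section \<open>Polynomial time functions\<close>

class enc =
  fixes enc :: "'a \<Rightarrow> D"
  assumes inj_enc: "enc x = enc y \<Longrightarrow> x = y"

instantiation D :: enc
begin
definition enc_D :: "D \<Rightarrow> D" where "enc_D x = x"
instance by standard (simp add: enc_D_def)
end

instantiation bool :: enc
begin
fun enc_bool :: "bool \<Rightarrow> D" where "enc_bool False = L" | "enc_bool True = N L L"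
instance
proof
  fix x y :: bool show "enc x = enc y \<Longrightarrow> x = y" by (cases x; cases y) auto
qed
end

text \<open>Unary, and the same tree as that of a list of \<open>n\<close> leaves; arithmetic can
  thus be done by list processing. Polynomial time in a number always refers to its value.\<close>

instantiation nat :: enc
begin
fun enc_nat :: "nat \<Rightarrow> D" where "enc_nat 0 = L" | "enc_nat (Suc n) = N L (enc_nat n)"
instance
proof
  fix x y :: nat show "enc x = enc y \<Longrightarrow> x = y"
    by (induction x arbitrary: y) (case_tac y, auto)+
qed
end

instantiation list :: (enc) enc
begin
fun enc_list :: "'a list \<Rightarrow> D" where "enc_list [] = L" | "enc_list (x # xs) = N (enc x) (enc_list xs)"
instance
proof
  fix x y :: "'a list" show "enc x = enc y \<Longrightarrow> x = y"
    by (induction x arbitrary: y) (case_tac y, auto dest: inj_enc)+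
qed
end

instantiation prod :: (enc, enc) enc
begin
fun enc_prod :: "'a \<times> 'b \<Rightarrow> D" where "enc_prod (x, y) = N (enc x) (enc y)"
instance by standard (auto dest: inj_enc)
end

definition sz :: "'a::enc \<Rightarrow> nat" where "sz x = dsize (enc x)"

lemma sz_simps [simp]:
  "sz (a, b) = sz a + sz b + 1" "sz ([] :: 'a::enc list) = 1"
  "sz (y # ys) = sz y + sz ys + 1" "sz (n :: nat) = 2 * n + 1" "sz False = 1" "sz True = 3"
proof -
  show "sz (n :: nat) = 2 * n + 1" by (induction n) (auto simp: sz_def)
qed (auto simp: sz_def)

lemma sz_bool_le: "sz (b :: bool) \<le> 3" by (cases b) auto

lemma sz_pos: "sz x \<ge> 1" using dsize_pos by (simp add: sz_def)

lemma sz_append: "sz (xs @ ys) + 1 = sz xs + sz ys"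
  by (induction xs) auto

lemma sz_list: "sz xs = (\<Sum>x\<leftarrow>xs. sz x + 1) + 1"
  by (induction xs) auto

lemma sz_list_le: "\<forall>x\<in>set xs. sz x \<le> B \<Longrightarrow> sz xs \<le> length xs * (B + 1) + 1"
  by (induction xs) auto

lemma length_le_sz: "length xs \<le> sz xs"
  by (induction xs) auto

lemma sz_elem_le: "x \<in> set xs \<Longrightarrow> sz x < sz xs"
  by (induction xs) auto

text \<open>The base is at least 2, so constants and sums are absorbed into the exponent and one
  number \<open>q\<close> describes the bound.\<close>

definition pb :: "('a::enc \<Rightarrow> nat) \<Rightarrow> bool" where
  "pb f \<longleftrightarrow> (\<exists>q. \<forall>x. f x \<le> (sz x + 2) ^ q)"

named_theorems pb_intros

lemma pb_mono: "pb g \<Longrightarrow> (\<And>x. f x \<le> g x) \<Longrightarrow> pb f"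
  unfolding pb_def by (meson le_trans)

lemma pb_const [pb_intros]: "pb (\<lambda>_. c)"
  unfolding pb_def
proof (intro exI allI)
  fix x :: 'a
  have "c \<le> 2 ^ c" by (simp add: less_imp_le)
  also have "\<dots> \<le> (sz x + 2) ^ c" by (rule power_mono) auto
  finally show "c \<le> (sz x + 2) ^ c" .
qed

lemma pb_sz [pb_intros]: "pb (\<lambda>x. sz x)"
  unfolding pb_def by (intro exI[of _ 1]) auto

lemma pb_mult [pb_intros]: "pb f \<Longrightarrow> pb g \<Longrightarrow> pb (\<lambda>x. f x * g x)"
proof -
  assume "pb f" "pb g"
  then obtain p q where "\<And>x. f x \<le> (sz x + 2) ^ p" "\<And>x. g x \<le> (sz x + 2) ^ q"
    by (auto simp: pb_def)
  then have "f x * g x \<le> (sz x + 2) ^ (p + q)" for x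
    unfolding power_add by (rule mult_le_mono)
  then show ?thesis unfolding pb_def by blast
qed

lemma pb_add [pb_intros]:
  assumes "pb f" "pb g" shows "pb (\<lambda>x. f x + g x)"
proof (rule pb_mono)
  have 1: "pb (\<lambda>x. f x + 1)" if "pb f" for f :: "'a \<Rightarrow> nat"
  proof -
    from that obtain q where q: "\<And>x. f x \<le> (sz x + 2) ^ q" by (auto simp: pb_def)
    have "f x + 1 \<le> (sz x + 2) ^ (q + 1)" for x
    proof -
      have "f x + 1 \<le> (sz x + 2) ^ q + (sz x + 2) ^ q"
        using q[of x] by (intro add_mono) auto
      also have "\<dots> \<le> (sz x + 2) ^ (q + 1)" by simp
      finally show ?thesis .
    qed
    then show ?thesis unfolding pb_def by blast
  qed
  show "pb (\<lambda>x. (f x + 1) * (g x + 1))" by (intro pb_mult 1 assms)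
qed auto

lemma pb_power [pb_intros]: "pb f \<Longrightarrow> pb (\<lambda>x. f x ^ c)"
  by (induction c) (auto intro: pb_intros)

lemma pb_comp:
  assumes "pb f" "pb (\<lambda>x. sz (h x))" shows "pb (\<lambda>x. f (h x))"
proof -
  from assms obtain q where q: "\<And>x. f x \<le> (sz x + 2) ^ q" by (auto simp: pb_def)
  have "pb (\<lambda>x. (sz (h x) + 2) ^ q)" by (intro pb_intros assms)
  then show ?thesis by (rule pb_mono) (rule q)
qed

text \<open>The output size is bounded along with the time, because composition evaluates the time
  bound of the outer function at the output of the inner one.\<close>

definition pt :: "('a::enc \<Rightarrow> 'b::enc) \<Rightarrow> bool" where
  "pt f \<longleftrightarrow> (\<exists>C T. pb T \<and> (\<forall>x. computes C (enc x) (T x) (enc (f x)))) \<and> pb (\<lambda>x. sz (f x))"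

lemma ptI: "pb T \<Longrightarrow> (\<And>x. computes C (enc x) (T x) (enc (f x))) \<Longrightarrow> pb (\<lambda>x. sz (f x)) \<Longrightarrow> pt f"
  unfolding pt_def by blast

lemma pt_sz: "pt f \<Longrightarrow> pb (\<lambda>x. sz (f x))" by (simp add: pt_def)

named_theorems pt_intros

lemma pt_id [pt_intros]: "pt (\<lambda>x. x)"
  by (rule ptI[OF pb_const computes_id pb_sz])

lemma pt_comp:
  assumes "pt g" "pt f" shows "pt (\<lambda>x. g (f x))"
proof -
  from assms obtain C T C' T' where C: "pb T" "\<And>x. computes C (enc x) (T x) (enc (f x))"
    and C': "pb T'" "\<And>x. computes C' (enc x) (T' x) (enc (g x))"
    unfolding pt_def by blast
  show ?thesis
  proof (rule ptI)
    show "pb (\<lambda>x. T x + T' (f x) + 1)"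
      by (intro pb_add pb_const C(1) pb_comp[OF C'(1)] pt_sz assms(2))
    show "pb (\<lambda>x. sz (g (f x)))"
      by (rule pb_comp[OF pt_sz[OF assms(1)]]) (rule pt_sz[OF assms(2)])
  qed (rule computes_Seq[OF C(2) C'(2)])
qed

lemma pt_Pair [pt_intros]:
  assumes "pt f" "pt g" shows "pt (\<lambda>x. (f x, g x))"
proof -
  from assms obtain C T C' T' where C: "pb T" "\<And>x. computes C (enc x) (T x) (enc (f x))"
    and C': "pb T'" "\<And>x. computes C' (enc x) (T' x) (enc (g x))"
    unfolding pt_def by blast
  show ?thesis
  proof (rule ptI)
    show "computes (pair_com C C') (enc x) (T x + T' x + 45 * sz x + 50) (enc (f x, g x))" for x
      using computes_pair[OF C(2) C'(2)] by (simp add: sz_def)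
  qed (auto intro!: pb_intros pt_sz assms C C' simp only: sz_simps)
qed

text \<open>Programs see only trees, so a function may be replaced by one of another type with the
  same encoded values. Most rules for concrete data are derived in this way.\<close>

lemma pt_recode: "pt f \<Longrightarrow> (\<And>x. enc (g x) = enc (f x)) \<Longrightarrow> pt g"
  unfolding pt_def by (simp add: sz_def)

lemma pt_L: "pt (\<lambda>_. L)"
proof (rule ptI)
  show "computes (drop_tree ;; push 1 1) (enc x) (18 * sz x + 30) (enc L)" for x :: 'a
    using computes_leaf by (simp add: sz_def enc_D_def)
qed (intro pb_intros)+

lemma pt_N [pt_intros]:
  assumes "pt f" "pt g" shows "pt (\<lambda>x. N (f x) (g x))"
  by (rule pt_recode[OF pt_Pair[OF assms]]) (simp add: enc_D_def)

lemma pt_const [pt_intros]: "pt (\<lambda>_. c)"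
proof -
  have "pt (\<lambda>_ :: 'a. d)" for d :: D
    by (induction d) (auto intro: pt_L pt_N)
  from this[of "enc c"] show ?thesis by (rule pt_recode) (simp add: enc_D_def)
qed

lemma pt_fst' : "pt (fst :: 'a::enc \<times> 'b::enc \<Rightarrow> 'a)"
proof (rule ptI)
  show "computes (pop 1 ;; save ;; drop_tree ;; restore) (enc x) (41 * sz x + 70) (enc (fst x))" for x :: "'a \<times> 'b"
    using computes_fst[of "enc (fst x)" "enc (snd x)"] by (cases x) (simp add: sz_def)
  show "pb (\<lambda>x :: 'a \<times> 'b. sz (fst x))"
    by (rule pb_mono[OF pb_sz]) (case_tac x, simp)
qed (intro pb_intros)

lemma pt_snd' : "pt (snd :: 'a::enc \<times> 'b::enc \<Rightarrow> 'b)"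
proof (rule ptI)
  show "computes (pop 1 ;; drop_tree) (enc x) (18 * sz x + 70) (enc (snd x))" for x :: "'a \<times> 'b"
    using computes_snd[of "enc (fst x)" "enc (snd x)"] by (cases x) (simp add: sz_def)
  show "pb (\<lambda>x :: 'a \<times> 'b. sz (snd x))"
    by (rule pb_mono[OF pb_sz]) (case_tac x, simp)
qed (intro pb_intros)

lemmas pt_fst [pt_intros] = pt_comp[OF pt_fst']
lemmas pt_snd [pt_intros] = pt_comp[OF pt_snd']

lemma pt_If_enc:
  assumes "pt b" "pt f" "pt g" shows "pt (\<lambda>x. if enc (b x) = L then g x else f x)"
proof -
  from assms obtain Cb Tb Cf Tf Cg Tg where
    b: "pb Tb" "\<And>x. computes Cb (enc x) (Tb x) (enc (b x))" and
    f: "pb Tf" "\<And>x. computes Cf (enc x) (Tf x) (enc (f x))" and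
    g: "pb Tg" "\<And>x. computes Cg (enc x) (Tg x) (enc (g x))"
    unfolding pt_def by blast
  show ?thesis
  proof (rule ptI)
    show "computes (if_com Cb Cf Cg) (enc x)
        (Tb x + (Tf x + Tg x) + 18 * sz (b x) + 45 * sz x + 80) (enc (if enc (b x) = L then g x else f x))" for x
      unfolding sz_def
      by (rule computes_if[OF b(2)])
         (auto intro: computes_mono[OF f(2)] computes_mono[OF g(2)])
    show "pb (\<lambda>x. sz (if enc (b x) = L then g x else f x))"
      by (rule pb_mono[of "\<lambda>x. sz (f x) + sz (g x)"]) (auto intro!: pb_intros pt_sz assms)
  qed (intro pb_intros pt_sz assms b f g)
qed

lemma pt_If [pt_intros]:
  assumes "pt b" "pt f" "pt g" shows "pt (\<lambda>x. if b x then f x else g x)"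
proof -
  have "(if b x then f x else g x) = (if enc (b x) = L then g x else f x)" for x
    by (cases "b x") auto
  then show ?thesis using pt_If_enc[OF assms] by simp
qed

text \<open>Repeating a polynomial time function can make sizes explode; the bound \<open>B\<close>
  on all intermediate values excludes this and turns the cost of a round into one polynomial in the
  input.\<close>

lemma pt_iter:
  fixes g :: "'b::enc \<Rightarrow> 'b" and k :: "'a::enc \<Rightarrow> 'c::enc"
  assumes g: "pt g" and k: "pt k" and i: "pt i" and B: "pb B"
    and le: "\<And>x j. j \<le> sz (k x) \<Longrightarrow> sz ((g ^^ j) (i x)) \<le> B x"
  shows "pt (\<lambda>x. (g ^^ sz (k x)) (i x))"
proof -
  from g obtain C T where C: "pb T" "\<And>x. computes C (enc x) (T x) (enc (g x))"
    unfolding pt_def by blast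
  from C(1) obtain q where q: "\<And>x. T x \<le> (sz x + 2) ^ q" unfolding pb_def by blast
  from pt_Pair[OF k i] obtain C' T' where
    C': "pb T'" "\<And>x. computes C' (enc x) (T' x) (N (enc (k x)) (enc (i x)))"
    unfolding pt_def by auto
  show ?thesis
  proof (rule ptI)
    fix x
    \<comment> \<open>\<open>computes_iter\<close> iterates a function on trees, so \<open>g\<close>
      is conjugated by the injective encoding.\<close>
    define F where "F d = enc (g (inv_into UNIV enc d))" for d
    have F: "(F ^^ j) (enc (i x)) = enc ((g ^^ j) (i x))" for j
    proof (induction j)
      case (Suc j)
      have "inj (enc :: 'b \<Rightarrow> D)" by (auto intro: injI inj_enc)
      then show ?case using Suc by (simp add: F_def)
    qed simp
    have "computes C ((F ^^ j) (enc (i x))) ((B x + 2) ^ q) ((F ^^ Suc j) (enc (i x)))"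
      if "j < dsize (enc (k x))" for j
    proof -
      have "T ((g ^^ j) (i x)) \<le> (B x + 2) ^ q"
        using le[of j x] that by (intro order_trans[OF q] power_mono) (auto simp: sz_def)
      then show ?thesis unfolding F using computes_mono[OF C(2)] by simp
    qed
    from computes_Seq[OF C'(2) computes_iter[OF this]]
    show "computes (C' ;; iter_com C) (enc x) (T' x + (((B x + 2) ^ q + 20) * sz (k x) + 40) + 1)
        (enc ((g ^^ sz (k x)) (i x)))"
      by (simp add: F sz_def)
  next
    show "pb (\<lambda>x. sz ((g ^^ sz (k x)) (i x)))"
      by (rule pb_mono[OF B]) (rule le, simp)
  qed (intro pb_intros B C' pt_sz k)
qed

section \<open>Machines for polynomial time functions\<close>

declare One_nat_def [simp del]

text \<open>A list in prefix notation has to be built from its last element, so the bits go through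
  the temporary stack first. The bit \<open>True\<close> becomes \<open>2 1 1\<close> and
  \<open>False\<close> becomes \<open>1\<close>, each preceded by the 2 of the list cell.\<close>

definition load_com :: com where
  "load_com = push 3 3 ;;
     Loop 0 (\<lambda>z. z \<noteq> 0) (Cond 0 (\<lambda>z. z = 1) (pop 0 ;; push 3 1) (pop 0 ;; push 3 2)) ;;
     push 1 1 ;;
     Loop 3 (\<lambda>z. z \<noteq> 3) (Cond 3 (\<lambda>z. z = 1) (pop 3 ;; push 1 1 ;; push 1 2)
       (pop 3 ;; push 1 1 ;; push 1 1 ;; push 1 2 ;; push 1 2)) ;; pop 3"

definition bits :: "bool list \<Rightarrow> nat list" where
  "bits x = map (\<lambda>b. if b then 2 else 1) x"

lemma exs_load_in:
  "exs (Loop 0 (\<lambda>z. z \<noteq> 0) (Cond 0 (\<lambda>z. z = 1) (pop 0 ;; push 3 1) (pop 0 ;; push 3 2)))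
     [bits x, m, v, t, c, u] (9 * length x + 1) [[], m, v, rev (bits x) @ t, c, u]"
proof (induction x arbitrary: t)
  case Nil
  show ?case by (simp add: bits_def) (rule exs_Loop_exit; simp)
next
  case (Cons b x)
  let ?b = "if b then 2 else 1 :: nat"
  have "exs (Cond 0 (\<lambda>z. z = 1) (pop 0 ;; push 3 1) (pop 0 ;; push 3 2))
      [?b # bits x, m, v, t, c, u] 8 [bits x, m, v, ?b # t, c, u]"
    by (rule exs_Cond[where n = 7]; cases b; simp) (rule exs_Seq[OF exs_pop0 exs_push3], simp)+
  then show ?case using Cons.IH[of "?b # t"]
    by - (rule exs_Loop_enter, simp, simp add: bits_def, simp add: bits_def, simp add: bits_def, simp)
qed

lemma exs_load_out:
  "exs (Loop 3 (\<lambda>z. z \<noteq> 3) (Cond 3 (\<lambda>z. z = 1) (pop 3 ;; push 1 1 ;; push 1 2)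
       (pop 3 ;; push 1 1 ;; push 1 1 ;; push 1 2 ;; push 1 2)))
     [i, ser (enc y) @ r, v, bits x @ 3 # t, c, u] (21 * length x + 1)
     [i, ser (enc (rev x @ y)) @ r, v, 3 # t, c, u]"
proof (induction x arbitrary: y)
  case Nil
  show ?case by (simp add: bits_def) (rule exs_Loop_exit; simp)
next
  case (Cons b x)
  let ?b = "if b then 2 else 1 :: nat"
  have "exs (Cond 3 (\<lambda>z. z = 1) (pop 3 ;; push 1 1 ;; push 1 2)
       (pop 3 ;; push 1 1 ;; push 1 1 ;; push 1 2 ;; push 1 2))
      [i, ser (enc y) @ r, v, ?b # bits x @ 3 # t, c, u] 20 [i, ser (enc (b # y)) @ r, v, bits x @ 3 # t, c, u]"
  proof (rule exs_Cond, simp, cases b)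
    case True
    show "exs (if top ([i, ser (enc y) @ r, v, ?b # bits x @ 3 # t, c, u] ! 3) = 1
      then pop 3 ;; push 1 1 ;; push 1 2
      else pop 3 ;; push 1 1 ;; push 1 1 ;; push 1 2 ;; push 1 2) 
        [i, ser (enc y) @ r, v, ?b # bits x @ 3 # t, c, u] 19 [i, ser (enc (b # y)) @ r, v, bits x @ 3 # t, c, u]"
      using True by simp (rule exs_Seq'[OF exs_pop3 exs_Seq'[OF exs_push1 exs_Seq'[OF exs_push1
        exs_Seq'[OF exs_push1 exs_push1]]], THEN exs_mono], simp)
  next
    case False
    show "exs (if top ([i, ser (enc y) @ r, v, ?b # bits x @ 3 # t, c, u] ! 3) = 1
      then pop 3 ;; push 1 1 ;; push 1 2
      else pop 3 ;; push 1 1 ;; push 1 1 ;; push 1 2 ;; push 1 2) 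
        [i, ser (enc y) @ r, v, ?b # bits x @ 3 # t, c, u] 19 [i, ser (enc (b # y)) @ r, v, bits x @ 3 # t, c, u]"
      using False by simp (rule exs_Seq'[OF exs_pop3 exs_Seq'[OF exs_push1 exs_push1], THEN exs_mono], simp)
  qed simp
  then show ?case using Cons.IH[of "b # y"]
    by - (rule exs_Loop_enter, simp, simp add: bits_def, simp add: bits_def, simp add: bits_def, simp)
qed

lemma exs_load:
  "exs load_com [bits x, r, v, t, c, u] (30 * length x + 20) [[], ser (enc x) @ r, v, t, c, u]"
proof -
  have b: "rev (bits x) = bits (rev x)" by (simp add: bits_def rev_map)
  show ?thesis unfolding load_com_def
    by (rule exs_Seq[OF exs_push3 exs_Seq'[OF exs_load_in[of x, unfolded b] exs_Seq'[OF exs_push1 exs_Seq'[OF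
        exs_load_out[where y = "[]" and x = "rev x", simplified] exs_pop3]]]]) simp
qed

lemma reps_init: "reps [bits x, [], [], [], [], []] (init_tapes 6 x)"
proof -
  have "is_stack [] (\<lambda>_. 0, 0)" "is_output [] (\<lambda>_. 0, 0)" "is_stack (bits x) (string_tape x, 0)"
    by (auto simp: bits_def string_tape_def)
  then show ?thesis
    by (auto simp: reps_def init_tapes_def less_Suc_eq numeral_eq_Suc simp del: is_stack.simps is_output.simps)
qed

lemma runs_stop:
  assumes "runs c ts n us" 
  shows "\<exists>t\<le>n + 1. (cstep ^^ t) ([c ;; Stop b], ts) = ([Stop b], us)"
proof -
  from assms obtain n' where n: "n' \<le> n" "\<forall>k. (cstep ^^ n') (c # k, ts) = (k, us)"
    by (auto simp: runs_def)
  have "(cstep ^^ Suc n') ([c ;; Stop b], ts) = ([Stop b], us)"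
    by (rule funpow_Suc_apply[OF _ n(2)[rule_format]]) (simp add: tape_act_stay)
  then show ?thesis using n by (intro exI[of _ "Suc n'"]) auto
qed

text \<open>Brings a polynomial into the shape used by the definitions of polynomial time. For
  \<open>n \<le> 1\<close> the additive constant suffices; for larger \<open>n\<close> constants are
  at most powers of \<open>n\<close>.\<close>

lemma poly_bound_form: "\<exists>e. \<forall>n. (a * n + b) ^ q + d \<le> n ^ e + (e :: nat)"
proof -
  define e where "e = (a + b + 1) * q + d + (a + b) ^ q"
  have "(a * n + b) ^ q + d \<le> n ^ e + e" for n
  proof (cases "n \<le> 1")
    case True
    have "(a * n + b) ^ q \<le> (a + b) ^ q" using True by (intro power_mono) auto
    then show ?thesis unfolding e_def by simp
  next
    case False
    have "a * n + b \<le> (a + b) * n" using False by (simp add: algebra_simps)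
    also have "\<dots> \<le> 2 ^ (a + b) * n" by (intro mult_right_mono) (auto simp: less_imp_le)
    also have "\<dots> \<le> n ^ (a + b) * n" using False by (intro mult_right_mono power_mono) auto
    finally have "a * n + b \<le> n ^ (a + b + 1)" by (simp add: power_add)
    then have "(a * n + b) ^ q \<le> n ^ ((a + b + 1) * q)"
      by (subst power_mult) (rule power_mono, auto)
    also have "\<dots> \<le> n ^ e" using False by (intro power_increasing) (auto simp: e_def)
    finally show ?thesis by (simp add: e_def)
  qed
  then show ?thesis by blast
qed

lemma sz_bits: "sz (x :: bool list) \<le> 4 * length x + 1"
proof (induction x)
  case (Cons b x)
  then show ?case using sz_bool_le[of b] by simp
qed simp

definition unload_com :: com where
  "unload_com = Loop 1 (\<lambda>z. z = 2) (pop 1 ;; Cond 1 (\<lambda>z. z = 1) (pop 1 ;; emit 1)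
     (pop 1 ;; pop 1 ;; pop 1 ;; emit 2))"

lemma exs_unload:
  "exs unload_com [i, ser (enc y), v, t, c, u] (21 * length y + 1) [i, [1], v, t, c, u @ bits y]"
proof (induction y arbitrary: u)
  case Nil
  show ?case unfolding unload_com_def by (simp add: bits_def) (rule exs_Loop_exit; simp add: stack_simps)
next
  case (Cons b y)
  let ?b = "if b then 2 else 1 :: nat"
  have "exs (pop 1 ;; Cond 1 (\<lambda>z. z = 1) (pop 1 ;; emit 1) (pop 1 ;; pop 1 ;; pop 1 ;; emit 2))
      [i, ser (enc (b # y)), v, t, c, u] 20 [i, ser (enc y), v, t, c, u @ [?b]]"
  proof (cases b)
    case True
    have "exs (Cond 1 (\<lambda>z. z = 1) (pop 1 ;; emit 1) (pop 1 ;; pop 1 ;; pop 1 ;; emit 2))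
      [i, 2 # 1 # 1 # ser (enc y), v, t, c, u] 16 [i, ser (enc y), v, t, c, u @ [2]]"
      by (rule exs_Cond, simp, simp add: stack_simps, 
        rule exs_Seq'[OF exs_pop1 exs_Seq'[OF exs_pop1 exs_Seq'[OF exs_pop1 exs_emit']]]) simp
    from exs_Seq'[OF exs_pop1 this, of 2] show ?thesis using True by simp
  next
    case False
    have "exs (Cond 1 (\<lambda>z. z = 1) (pop 1 ;; emit 1) (pop 1 ;; pop 1 ;; pop 1 ;; emit 2))
      [i, 1 # ser (enc y), v, t, c, u] 8 [i, ser (enc y), v, t, c, u @ [1]]"
      by (rule exs_Cond, simp, simp add: stack_simps, rule exs_Seq'[OF exs_pop1 exs_emit']) simp
    from exs_Seq'[OF exs_pop1 this, of 2] show ?thesis using False by (auto elim: exs_mono)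
  qed
  then show ?case using Cons.IH[of "u @ [?b]"] unfolding unload_com_def
    by - (rule exs_Loop_enter, simp, simp, assumption, simp add: bits_def, simp)
qed

theorem pt_polytime_computable:
  assumes "pt f" shows "polytime_computable f"
proof -
  from assms obtain C T where C: "pb T" "\<And>x. computes C (enc x) (T x) (enc (f x))" and f: "pb (\<lambda>x. sz (f x))"
    unfolding pt_def by blast
  from pb_add[OF C(1) f] obtain q where q: "\<And>x. T x + sz (f x) \<le> (sz x + 2) ^ q" by (auto simp: pb_def)
  obtain e where e: "\<And>n. (60 * n + 100) ^ (q + 1) + 0 \<le> n ^ e + e" using poly_bound_form by blast
  let ?P = "load_com ;; C ;; unload_com"
  obtain M where M: "turing_machine M" "\<And>x t b k ts. (cstep ^^ t) ([?P ;; Stop True], init_tapes 6 x) = (Stop b # k, ts) \<Longrightarrow>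
      tm_run M x t = (if b then accept_state else reject_state, ts)"
    using program_machine[of 6 "?P ;; Stop True"] by auto
  have "\<exists>t\<le>length x ^ e + e. fst (tm_run M x t) = accept_state \<and>
      fst (last (snd (tm_run M x t))) = string_tape (f x)" for x
  proof -
    let ?X = "sz x + 2"
    let ?n = "30 * length x + 20 + (T x + (21 * length (f x) + 1) + 1) + 1"
    have "exs ?P [bits x, [], [], [], [], []] ?n [[], [1], [], [], [], bits (f x)]"
      using exs_Seq'[OF exs_load[of x "[]" "[]" "[]" "[]" "[]", unfolded append_Nil2] exs_Seq'[OF
        C(2)[unfolded computes_def, rule_format, of "[]" x "[]" "[]" "[]" "[]", unfolded append_Nil2]
        exs_unload[of "[]" "f x" "[]" "[]" "[]" "[]", unfolded append_Nil]]]
      by simp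
    then obtain ts where ts: "reps [[], [1], [], [], [], bits (f x)] ts" "runs ?P (init_tapes 6 x) ?n ts"
      unfolding exs_def using reps_init by blast
    from runs_stop[OF ts(2)] obtain t where t: "t \<le> ?n + 1"
      "(cstep ^^ t) ([?P ;; Stop True], init_tapes 6 x) = ([Stop True], ts)" by blast
    have "?n + 1 \<le> 60 * length x + 60 + 21 * (T x + sz (f x))"
      using length_le_sz[of "f x"] by simp
    also have "\<dots> \<le> 60 * length x + 60 + 21 * ?X ^ q" using q[of x] by simp
    also have "\<dots> \<le> (60 * length x + 60) * ?X ^ q + 21 * ?X ^ q"
      by (intro add_mono) auto
    also have "\<dots> = (60 * length x + 81) * ?X ^ q" by (simp add: algebra_simps)
    also have "\<dots> \<le> (60 * length x + 100) * (60 * length x + 100) ^ q"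
      using sz_bits[of x] by (intro mult_mono power_mono) auto
    also have "\<dots> \<le> length x ^ e + e" using e[of "length x"] by (simp add: power_add mult.commute)
    finally have "t \<le> length x ^ e + e" using t(1) by linarith
    moreover have "tm_run M x t = (accept_state, ts)" using M(2)[OF t(2)] by simp
    moreover have "fst (last ts) = string_tape (f x)"
    proof -
      obtain c h where ch: "ts ! 5 = (c, h)" by fastforce
      have "is_output (bits (f x)) (c, h)" "length ts = 6" using ts(1) ch by (auto simp: reps_def)
      moreover from this have "last ts = ts ! 5" by (subst last_conv_nth) auto
      ultimately show ?thesis using ch
        by (auto simp: string_tape_def bits_def fun_eq_iff)
    qed
    ultimately show ?thesis by auto
  qed
  then show ?thesis unfolding polytime_computable_def using M(1) by blast
qed

section \<open>A machine that searches for the first successful parameter\<close>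

definition search_body :: "com \<Rightarrow> com" where
  "search_body C = pop 1 ;; drop_tree ;; C ;; pop 1 ;; pop 1"

definition search_com :: "com \<Rightarrow> com" where
  "search_com C = push 1 1 ;; load_com ;; push 1 2 ;; push 1 1 ;; push 1 1 ;;
     Loop 1 (\<lambda>z. z = 1) (search_body C) ;; pop 1 ;; pop 1 ;; pop 1"

text \<open>The top of the main stack is the pair of the stop flag, the answer, and the remaining
  arguments; the machine tries \<open>n = 0, 1, \<dots>\<close> until the flag is set.\<close>

theorem pt_search_machine:
  fixes G :: "bool list \<times> nat \<Rightarrow> bool \<times> bool"
  assumes "pt G"
  shows "\<exists>M q. turing_machine M \<and> (\<forall>x n. fst (G (x, n)) \<and> (\<forall>j<n. \<not> fst (G (x, j))) \<longrightarrow>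
     (\<exists>t \<le> (length x + n + 2) ^ q. fst (tm_run M x t) = (if snd (G (x, n)) then accept_state else reject_state)))"
proof -
  \<comment> \<open>The result is delivered together with the arguments of the next round, so that
    the stack is ready for another round once flag and answer are dropped.\<close>
  define H where "H p = (G p, (fst p, Suc (snd p)))" for p
  have "pt (\<lambda>p :: bool list \<times> nat. Suc (snd p))"
    by (rule pt_recode[OF pt_Pair[OF pt_const[of L] pt_snd[OF pt_id]]]) (simp add: enc_D_def)
  then have "pt H" unfolding H_def by (intro pt_intros assms)
  then obtain C T where C: "pb T" "\<And>x. computes C (enc x) (T x) (enc (H x))"
    unfolding pt_def by blast
  from C(1) obtain q where q: "\<And>x. T x \<le> (sz x + 2) ^ q" unfolding pb_def by blast
  \<comment> \<open>After the search the answer lies on top; its first symbol is 1 exactly for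
    \<open>False\<close>.\<close>
  let ?P = "search_com C ;; Cond 1 (\<lambda>z. z = 1) (Stop False) (Stop True)"
  obtain M where M: "turing_machine M" "\<And>x t b k ts. (cstep ^^ t) ([?P], init_tapes 6 x) = (Stop b # k, ts) \<Longrightarrow>
      tm_run M x t = (if b then accept_state else reject_state, ts)"
    using program_machine[of 6 ?P] by auto
  have main: "\<exists>t \<le> (length x + n + 2) ^ (3 * q + 10). fst (tm_run M x t) = (if snd (G (x, n)) then accept_state else reject_state)"
    if n: "fst (G (x, n))" "\<forall>j<n. \<not> fst (G (x, j))" for x n
  proof -
    let ?B = "(sz (x, n) + 2) ^ q"
    let ?s = "\<lambda>b j r. [[], ser (enc (b :: bool \<times> bool)) @ ser (enc (x, j)) @ r, [], [], [], []] :: nat list list"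
    let ?s' = "\<lambda>b j. [[], ser (enc (fst b)) @ ser (enc (snd b)) @ ser (enc (x, j)), [], [], [], []] :: nat list list"
    have body: "exs (search_body C) [[], ser (enc False) @ ser (enc a) @ ser (enc (x, j)), [], [], [], []] (?B + 100)
       (?s' (G (x, j)) (Suc j))" if "j \<le> n" for a :: bool and j
    proof -
      have "T (x, j) \<le> ?B" using that by (intro order_trans[OF q] power_mono) auto
      moreover have "exs (search_body C) [[], 1 # ser (enc a) @ ser (enc (x, j)) @ [], [], [], [], []] (T (x, j) + 100)
         [[], ser (enc (fst (G (x, j)))) @ ser (enc (snd (G (x, j)))) @ ser (enc (x, Suc j)) @ [], [], [], [], []]"
        unfolding search_body_def
        by (rule exs_Seq[OF exs_pop1 exs_Seq'[OF exs_drop exs_Seq'[OF C(2)[unfolded computes_def, rule_format]]]],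
            unfold H_def prod.sel enc_prod.simps prod.collapse,
            subst (1) prod.collapse[of "G (x, j)", symmetric],
            unfold enc_prod.simps ser.simps append.simps append_assoc,
            rule exs_Seq'[OF exs_pop1 exs_pop1])
           (use sz_bool_le[of a] in \<open>simp add: sz_def\<close>)
      ultimately show ?thesis by (auto intro: exs_mono)
    qed
    have loop: "exs (Loop 1 (\<lambda>z. z = 1) (search_body C)) [[], ser (enc False) @ ser (enc a) @ ser (enc (x, n - m)), [], [], [], []]
       ((m + 1) * (?B + 101) + 1) (?s' (G (x, n)) (Suc n))" if "m \<le> n" for a :: bool and m
      using that
    proof (induction m arbitrary: a)
      case 0
      have x: "exs (Loop 1 (\<lambda>z. z = 1) (search_body C)) (?s' (G (x, n)) (Suc n)) 1 (?s' (G (x, n)) (Suc n))"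
        by (rule exs_Loop_exit) (use n in auto)
      show ?case unfolding diff_zero
        by (rule exs_Loop_enter[OF _ _ body[OF order_refl] x]) (auto simp: stack_simps)
    next
      case (Suc m)
      have "\<not> fst (G (x, n - Suc m))" using n Suc.prems by auto
      then have e: "?s' (G (x, n - Suc m)) (Suc (n - Suc m)) =
         [[], ser (enc False) @ ser (enc (snd (G (x, n - Suc m)))) @ ser (enc (x, n - m)), [], [], [], []]"
        using Suc.prems by (simp add: Suc_diff_Suc)
      have "m \<le> n" "n - Suc m \<le> n" using Suc.prems by auto
      show ?case
        by (rule exs_Loop_enter[OF _ _ body[OF \<open>n - Suc m \<le> n\<close>, unfolded e] Suc.IH[OF \<open>m \<le> n\<close>]])
           (auto simp: stack_simps)
    qed
    let ?N = "30 * length x + 100 + (n + 1) * (?B + 101)"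
    have "exs (search_com C) [bits x, [], [], [], [], []] ?N
       [[], ser (enc (snd (G (x, n)))) @ ser (enc (x, Suc n)), [], [], [], []]"
    proof -
      \<comment> \<open>Initially flag and answer are \<open>False\<close>; below them lies the pair
        of \<open>x\<close> and 0, whose closing leaf was pushed before the input was
        loaded.\<close>
      have l: "exs (Loop 1 (\<lambda>z. z = 1) (search_body C)) [[], 1 # 1 # 2 # ser (enc x) @ [1], [], [], [], []]
         ((n + 1) * (?B + 101) + 1) [[], 2 # 1 # 1 # ser (enc (snd (G (x, n)))) @ ser (enc (x, Suc n)), [], [], [], []]"
        using loop[of n False] n(1) by simp
      show ?thesis unfolding search_com_def
        by (rule exs_Seq[OF exs_push1 exs_Seq'[OF exs_load exs_Seq'[OF exs_push1 exs_Seq'[OF exs_push1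
          exs_Seq'[OF exs_push1 exs_Seq'[OF l exs_Seq'[OF exs_pop1 exs_Seq'[OF exs_pop1 exs_pop1]]]]]]]]) simp
    qed
    then obtain ts where ts: "reps [[], ser (enc (snd (G (x, n)))) @ ser (enc (x, Suc n)), [], [], [], []] ts"
      "runs (search_com C) (init_tapes 6 x) ?N ts"
      unfolding exs_def using reps_init by blast
    from ts(2) obtain t where t: "t \<le> ?N" "\<And>k. (cstep ^^ t) (search_com C # k, init_tapes 6 x) = (k, ts)"
      by (auto simp: runs_def)
    let ?b = "snd (G (x, n))"
    have rd: "reads ts ! 1 = (if ?b then 2 else 1)"
      using reads_top[OF ts(1), of 1] by (cases ?b) auto
    have s1: "cstep ([Cond 1 (\<lambda>z. z = 1) (Stop False) (Stop True)], ts) = ([Stop ?b], ts)"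
      using rd by (simp add: tape_act_stay)
    have "(cstep ^^ Suc (t + 1)) ([?P], init_tapes 6 x) = ([Stop ?b], ts)"
    proof (rule funpow_Suc_apply)
      show "cstep ([?P], init_tapes 6 x) = ([search_com C, Cond 1 (\<lambda>z. z = 1) (Stop False) (Stop True)], init_tapes 6 x)"
        by (simp add: tape_act_stay)
      show "(cstep ^^ (t + 1)) ([search_com C, Cond 1 (\<lambda>z. z = 1) (Stop False) (Stop True)], init_tapes 6 x) = ([Stop ?b], ts)"
        by (rule funpow_add_apply[OF t(2)]) (use s1 in \<open>simp add: One_nat_def\<close>)
    qed
    from M(2)[OF this] have "fst (tm_run M x (Suc (t + 1))) = (if ?b then accept_state else reject_state)" by simp
    moreover have "Suc (t + 1) \<le> (length x + n + 2) ^ (3 * q + 10)"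
    proof -
      define X where "X = length x + n + 2"
      have X: "X \<ge> 2" by (simp add: X_def)
      have four: "4 \<le> X ^ 2" using power_mono[OF X, of 2] by simp
      have "sz (x, n) + 2 \<le> 4 * X" using sz_bits[of x] by (simp add: X_def)
      also have "\<dots> \<le> X ^ 2 * X" using four by (rule mult_right_mono) simp
      also have "\<dots> = X ^ 3" by (simp add: power2_eq_square power3_eq_cube)
      finally have "?B \<le> (X ^ 3) ^ q" by (rule power_mono) simp
      then have B: "?B \<le> X ^ (3 * q)" by (simp add: power_mult)
      have p: "1 \<le> X ^ (3 * q)" using X by simp
      have "Suc (t + 1) \<le> 30 * X + 102 + X * (X ^ (3 * q) + 101)"
        using t(1) mult_mono[of "n + 1" X "?B + 101" "X ^ (3 * q) + 101"] B X by (simp add: X_def)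
      \<comment> \<open>The constant is a power of 2 and \<open>X \<ge> 2\<close>, so it turns into
        nine further factors \<open>X\<close>.\<close>
      also have "\<dots> \<le> 512 * (X * X ^ (3 * q))"
      proof -
        define Y where "Y = X * X ^ (3 * q)"
        have "X \<le> Y" using p by (simp add: Y_def)
        moreover have "X * (X ^ (3 * q) + 101) = Y + 101 * X" by (simp add: Y_def algebra_simps)
        ultimately show ?thesis using X unfolding Y_def[symmetric] by linarith
      qed
      also have "512 = (2 :: nat) ^ 9" by simp
      also have "2 ^ 9 * (X * X ^ (3 * q)) \<le> X ^ 9 * (X * X ^ (3 * q))"
        by (intro mult_right_mono power_mono X) auto
      also have "\<dots> = X ^ (9 + (1 + 3 * q))" by (simp only: power_add power_one_right)
      also have "9 + (1 + 3 * q) = 3 * q + 10" by simp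
      finally show ?thesis by (simp add: X_def)
    qed
    ultimately show ?thesis by blast
  qed
  show ?thesis
    by (rule exI[of _ M], rule exI[of _ "3 * q + 10"]) (intro conjI allI impI M(1) main; simp)
qed

declare One_nat_def [simp]

section \<open>A library of polynomial time functions\<close>

lemma pt_enc [pt_intros]: "pt f \<Longrightarrow> pt (\<lambda>x. enc (f x))"
  by (rule pt_recode) (simp_all add: enc_D_def)

lemma pt_eqI: "pt g \<Longrightarrow> (\<And>x. f x = g x) \<Longrightarrow> pt f"
  by (rule pt_recode) simp_all

text \<open>Destructing a value costs nothing: a tree that is not a leaf is handed on unchanged and
  merely read as the encoding of some \<open>y\<close>, for instance of the pair of head and
  tail.\<close>

lemma pt_case_enc:
  fixes l :: "'a::enc \<Rightarrow> 'l::enc" and g :: "'a \<times> 'y::enc \<Rightarrow> 'b::enc"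
  assumes l: "pt l" and f: "pt f" and g: "pt g"
    and leaf: "\<And>x. enc (l x) = L \<Longrightarrow> h x = f x"
    and node: "\<And>x. enc (l x) \<noteq> L \<Longrightarrow> \<exists>y. enc (l x) = enc y \<and> h x = g (x, y)"
  shows "pt h"
proof -
  from l f g obtain Cl Tl Cf Tf Cg Tg where
    L: "pb Tl" "\<And>x. computes Cl (enc x) (Tl x) (enc (l x))" and
    F: "pb Tf" "\<And>x. computes Cf (enc x) (Tf x) (enc (f x))" and
    G: "pb Tg" "\<And>x. computes Cg (enc x) (Tg x) (enc (g x))"
    unfolding pt_def by blast
  from pb_add[OF G(1) pt_sz[OF g]] obtain q where q: "\<And>x. Tg x + sz (g x) \<le> (sz x + 2) ^ q"
    unfolding pb_def by blast
  let ?B = "\<lambda>x. (sz x + sz (l x) + 3) ^ q"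
  have B: "Tg (x, y) \<le> ?B x" "sz (g (x, y)) \<le> ?B x" if "enc (l x) = enc y" for x y
  proof -
    have "sz (x, y) + 2 = sz x + sz (l x) + 3" using that by (simp add: sz_def)
    then have "Tg (x, y) + sz (g (x, y)) \<le> ?B x" using q[of "(x, y)"] by metis
    then show "Tg (x, y) \<le> ?B x" "sz (g (x, y)) \<le> ?B x" by linarith+
  qed
  let ?id = "push 1 1 ;; pop 1"
  let ?m = "\<lambda>x. (7 + Tl x + 45 * sz x + 50) + ?B x + 1 + Tf x"
  show ?thesis
  proof (rule ptI)
    fix x
    have "computes (if_com Cl (pair_com ?id Cl ;; Cg) Cf) (enc x)
       (Tl x + ?m x + 18 * dsize (enc (l x)) + 45 * dsize (enc x) + 80) (enc (h x))"
    proof (rule computes_if[OF L(2)])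
      show "computes (if enc (l x) = L then Cf else pair_com ?id Cl ;; Cg) (enc x)
        (7 + Tl x + 45 * sz x + 50 + ?B x + 1 + Tf x) (enc (h x))"
      proof (cases "enc (l x) = L")
        case True
        then show ?thesis using leaf[of x] computes_mono[OF F(2)] by simp
      next
        case False
        then obtain y where y: "enc (l x) = enc y" "h x = g (x, y)" using node by blast
        have "computes (pair_com ?id Cl ;; Cg) (enc x) (7 + Tl x + 45 * sz x + 50 + Tg (x, y) + 1) (enc (h x))"
          using computes_Seq[OF computes_pair[OF computes_id L(2)[of x]]] G(2)[of "(x, y)"] y
          by (simp add: sz_def)
        then show ?thesis using False B(1)[OF y(1)] by (auto elim: computes_mono)
      qed
    qed
    then show "computes (if_com Cl (pair_com ?id Cl ;; Cg) Cf) (enc x)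
       (Tl x + ?m x + 18 * sz (l x) + 45 * sz x + 80) (enc (h x))" unfolding sz_def .
  next
    show "pb (\<lambda>x. sz (h x))"
    proof (rule pb_mono)
      show "sz (h x) \<le> sz (f x) + ?B x" for x
        using leaf[of x] node[of x] B(2)[of x] by (cases "enc (l x) = L") (auto intro: trans_le_add2)
    qed (intro pb_intros pt_sz f l)
  qed (intro pb_intros pt_sz l L F)
qed

lemma pt_case_list [pt_intros]:
  assumes "pt l" "pt f" "pt (\<lambda>p. g (fst p) (fst (snd p)) (snd (snd p)))"
  shows "pt (\<lambda>x. case l x of [] \<Rightarrow> f x | y # ys \<Rightarrow> g x y ys)"
proof (rule pt_case_enc[OF assms])
  fix x assume "enc (l x) \<noteq> L"
  then obtain y ys where "l x = y # ys" by (cases "l x") auto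
  then show "\<exists>y. enc (l x) = enc y \<and> (case l x of [] \<Rightarrow> f x | y # ys \<Rightarrow> g x y ys) =
     g (fst (x, y)) (fst (snd (x, y))) (snd (snd (x, y)))" by (intro exI[of _ "(y, ys)"]) auto
qed (auto split: list.split)

fun tree_left :: "D \<Rightarrow> D" where "tree_left L = L" | "tree_left (N a b) = a"
fun tree_right :: "D \<Rightarrow> D" where "tree_right L = L" | "tree_right (N a b) = b"

lemma pt_tree_left [pt_intros]: "pt f \<Longrightarrow> pt (\<lambda>x. tree_left (f x))"
proof (rule pt_case_enc[OF _ pt_const[of L] pt_fst[OF pt_snd[OF pt_id]]])
  fix x assume "enc (f x) \<noteq> L"
  then obtain a b where "f x = N a b" by (cases "f x") (auto simp: enc_D_def)
  then show "\<exists>y. enc (f x) = enc y \<and> tree_left (f x) = fst (snd (x, y :: D \<times> D))"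
    by (intro exI[of _ "(a, b)"]) (auto simp: enc_D_def)
qed (auto simp: enc_D_def)

lemma pt_tree_right [pt_intros]: "pt f \<Longrightarrow> pt (\<lambda>x. tree_right (f x))"
proof (rule pt_case_enc[OF _ pt_const[of L] pt_snd[OF pt_snd[OF pt_id]]])
  fix x assume "enc (f x) \<noteq> L"
  then obtain a b where "f x = N a b" by (cases "f x") (auto simp: enc_D_def)
  then show "\<exists>y. enc (f x) = enc y \<and> tree_right (f x) = snd (snd (x, y :: D \<times> D))"
    by (intro exI[of _ "(a, b)"]) (auto simp: enc_D_def)
qed (auto simp: enc_D_def)

lemma pt_is_leaf: "pt f \<Longrightarrow> pt (\<lambda>x. enc (f x) = L)"
proof -
  assume "pt f"
  then have "pt (\<lambda>x. if enc (f x) = L then True else False)" by (intro pt_If_enc pt_intros)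
  moreover have "(\<lambda>x. if enc (f x) = L then True else False) = (\<lambda>x. enc (f x) = L)" by auto
  ultimately show ?thesis by simp
qed

lemma pt_not [pt_intros]: "pt b \<Longrightarrow> pt (\<lambda>x. \<not> b x)"
proof -
  assume "pt b"
  then have "pt (\<lambda>x. if b x then False else True)" by (intro pt_intros)
  moreover have "(\<lambda>x. if b x then False else True) = (\<lambda>x. \<not> b x)" by auto
  ultimately show ?thesis by simp
qed

lemma pt_conj [pt_intros]: "pt a \<Longrightarrow> pt b \<Longrightarrow> pt (\<lambda>x. a x \<and> b x)"
proof -
  assume "pt a" "pt b"
  then have "pt (\<lambda>x. if a x then b x else False)" by (intro pt_intros)
  moreover have "(\<lambda>x. if a x then b x else False) = (\<lambda>x. a x \<and> b x)" by auto
  ultimately show ?thesis by simp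
qed

lemma pt_disj [pt_intros]: "pt a \<Longrightarrow> pt b \<Longrightarrow> pt (\<lambda>x. a x \<or> b x)"
  by (rule pt_eqI[of "\<lambda>x. \<not> (\<not> a x \<and> \<not> b x)"]) (intro pt_intros | auto)+

lemma pt_imp [pt_intros]: "pt a \<Longrightarrow> pt b \<Longrightarrow> pt (\<lambda>x. a x \<longrightarrow> b x)"
  by (rule pt_eqI[of "\<lambda>x. \<not> a x \<or> b x"]) (intro pt_intros | auto)+

lemma pt_iff [pt_intros]: "pt a \<Longrightarrow> pt b \<Longrightarrow> pt (\<lambda>x. a x \<longleftrightarrow> b x)"
  by (rule pt_eqI[of "\<lambda>x. (a x \<longrightarrow> b x) \<and> (b x \<longrightarrow> a x)"]) (intro pt_intros | auto)+

lemma pt_Cons [pt_intros]: "pt f \<Longrightarrow> pt g \<Longrightarrow> pt (\<lambda>x. f x # g x)"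
  by (rule pt_recode[OF pt_Pair]) auto

lemma pt_Suc [pt_intros]: "pt f \<Longrightarrow> pt (\<lambda>x. Suc (f x))"
  by (rule pt_recode[OF pt_N[OF pt_L pt_enc]]) (auto simp: enc_D_def)

lemma pt_pred: "pt f \<Longrightarrow> pt (\<lambda>x. f x - (1 :: nat))"
  by (rule pt_recode[OF pt_tree_right[OF pt_enc]]) (auto simp: enc_D_def, case_tac "f x", auto)

lemma pt_tl [pt_intros]: "pt f \<Longrightarrow> pt (\<lambda>x. tl (f x))"
  by (rule pt_recode[OF pt_tree_right[OF pt_enc]]) (auto simp: enc_D_def, case_tac "f x", auto)

text \<open>Iterates on triples of parameter, remaining list and accumulator. The list serves as its
  own clock; since its size exceeds its length, the step has to idle once the list is exhausted. As
  with \<open>pt_iter\<close>, all intermediate accumulators need a bound.\<close>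

lemma pt_fold:
  fixes f :: "'a::enc \<Rightarrow> 'y::enc \<Rightarrow> 'b::enc \<Rightarrow> 'b"
  assumes l: "pt l" and a: "pt a" and f: "pt (\<lambda>p. f (fst p) (fst (snd p)) (snd (snd p)))"
    and B: "pb B" and le: "\<And>x ys zs. l x = ys @ zs \<Longrightarrow> sz (fold (f x) ys (a x)) \<le> B x"
  shows "pt (\<lambda>x. fold (f x) (l x) (a x))"
proof -
  define g where "g p = (case fst (snd p) of [] \<Rightarrow> p
     | y # ys \<Rightarrow> (fst p, (ys, f (fst p) y (snd (snd p)))))" for p :: "'a \<times> ('y list \<times> 'b)"
  have g: "pt g" unfolding g_def
  proof (intro pt_case_list)
    have "pt (\<lambda>p. (\<lambda>p. f (fst p) (fst (snd p)) (snd (snd p)))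
       (fst (fst p), (fst (snd p), snd (snd (fst p)))))" for p :: "('a \<times> 'y list \<times> 'b) \<times> ('y \<times> 'y list)"
      by (rule pt_comp[OF f]) (intro pt_intros)
    then show "pt (\<lambda>p :: ('a \<times> 'y list \<times> 'b) \<times> ('y \<times> 'y list). (fst (fst p), snd (snd p),
        f (fst (fst p)) (fst (snd p)) (snd (snd (fst p)))))"
      by (intro pt_intros) simp
  qed (intro pt_intros)+
  have it: "(g ^^ j) (x, l x, a x) = (x, drop j (l x), fold (f x) (take j (l x)) (a x))" for x j
  proof (induction j)
    case (Suc j)
    show ?case
    proof (cases "j < length (l x)")
      case True
      then show ?thesis using Suc
        by (simp add: g_def Cons_nth_drop_Suc[symmetric] take_Suc_conv_app_nth)
    next
      case False
      then show ?thesis using Suc by (simp add: g_def)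
    qed
  qed simp
  have "pt (\<lambda>x. (g ^^ sz (l x)) (x, l x, a x))"
  proof (rule pt_iter[OF g l])
    show "pb (\<lambda>x. sz x + sz (l x) + B x + 2)" by (intro pb_intros B pt_sz l)
    show "sz ((g ^^ j) (x, l x, a x)) \<le> sz x + sz (l x) + B x + 2" for x j
      using le[of x "take j (l x)" "drop j (l x)"] sz_append[of "take j (l x)" "drop j (l x)"] sz_pos[of "take j (l x)"]
      by (simp add: it)
  qed (intro pt_intros l a)
  then have "pt (\<lambda>x. snd (snd ((g ^^ sz (l x)) (x, l x, a x))))" by (intro pt_intros)
  then show ?thesis by (simp add: it length_le_sz)
qed

lemma sz_rev: "sz (rev xs) = sz xs"
  by (simp add: sz_list flip: rev_map)

lemma pt_rev [pt_intros]: "pt l \<Longrightarrow> pt (\<lambda>x. rev (l x))"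
proof -
  assume l: "pt l"
  have e: "fold Cons ys zs = rev ys @ zs" for ys zs :: "'b list" by (simp add: fold_Cons_rev)
  have "pt (\<lambda>x. fold Cons (l x) [])"
  proof (rule pt_fold[OF l])
    show "pb (\<lambda>x. sz (l x))" by (rule pt_sz[OF l])
    show "sz (fold Cons ys []) \<le> sz (l x)" if "l x = ys @ zs" for x ys zs
      using sz_append[of ys zs] sz_pos[of zs] that by (simp add: e sz_rev)
  qed (intro pt_intros)+
  then show ?thesis by (simp add: e)
qed

lemma pt_append [pt_intros]: assumes l: "pt l" and m: "pt m" shows "pt (\<lambda>x. l x @ m x)"
proof -
  have e: "fold Cons ys zs = rev ys @ zs" for ys zs :: "'b list" by (simp add: fold_Cons_rev)
  have "pt (\<lambda>x. fold Cons (rev (l x)) (m x))"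
  proof (rule pt_fold)
    show "pb (\<lambda>x. sz (l x) + sz (m x))" by (intro pb_intros pt_sz l m)
    show "sz (fold Cons ys (m x)) \<le> sz (l x) + sz (m x)" if "rev (l x) = ys @ zs" for x ys zs
    proof -
      have "sz (l x) + 1 = sz ys + sz zs" using sz_append[of ys zs] that sz_rev[of "l x"] by simp
      then show ?thesis using sz_append[of "rev ys" "m x"] sz_pos[of zs] by (simp add: e sz_rev)
    qed
  qed (intro pt_intros l m)+
  then show ?thesis by (simp add: e)
qed

text \<open>An element is smaller than its list, so one polynomial in \<open>x\<close> covers the
  images of all elements.\<close>

lemma pt_image_bound:
  assumes "pt (\<lambda>p. f (fst p) (snd p))" "pt l"
  obtains B where "pb B" "\<And>x y. y \<in> set (l x) \<Longrightarrow> sz (f x y) \<le> B x"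
proof -
  from pt_sz[OF assms(1)] obtain q where q: "\<And>x. sz (f (fst x) (snd x)) \<le> (sz x + 2) ^ q"
    unfolding pb_def by blast
  have "pb (\<lambda>x. (sz x + sz (l x) + 3) ^ q)" by (intro pb_intros pt_sz assms)
  moreover have "sz (f x y) \<le> (sz x + sz (l x) + 3) ^ q" if "y \<in> set (l x)" for x y
    using q[of "(x, y)"] sz_elem_le[OF that] power_mono[of "sz (x, y) + 2" "sz x + sz (l x) + 3" q] by simp
  ultimately show thesis using that by blast
qed

lemma pt_map [pt_intros]:
  assumes f: "pt (\<lambda>p. f (fst p) (snd p))" and l: "pt l" shows "pt (\<lambda>x. map (f x) (l x))"
proof -
  have e: "fold (\<lambda>y acc. f x y # acc) ys zs = rev (map (f x) ys) @ zs" for x ys zs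
    by (induction ys arbitrary: zs) auto
  obtain B where B: "pb B" "\<And>x y. y \<in> set (l x) \<Longrightarrow> sz (f x y) \<le> B x"
    by (rule pt_image_bound[OF f l]) blast
  have "pt (\<lambda>x. fold (\<lambda>y acc. f x y # acc) (l x) [])"
  proof (rule pt_fold[OF l])
    show "pb (\<lambda>x. sz (l x) * (B x + 1) + 1)" by (intro pb_intros B pt_sz l)
    show "sz (fold (\<lambda>y acc. f x y # acc) ys []) \<le> sz (l x) * (B x + 1) + 1" if "l x = ys @ zs" for x ys zs
    proof -
      have "sz (rev (map (f x) ys)) \<le> length ys * (B x + 1) + 1"
        using sz_list_le[of "rev (map (f x) ys)" "B x"] B(2)[of _ x] that by auto
      also have "\<dots> \<le> sz (l x) * (B x + 1) + 1"
        using length_le_sz[of "l x"] that by (intro add_mono mult_mono) auto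
      finally show ?thesis by (simp add: e)
    qed
    have "pt (\<lambda>p. (\<lambda>p. f (fst p) (snd p)) (fst p, fst (snd (p :: 'a \<times> 'b \<times> 'c list))))"
      by (rule pt_comp[OF f]) (intro pt_intros)
    then show "pt (\<lambda>p. f (fst p) (fst (snd p)) # snd (snd p))" by (intro pt_intros) simp
  qed (intro pt_intros)
  then have "pt (\<lambda>x. rev (fold (\<lambda>y acc. f x y # acc) (l x) []))" by (intro pt_intros)
  then show ?thesis by (simp add: e)
qed

lemma pt_concat [pt_intros]: assumes l: "pt l" shows "pt (\<lambda>x. concat (l x))"
proof -
  have e: "fold (\<lambda>y acc. acc @ y) ys zs = zs @ concat ys" for ys and zs :: "'b list"
    by (induction ys arbitrary: zs) auto
  have s: "sz (concat ys) \<le> sz ys" for ys :: "'b list list"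
  proof (induction ys)
    case (Cons y ys)
    then show ?case using sz_append[of y "concat ys"] by simp
  qed simp
  have "pt (\<lambda>x. fold (\<lambda>y acc. acc @ y) (l x) [])"
  proof (rule pt_fold[OF l])
    show "pb (\<lambda>x. sz (l x))" by (rule pt_sz[OF l])
    show "sz (fold (\<lambda>y acc. acc @ y) ys []) \<le> sz (l x)" if "l x = ys @ zs" for x ys zs
      using sz_append[of ys zs] sz_pos[of zs] that s[of ys] by (simp add: e)
  qed (intro pt_intros)+
  then show ?thesis by (simp add: e)
qed

lemma pt_filter [pt_intros]:
  assumes "pt (\<lambda>p. P (fst p) (snd p))" "pt l" shows "pt (\<lambda>x. filter (P x) (l x))"
proof -
  have "filter (P x) l = concat (map (\<lambda>y. if P x y then [y] else []) l)" for x l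
    by (induction l) auto
  moreover have "pt (\<lambda>x. concat (map (\<lambda>y. if P x y then [y] else []) (l x)))"
    by (intro pt_intros assms)
  ultimately show ?thesis by simp
qed

lemma pt_is_Nil [pt_intros]: "pt l \<Longrightarrow> pt (\<lambda>x. l x = [])"
proof -
  have "enc l = L \<longleftrightarrow> l = []" for l :: "'b list" by (cases l) auto
  then show "pt l \<Longrightarrow> ?thesis" using pt_is_leaf[of l] by simp
qed

lemma pt_is_zero: "pt n \<Longrightarrow> pt (\<lambda>x. n x = (0 :: nat))"
proof -
  have "enc n = L \<longleftrightarrow> n = 0" for n :: nat by (cases n) auto
  then show "pt n \<Longrightarrow> ?thesis" using pt_is_leaf[of n] by simp
qed

lemma pt_Bex [pt_intros]:
  assumes "pt l" "pt (\<lambda>p. P (fst p) (snd p))" shows "pt (\<lambda>x. \<exists>y\<in>set (l x). P x y)"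
proof -
  have "(\<exists>y\<in>set (l x). P x y) = (filter (P x) (l x) \<noteq> [])" for x
    by (auto simp: filter_empty_conv)
  moreover have "pt (\<lambda>x. filter (P x) (l x) \<noteq> [])" by (intro pt_intros assms)
  ultimately show ?thesis by simp
qed

lemma pt_Ball [pt_intros]:
  assumes "pt l" "pt (\<lambda>p. P (fst p) (snd p))" shows "pt (\<lambda>x. \<forall>y\<in>set (l x). P x y)"
  by (rule pt_eqI[OF pt_not[OF pt_Bex[OF assms(1) pt_not[OF assms(2)]]]]) simp

text \<open>A number and this list have the same tree, so sums, products and bounded loops come from
  the rules for lists.\<close>

definition units :: "nat \<Rightarrow> D list" where "units n = replicate n L"

lemma enc_units: "enc (units n) = enc n"
  by (induction n) (auto simp: units_def enc_D_def)

lemma length_units [simp]: "length (units n) = n" by (simp add: units_def)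

lemma units_append: "units m @ units n = units (m + n)"
  by (simp add: units_def replicate_add)

lemma pt_units [pt_intros]: "pt n \<Longrightarrow> pt (\<lambda>x. units (n x))"
  by (rule pt_recode, assumption) (simp add: enc_units)

lemma pt_add [pt_intros]: assumes "pt m" "pt n" shows "pt (\<lambda>x. m x + n x :: nat)"
  by (rule pt_recode[OF pt_append[OF pt_units[OF assms(1)] pt_units[OF assms(2)]]])
     (simp add: units_append enc_units)

lemma pt_mult [pt_intros]: assumes "pt m" "pt n" shows "pt (\<lambda>x. m x * n x :: nat)"
proof (rule pt_recode)
  show "pt (\<lambda>x. concat (map (\<lambda>_. units (n x)) (units (m x))))"
    by (intro pt_intros pt_comp[OF assms(2)] assms)
  have "concat (map (\<lambda>_. units b) (units a)) = units (a * b)" for a b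
    by (induction a) (auto simp: units_def replicate_add)
  then show "enc (m x * n x) = enc (concat (map (\<lambda>_. units (n x)) (units (m x))))" for x
    by (simp add: enc_units)
qed

lemma pt_power [pt_intros]: "pt n \<Longrightarrow> pt (\<lambda>x. n x ^ c :: nat)"
  by (induction c) (auto intro: pt_intros)

lemma pt_diff [pt_intros]: assumes m: "pt m" and n: "pt n" shows "pt (\<lambda>x. m x - n x :: nat)"
proof -
  have e: "fold (\<lambda>_ k. k - 1) ys k = k - length ys" for ys :: "D list" and k :: nat
    by (induction ys arbitrary: k) auto
  have "pt (\<lambda>x. fold (\<lambda>_ k. k - 1) (units (n x)) (m x))"
  proof (rule pt_fold)
    show "pb (\<lambda>x. sz (m x))" by (rule pt_sz[OF m])
  qed (auto simp: e intro!: pt_intros pt_pred m n simp del: One_nat_def)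
  then show ?thesis by (simp only: e length_units)
qed

lemma pt_le [pt_intros]: "pt m \<Longrightarrow> pt n \<Longrightarrow> pt (\<lambda>x. m x \<le> (n x :: nat))"
  by (rule pt_eqI[of "\<lambda>x. m x - n x = 0"]) (intro pt_is_zero pt_intros | auto)+

lemma pt_less [pt_intros]: "pt m \<Longrightarrow> pt n \<Longrightarrow> pt (\<lambda>x. m x < (n x :: nat))"
  by (rule pt_eqI[of "\<lambda>x. Suc (m x) \<le> n x"]) (intro pt_intros | auto)+

lemma pt_length [pt_intros]: assumes "pt l" shows "pt (\<lambda>x. length (l x))"
proof (rule pt_recode)
  show "pt (\<lambda>x. map (\<lambda>_. L) (l x))" by (intro pt_intros assms)
  show "enc (length (l x)) = enc (map (\<lambda>_. L) (l x))" for x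
    using enc_units[of "length (l x)"] by (simp add: units_def map_replicate_const)
qed

lemma pt_upt [pt_intros]: assumes n: "pt n" shows "pt (\<lambda>x. [0..<n x])"
proof -
  have e: "fold (\<lambda>_ acc. acc @ [length acc]) ys [0..<k] = [0..<k + length ys]" for ys :: "D list" and k :: nat
  proof (induction ys arbitrary: k)
    case (Cons y ys)
    show ?case using Cons[of "Suc k"] by simp
  qed simp
  from e[of _ 0] have e0: "fold (\<lambda>_ acc. acc @ [length acc]) ys [] = [0..<length ys]" for ys :: "D list"
    by simp
  have "pt (\<lambda>x. fold (\<lambda>_ acc. acc @ [length acc]) (units (n x)) [])"
  proof (rule pt_fold)
    show "pb (\<lambda>x. n x * (2 * n x + 2) + 1)"
      by (intro pb_intros; rule pb_mono[OF pt_sz[OF n]]) auto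
    show "sz (fold (\<lambda>_ acc. acc @ [length acc]) ys []) \<le> n x * (2 * n x + 2) + 1"
      if "units (n x) = ys @ zs" for x ys zs
    proof -
      have le: "length ys \<le> n x" using arg_cong[OF that, of length] by simp
      have "sz [0..<length ys] \<le> length ys * (2 * n x + 1 + 1) + 1"
        using sz_list_le[of "[0..<length ys]" "2 * n x + 1"] le by simp
      also have "\<dots> \<le> n x * (2 * n x + 2) + 1" using mult_le_mono1[OF le, of "2 * n x + 2"] by simp
      finally show ?thesis by (simp add: e0)
    qed
  qed (intro pt_intros n)+
  then show ?thesis by (simp add: e0)
qed

lemma pt_drop [pt_intros]: assumes n: "pt n" and l: "pt l" shows "pt (\<lambda>x. drop (n x) (l x))"
proof -
  have e: "fold (\<lambda>_ k. tl k) ys k = drop (length ys) k" for ys :: "D list" and k :: "'b list"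
    by (induction ys arbitrary: k) (auto simp: drop_Suc)
  have "pt (\<lambda>x. fold (\<lambda>_ k. tl k) (units (n x)) (l x))"
  proof (rule pt_fold)
    show "pb (\<lambda>x. sz (l x))" by (rule pt_sz[OF l])
    show "sz (fold (\<lambda>_ k. tl k) ys (l x)) \<le> sz (l x)" for ys :: "D list" and x
      using sz_append[of "take (length ys) (l x)" "drop (length ys) (l x)"] sz_pos[of "take (length ys) (l x)"]
      by (simp add: e)
  qed (intro pt_intros l n)+
  then show ?thesis by (simp add: e)
qed

text \<open>Total access with a default value, so that its \<open>pt\<close> rule carries no side
  condition on the index.\<close>

definition nth_or :: "'a \<Rightarrow> 'a list \<Rightarrow> nat \<Rightarrow> 'a" where
  "nth_or d l n = (case drop n l of [] \<Rightarrow> d | y # _ \<Rightarrow> y)"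

lemma nth_or_nth: "nth_or d l n = (if n < length l then l ! n else d)"
  by (auto simp: nth_or_def Cons_nth_drop_Suc[symmetric])

lemma pt_nth_or [pt_intros]:
  assumes "pt d" "pt l" "pt n" shows "pt (\<lambda>x. nth_or (d x) (l x) (n x))"
  unfolding nth_or_def by (intro pt_intros assms)

text \<open>Equality of trees by a worklist of pairs of subtrees. Each round removes a node of the
  first tree or discards a whole pair, so the size of the first tree bounds the number of
  rounds.\<close>

definition eq_step :: "bool \<times> (D \<times> D) list \<Rightarrow> bool \<times> (D \<times> D) list" where
  "eq_step s = (case snd s of [] \<Rightarrow> s
     | p # r \<Rightarrow> if enc (fst p) = L \<or> enc (snd p) = L then (fst s \<and> enc (fst p) = L \<and> enc (snd p) = L, r)
       else (fst s, (tree_left (fst p), tree_left (snd p)) # (tree_right (fst p), tree_right (snd p)) # r))"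

lemma eq_step_funpow: "\<exists>j\<le>dsize a. (eq_step ^^ j) (ok, (a, b) # r) = (ok \<and> a = b, r)"
proof (induction a arbitrary: ok b r)
  case L
  show ?case by (intro exI[of _ 1]) (auto simp: eq_step_def enc_D_def)
next
  case (N a1 a2)
  show ?case
  proof (cases b)
    case L
    then show ?thesis by (intro exI[of _ 1]) (auto simp: eq_step_def enc_D_def)
  next
    case (N b1 b2)
    obtain j where j: "j \<le> dsize a1" "(eq_step ^^ j) (ok, (a1, b1) # (a2, b2) # r) = (ok \<and> a1 = b1, (a2, b2) # r)"
      using N.IH(1) by blast
    obtain k where k: "k \<le> dsize a2" "(eq_step ^^ k) (ok \<and> a1 = b1, (a2, b2) # r) = ((ok \<and> a1 = b1) \<and> a2 = b2, r)"
      using N.IH(2) by blast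
    have "(eq_step ^^ Suc (j + k)) (ok, (N a1 a2, b) # r) = ((ok \<and> a1 = b1) \<and> a2 = b2, r)"
      by (rule funpow_Suc_apply[OF _ funpow_add_apply[OF j(2) k(2)]]) (simp add: N eq_step_def enc_D_def)
    then show ?thesis using j k N by (intro exI[of _ "Suc (j + k)"]) auto
  qed
qed

lemma pt_eq [pt_intros]:
  fixes f g :: "'a::enc \<Rightarrow> 'b::enc"
  assumes f: "pt f" and g: "pt g" shows "pt (\<lambda>x. f x = g x)"
proof -
  have sz_step: "sz (snd (eq_step s)) \<le> sz (snd s)" for s
  proof (cases "snd s")
    case (Cons p r)
    then show ?thesis
      by (cases "fst p"; cases "snd p"; cases p) (auto simp: eq_step_def enc_D_def sz_def[where 'a = D])
  qed (simp add: eq_step_def)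
  have sz_steps: "sz (snd ((eq_step ^^ j) s)) \<le> sz (snd s)" for j s
    by (induction j) (auto intro: order_trans[OF sz_step])
  have fix_step: "(eq_step ^^ j) (ok, []) = (ok, [])" for j ok
    by (induction j) (auto simp: eq_step_def)
  have "pt eq_step" unfolding eq_step_def by (intro pt_intros pt_is_leaf)
  then have "pt (\<lambda>x. (eq_step ^^ sz (f x)) (True, [(enc (f x), enc (g x))]))"
  proof (rule pt_iter[OF _ f])
    show "pb (\<lambda>x. sz (f x) + sz (g x) + 10)" by (intro pb_intros pt_sz f g)
    show "sz ((eq_step ^^ j) (True, [(enc (f x), enc (g x))])) \<le> sz (f x) + sz (g x) + 10" for j x
      using sz_steps[of j "(True, [(enc (f x), enc (g x))])"]
        sz_bool_le[of "fst ((eq_step ^^ j) (True, [(enc (f x), enc (g x))]))"]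
      by (cases "(eq_step ^^ j) (True, [(enc (f x), enc (g x))])") (simp add: sz_def[where 'a = D] enc_D_def flip: sz_def)
  qed (intro pt_intros f g)
  then have "pt (\<lambda>x. fst ((eq_step ^^ sz (f x)) (True, [(enc (f x), enc (g x))])))" by (intro pt_intros)
  moreover have "fst ((eq_step ^^ sz (f x)) (True, [(enc (f x), enc (g x))])) = (f x = g x)" for x
  proof -
    obtain j where j: "j \<le> sz (f x)" "(eq_step ^^ j) (True, [(enc (f x), enc (g x))]) = (enc (f x) = enc (g x), [])"
      using eq_step_funpow[of "enc (f x)" True "enc (g x)" "[]"] by (auto simp: sz_def)
    have "(eq_step ^^ (j + (sz (f x) - j))) (True, [(enc (f x), enc (g x))]) = (enc (f x) = enc (g x), [])"
      by (rule funpow_add_apply[OF j(2) fix_step])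
    then show ?thesis using j(1) inj_enc by fastforce
  qed
  ultimately show ?thesis by simp
qed

lemma pt_member [pt_intros]: assumes "pt y" "pt l" shows "pt (\<lambda>x. y x \<in> set (l x))"
proof -
  have "(y x \<in> set (l x)) = (\<exists>z\<in>set (l x). z = y x)" for x by auto
  moreover have "pt (\<lambda>x. \<exists>z\<in>set (l x). z = y x)" by (intro pt_intros pt_comp[OF assms(1)] assms)
  ultimately show ?thesis by simp
qed

section \<open>The gadget graph of a formula\<close>

text \<open>\<open>VA i a\<close> is a corner of the triangle of clause \<open>i\<close> and
  \<open>VP c r\<close> a strip vertex; \<open>VQ c r t\<close> and \<open>VR i t\<close> are the
  further common neighbours of the third edge of a strip triangle and of one edge of a clause
  triangle.\<close>

datatype vtx = VA nat nat | VP "nat \<times> nat" nat | VQ "nat \<times> nat" nat nat | VR nat nat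

text \<open>The colour of a strip vertex is its position modulo 3. A vertex \<open>VQ c r t\<close>
  is joined to the positions \<open>r\<close> and \<open>r + 2\<close> and takes the remaining
  colour; \<open>VR i t\<close> is joined to the corners 0 and 1.\<close>

fun colour :: "vtx \<Rightarrow> nat" where
  "colour (VA i a) = a"
| "colour (VP c r) = r mod 3"
| "colour (VQ c r t) = Suc r mod 3"
| "colour (VR i t) = 2"

text \<open>
  An occurrence \<open>c = (i, j)\<close> is the \<open>j\<close>-th literal of clause \<open>i\<close>; it owns 18 consecutive positions
  of the cyclic strip of its variable \<open>vr c\<close>, and \<open>nx c\<close> owns the next 18. The positions
  \<open>r0 c\<close> and \<open>r0 c + 1\<close> are identified with two vertices of the clause triangle. The residue
  of \<open>r0 c\<close> modulo 3 makes the graph 3-colourable, its parity is the sign of the literal, and its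
  distance to the ends of the block excludes unintended triangles.
\<close>

locale strips =
  fixes Oc :: "(nat \<times> nat) set" and nx :: "nat \<times> nat \<Rightarrow> nat \<times> nat" and vr :: "nat \<times> nat \<Rightarrow> 'v"
    and sg :: "nat \<times> nat \<Rightarrow> bool" and m s :: nat
  assumes Oc: "Oc \<subseteq> {..<m} \<times> {..<3}"
    and nx_Oc: "c \<in> Oc \<Longrightarrow> nx c \<in> Oc" and nx_inj: "inj_on nx Oc"
    and nx_vr: "c \<in> Oc \<Longrightarrow> vr (nx c) = vr c"
    and nx_conn: "c \<in> Oc \<Longrightarrow> c' \<in> Oc \<Longrightarrow> vr c = vr c' \<Longrightarrow> \<exists>k. (nx ^^ k) c = c'"
    and s_pos: "s \<ge> 1"
begin

text \<open>The unique number between 6 and 11 with the index of the literal as residue modulo 3 and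
  with the parity given by the sign.\<close>

definition r0 :: "nat \<times> nat \<Rightarrow> nat" where
  "r0 c = (if snd c = 0 then (if sg c then 6 else 9)
     else if snd c = 1 then (if sg c then 10 else 7) else (if sg c then 8 else 11))"

text \<open>As 18 is divisible by 6, parity and residue modulo 3 continue regularly from the end of
  a block to the start of the next.\<close>

definition adv :: "(nat \<times> nat) \<times> nat \<Rightarrow> (nat \<times> nat) \<times> nat" where
  "adv p = (if snd p < 17 then (fst p, Suc (snd p)) else (nx (fst p), 0))"

definition P :: "((nat \<times> nat) \<times> nat) set" where "P = Oc \<times> {..<18}"

definition v :: "(nat \<times> nat) \<times> nat \<Rightarrow> vtx" where
  "v p = (if snd p = r0 (fst p) then VA (fst (fst p)) (snd (fst p))
     else if snd p = Suc (r0 (fst p)) then VA (fst (fst p)) (Suc (snd (fst p)) mod 3)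
     else VP (fst p) (snd p))"

text \<open>The triangle at \<open>p\<close> has the corners \<open>p\<close>, \<open>adv p\<close>,
  \<open>adv (adv p)\<close>. Its rungs at \<open>p\<close> and at \<open>adv p\<close> are shared
  with the previous and the next triangle; its side is the third edge, which carries the pendant
  vertices. The rung at \<open>r0 c\<close> is also an edge of the clause triangle.\<close>

inductive_set arcs :: "(vtx \<times> vtx) set" where
  rung: "p \<in> P \<Longrightarrow> (v p, v (adv p)) \<in> arcs"
| side: "p \<in> P \<Longrightarrow> (v p, v (adv (adv p))) \<in> arcs"
| pendant: "p \<in> P \<Longrightarrow> t < s \<Longrightarrow> (v p, VQ (fst p) (snd p) t) \<in> arcs"
| pendant2: "p \<in> P \<Longrightarrow> t < s \<Longrightarrow> (v (adv (adv p)), VQ (fst p) (snd p) t) \<in> arcs"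
| clause01: "i < m \<Longrightarrow> (VA i 0, VA i 1) \<in> arcs"
| clause02: "i < m \<Longrightarrow> (VA i 0, VA i 2) \<in> arcs"
| clause12: "i < m \<Longrightarrow> (VA i 1, VA i 2) \<in> arcs"
| clause_pendant: "i < m \<Longrightarrow> t < s \<Longrightarrow> (VA i 0, VR i t) \<in> arcs"
| clause_pendant2: "i < m \<Longrightarrow> t < s \<Longrightarrow> (VA i 1, VR i t) \<in> arcs"

text \<open>The names \<open>VP c r\<close> at identified positions remain as isolated vertices,
  which keeps the set a plain product.\<close>

definition V :: "vtx set" where
  "V = (\<lambda>(i, a). VA i a) ` ({..<m} \<times> {..<3}) \<union> (\<lambda>p. VP (fst p) (snd p)) ` P \<union>
     (\<lambda>(p, t). VQ (fst p) (snd p) t) ` (P \<times> {..<s}) \<union> (\<lambda>(i, t). VR i t) ` ({..<m} \<times> {..<s})"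

definition E :: "vtx set set" where "E = (\<lambda>(x, y). {x, y}) ` arcs"

definition adj :: "vtx \<Rightarrow> vtx \<Rightarrow> bool" where "adj x y \<longleftrightarrow> (x, y) \<in> arcs \<or> (y, x) \<in> arcs"

section \<open>Adjacency, colouring and triangles of the gadget graph\<close>

lemma adj_E: "{x, y} \<in> E \<longleftrightarrow> adj x y"
  unfolding E_def adj_def image_iff by (auto simp: doubleton_eq_iff)

lemma adj_sym: "adj x y \<longleftrightarrow> adj y x" by (auto simp: adj_def)

lemma fin: "finite Oc" "finite P"
  using finite_subset[OF Oc] by (auto simp: P_def)

lemma slot: "c \<in> Oc \<Longrightarrow> fst c < m" "c \<in> Oc \<Longrightarrow> snd c < 3" "p \<in> P \<Longrightarrow> fst p \<in> Oc" "p \<in> P \<Longrightarrow> snd p < 18"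
  using Oc by (auto simp: P_def)

lemma adv_P: "p \<in> P \<Longrightarrow> adv p \<in> P"
  using nx_Oc by (auto simp: P_def adv_def)

lemma snd_adv: "p \<in> P \<Longrightarrow> snd (adv p) = (if snd p = 17 then 0 else Suc (snd p))"
  by (auto simp: adv_def P_def)

lemma adv_inj: "p \<in> P \<Longrightarrow> q \<in> P \<Longrightarrow> adv p = adv q \<Longrightarrow> p = q"
  using nx_inj by (cases p; cases q) (auto simp: adv_def P_def inj_on_def split: if_splits)

lemma r0_range: "6 \<le> r0 c" "r0 c \<le> 11" by (auto simp: r0_def)

lemma less_3: "a < (3 :: nat) \<longleftrightarrow> a = 0 \<or> a = 1 \<or> a = 2" by auto

lemma r0_mod: "snd c < 3 \<Longrightarrow> r0 c mod 3 = snd c"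
  by (auto simp: r0_def less_3)

lemma r0_even: "even (r0 c) \<longleftrightarrow> sg c" by (auto simp: r0_def)

text \<open>Identified positions lie between 6 and 12, so all positions within two steps of them
  belong to the same block.\<close>

lemma v_VA: "v p = VA i a \<Longrightarrow> fst (fst p) = i \<and> 6 \<le> snd p \<and> snd p \<le> 12 \<and>
    (snd p = r0 (fst p) \<and> a = snd (fst p) \<or> snd p = Suc (r0 (fst p)) \<and> a = Suc (snd (fst p)) mod 3)"
  using r0_range[of "fst p"] by (auto simp: v_def split: if_splits)

lemma v_VP: "v p = VP c r \<Longrightarrow> p = (c, r)"
  by (cases p) (auto simp: v_def split: if_splits)

lemma v_cases: obtains i a where "v p = VA i a" | "v p = VP (fst p) (snd p)"
  by (cases "snd p = r0 (fst p)"; cases "snd p = Suc (r0 (fst p))") (simp_all add: v_def)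

lemma v_neq [simp]: "v p \<noteq> VQ c r t" "v p \<noteq> VR i t" "VQ c r t \<noteq> v p" "VR i t \<noteq> v p"
  by (auto simp: v_def)

lemma mod3_Suc: "a < 3 \<Longrightarrow> Suc a mod 3 \<noteq> a" by (auto simp: less_3)

lemma v_block_inj: "p \<in> P \<Longrightarrow> q \<in> P \<Longrightarrow> fst p = fst q \<Longrightarrow> v p = v q \<Longrightarrow> p = q"
proof -
  assume a: "p \<in> P" "q \<in> P" "fst p = fst q" "v p = v q"
  have "Suc (snd (fst q)) mod 3 \<noteq> snd (fst q)" using mod3_Suc slot a by blast
  then show ?thesis using a by (cases p; cases q) (auto simp: v_def split: if_splits)
qed

lemma colour_v: "p \<in> P \<Longrightarrow> colour (v p) = snd p mod 3"
proof -
  assume "p \<in> P"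
  then have "snd (fst p) < 3" using slot by blast
  from r0_mod[OF this] mod_Suc_eq[of "r0 (fst p)" 3] show ?thesis
    by (auto simp: v_def)
qed

lemma colour_adv: "p \<in> P \<Longrightarrow> colour (v (adv p)) = Suc (snd p) mod 3"
  by (subst colour_v) (auto simp: adv_P snd_adv)

lemma colour_adv2: "p \<in> P \<Longrightarrow> colour (v (adv (adv p))) = Suc (Suc (snd p)) mod 3"
  by (subst colour_adv) (auto simp: adv_P snd_adv)

text \<open>Three colours exclude a \<open>K\<^sub>4\<close>; besides, they exclude edges between
  strip positions at distance 3.\<close>

lemma adj_colour: "adj x y \<Longrightarrow> colour x \<noteq> colour y \<and> colour x < 3 \<and> colour y < 3"
proof -
  have *: "Suc n mod 3 \<noteq> n mod 3" "Suc (Suc n) mod 3 \<noteq> n mod 3" "Suc (Suc n) mod 3 \<noteq> Suc n mod 3" for n :: nat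
    by (auto simp: mod_Suc)
  have "colour x \<noteq> colour y \<and> colour x < 3 \<and> colour y < 3" if "(x, y) \<in> arcs" for x y
    using that by cases (auto simp: colour_v colour_adv colour_adv2 * *[symmetric])
  then show "adj x y \<Longrightarrow> ?thesis" unfolding adj_def by metis
qed

definition near :: "(nat \<times> nat) \<times> nat \<Rightarrow> (nat \<times> nat) \<times> nat \<Rightarrow> bool" where
  "near p q \<longleftrightarrow> q = adv p \<or> q = adv (adv p) \<or> p = adv q \<or> p = adv (adv q)"

lemma near_sym: "near p q \<longleftrightarrow> near q p" by (auto simp: near_def)

lemma near_block:
  "near p q \<Longrightarrow> 2 \<le> snd p \<Longrightarrow> snd p \<le> 15 \<Longrightarrow>
   fst q = fst p \<and> (snd q = Suc (snd p) \<or> snd q = Suc (Suc (snd p)) \<or> snd p = Suc (snd q) \<or> snd p = Suc (Suc (snd q)))"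
  by (cases p; cases q) (auto simp: near_def adv_def split: if_splits)

lemma adj_VQ: "adj (VQ c r t) y \<Longrightarrow> (c, r) \<in> P \<and> t < s \<and> (y = v (c, r) \<or> y = v (adv (adv (c, r))))"
  unfolding adj_def by (auto elim: arcs.cases)

lemma adj_VR: "adj (VR i t) y \<Longrightarrow> i < m \<and> t < s \<and> (y = VA i 0 \<or> y = VA i 1)"
  unfolding adj_def by (auto elim: arcs.cases)

lemma adj_VP: "adj (VP c r) y \<Longrightarrow> (c, r) \<in> P \<and> ((\<exists>q\<in>P. near (c, r) q \<and> y = v q) \<or> (\<exists>c' r' t. y = VQ c' r' t))"
proof -
  assume "adj (VP c r) y"
  then consider p where "p \<in> P" "VP c r = v p" "y = v (adv p) \<or> y = v (adv (adv p))"
    | p where "p \<in> P" "y = v p" "VP c r = v (adv p) \<or> VP c r = v (adv (adv p))"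
    | c' r' t p where "p \<in> P" "VP c r = v p \<or> VP c r = v (adv (adv p))" "y = VQ c' r' t"
    unfolding adj_def arcs.simps[of "VP c r" y] arcs.simps[of y "VP c r"] prod.inject
    by (elim disjE exE conjE) (metis vtx.distinct)+
  then show ?thesis
  proof cases
    case 1
    then show ?thesis using v_VP[of p c r] by (auto simp: near_def intro: adv_P)
  next
    case 2
    then have "(c, r) = adv p \<or> (c, r) = adv (adv p)" using v_VP by metis
    then show ?thesis using 2 adv_P unfolding near_def by metis
  next
    case 3
    then show ?thesis using v_VP[of p c r] v_VP[of "adv (adv p)" c r]
      by (auto intro: adv_P) (metis adv_P)+
  qed
qed

text \<open>A strip can join two clause vertices only within one block, hence within one clause,
  since the identified positions of different blocks are more than two steps apart.\<close>

lemma adj_VA: "adj (VA i a) (VA i' b) \<Longrightarrow> i = i' \<and> i < m \<and> a < 3 \<and> b < 3"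
proof -
  assume adj: "adj (VA i a) (VA i' b)"
  have "i = i' \<and> i < m" if "(VA i a, VA i' b) \<in> arcs" for i a i' b
  proof -
    have "i = i' \<and> i < m" if "p \<in> P" "near p q" "v p = VA i a" "v q = VA i' b" for p q
      using v_VA[OF that(3)] v_VA[OF that(4)] near_block[OF that(2)] slot(1)[OF slot(3)[OF that(1)]] by auto
    moreover have "near p (adv p)" "near p (adv (adv p))" for p by (auto simp: near_def)
    ultimately show ?thesis using that unfolding arcs.simps[of "VA i a" "VA i' b"] prod.inject
      by (elim disjE exE conjE) (metis v_neq vtx.distinct vtx.inject(1))+
  qed
  then show ?thesis using adj adj_colour[OF adj] by (auto simp: adj_def)
qed

lemma adj_VA_VP:
  assumes "adj (VA i a) (VP c r)"
  shows "\<exists>q\<in>P. near q (c, r) \<and> v q = VA i a \<and> fst q = c"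
proof -
  have "adj (VP c r) (VA i a)" using assms adj_sym by blast
  from adj_VP[OF this] obtain q where q: "q \<in> P" "near (c, r) q" "v q = VA i a" by auto
  have "near q (c, r)" using q(2) near_sym by blast
  then show ?thesis using q near_block[of q "(c, r)"] v_VA[OF q(3)] by auto
qed

text \<open>The neighbours two steps before and two steps after a strip vertex have different
  colours, so the colouring does not separate them; an edge between them could only come from an
  identification, which would need two identified positions too close to different blocks.\<close>

lemma not_adj_four:
  assumes w: "w \<in> P" shows "\<not> adj (v w) (v (adv (adv (adv (adv w)))))"
proof
  let ?z = "adv (adv (adv (adv w)))"
  assume adj: "adj (v w) (v ?z)"
  have z: "?z \<in> P" using w adv_P by blast
  have sz: "snd ?z = (if snd w < 14 then snd w + 4 else snd w - 14)"
    using slot(4)[OF w] by (auto simp: adv_def)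
  have fz: "snd w < 14 \<Longrightarrow> fst ?z = fst w" by (auto simp: adv_def)
  show False
  proof (cases rule: v_cases[of w])
    case (1 i a)
    note w1 = v_VA[OF 1]
    show False
    proof (cases rule: v_cases[of ?z])
      case (1 i' a')
      from v_VA[OF 1] w1 fz sz show False by auto
    next
      case 2
      from adj_VA_VP[of i a "fst ?z" "snd ?z"] adj 2 \<open>v w = VA i a\<close> obtain q where
        q: "q \<in> P" "near q ?z" "v q = VA i a" "fst q = fst ?z" by auto
      have "q = w" using v_block_inj[OF q(1) w] q fz w1 \<open>v w = VA i a\<close> by auto
      then show False using near_block[OF q(2)] w1 sz by (auto split: if_splits)
    qed
  next
    case 2
    show False
    proof (cases rule: v_cases[of ?z])
      case (1 i a)
      note z1 = v_VA[OF 1]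
      have lt: "snd w < 14" using z1 sz slot(4)[OF w] by (auto split: if_splits)
      from adj_VA_VP[of i a "fst w" "snd w"] adj 2 1 adj_sym obtain q where
        q: "q \<in> P" "near q w" "v q = VA i a" "fst q = fst w" by auto
      have "q = ?z" using v_block_inj[OF q(1) z] q fz lt 1 by auto
      then show False using near_block[OF q(2)] z1 sz by (auto split: if_splits)
    next
      case 2
      have "adj (VP (fst w) (snd w)) (v ?z)" using adj \<open>v w = VP (fst w) (snd w)\<close> by simp
      from adj_VP[OF this] obtain q where q: "near w q" "v ?z = v q" using 2 by auto
      then have "near w ?z" using v_VP[of q] 2 by (metis prod.collapse)
      then have "snd ?z \<in> {snd (adv w), snd (adv (adv w))} \<or> snd w \<in> {snd (adv ?z), snd (adv (adv ?z))}"
        unfolding near_def by auto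
      then show False using sz slot(4)[OF w] snd_adv w z adv_P by (auto split: if_splits)
    qed
  qed
qed

definition tri :: "(nat \<times> nat) \<times> nat \<Rightarrow> ((nat \<times> nat) \<times> nat) set" where
  "tri p = {p, adv p, adv (adv p)}"

text \<open>The other two corners lie one or two steps away on either side. Of the six pairs of such
  positions, the two at distance 3 are excluded by colours and the one at distance 4 by
  \<open>not_adj_four\<close>; each of the remaining three completes three consecutive
  positions.\<close>

lemma triangle_VP:
  assumes "adj (VP c r) x" "adj (VP c r) y" "adj x y" "\<forall>a b t. x \<noteq> VQ a b t" "\<forall>a b t. y \<noteq> VQ a b t"
  shows "\<exists>p\<in>P. {VP c r, x, y} = v ` tri p"
proof -
  let ?p = "(c, r)"
  have p: "?p \<in> P" using adj_VP assms by blast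
  obtain q q' where q: "q \<in> P" "near ?p q" "x = v q" and q': "q' \<in> P" "near ?p q'" "y = v q'"
    using adj_VP[OF assms(1)] adj_VP[OF assms(2)] assms(4,5) by metis
  have vp: "VP c r = v ?p"
  proof -
    have "\<exists>p'\<in>P. v p' = VP c r"
      using assms(1) unfolding adj_def arcs.simps[of "VP c r" x] arcs.simps[of x "VP c r"] prod.inject
      by (elim disjE exE conjE) (metis adv_P vtx.distinct)+
    then show ?thesis using v_VP by metis
  qed
  have cq: "colour (v q) = snd q mod 3" "colour (v q') = snd q' mod 3" using colour_v q q' by auto
  have ne: "snd q mod 3 \<noteq> snd q' mod 3" using adj_colour[OF assms(3)] cq q q' by simp
  have n4: "q' \<noteq> adv (adv (adv (adv q)))" "q \<noteq> adv (adv (adv (adv q')))"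
    using not_adj_four[OF q(1)] not_adj_four[OF q'(1)] assms(3) q q' adj_sym by auto
  have m: "snd (adv (adv (adv w))) mod 3 = snd w mod 3" if "w \<in> P" for w
    using snd_adv[OF that] snd_adv[OF adv_P[OF that]] snd_adv[OF adv_P[OF adv_P[OF that]]]
    by (auto simp: mod_Suc)
  have "q = adv ?p \<and> q' = adv (adv ?p) \<or> q' = adv ?p \<and> q = adv (adv ?p)
    \<or> ?p = adv q \<and> q' = adv ?p \<or> ?p = adv q' \<and> q = adv ?p
    \<or> ?p = adv q \<and> q = adv q' \<or> ?p = adv q' \<and> q' = adv q"
  proof -
    have A: "q = adv ?p \<or> q = adv (adv ?p) \<or> ?p = adv q \<or> ?p = adv (adv q)" using q(2) by (simp add: near_def)
    have B: "q' = adv ?p \<or> q' = adv (adv ?p) \<or> ?p = adv q' \<or> ?p = adv (adv q')" using q'(2) by (simp add: near_def)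
    from A B show ?thesis
      by (elim disjE) (metis ne n4 m q(1) q'(1) p adv_inj adv_P)+
  qed
  then show ?thesis
    unfolding vp q(3) q'(3) tri_def
    by (elim disjE conjE) (rule bexI[OF _ p] bexI[OF _ q(1)] bexI[OF _ q'(1)], auto; fail)+
qed

text \<open>A pendant vertex has degree two, which fixes a triangle through it. A triangle through a
  \<open>VP\<close> is settled by \<open>triangle_VP\<close>. What remains are three clause
  vertices, and these belong to one clause.\<close>

lemma triangle:
  assumes "adj x y" "adj y z" "adj x z"
  shows "(\<exists>p\<in>P. {x, y, z} = v ` tri p) \<or> (\<exists>i<m. {x, y, z} = {VA i 0, VA i 1, VA i 2}) \<or>
    (\<exists>p\<in>P. \<exists>t<s. {x, y, z} = {v p, v (adv (adv p)), VQ (fst p) (snd p) t}) \<or>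
    (\<exists>i<m. \<exists>t<s. {x, y, z} = {VA i 0, VA i 1, VR i t})"
proof -
  have Q: "\<exists>p\<in>P. \<exists>t<s. {x, y, z} = {v p, v (adv (adv p)), VQ (fst p) (snd p) t}"
    if "adj x y" "adj y z" "adj x z" "x = VQ c r t" for x y z c r t
  proof -
    have "y \<noteq> z" using adj_colour that by blast
    then show ?thesis using adj_VQ[of c r t y] adj_VQ[of c r t z] that
      by (intro bexI[of _ "(c, r)"] exI[of _ t]) auto
  qed
  have R: "\<exists>i<m. \<exists>t<s. {x, y, z} = {VA i 0, VA i 1, VR i t}"
    if "adj x y" "adj y z" "adj x z" "x = VR i t" for x y z i t
  proof -
    have "y \<noteq> z" using adj_colour that by blast
    then show ?thesis using adj_VR[of i t y] adj_VR[of i t z] that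
      by (intro exI[of _ i] conjI exI[of _ t]) auto
  qed
  have Pp: "\<exists>p\<in>P. {x, y, z} = v ` tri p"
    if "adj x y" "adj y z" "adj x z" "x = VP c r" "\<forall>a b t. y \<noteq> VQ a b t" "\<forall>a b t. z \<noteq> VQ a b t" for x y z c r
    using triangle_VP[of c r y z] that by simp
  have A: "\<exists>i<m. {x, y, z} = {VA i 0, VA i 1, VA i 2}"
    if "adj x y" "adj y z" "adj x z" "x = VA i a" "y = VA i' b" "z = VA i'' c" for x y z i a i' b i'' c
  proof -
    have "i' = i" "i'' = i" "i < m" "a < 3" "b < 3" "c < 3" "a \<noteq> b" "b \<noteq> c" "a \<noteq> c"
      using adj_VA[of i a i' b] adj_VA[of i' b i'' c] adj_colour[OF that(1)] adj_colour[OF that(2)]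
        adj_colour[OF that(3)] that by auto
    then show ?thesis using that by (intro exI[of _ i]) (auto simp: less_3)
  qed
  have sym: "adj y x" "adj z y" "adj z x" using assms adj_sym by auto
  have perm: "{y, z, x} = {x, y, z}" "{z, x, y} = {x, y, z}" by auto
  show ?thesis
  proof (cases "(\<exists>c r t. x = VQ c r t) \<or> (\<exists>c r t. y = VQ c r t) \<or> (\<exists>c r t. z = VQ c r t)")
    case True
    then show ?thesis
    proof (elim disjE exE)
      fix c r t assume "x = VQ c r t"
      from Q[OF assms(1,2,3) this] show ?thesis by blast
    next
      fix c r t assume "y = VQ c r t"
      from Q[OF assms(2) sym(3,1) this, unfolded perm] show ?thesis by blast
    next
      fix c r t assume "z = VQ c r t"
      from Q[OF sym(3) assms(1) sym(2) this, unfolded perm] show ?thesis by blast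
    qed
  next
    case noQ: False
    then have noQ': "\<forall>c r t. x \<noteq> VQ c r t" "\<forall>c r t. y \<noteq> VQ c r t" "\<forall>c r t. z \<noteq> VQ c r t" by auto
    show ?thesis
    proof (cases "(\<exists>c r. x = VR c r) \<or> (\<exists>c r. y = VR c r) \<or> (\<exists>c r. z = VR c r)")
      case True
      then show ?thesis
      proof (elim disjE exE)
      fix c r assume "x = VR c r"
      from R[OF assms(1,2,3) this] show ?thesis by blast
    next
      fix c r assume "y = VR c r"
      from R[OF assms(2) sym(3,1) this, unfolded perm] show ?thesis by blast
    next
      fix c r assume "z = VR c r"
      from R[OF sym(3) assms(1) sym(2) this, unfolded perm] show ?thesis by blast
    qed
    next
      case noR: False
      show ?thesis
      proof (cases "(\<exists>c r. x = VP c r) \<or> (\<exists>c r. y = VP c r) \<or> (\<exists>c r. z = VP c r)")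
        case True
        then show ?thesis
        proof (elim disjE exE)
      fix c r assume "x = VP c r"
      from Pp[OF assms(1,2,3) this noQ'(2,3)] show ?thesis by blast
    next
      fix c r assume "y = VP c r"
      from Pp[OF assms(2) sym(3,1) this noQ'(3,1), unfolded perm] show ?thesis by blast
    next
      fix c r assume "z = VP c r"
      from Pp[OF sym(3) assms(1) sym(2) this noQ'(1,2), unfolded perm] show ?thesis by blast
    qed
      next
        case False
        then show ?thesis using noQ noR A[OF assms(1,2,3)] by (cases x; cases y; cases z) auto
      qed
    qed
  qed
qed

end

lemma diamond_edge_iff:
  assumes "u < s + 3" "w < s + 3"
  shows "{u, w} \<in> edges (diamond s) \<longleftrightarrow> u < 2 \<and> 2 \<le> w \<or> w < 2 \<and> 2 \<le> u \<or> u = 0 \<and> w = 1 \<or> u = 1 \<and> w = 0"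
  using assms unfolding diamond_def by (auto simp: doubleton_eq_iff)

context strips
begin

section \<open>The diamonds that have to be destroyed and how they overlap\<close>

lemma v_V: "p \<in> P \<Longrightarrow> v p \<in> V"
proof -
  assume p: "p \<in> P"
  then have s: "fst (fst p) < m" "snd (fst p) < 3" using slot by blast+
  show ?thesis
  proof (cases rule: v_cases[of p])
    case (1 i a)
    then have "i < m" "a < 3" using v_VA[OF 1] s by auto
    then show ?thesis unfolding V_def 1 by force
  next
    case 2
    then show ?thesis unfolding V_def 2 using p by blast
  qed
qed

lemma VQ_V: "p \<in> P \<Longrightarrow> t < s \<Longrightarrow> VQ (fst p) (snd p) t \<in> V" unfolding V_def by force
lemma VR_V: "i < m \<Longrightarrow> t < s \<Longrightarrow> VR i t \<in> V" unfolding V_def by force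
lemma VA_V: "i < m \<Longrightarrow> a < 3 \<Longrightarrow> VA i a \<in> V" unfolding V_def by force

lemma fin_V: "finite V" using fin by (simp add: V_def)

lemma adj_V: "adj x y \<Longrightarrow> x \<in> V \<and> y \<in> V \<and> x \<noteq> y"
proof -
  have "x \<in> V \<and> y \<in> V" if "(x, y) \<in> arcs" for x y
    using that by cases (auto intro: v_V VQ_V VR_V VA_V adv_P)
  then show "adj x y \<Longrightarrow> ?thesis" using adj_colour unfolding adj_def by metis
qed

lemma E_pairs: "E \<subseteq> vertex_pairs V"
proof
  fix e assume "e \<in> E"
  then obtain x y where "e = {x, y}" "adj x y" unfolding E_def adj_def by auto
  then show "e \<in> vertex_pairs V" using adj_V by (auto simp: vertex_pairs_def)
qed

lemma simple: "simple_graph (V, E)" using fin_V E_pairs by (simp add: simple_graph_def)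

lemma K4_free: "\<not> has_induced (V, E) (complete_graph 4)"
proof
  assume "has_induced (V, E) (complete_graph 4)"
  then obtain g where g: "inj_on g {..<4}" "\<And>u w. u < 4 \<Longrightarrow> w < 4 \<Longrightarrow> {g u, g w} \<in> E \<longleftrightarrow> {u, w} \<in> vertex_pairs {..<4 :: nat}"
    by (auto simp: has_induced_def complete_graph_def)
  have adj: "adj (g u) (g w)" if "u < 4" "w < 4" "u \<noteq> w" for u w
    using g(2)[OF that(1,2)] that by (simp add: adj_E vertex_pairs_def)
  have "inj_on (\<lambda>u. colour (g u)) {..<4 :: nat}"
    using adj adj_colour unfolding inj_on_def by (metis lessThan_iff)
  moreover have "(\<lambda>u. colour (g u)) ` {..<4 :: nat} \<subseteq> {..<3}"
  proof -
    have "colour (g u) < 3" if "u < 4" for u :: nat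
      using adj_colour[OF adj[of u 1]] adj_colour[OF adj[of u 0]] that by (cases "u = 0") auto
    then show ?thesis by auto
  qed
  ultimately have "card {..<4 :: nat} \<le> card {..<3 :: nat}" by (rule card_inj_on_le) simp
  then show False by simp
qed

text \<open>Common neighbours of the same colour are independent, so together with an edge they form
  an \<open>s\<close>-diamond. It survives every modification that has no pair within its vertex
  set, whether pairs are deleted or inserted.\<close>

lemma diamond_intro:
  assumes xy: "adj x y" and zs: "distinct zs" "length zs = s + 1"
    and z: "\<And>z. z \<in> set zs \<Longrightarrow> adj x z \<and> adj y z \<and> colour z = c"
    and F: "\<And>e. e \<in> F \<Longrightarrow> \<not> e \<subseteq> {x, y} \<union> set zs"
  shows "has_induced (V, (E - F) \<union> (F - E)) (diamond s)"
proof -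
  define g where "g u = (if u = 0 then x else if u = 1 then y else zs ! (u - 2))" for u :: nat
  have ran: "g u \<in> {x, y} \<union> set zs" if "u < s + 3" for u
    using that zs(2) by (auto simp: g_def intro!: nth_mem)
  have gz: "g u \<in> set zs" if "u < s + 3" "2 \<le> u" for u
    using that zs(2) by (auto simp: g_def intro!: nth_mem)
  have irr: "\<not> adj a a" for a using adj_colour by blast
  have zz: "\<not> adj a b" if "a \<in> set zs" "b \<in> set zs" for a b
    using z that adj_colour by metis
  have adjg: "adj (g u) (g w) \<longleftrightarrow> u < 2 \<and> 2 \<le> w \<or> w < 2 \<and> 2 \<le> u \<or> u = 0 \<and> w = 1 \<or> u = 1 \<and> w = 0"
    if "u < s + 3" "w < s + 3" for u w
  proof -
    have c: "n = 0 \<or> n = 1 \<or> 2 \<le> n" for n :: nat by auto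
    have g01: "g 0 = x" "g 1 = y" by (auto simp: g_def)
    have z': "adj a x \<and> adj a y \<and> adj x a \<and> adj y a" if "a \<in> set zs" for a
      using z[OF that] adj_sym by blast
    have "adj y x" using xy adj_sym by blast
    then show ?thesis using c[of u] c[of w] gz[OF that(1)] gz[OF that(2)] z' xy zz irr
      by (elim disjE) (auto simp: g01[unfolded One_nat_def] g01)
  qed
  have "inj_on g {..<s + 3}"
  proof (rule inj_onI)
    fix u w assume uw: "u \<in> {..<s + 3}" "w \<in> {..<s + 3}" "g u = g w"
    have "x \<noteq> y" using adj_V[OF xy] by simp
    have nx: "x \<notin> set zs" "y \<notin> set zs" using z irr by blast+
    have lt: "u - 2 < length zs" "w - 2 < length zs" using uw zs(2) by auto
    show "u = w" using uw nx \<open>x \<noteq> y\<close> gz[of u] gz[of w] nth_eq_iff_index_eq[OF zs(1) lt]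
      by (auto simp: g_def split: if_splits)
  qed
  moreover have "g ` {..<s + 3} \<subseteq> V"
  proof -
    have "{x, y} \<union> set zs \<subseteq> V" using adj_V xy z by blast
    then show ?thesis using ran by blast
  qed
  moreover have "{g u, g w} \<in> (E - F) \<union> (F - E) \<longleftrightarrow> {u, w} \<in> edges (diamond s)"
    if "u < s + 3" "w < s + 3" for u w
  proof -
    have "{g u, g w} \<notin> F" using F ran that by blast
    then show ?thesis using diamond_edge_iff[OF that] adjg[OF that] by (simp add: adj_E)
  qed
  ultimately show ?thesis unfolding has_induced_def
    by (intro exI[of _ g]) (auto simp: diamond_def)
qed

definition Dm :: "(nat \<times> nat) \<times> nat \<Rightarrow> vtx set" where
  "Dm p = v ` tri p \<union> VQ (fst p) (snd p) ` {..<s}"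

lemma hit_Dm:
  assumes "\<not> has_induced (V, (E - F) \<union> (F - E)) (diamond s)" "p \<in> P"
  shows "\<exists>e\<in>F. e \<subseteq> Dm p"
proof (rule ccontr)
  assume n: "\<not> (\<exists>e\<in>F. e \<subseteq> Dm p)"
  let ?zs = "v (adv p) # map (VQ (fst p) (snd p)) [0..<s]"
  have "has_induced (V, (E - F) \<union> (F - E)) (diamond s)"
  proof (rule diamond_intro[of "v p" "v (adv (adv p))" ?zs "Suc (snd p) mod 3"])
    show "adj (v p) (v (adv (adv p)))" using assms(2) by (auto simp: adj_def intro: arcs.intros)
    show "distinct ?zs" by (auto simp: distinct_map inj_on_def)
    show "adj (v p) z \<and> adj (v (adv (adv p))) z \<and> colour z = Suc (snd p) mod 3" if "z \<in> set ?zs" for z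
      using that assms(2) colour_adv[OF assms(2)] by (auto simp: adj_def intro: arcs.intros adv_P)
    show "\<not> e \<subseteq> {v p, v (adv (adv p))} \<union> set ?zs" if "e \<in> F" for e
    proof -
      have "{v p, v (adv (adv p))} \<union> set ?zs = Dm p" by (auto simp: Dm_def tri_def)
      then show ?thesis using n that by auto
    qed
  qed simp
  then show False using assms(1) by simp
qed

lemma hit_clause:
  assumes "\<not> has_induced (V, (E - F) \<union> (F - E)) (diamond s)" "i < m"
  shows "\<exists>e\<in>F. e \<subseteq> {VA i 0, VA i 1, VA i 2} \<union> VR i ` {..<s}"
proof (rule ccontr)
  assume n: "\<not> (\<exists>e\<in>F. e \<subseteq> {VA i 0, VA i 1, VA i 2} \<union> VR i ` {..<s})"
  let ?zs = "VA i 2 # map (VR i) [0..<s]"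
  have "has_induced (V, (E - F) \<union> (F - E)) (diamond s)"
  proof (rule diamond_intro[of "VA i 0" "VA i 1" ?zs 2])
    show "adj (VA i 0) (VA i 1)" using assms(2) unfolding adj_def by (blast intro: arcs.intros)
    show "distinct ?zs" by (auto simp: distinct_map inj_on_def)
    show "adj (VA i 0) z \<and> adj (VA i 1) z \<and> colour z = 2" if "z \<in> set ?zs" for z
      using that assms(2) unfolding adj_def by (auto intro: arcs.intros arcs.intros[unfolded One_nat_def])
    show "\<not> e \<subseteq> {VA i 0, VA i 1} \<union> set ?zs" if "e \<in> F" for e
    proof -
      have "{VA i 0, VA i 1} \<union> set ?zs = {VA i 0, VA i 1, VA i 2} \<union> VR i ` {..<s}" by auto
      then show ?thesis using n that by auto
    qed
  qed simp
  then show False using assms(1) by simp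
qed

lemma tri_block: "a \<in> tri p \<Longrightarrow> b \<in> tri p \<Longrightarrow> 6 \<le> snd a \<Longrightarrow> snd a \<le> 12 \<Longrightarrow> fst b = fst a"
  by (cases p) (auto simp: tri_def adv_def split: if_splits)

lemma tri_P: "p \<in> P \<Longrightarrow> tri p \<subseteq> P" using adv_P by (auto simp: tri_def)

text \<open>Only positions matter here, not the vertices that they name. Up to four steps never lead
  back to the start, even on a strip of a single block, so triangles overlap as on a line.\<close>

lemma tri_inter:
  assumes "p \<in> P" "q \<in> P" "p \<noteq> q" "a \<noteq> b" "{a, b} \<subseteq> tri p \<inter> tri q"
  shows "q = adv p \<and> {a, b} = {adv p, adv (adv p)} \<or> p = adv q \<and> {a, b} = {adv q, adv (adv q)}"
proof -
  have inj: "adv a = adv b \<longleftrightarrow> a = b" if "a \<in> P" "b \<in> P" for a b using adv_inj that by blast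
  have ne: "adv w \<noteq> w" "adv (adv w) \<noteq> w" "adv (adv (adv w)) \<noteq> w" "adv (adv (adv (adv w))) \<noteq> w" if "w \<in> P" for w
  proof -
    have *: "snd (adv w) \<noteq> snd w" "snd (adv (adv w)) \<noteq> snd w"
      "snd (adv (adv (adv w))) \<noteq> snd w" "snd (adv (adv (adv (adv w)))) \<noteq> snd w"
      using slot(4)[OF that] by (auto simp: adv_def)
    show "adv w \<noteq> w" "adv (adv w) \<noteq> w" "adv (adv (adv w)) \<noteq> w" "adv (adv (adv (adv w))) \<noteq> w"
      using * by metis+
  qed
  have cl: "adv p \<in> P" "adv (adv p) \<in> P" "adv q \<in> P" "adv (adv q) \<in> P" using assms adv_P by auto
  have one: "q = adv p \<and> x \<in> {adv p, adv (adv p)} \<or> q = adv (adv p) \<and> x = adv (adv p) \<or>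
      p = adv q \<and> x \<in> {adv q, adv (adv q)} \<or> p = adv (adv q) \<and> x = adv (adv q)"
    if "x \<in> tri p" "x \<in> tri q" for x
  proof -
    have "x = p \<or> x = adv p \<or> x = adv (adv p)" "x = q \<or> x = adv q \<or> x = adv (adv q)"
      using that by (auto simp: tri_def)
    then show ?thesis using assms(1-3) cl by (elim disjE) (simp_all add: inj)
  qed
  have ex: "\<not> (q = adv p \<and> p = adv q)" "\<not> (q = adv p \<and> p = adv (adv q))" "\<not> (q = adv (adv p) \<and> p = adv q)"
    "\<not> (q = adv (adv p) \<and> p = adv (adv q))" "\<not> (q = adv p \<and> q = adv (adv p))" "\<not> (p = adv q \<and> p = adv (adv q))"
    using ne[OF assms(1)] ne[OF assms(2)] ne[OF cl(1)] ne[OF cl(3)] by auto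
  have "a \<in> tri p" "a \<in> tri q" "b \<in> tri p" "b \<in> tri q" using assms(5) by auto
  note oa = one[OF this(1,2)] and ob = one[OF this(3,4)]
  consider "q = adv p" | "p = adv q" | "q = adv (adv p)" "q \<noteq> adv p" "p \<noteq> adv q" | "p = adv (adv q)" "q \<noteq> adv p" "p \<noteq> adv q"
    using oa by blast
  then show ?thesis
  proof cases
    case 1
    then have "a \<in> {adv p, adv (adv p)}" "b \<in> {adv p, adv (adv p)}" using oa ob ex by blast+
    then show ?thesis using 1 assms(4) by auto
  next
    case 2
    then have "a \<in> {adv q, adv (adv q)}" "b \<in> {adv q, adv (adv q)}" using oa ob ex by blast+
    then show ?thesis using 2 assms(4) by auto
  next
    case 3
    then show ?thesis using oa ob ex assms(4) by metis
  next
    case 4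
    then show ?thesis using oa ob ex assms(4) by metis
  qed
qed

lemma v_eq_diff:
  assumes "a \<in> P" "a' \<in> P" "v a = v a'" "a \<noteq> a'"
  obtains i x where "v a = VA i x" "fst (fst a) = i" "fst (fst a') = i" "6 \<le> snd a" "snd a \<le> 12"
    "6 \<le> snd a'" "snd a' \<le> 12" "fst a \<noteq> fst a'"
proof (cases rule: v_cases[of a])
  case (1 i x)
  have "fst a \<noteq> fst a'" using v_block_inj assms by blast
  then show thesis using v_VA[OF 1] v_VA[of a' i x] 1 assms that by auto
next
  case 2
  then show thesis using v_VP[of a' "fst a" "snd a"] assms by auto
qed

text \<open>Identifications create no further overlap. A vertex with two names belongs to two
  different blocks, and a triangle that meets an identified position stays within one block; so both
  common vertices would be clause vertices met by two occurrences of one clause, and these have only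
  one vertex in common.\<close>

lemma Dm_inter:
  assumes p: "p \<in> P" and q: "q \<in> P" and "p \<noteq> q" "x \<noteq> y" "{x, y} \<subseteq> Dm p \<inter> Dm q"
  shows "q = adv p \<and> {x, y} = {v (adv p), v (adv (adv p))} \<or> p = adv q \<and> {x, y} = {v (adv q), v (adv (adv q))}"
proof -
  have "VQ (fst p) (snd p) t \<notin> Dm q" "VQ (fst q) (snd q) t \<notin> Dm p" for t
    using assms(3) by (cases p; cases q; auto simp: Dm_def)+
  then have "{x, y} \<subseteq> v ` tri p" "{x, y} \<subseteq> v ` tri q"
    using assms(5) unfolding Dm_def by auto
  then obtain a b a' b' where a: "a \<in> tri p" "x = v a" and b: "b \<in> tri p" "y = v b"
    and a': "a' \<in> tri q" "x = v a'" and b': "b' \<in> tri q" "y = v b'" by auto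
  have P: "a \<in> P" "b \<in> P" "a' \<in> P" "b' \<in> P" using a b a' b' tri_P p q by blast+
  have "a \<noteq> b" "a' \<noteq> b'" using assms(4) a b a' b' by auto
  \<comment> \<open>If just one of the two vertices has different names, these lie in different
    blocks, while the common name of the other vertex forces both into its own block.\<close>
  have one: False if "a \<in> tri p" "b \<in> tri p" "a' \<in> tri q" "b \<in> tri q" "a \<in> P" "a' \<in> P" "v a = v a'" "a \<noteq> a'" for a a' b
  proof -
    note t = that
    obtain i x where *: "6 \<le> snd a" "snd a \<le> 12" "6 \<le> snd a'" "snd a' \<le> 12" "fst a \<noteq> fst a'"
      using v_eq_diff[OF t(5-8)] by metis
    from tri_block[OF that(1,2) *(1,2)] tri_block[OF that(3,4) *(3,4)] *(5) show False by simp
  qed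
  have "a = a' \<and> b = b'"
  proof (rule ccontr)
    assume n: "\<not> (a = a' \<and> b = b')"
    show False
    proof (cases "a = a' \<or> b = b'")
      case True
      then show False using n one[of a b a'] one[of b a b'] a b a' b' P by auto
    next
      case False
      have va: "v a = v a'" and vb: "v b = v b'" using a b a' b' by auto
      obtain i x1 where A: "v a = VA i x1" "6 \<le> snd a" "snd a \<le> 12" "6 \<le> snd a'" "snd a' \<le> 12" "fst a \<noteq> fst a'"
        "fst (fst a) = i" "fst (fst a') = i"
        using v_eq_diff[OF P(1,3) va] False by metis
      obtain i' y1 where B: "v b = VA i' y1"
        using v_eq_diff[OF P(2,4) vb] False by metis
      have f: "fst b = fst a" "fst b' = fst a'"
        using tri_block[OF a(1) b(1)] tri_block[OF a'(1) b'(1)] A by auto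
      have sl: "snd (fst a) < 3" "snd (fst a') < 3" using slot P by blast+
      have ai: "snd (fst a) \<noteq> snd (fst a')" using A by (metis prod.collapse)
      have xy: "x1 \<noteq> y1" using A(1) B assms(4) a b v_VA[OF A(1)] v_VA[OF B] f by auto
      have 1: "snd a = r0 (fst a) \<and> x1 = snd (fst a) \<or> snd a = Suc (r0 (fst a)) \<and> x1 = Suc (snd (fst a)) mod 3"
        using v_VA[OF A(1)] by blast
      have 2: "snd b = r0 (fst a) \<and> y1 = snd (fst a) \<or> snd b = Suc (r0 (fst a)) \<and> y1 = Suc (snd (fst a)) mod 3"
        using v_VA[OF B] f by auto
      have 3: "snd a' = r0 (fst a') \<and> x1 = snd (fst a') \<or> snd a' = Suc (r0 (fst a')) \<and> x1 = Suc (snd (fst a')) mod 3"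
        using v_VA[of a' i x1] A va by auto
      have 4: "snd b' = r0 (fst a') \<and> y1 = snd (fst a') \<or> snd b' = Suc (r0 (fst a')) \<and> y1 = Suc (snd (fst a')) mod 3"
        using v_VA[of b' i' y1] B vb f by auto
      \<comment> \<open>Literals \<open>j\<close> and \<open>j'\<close> own the edges from
        \<open>j\<close> to \<open>j + 1\<close> and from \<open>j'\<close> to \<open>j' + 1\<close>
        modulo 3; for different \<open>j\<close> and \<open>j'\<close> these two edges of the clause
        triangle share a single corner.\<close>
      show False using 1 2 3 4 sl ai xy by (auto simp: less_3)
    qed
  qed
  then have "{a, b} \<subseteq> tri p \<inter> tri q" using a b a' b' by auto
  from tri_inter[OF p q assms(3) \<open>a \<noteq> b\<close> this] show ?thesis
  proof (elim disjE conjE)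
    assume "q = adv p" "{a, b} = {adv p, adv (adv p)}"
    moreover have "{x, y} = v ` {a, b}" using a b by auto
    ultimately show ?thesis by simp
  next
    assume "p = adv q" "{a, b} = {adv q, adv (adv q)}"
    moreover have "{x, y} = v ` {a, b}" using a b by auto
    ultimately show ?thesis by simp
  qed
qed

section \<open>Solutions within the budget and satisfying assignments\<close>

definition e :: "(nat \<times> nat) \<times> nat \<Rightarrow> vtx set" where "e p = {v p, v (adv p)}"

text \<open>Nine of the 18 positions of a block have a given parity.\<close>

definition kk :: nat where "kk = 9 * card Oc"

text \<open>The parity may vary with the block: a constant \<open>h\<close> gives the lower bound on
  solutions, the truth values of the variables give the size of the constructed one.\<close>

lemma card_parity: "card {p \<in> P. even (snd p) = h (fst p)} = kk"
proof -
  have 1: "card {r. r < (18 :: nat) \<and> even r = b} = 9" for b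
  proof -
    have "{r. r < (18 :: nat) \<and> even r = b} = set (filter (\<lambda>r. even r = b) [0..<18])" by auto
    then show ?thesis by (cases b) (simp_all add: upt_rec)
  qed
  have "{p \<in> P. even (snd p) = h (fst p)} = Sigma Oc (\<lambda>c. {r. r < 18 \<and> even r = h c})"
    by (auto simp: P_def)
  then have "card {p \<in> P. even (snd p) = h (fst p)} = (\<Sum>c\<in>Oc. 9)"
    using fin by (simp add: 1)
  then show ?thesis by (simp add: kk_def)
qed

lemma parity_adv: "p \<in> P \<Longrightarrow> even (snd (adv p)) \<longleftrightarrow> odd (snd p)" by (auto simp: snd_adv)

text \<open>Positions of equal parity are never consecutive, so their diamonds share no pair and
  already need \<open>kk\<close> different pairs. Hence the pairs chosen for the even positions
  exhaust \<open>F\<close>, and so do those for the odd ones. Every pair of \<open>F\<close> thus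
  hits a diamond of each parity and must be a rung, and every triangle loses exactly one of its two
  rungs. Insertions are covered because \<open>F\<close> consists of arbitrary pairs.\<close>

lemma edit_structure:
  assumes F: "F \<subseteq> vertex_pairs V" "card F \<le> kk" "\<not> has_induced (V, (E - F) \<union> (F - E)) (diamond s)"
  shows "F \<subseteq> e ` P" and "p \<in> P \<Longrightarrow> e (adv p) \<in> F \<longleftrightarrow> e p \<notin> F"
proof -
  have finF: "finite F" using F(1) fin_V by (auto simp: vertex_pairs_def intro: finite_subset[of _ "Pow V"])
  have two: "\<exists>x y. f = {x, y} \<and> x \<noteq> y" if "f \<in> F" for f
    using F(1) that by (auto simp: vertex_pairs_def card_2_iff)
  define f where "f p = (SOME e. e \<in> F \<and> e \<subseteq> Dm p)" for p
  have f: "f p \<in> F" "f p \<subseteq> Dm p" if "p \<in> P" for p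
    using someI_ex[of "\<lambda>e. e \<in> F \<and> e \<subseteq> Dm p"] hit_Dm[OF F(3) that] by (auto simp: f_def)
  have inter: "q = adv p \<and> g = e (adv p) \<or> p = adv q \<and> g = e p"
    if "p \<in> P" "q \<in> P" "p \<noteq> q" "g \<in> F" "g \<subseteq> Dm p" "g \<subseteq> Dm q" for p q g
  proof -
    note t = that
    obtain x y where "g = {x, y}" "x \<noteq> y" using two[OF t(4)] by auto
    then show ?thesis using Dm_inter[OF that(1-3), of x y] that by (auto simp: e_def)
  qed
  \<comment> \<open>The choice \<open>f\<close> is injective on each parity class, which has
    \<open>kk\<close> elements, while \<open>F\<close> has at most \<open>kk\<close>.\<close>
  have img: "f ` {p \<in> P. even (snd p) = b} = F" for b
  proof (rule card_subset_eq[OF finF])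
    show "f ` {p \<in> P. even (snd p) = b} \<subseteq> F" using f by auto
    have "inj_on f {p \<in> P. even (snd p) = b}"
    proof (rule inj_onI, rule ccontr)
      fix p q assume a: "p \<in> {p \<in> P. even (snd p) = b}" "q \<in> {p \<in> P. even (snd p) = b}" "f p = f q" "p \<noteq> q"
      then have "q = adv p \<or> p = adv q" using inter[of p q "f p"] f[of p] f[of q] by auto
      then show False using a parity_adv[of p] parity_adv[of q] by auto
    qed
    then have "card (f ` {p \<in> P. even (snd p) = b}) = kk"
      using card_parity[of "\<lambda>_. b"] by (simp add: card_image)
    moreover have "card (f ` {p \<in> P. even (snd p) = b}) \<le> card F"
      using f by (intro card_mono finF) auto
    ultimately show "card (f ` {p \<in> P. even (snd p) = b}) = card F" using F(2) by simp
  qed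
  \<comment> \<open>\<open>g\<close> was chosen for some position \<open>q\<close> of the same
    parity as \<open>p\<close>; if \<open>q\<close> were not \<open>p\<close>, then \<open>g\<close>
    would lie in two diamonds of equal parity.\<close>
  have uniq: "g = f p" if "p \<in> P" "g \<in> F" "g \<subseteq> Dm p" for p g
  proof -
    note t = that
    obtain q where q: "q \<in> P" "even (snd q) = even (snd p)" "g = f q"
      using img[of "even (snd p)"] t(2) by auto
    have "q = p"
    proof (rule ccontr)
      assume "q \<noteq> p"
      then have "q = adv p \<or> p = adv q" using inter[of p q g] that q f[of q] by auto
      then show False using q that parity_adv[of p] parity_adv[of q] by auto
    qed
    then show ?thesis using q by simp
  qed
  \<comment> \<open>The pair chosen for \<open>p\<close> is also the choice of a position of the
    other parity, so it lies in two diamonds and is the rung between them.\<close>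
  have fe: "f p = e (adv p) \<or> f p = e p" if "p \<in> P" for p
  proof -
    note t = that
    obtain q where q: "q \<in> P" "even (snd q) = odd (snd p)" "f p = f q"
      using img[of "odd (snd p)"] f[OF t] by auto
    then show ?thesis using inter[of p q "f p"] f[of p] f[of q] that by auto
  qed
  show "F \<subseteq> e ` P"
  proof
    fix g assume "g \<in> F"
    then obtain p where "p \<in> P" "g = f p" using img[of True] by auto
    then show "g \<in> e ` P" using fe[of p] adv_P[of p] by auto
  qed
  assume p: "p \<in> P"
  have sub: "e p \<subseteq> Dm p" "e (adv p) \<subseteq> Dm p" by (auto simp: e_def Dm_def tri_def)
  have ne: "e p \<noteq> e (adv p)"
  proof
    assume "e p = e (adv p)"
    then have "v p = v (adv p) \<or> v p = v (adv (adv p))" by (auto simp: e_def)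
    moreover have "colour (v p) \<noteq> colour (v (adv p))" "colour (v p) \<noteq> colour (v (adv (adv p)))"
      using p adj_colour arcs.intros(1,2) unfolding adj_def by blast+
    ultimately show False by auto
  qed
  show "e (adv p) \<in> F \<longleftrightarrow> e p \<notin> F"
    using uniq[OF p _ sub(1)] uniq[OF p _ sub(2)] ne fe[OF p] f[OF p] by auto
qed

text \<open>Deleted and kept rungs alternate around each strip, so a single bit describes a strip;
  it is the truth value of the variable. A clause triangle has to lose one of its edges, and as only
  rungs are modified, this edge is the rung at \<open>r0 c\<close> of a literal, whose parity makes
  that literal true.\<close>

lemma edit_imp_sat:
  assumes F: "F \<subseteq> vertex_pairs V" "card F \<le> kk" "\<not> has_induced (V, (E - F) \<union> (F - E)) (diamond s)"
  shows "\<exists>\<alpha>. \<forall>i<m. \<exists>c\<in>Oc. fst c = i \<and> \<alpha> (vr c) = sg c"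
proof -
  note alt = edit_structure(2)[OF F]
  have block: "e (c, r) \<in> F \<longleftrightarrow> (e (c, 0) \<in> F \<longleftrightarrow> even r)" if "c \<in> Oc" "r < 18" for c r
    using that(2)
  proof (induction r)
    case (Suc r)
    have "(c, r) \<in> P" using Suc that by (simp add: P_def)
    moreover have "adv (c, r) = (c, Suc r)" using Suc.prems by (simp add: adv_def)
    ultimately have "e (c, Suc r) \<in> F \<longleftrightarrow> e (c, r) \<notin> F" using alt[of "(c, r)"] by simp
    then show ?case using Suc by auto
  qed simp
  \<comment> \<open>Position 17 is odd and is followed by position 0 of the next block, so the bit
    is passed on unchanged.\<close>
  have nxt: "e (nx c, 0) \<in> F \<longleftrightarrow> e (c, 0) \<in> F" if "c \<in> Oc" for c
    using alt[of "(c, 17)"] block[OF that, of 17] that by (simp add: P_def adv_def)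
  have "(nx ^^ k) c \<in> Oc \<and> (e ((nx ^^ k) c, 0) \<in> F \<longleftrightarrow> e (c, 0) \<in> F)" if "c \<in> Oc" for c k
    by (induction k) (use that nxt nx_Oc in auto)
  then have cons: "e (c, 0) \<in> F \<longleftrightarrow> e (c', 0) \<in> F" if "c \<in> Oc" "c' \<in> Oc" "vr c = vr c'" for c c'
    using nx_conn[OF that] that by metis
  \<comment> \<open>Variables without occurrence become false; all occurrences of any other variable
    agree by \<open>cons\<close>.\<close>
  define \<alpha> where "\<alpha> x = (\<exists>c\<in>Oc. vr c = x \<and> e (c, 0) \<in> F)" for x
  have \<alpha>: "\<alpha> (vr c) \<longleftrightarrow> e (c, 0) \<in> F" if "c \<in> Oc" for c unfolding \<alpha>_def using cons that by blast
  have "\<exists>c\<in>Oc. fst c = i \<and> \<alpha> (vr c) = sg c" if "i < m" for i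
  proof -
    obtain g where g: "g \<in> F" "g \<subseteq> {VA i 0, VA i 1, VA i 2} \<union> VR i ` {..<s}"
      using hit_clause[OF F(3) \<open>i < m\<close>] by blast
    then obtain p where p: "p \<in> P" "g = e p" using edit_structure(1)[OF F] by auto
    \<comment> \<open>A rung has no pendant end, so both ends of this one are corners of the clause
      triangle.\<close>
    have "\<exists>a. v p = VA i a" "\<exists>b. v (adv p) = VA i b" using g p by (auto simp: e_def)
    then obtain a b where ab: "v p = VA i a" "v (adv p) = VA i b" by auto
    have c: "fst p \<in> Oc" using slot p by blast
    have "snd p < 17" using v_VA[OF ab(1)] by auto
    then have "adv p = (fst p, Suc (snd p))" by (simp add: adv_def)
    then have r: "snd p = r0 (fst p)" "fst (fst p) = i"
      using v_VA[OF ab(1)] v_VA[OF ab(2)] by auto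
    have "e (fst p, snd p) \<in> F" using g p by simp
    then have "e (fst p, 0) \<in> F \<longleftrightarrow> even (r0 (fst p))" using block[OF c, of "snd p"] slot(4)[OF p(1)] r by simp
    then have "\<alpha> (vr (fst p)) = sg (fst p)" using \<alpha>[OF c] r0_even by simp
    then show ?thesis using c r by blast
  qed
  then show ?thesis by blast
qed

text \<open>Each strip triangle contains rungs of both parities and loses one; each clause triangle
  loses the rung of a true literal. Only triangles with a pendant vertex survive. An
  \<open>s\<close>-diamond would need \<open>s + 1\<close> of them on one edge, but an edge carries
  pendant vertices of one family only, and these are \<open>s\<close> many.\<close>

lemma sat_imp_deletion:
  assumes \<alpha>: "\<And>i. i < m \<Longrightarrow> \<exists>c\<in>Oc. fst c = i \<and> \<alpha> (vr c) = sg c"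
  shows "\<exists>F \<subseteq> E. card F \<le> kk \<and> \<not> has_induced (V, E - F) (diamond s)"
proof -
  define X where "X = {p \<in> P. even (snd p) = \<alpha> (vr (fst p))}"
  define F where "F = e ` X"
  have "F \<subseteq> E" unfolding F_def X_def e_def E_def by (auto intro!: image_eqI[OF _ arcs.rung])
  moreover have "card F \<le> kk"
    using card_image_le[of X e] card_parity[of "\<lambda>c. \<alpha> (vr c)"] fin unfolding F_def X_def by simp
  moreover have "\<not> has_induced (V, E - F) (diamond s)"
  proof
    assume "has_induced (V, E - F) (diamond s)"
    then obtain g where inj: "inj_on g {..<s + 3}" and
      g: "\<And>u w. u < s + 3 \<Longrightarrow> w < s + 3 \<Longrightarrow> {g u, g w} \<in> E - F \<longleftrightarrow> {u, w} \<in> edges (diamond s)"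
      by (auto simp: has_induced_def diamond_def)
    have hit: "e p \<in> F \<or> e (adv p) \<in> F" if "p \<in> P" for p
    proof -
      have "vr (fst (adv p)) = vr (fst p)" using slot(3)[OF that] nx_vr by (auto simp: adv_def)
      then have "p \<in> X \<or> adv p \<in> X" using that adv_P[OF that] parity_adv[OF that] by (auto simp: X_def)
      then show ?thesis by (auto simp: F_def)
    qed
    define x where "x = g 0"
    define y where "y = g 1"
    have xy: "{x, y} \<in> E - F" using g[of 0 1] by (simp add: x_def y_def diamond_edge_iff)
    have xz: "{x, g u} \<in> E - F" "{y, g u} \<in> E - F" if "2 \<le> u" "u < s + 3" for u
      using g[of 0 u] g[of 1 u] that by (simp_all add: x_def y_def diamond_edge_iff)
    let ?Z = "g ` {2..<s + 3}"
    have cardZ: "card ?Z = s + 1" 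
    proof -
      have "{2..<s + 3} \<subseteq> {..<s + 3}" by auto
      then show ?thesis using inj_on_subset[OF inj] by (auto simp: card_image)
    qed
    \<comment> \<open>Surviving triangles contain no deleted edge, which leaves only the last two
      kinds of the classification.\<close>
    have cases: "(\<exists>p\<in>P. \<exists>t<s. {x, y, z} = {v p, v (adv (adv p)), VQ (fst p) (snd p) t}) \<or>
      (\<exists>i<m. \<exists>t<s. {x, y, z} = {VA i 0, VA i 1, VR i t})" if "z \<in> ?Z" for z
    proof -
      have e3: "{x, y} \<in> E - F" "{x, z} \<in> E - F" "{y, z} \<in> E - F" using xy xz that by auto
      have nF: "\<not> f \<subseteq> {x, y, z}" if "f \<in> F" for f
      proof
        assume a: "f \<subseteq> {x, y, z}"
        have "f \<in> E" using that \<open>F \<subseteq> E\<close> by blast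
        then obtain a b where "f = {a, b}" "a \<noteq> b" using E_pairs by (auto simp: vertex_pairs_def card_2_iff)
        then have "f \<in> {{x, y}, {x, z}, {y, z}}" using a by auto
        then show False using e3 that by auto
      qed
      have "\<not> (\<exists>p\<in>P. {x, y, z} = v ` tri p)"
      proof
        assume "\<exists>p\<in>P. {x, y, z} = v ` tri p"
        then obtain p where p: "p \<in> P" "{x, y, z} = v ` tri p" by auto
        then have "e p \<subseteq> {x, y, z}" "e (adv p) \<subseteq> {x, y, z}" by (auto simp: e_def tri_def)
        then show False using hit[OF p(1)] nF by blast
      qed
      moreover have "\<not> (\<exists>i<m. {x, y, z} = {VA i 0, VA i 1, VA i 2})"
      proof
        assume "\<exists>i<m. {x, y, z} = {VA i 0, VA i 1, VA i 2}"
        then obtain i where i: "i < m" "{x, y, z} = {VA i 0, VA i 1, VA i 2}" by auto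
        obtain c where c: "c \<in> Oc" "fst c = i" "\<alpha> (vr c) = sg c" using \<alpha>[OF i(1)] by auto
        have "(c, r0 c) \<in> X" using c r0_range[of c] r0_even[of c] by (auto simp: X_def P_def)
        then have "e (c, r0 c) \<in> F" by (simp add: F_def)
        moreover have "e (c, r0 c) \<subseteq> {VA i 0, VA i 1, VA i 2}"
          using slot(2)[OF c(1)] c r0_range[of c] by (auto simp: e_def v_def adv_def less_3)
        ultimately show False using nF i by auto
      qed
      ultimately show ?thesis using triangle[of x y z] e3 by (auto simp: adj_E)
    qed
    \<comment> \<open>A pendant vertex has two neighbours, so as an end of the central edge it would
      leave room for just one common neighbour; since \<open>s \<ge> 1\<close>, at least two are
      required.\<close>
    have uniq: "z = z'" if "z \<in> ?Z" "z' \<in> ?Z" "(\<exists>c r t. x = VQ c r t) \<or> (\<exists>i t. x = VR i t) \<or> (\<exists>c r t. y = VQ c r t) \<or> (\<exists>i t. y = VR i t)" for z z'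
    proof -
      have one: "z = z'" if "adj a b" "adj a z" "adj a z'" "b \<noteq> z" "b \<noteq> z'" "(\<exists>c r t. a = VQ c r t) \<or> (\<exists>i t. a = VR i t)" for a b
        using that adj_VQ adj_VR by metis
      have "adj x y" "adj y x" "adj x z" "adj x z'" "adj y z" "adj y z'"
        using xy xz that(1,2) adj_sym by (auto simp: adj_E[symmetric])
      moreover from this have "x \<noteq> y" "x \<noteq> z" "y \<noteq> z" "x \<noteq> z'" "y \<noteq> z'" using adj_V by metis+
      ultimately show ?thesis using one[of x y] one[of y x] that(3) by metis
    qed
    have noQR: "\<not> ((\<exists>c r t. x = VQ c r t) \<or> (\<exists>i t. x = VR i t) \<or> (\<exists>c r t. y = VQ c r t) \<or> (\<exists>i t. y = VR i t))"
    proof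
      assume *: "(\<exists>c r t. x = VQ c r t) \<or> (\<exists>i t. x = VR i t) \<or> (\<exists>c r t. y = VQ c r t) \<or> (\<exists>i t. y = VR i t)"
      have "g 2 = g 3" by (rule uniq) (use s_pos * in auto)
      moreover have "(2 :: nat) \<in> {..<s + 3}" "(3 :: nat) \<in> {..<s + 3}" using s_pos by auto
      ultimately show False using inj_onD[OF inj] by force
    qed
    have zc: "(\<exists>p\<in>P. \<exists>t<s. {x, y} = {v p, v (adv (adv p))} \<and> z = VQ (fst p) (snd p) t) \<or>
      (\<exists>i<m. \<exists>t<s. {x, y} = {VA i 0, VA i 1} \<and> z = VR i t)" if "z \<in> ?Z" for z
      using cases[OF that]
    proof (elim disjE bexE exE conjE)
      fix p t assume a: "p \<in> P" "t < s" "{x, y, z} = {v p, v (adv (adv p)), VQ (fst p) (snd p) t}"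
      have "VQ (fst p) (snd p) t \<in> {x, y, z}" using a by simp
      then have "z = VQ (fst p) (snd p) t" using noQR by blast
      moreover have "z \<notin> {x, y}" using calculation noQR by blast
      ultimately have "{x, y} = {v p, v (adv (adv p))}" using a(3) by auto
      then show ?thesis using a \<open>z = _\<close> by blast
    next
      fix i t assume a: "i < m" "t < s" "{x, y, z} = {VA i 0, VA i 1, VR i t}"
      have "VR i t \<in> {x, y, z}" using a by simp
      then have "z = VR i t" using noQR by auto
      moreover have "z \<notin> {x, y}" using calculation noQR by auto
      ultimately have "{x, y} = {VA i 0, VA i 1}" using a(3) by auto
      then show ?thesis using a \<open>z = _\<close> by blast
    qed
    \<comment> \<open>Otherwise the pendant vertices of a strip triangle and of a clause triangle
      would add up on one edge. Both ends being identified would put two positions at distance 2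
      among two consecutive ones.\<close>
    have no_both: "{v p, v (adv (adv p))} \<noteq> {VA i 0, VA i 1}" if "p \<in> P" for p i
    proof
      assume "{v p, v (adv (adv p))} = {VA i 0, VA i 1}"
      then obtain a b where ab: "v p = VA i a" "v (adv (adv p)) = VA i b" by (auto simp: doubleton_eq_iff)
      then have "adv (adv p) = (fst p, Suc (Suc (snd p)))" using v_VA[OF ab(1)] by (auto simp: adv_def)
      then show False using v_VA[OF ab(1)] v_VA[OF ab(2)] by auto
    qed
    have same: "p = q" if "p \<in> P" "q \<in> P" "{v p, v (adv (adv p))} = {v q, v (adv (adv q))}" for p q
    proof (rule ccontr)
      assume "p \<noteq> q"
      have 1: "v p \<noteq> v (adv p)" "v p \<noteq> v (adv (adv p))" "v q \<noteq> v (adv q)" "v q \<noteq> v (adv (adv q))"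
        using that(1,2) adj_V arcs.intros(1,2) unfolding adj_def by blast+
      have "{v p, v (adv (adv p))} \<subseteq> Dm p \<inter> Dm q" using that(3) by (auto simp: Dm_def tri_def)
      from Dm_inter[OF that(1,2) \<open>p \<noteq> q\<close> 1(2) this] show False
        using 1 that(3) by (auto simp: doubleton_eq_iff)
    qed
    \<comment> \<open>All common neighbours carry the index of the same triangle, so only the last
      index \<open>t\<close> distinguishes them.\<close>
    have "\<exists>h. inj_on h {..<s} \<and> ?Z \<subseteq> h ` {..<s}"
    proof -
      have "g 2 \<in> ?Z" by auto
      from zc[OF this] show ?thesis
      proof (elim disjE bexE exE conjE)
        fix p t assume p: "p \<in> P" "{x, y} = {v p, v (adv (adv p))}"
        have "z \<in> VQ (fst p) (snd p) ` {..<s}" if "z \<in> ?Z" for z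
          using zc[OF that] p same no_both by (auto, metis imageI lessThan_iff prod.collapse)
        then show ?thesis by (intro exI[of _ "VQ (fst p) (snd p)"]) (auto simp: inj_on_def)
      next
        fix i t assume i: "{x, y} = {VA i 0, VA i 1}"
        have "z \<in> VR i ` {..<s}" if "z \<in> ?Z" for z
          using zc[OF that]
        proof (elim disjE bexE exE conjE)
          fix i' t assume "{x, y} = {VA i' 0, VA i' 1}" "z = VR i' t" "t < s"
          then show ?thesis using i by (auto simp: doubleton_eq_iff)
        next
          fix p assume "p \<in> P" "{x, y} = {v p, v (adv (adv p))}"
          then show ?thesis using i no_both by metis
        qed
        then show ?thesis by (intro exI[of _ "VR i"]) (auto simp: inj_on_def)
      qed
    qed
    then obtain h where "inj_on h {..<s}" "?Z \<subseteq> h ` {..<s}" by auto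
    then have "card ?Z \<le> s" using card_mono[of "h ` {..<s}" ?Z] card_image[of h "{..<s}"] by simp
    then show False using cardZ by simp
  qed
  ultimately show ?thesis by blast
qed

end

section \<open>The reduction from 3-SAT\<close>

instantiation vtx :: enc
begin
fun enc_vtx :: "vtx \<Rightarrow> D" where
  "enc_vtx (VA i a) = enc [0, i, a]"
| "enc_vtx (VP c r) = enc [1, fst c, snd c, r]"
| "enc_vtx (VQ c r t) = enc [2, fst c, snd c, r, t]"
| "enc_vtx (VR i t) = enc [3, i, t]"
instance
proof
  fix x y :: vtx
  show "enc x = enc y \<Longrightarrow> x = y"
    by (cases x; cases y; simp only: enc_vtx.simps; drule inj_enc) (auto simp: prod_eq_iff)
qed
end

lemma pt_VA [pt_intros]: assumes "pt i" "pt a" shows "pt (\<lambda>x. VA (i x) (a x))"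
  by (rule pt_recode[of "\<lambda>x. [0, i x, a x]"]) (intro pt_intros assms | simp)+
lemma pt_VP [pt_intros]: assumes "pt c" "pt r" shows "pt (\<lambda>x. VP (c x) (r x))"
  by (rule pt_recode[of "\<lambda>x. [1, fst (c x), snd (c x), r x]"]) (intro pt_intros assms | simp)+
lemma pt_VQ [pt_intros]: assumes "pt c" "pt r" "pt t" shows "pt (\<lambda>x. VQ (c x) (r x) (t x))"
  by (rule pt_recode[of "\<lambda>x. [2, fst (c x), snd (c x), r x, t x]"]) (intro pt_intros assms | simp)+
lemma pt_VR [pt_intros]: assumes "pt i" "pt a" shows "pt (\<lambda>x. VR (i x) (a x))"
  by (rule pt_recode[of "\<lambda>x. [3, i x, a x]"]) (intro pt_intros assms | simp)+

definition dedup :: "'a list \<Rightarrow> 'a list" where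
  "dedup l = fold (\<lambda>y acc. if y \<in> set acc then acc else y # acc) l []"

lemma dedup: "set (dedup l) = set l" "distinct (dedup l)" "length (dedup l) \<le> length l"
proof -
  have "set (fold (\<lambda>y acc. if y \<in> set acc then acc else y # acc) l a) = set l \<union> set a \<and>
    (distinct a \<longrightarrow> distinct (fold (\<lambda>y acc. if y \<in> set acc then acc else y # acc) l a)) \<and>
    length (fold (\<lambda>y acc. if y \<in> set acc then acc else y # acc) l a) \<le> length l + length a" for a
  proof (induction l arbitrary: a)
    case (Cons y l)
    show ?case using Cons[of a] Cons[of "y # a"] by auto
  qed simp
  from this[of "[]"] show "set (dedup l) = set l" "distinct (dedup l)" "length (dedup l) \<le> length l"
    by (auto simp: dedup_def)
qed

lemma pt_dedup [pt_intros]: assumes l: "pt l" shows "pt (\<lambda>x. dedup (l x))"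
  unfolding dedup_def
proof (rule pt_fold[OF l])
  show "pb (\<lambda>x. sz (l x))" by (rule pt_sz[OF l])
  have "sz (fold (\<lambda>y acc. if y \<in> set acc then acc else y # acc) ys a) + 1 \<le> sz ys + sz a" for ys and a :: "'b list"
  proof (induction ys arbitrary: a)
    case (Cons y ys)
    show ?case using Cons[of a] Cons[of "y # a"] by auto
  qed simp
  from this[of _ "[]"] show "sz (fold (\<lambda>y acc. if y \<in> set acc then acc else y # acc) ys []) \<le> sz (l x)"
    if "l x = ys @ zs" for x ys zs
    using that sz_append[of ys zs] sz_pos[of zs] by (simp add: order_trans[of _ "sz ys"])
qed (intro pt_intros)+

lemma pt_half: assumes n: "pt n" shows "pt (\<lambda>x. (odd (n x), n x div 2 :: nat))"
proof -
  define st where "st = (\<lambda>(_ :: D) s. if fst s then (False, Suc (snd s)) else (True, snd s :: nat))"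
  have e: "fold st ys (False, 0) = (odd (length ys), length ys div 2)" for ys :: "D list"
    by (induction ys rule: rev_induct) (auto simp: st_def)
  have "pt (\<lambda>x. fold st (units (n x)) (False, 0))"
  proof (rule pt_fold)
    show "pb (\<lambda>x. 2 * n x + 10)"
      by (rule pb_mono[OF pb_add[OF pt_sz[OF n] pb_const[of 10]]]) simp
    show "sz (fold st ys (False, 0)) \<le> 2 * n x + 10" if "units (n x) = ys @ zs" for x ys zs
    proof -
      have "length ys \<le> n x" using arg_cong[OF that, of length] by simp
      moreover have "length ys div 2 \<le> length ys" by simp
      ultimately show ?thesis using sz_bool_le[of "odd (length ys)"] unfolding e sz_simps by linarith
    qed
  qed (intro pt_intros n | unfold st_def)+
  then show ?thesis by (simp add: e)
qed

lemma pt_even [pt_intros]: "pt n \<Longrightarrow> pt (\<lambda>x. even (n x :: nat))"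
  using pt_not[OF pt_fst[OF pt_half]] by simp

lemma pt_div2 [pt_intros]: "pt n \<Longrightarrow> pt (\<lambda>x. n x div 2 :: nat)"
  using pt_snd[OF pt_half] by simp

lemma pt_encode_binary [pt_intros]: assumes n: "pt n" shows "pt (\<lambda>x. encode_binary (n x))"
proof -
  define st where "st = (\<lambda>(_ :: D) s. if fst s = 0 then s else (fst s div 2, snd s @ [odd (fst s :: nat)]))"
  have inv: "snd (fold st ys (k, a)) @ encode_binary (fst (fold st ys (k, a))) = a @ encode_binary k \<and>
      fst (fold st ys (k, a)) \<le> k - length ys \<and> length (snd (fold st ys (k, a))) \<le> length a + length ys" for ys k a
  proof (induction ys arbitrary: k a)
    case (Cons y ys)
    show ?case using Cons[of k a] Cons[of "k div 2" "a @ [odd k]"]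
      by (cases "k = 0") (auto simp: st_def encode_binary.simps[of k])
  qed simp
  have "pt (\<lambda>x. fold st (units (n x)) (n x, []))"
  proof (rule pt_fold)
    show "pb (\<lambda>x. 6 * sz (n x) + 10)" by (intro pb_intros pt_sz n)
    show "sz (fold st ys (n x, [])) \<le> 6 * sz (n x) + 10" if "units (n x) = ys @ zs" for x ys zs
    proof -
      have "length ys \<le> n x" using arg_cong[OF that, of length] by simp
      then show ?thesis using inv[of ys "n x" "[]"] sz_bits[of "snd (fold st ys (n x, []))"]
        by (cases "fold st ys (n x, [])") auto
    qed
    show "pt (\<lambda>p. st (fst (snd p)) (snd (snd p)))" for p :: "'a \<times> D \<times> nat \<times> bool list"
      unfolding st_def by (intro pt_intros)
  qed (intro pt_intros n)+
  then have "pt (\<lambda>x. snd (fold st (units (n x)) (n x, [])))" by (intro pt_intros)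
  moreover have "snd (fold st (units k) (k, [])) = encode_binary k" for k
    using inv[of "units k" k "[]"] by (auto simp: encode_binary.simps[of 0])
  ultimately show ?thesis by simp
qed

lemma pt_encode_unary [pt_intros]: assumes "pt n" shows "pt (\<lambda>x. encode_unary (n x))"
proof (rule pt_eqI)
  show "pt (\<lambda>x. map (\<lambda>_. True) (units (n x)) @ [False])" by (intro pt_intros assms)
qed (simp add: encode_unary_def units_def map_replicate_const)

text \<open>Variables are lists of numbers: a variable \<open>v\<close> of a 3-SAT instance is
  \<open>[v]\<close>, while the tableau uses tuples of indices without any pairing function.\<close>

type_synonym form = "(nat list \<times> bool) list list"

definition fsat :: "form \<Rightarrow> bool" where
  "fsat \<phi> \<longleftrightarrow> (\<exists>\<alpha>. \<forall>C\<in>set \<phi>. \<exists>l\<in>set C. \<alpha> (fst l) = snd l)"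

section \<open>The gadget graph computed from a formula\<close>

definition lit :: "form \<Rightarrow> nat \<times> nat \<Rightarrow> nat list \<times> bool" where
  "lit \<phi> c = nth_or ([], False) (nth_or [] \<phi> (fst c)) (snd c)"

definition occs :: "form \<Rightarrow> (nat \<times> nat) list" where
  "occs \<phi> = dedup (concat (map (\<lambda>i. map (\<lambda>j. (i, j)) [0..<length (nth_or [] \<phi> i)]) [0..<length \<phi>]))"

definition peers :: "form \<Rightarrow> nat \<times> nat \<Rightarrow> (nat \<times> nat) list" where
  "peers \<phi> c = filter (\<lambda>c'. fst (lit \<phi> c') = fst (lit \<phi> c)) (occs \<phi>)"

text \<open>The strip of a variable visits its occurrences in the order of \<open>occs\<close> and
  then returns to the first.\<close>

definition nxc :: "form \<Rightarrow> nat \<times> nat \<Rightarrow> nat \<times> nat" where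
  "nxc \<phi> c = (case filter (\<lambda>k. nth_or c (peers \<phi> c) k = c) [0..<length (peers \<phi> c)] of [] \<Rightarrow> c
     | k # _ \<Rightarrow> if Suc k < length (peers \<phi> c) then nth_or c (peers \<phi> c) (Suc k) else nth_or c (peers \<phi> c) 0)"

text \<open>\<open>cr0\<close>, \<open>cadv\<close> and \<open>cv\<close> repeat the constants of
  the locale with a formula as explicit argument, and \<open>cnext\<close> replaces the remainder
  modulo 3, so that the \<open>pt\<close> rules apply.\<close>

definition cr0 :: "form \<Rightarrow> nat \<times> nat \<Rightarrow> nat" where
  "cr0 \<phi> c = (if snd c = 0 then (if snd (lit \<phi> c) then 6 else 9)
     else if snd c = 1 then (if snd (lit \<phi> c) then 10 else 7) else (if snd (lit \<phi> c) then 8 else 11))"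

definition cadv :: "form \<Rightarrow> (nat \<times> nat) \<times> nat \<Rightarrow> (nat \<times> nat) \<times> nat" where
  "cadv \<phi> p = (if snd p < 17 then (fst p, Suc (snd p)) else (nxc \<phi> (fst p), 0))"

definition cnext :: "nat \<Rightarrow> nat" where
  "cnext a = (if a = 2 then 0 else Suc a)"

definition cv :: "form \<Rightarrow> (nat \<times> nat) \<times> nat \<Rightarrow> vtx" where
  "cv \<phi> p = (if snd p = cr0 \<phi> (fst p) then VA (fst (fst p)) (snd (fst p))
     else if snd p = Suc (cr0 \<phi> (fst p)) then VA (fst (fst p)) (cnext (snd (fst p)))
     else VP (fst p) (snd p))"

definition poss :: "form \<Rightarrow> ((nat \<times> nat) \<times> nat) list" where
  "poss \<phi> = concat (map (\<lambda>c. map (\<lambda>r. (c, r)) [0..<18]) (occs \<phi>))"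

definition alist :: "nat \<Rightarrow> form \<Rightarrow> (vtx \<times> vtx) list" where
  "alist s \<phi> = concat (map (\<lambda>p. (cv \<phi> p, cv \<phi> (cadv \<phi> p)) # (cv \<phi> p, cv \<phi> (cadv \<phi> (cadv \<phi> p))) #
       concat (map (\<lambda>t. [(cv \<phi> p, VQ (fst p) (snd p) t), (cv \<phi> (cadv \<phi> (cadv \<phi> p)), VQ (fst p) (snd p) t)]) [0..<s])) (poss \<phi>)) @
     concat (map (\<lambda>i. (VA i 0, VA i 1) # (VA i 0, VA i 2) # (VA i 1, VA i 2) #
       concat (map (\<lambda>t. [(VA i 0, VR i t), (VA i 1, VR i t)]) [0..<s])) [0..<length \<phi>])"

definition vlist :: "nat \<Rightarrow> form \<Rightarrow> vtx list" where
  "vlist s \<phi> = dedup (concat (map (\<lambda>i. [VA i 0, VA i 1, VA i 2] @ map (\<lambda>t. VR i t) [0..<s]) [0..<length \<phi>]) @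
     concat (map (\<lambda>p. VP (fst p) (snd p) # map (\<lambda>t. VQ (fst p) (snd p) t) [0..<s]) (poss \<phi>)))"

text \<open>Written directly from vertex names; the graph on numbers that this string encodes is
  \<open>inst\<close>.\<close>

definition gstr :: "nat \<Rightarrow> form \<Rightarrow> bool list" where
  "gstr s \<phi> = encode_unary (length (vlist s \<phi>)) @
     concat (map (\<lambda>x. map (\<lambda>y. (x, y) \<in> set (alist s \<phi>) \<or> (y, x) \<in> set (alist s \<phi>)) (vlist s \<phi>)) (vlist s \<phi>)) @
     encode_binary (9 * length (occs \<phi>))"

lemma pt_lit [pt_intros]: "pt \<phi> \<Longrightarrow> pt c \<Longrightarrow> pt (\<lambda>x. lit (\<phi> x) (c x))"
  unfolding lit_def by (intro pt_intros)

lemma pt_occs [pt_intros]: assumes "pt \<phi>" shows "pt (\<lambda>x. occs (\<phi> x))"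
  unfolding occs_def by (intro pt_intros assms pt_comp[OF assms])

lemma pt_peers [pt_intros]: assumes "pt \<phi>" "pt c" shows "pt (\<lambda>x. peers (\<phi> x) (c x))"
  unfolding peers_def by (intro pt_intros assms pt_comp[OF assms(1)] pt_comp[OF assms(2)])

lemma pt_nxc [pt_intros]: assumes "pt \<phi>" "pt c" shows "pt (\<lambda>x. nxc (\<phi> x) (c x))"
  unfolding nxc_def by (intro pt_intros assms pt_comp[OF assms(1)] pt_comp[OF assms(2)])

lemma pt_cr0 [pt_intros]: assumes "pt \<phi>" "pt c" shows "pt (\<lambda>x. cr0 (\<phi> x) (c x))"
  unfolding cr0_def by (intro pt_intros assms)

lemma pt_cadv [pt_intros]: assumes "pt \<phi>" "pt c" shows "pt (\<lambda>x. cadv (\<phi> x) (c x))"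
  unfolding cadv_def by (intro pt_intros assms)

lemma pt_cnext [pt_intros]: assumes "pt c" shows "pt (\<lambda>x. cnext (c x))"
  unfolding cnext_def by (intro pt_intros assms)

lemma pt_cv [pt_intros]: assumes "pt \<phi>" "pt c" shows "pt (\<lambda>x. cv (\<phi> x) (c x))"
  unfolding cv_def by (intro pt_intros assms)

lemma pt_poss [pt_intros]: assumes "pt \<phi>" shows "pt (\<lambda>x. poss (\<phi> x))"
  unfolding poss_def by (intro pt_intros assms)

lemma pt_alist [pt_intros]: assumes "pt \<phi>" shows "pt (\<lambda>x. alist s (\<phi> x))"
  unfolding alist_def by (intro pt_intros assms pt_comp[OF assms])

lemma pt_vlist [pt_intros]: assumes "pt \<phi>" shows "pt (\<lambda>x. vlist s (\<phi> x))"
  unfolding vlist_def by (intro pt_intros assms pt_comp[OF assms])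

lemma pt_gstr: "pt (gstr s)"
  unfolding gstr_def by (intro pt_intros)


lemma fst_lit_default: "i < length \<phi> \<Longrightarrow> j < length (\<phi> ! i) \<Longrightarrow> lit \<phi> (i, j) = \<phi> ! i ! j"
  by (simp add: lit_def nth_or_nth)

lemma set_occs: "set (occs \<phi>) = {(i, j). i < length \<phi> \<and> j < length (\<phi> ! i)}"
  by (auto simp: occs_def dedup nth_or_nth)

lemma distinct_occs: "distinct (occs \<phi>)" by (simp add: occs_def dedup)

lemma nxc_peers:
  assumes "k < length (peers \<phi> c)" "c = peers \<phi> c ! k"
  shows "nxc \<phi> c = peers \<phi> c ! (Suc k mod length (peers \<phi> c))"
proof -
  let ?l = "peers \<phi> c"
  have d: "distinct ?l" using distinct_occs by (simp add: peers_def)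
  have "filter (\<lambda>j. nth_or c ?l j = c) [0..<length ?l] = filter (\<lambda>j. j = k) [0..<length ?l]"
    using nth_eq_iff_index_eq[OF d, of _ k] assms by (intro filter_cong) (auto simp: nth_or_nth)
  also have "\<dots> = [k]"
  proof -
    have "filter (\<lambda>j. j = k) [0..<n] = (if k < n then [k] else [])" for n by (induction n) auto
    then show ?thesis using assms(1) by simp
  qed
  finally have "nxc \<phi> c = (if Suc k < length ?l then nth_or c ?l (Suc k) else nth_or c ?l 0)"
    by (simp add: nxc_def)
  then show ?thesis using assms(1) by (cases "Suc k = length ?l") (auto simp: nth_or_nth)
qed

lemma peers_eq: "fst (lit \<phi> c) = fst (lit \<phi> c') \<Longrightarrow> peers \<phi> c = peers \<phi> c'"
  by (simp add: peers_def)

lemma peers_mem: "c' \<in> set (peers \<phi> c) \<longleftrightarrow> c' \<in> set (occs \<phi>) \<and> fst (lit \<phi> c') = fst (lit \<phi> c)"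
  by (auto simp: peers_def)

text \<open>On the list of all occurrences of one variable \<open>nxc\<close> is the shift modulo
  its length, hence injective and transitive.\<close>

lemma strips_formula:
  assumes three: "\<forall>C\<in>set \<phi>. length C \<le> 3" and s: "s \<ge> 1"
  shows "strips (set (occs \<phi>)) (nxc \<phi>) (\<lambda>c. fst (lit \<phi> c)) (length \<phi>) s"
proof
  let ?O = "set (occs \<phi>)"
  have len: "length (\<phi> ! i) \<le> 3" if "i < length \<phi>" for i using three that by auto
  show "?O \<subseteq> {..<length \<phi>} \<times> {..<3}" using len by (force simp: set_occs)
  have idx: "\<exists>k<length (peers \<phi> c). c = peers \<phi> c ! k" if "c \<in> ?O" for c
    using that peers_mem[of c \<phi> c] by (auto simp: in_set_conv_nth)
  have nx: "nxc \<phi> c \<in> set (peers \<phi> c)" if "c \<in> ?O" for c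
  proof -
    note t = that
    obtain k where "k < length (peers \<phi> c)" "c = peers \<phi> c ! k" using idx[OF t] by auto
    from nxc_peers[OF this] this show ?thesis by (auto intro!: nth_mem mod_less_divisor)
  qed
  show "nxc \<phi> c \<in> ?O" "fst (lit \<phi> (nxc \<phi> c)) = fst (lit \<phi> c)" if "c \<in> ?O" for c
    using nx[OF that] by (auto simp: peers_mem)
  then have pe: "peers \<phi> (nxc \<phi> c) = peers \<phi> c" if "c \<in> ?O" for c
    using that by (intro peers_eq) auto
  show "inj_on (nxc \<phi>) ?O"
  proof (rule inj_onI)
    fix c c' assume a: "c \<in> ?O" "c' \<in> ?O" "nxc \<phi> c = nxc \<phi> c'"
    let ?l = "peers \<phi> c"
    have l: "peers \<phi> c' = ?l" using pe[OF a(1)] pe[OF a(2)] a(3) by simp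
    obtain k where k: "k < length ?l" "c = ?l ! k" using idx[OF a(1)] by auto
    obtain k' where k': "k' < length ?l" "c' = ?l ! k'" using idx[OF a(2)] l by auto
    have "?l ! (Suc k mod length ?l) = ?l ! (Suc k' mod length ?l)"
      using nxc_peers[OF k] nxc_peers[of k' \<phi> c'] k' l a(3) by simp
    moreover have "distinct ?l" using distinct_occs by (simp add: peers_def)
    moreover have "Suc k mod length ?l < length ?l" "Suc k' mod length ?l < length ?l"
      using k by (auto intro!: mod_less_divisor)
    ultimately have "Suc k mod length ?l = Suc k' mod length ?l" by (simp add: nth_eq_iff_index_eq)
    then have "k = k'" using k k' by (auto simp: mod_Suc split: if_splits)
    then show "c = c'" using k k' by simp
  qed
  show "\<exists>j. (nxc \<phi> ^^ j) c = c'" if a: "c \<in> ?O" "c' \<in> ?O" "fst (lit \<phi> c) = fst (lit \<phi> c')" for c c'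
  proof -
    let ?l = "peers \<phi> c"
    have l: "peers \<phi> c' = ?l" using peers_eq a(3) by metis
    obtain k where k: "k < length ?l" "c = ?l ! k" using idx[OF a(1)] by auto
    obtain k' where k': "k' < length ?l" "c' = ?l ! k'" using idx[OF a(2)] l by auto
    have it: "(nxc \<phi> ^^ j) c = ?l ! ((k + j) mod length ?l)" for j
    proof (induction j)
      case 0
      then show ?case using k by simp
    next
      case (Suc j)
      let ?i = "(k + j) mod length ?l" and ?c = "(nxc \<phi> ^^ j) c"
      have i: "?i < length ?l" using k by (auto intro: mod_less_divisor)
      then have "?c \<in> set ?l" using Suc by simp
      then have lc: "peers \<phi> ?c = ?l" by (intro peers_eq) (auto simp: peers_mem)
      have "nxc \<phi> ?c = ?l ! (Suc ?i mod length ?l)"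
        using nxc_peers[of ?i \<phi> ?c] i Suc lc by simp
      then show ?case by (simp add: mod_Suc_eq)
    qed
    have "(k + (length ?l - k + k')) mod length ?l = k'" using k k' by simp
    then show ?thesis using it[of "length ?l - k + k'"] k' by metis
  qed
qed (rule s)

lemma concrete_strips:
  assumes three: "\<forall>C\<in>set \<phi>. length C \<le> 3" and s: "s \<ge> 1"
  defines "O' \<equiv> set (occs \<phi>)" and "sg \<equiv> \<lambda>c. snd (lit \<phi> c)"
  shows "set (poss \<phi>) = strips.P O'" "set (alist s \<phi>) = strips.arcs O' (nxc \<phi>) sg (length \<phi>) s"
    "set (vlist s \<phi>) = strips.V O' (length \<phi>) s"
proof -
  interpret strips O' "nxc \<phi>" "\<lambda>c. fst (lit \<phi> c)" sg "length \<phi>" s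
    unfolding O'_def by (rule strips_formula[OF three s])
  show P': "set (poss \<phi>) = P" unfolding P_def by (auto simp: poss_def O'_def)
  have r0': "cr0 \<phi> c = r0 c" for c unfolding r0_def by (simp add: cr0_def sg_def)
  have adv': "cadv \<phi> p = adv p" for p by (simp add: cadv_def adv_def)
  have v': "cv \<phi> p = v p" if "p \<in> P" for p
    using slot(2)[OF slot(3)[OF that]] by (auto simp: cv_def v_def r0' cnext_def less_3)
  show "set (vlist s \<phi>) = V"
    unfolding vlist_def V_def dedup(1) P'[symmetric] by (auto simp: less_3 image_iff)
  show "set (alist s \<phi>) = arcs"
  proof
    show "set (alist s \<phi>) \<subseteq> arcs"
      unfolding alist_def by (auto simp: P' adv' v' adv_P intro: arcs.intros arcs.intros[unfolded One_nat_def])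
    have mem: "(x, y) \<in> set (alist s \<phi>) \<longleftrightarrow> (\<exists>p\<in>P. x = v p \<and> (y = v (adv p) \<or> y = v (adv (adv p)) \<or>
         (\<exists>t<s. y = VQ (fst p) (snd p) t)) \<or> x = v (adv (adv p)) \<and> (\<exists>t<s. y = VQ (fst p) (snd p) t)) \<or>
       (\<exists>i<length \<phi>. x = VA i 0 \<and> (y = VA i 1 \<or> y = VA i 2 \<or> (\<exists>t<s. y = VR i t)) \<or>
         x = VA i 1 \<and> (y = VA i 2 \<or> (\<exists>t<s. y = VR i t)))" for x y
      by (auto simp: alist_def P' adv' v' adv_P cong: bex_cong) force+
    show "arcs \<subseteq> set (alist s \<phi>)"
    proof
      fix a assume "a \<in> arcs"
      moreover obtain x y where a: "a = (x, y)" by fastforce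
      ultimately have "(x, y) \<in> arcs" by simp
      then show "a \<in> set (alist s \<phi>)" unfolding a mem by cases blast+
    qed
  qed
qed

section \<open>Renaming vertices\<close>

definition map_graph :: "('a \<Rightarrow> 'b) \<Rightarrow> 'a graph \<Rightarrow> 'b graph" where
  "map_graph f G = (f ` verts G, (`) f ` edges G)"

lemma has_induced_map:
  assumes f: "inj_on f W" and X: "X \<subseteq> Pow W" and h: "has_induced (f ` W, (`) f ` X) H"
  shows "has_induced (W, X) H"
proof -
  obtain g where g: "inj_on g (verts H)" "g ` verts H \<subseteq> f ` W"
    "\<And>u w. u \<in> verts H \<Longrightarrow> w \<in> verts H \<Longrightarrow> {g u, g w} \<in> (`) f ` X \<longleftrightarrow> {u, w} \<in> edges H"
    using h by (auto simp: has_induced_def)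
  let ?i = "inv_into W f"
  have fi: "f (?i (g u)) = g u" "?i (g u) \<in> W" if "u \<in> verts H" for u
    using g(2) that by (auto intro!: f_inv_into_f inv_into_into)
  have "{?i (g u), ?i (g w)} \<in> X \<longleftrightarrow> {u, w} \<in> edges H" if uw: "u \<in> verts H" "w \<in> verts H" for u w
  proof -
    have "{?i (g u), ?i (g w)} \<in> X \<longleftrightarrow> f ` {?i (g u), ?i (g w)} \<in> (`) f ` X"
    proof
      assume "f ` {?i (g u), ?i (g w)} \<in> (`) f ` X"
      then obtain Y where Y: "Y \<in> X" "f ` {?i (g u), ?i (g w)} = f ` Y" by auto
      then have "{?i (g u), ?i (g w)} = Y"
        using inj_on_image_eq_iff[OF f, of "{?i (g u), ?i (g w)}" Y] fi uw X by auto
      then show "{?i (g u), ?i (g w)} \<in> X" using Y by simp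
    qed (rule imageI)
    then show ?thesis using fi uw g(3) by simp
  qed
  moreover have "inj_on (?i \<circ> g) (verts H)"
    by (rule comp_inj_on[OF g(1) inj_on_inv_into[OF g(2)]])
  ultimately show ?thesis unfolding has_induced_def
    by (intro exI[of _ "?i \<circ> g"]) (use fi in auto)
qed

lemma diff_image_Pow:
  "inj_on f W \<Longrightarrow> X \<subseteq> Pow W \<Longrightarrow> Y \<subseteq> Pow W \<Longrightarrow> (`) f ` X - (`) f ` Y = (`) f ` (X - Y)"
  by (rule inj_on_image_set_diff[OF inj_on_image_Pow, symmetric]) auto

lemma deletion_map:
  assumes f: "inj_on f (verts G)" and G: "simple_graph G"
    and d: "diamond_free_edge_deletion s (G, k)"
  shows "diamond_free_edge_deletion s (map_graph f G, k)"
proof -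
  obtain F where F: "F \<subseteq> edges G" "card F \<le> k" "\<not> has_induced (verts G, edges G - F) (diamond s)"
    using d by (auto simp: diamond_free_edge_deletion_def)
  have E: "edges G \<subseteq> Pow (verts G)" using G by (auto simp: simple_graph_def vertex_pairs_def)
  have fin: "finite F" using F E G by (meson finite_Pow_iff finite_subset simple_graph_def)
  have "\<not> has_induced (f ` verts G, (`) f ` (edges G - F)) (diamond s)"
    using has_induced_map[OF f, of "edges G - F"] F E by blast
  moreover have "(`) f ` edges G - (`) f ` F = (`) f ` (edges G - F)"
    using F E by (intro diff_image_Pow[OF f]) auto
  ultimately show ?thesis unfolding diamond_free_edge_deletion_def map_graph_def
    using F card_image_le[OF fin, of "(`) f"] by (auto intro!: exI[of _ "(`) f ` F"])
qed

lemma editing_map: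
  assumes f: "inj_on f (verts G)" and G: "simple_graph G"
    and d: "diamond_free_edge_editing s (G, k)"
  shows "diamond_free_edge_editing s (map_graph f G, k)"
proof -
  obtain F where F: "F \<subseteq> vertex_pairs (verts G)" "card F \<le> k"
    "\<not> has_induced (verts G, (edges G - F) \<union> (F - edges G)) (diamond s)"
    using d by (auto simp: diamond_free_edge_editing_def)
  have E: "edges G \<subseteq> Pow (verts G)" "F \<subseteq> Pow (verts G)"
    using G F by (auto simp: simple_graph_def vertex_pairs_def)
  have fin: "finite F" using E G by (meson finite_Pow_iff finite_subset simple_graph_def)
  have "\<not> has_induced (f ` verts G, (`) f ` ((edges G - F) \<union> (F - edges G))) (diamond s)"
    using has_induced_map[OF f, of "(edges G - F) \<union> (F - edges G)"] F E by blast
  moreover have "((`) f ` edges G - (`) f ` F) \<union> ((`) f ` F - (`) f ` edges G) = (`) f ` ((edges G - F) \<union> (F - edges G))"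
    using diff_image_Pow[OF f] E by (simp add: image_Un)
  moreover have "(`) f ` F \<subseteq> vertex_pairs (f ` verts G)"
  proof
    fix h assume "h \<in> (`) f ` F"
    then obtain h' where h': "h' \<in> F" "h = f ` h'" by auto
    then have "h' \<subseteq> verts G" "card h' = 2" using F by (auto simp: vertex_pairs_def)
    then show "h \<in> vertex_pairs (f ` verts G)"
      using h' card_image[OF inj_on_subset[OF f]] by (auto simp: vertex_pairs_def)
  qed
  ultimately show ?thesis unfolding diamond_free_edge_editing_def map_graph_def
    using F card_image_le[OF fin, of "(`) f"] by (auto intro!: exI[of _ "(`) f ` F"])
qed

lemma deletion_imp_editing:
  assumes "simple_graph G" "diamond_free_edge_deletion s (G, k)"
  shows "diamond_free_edge_editing s (G, k)"
proof -
  obtain F where F: "F \<subseteq> edges G" "card F \<le> k" "\<not> has_induced (verts G, edges G - F) (diamond s)"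
    using assms by (auto simp: diamond_free_edge_deletion_def)
  moreover have "(edges G - F) \<union> (F - edges G) = edges G - F" "F \<subseteq> vertex_pairs (verts G)"
    using F assms by (auto simp: simple_graph_def)
  ultimately show ?thesis unfolding diamond_free_edge_editing_def prod.case by (intro exI[of _ F]) simp
qed

definition inst :: "nat \<Rightarrow> form \<Rightarrow> nat graph \<times> nat" where
  "inst s \<phi> = (({..<length (vlist s \<phi>)}, {{a, b} | a b. a < length (vlist s \<phi>) \<and> b < length (vlist s \<phi>) \<and>
     ((vlist s \<phi> ! a, vlist s \<phi> ! b) \<in> set (alist s \<phi>) \<or> (vlist s \<phi> ! b, vlist s \<phi> ! a) \<in> set (alist s \<phi>))}),
     9 * length (occs \<phi>))"

lemma map_nth_upt: "map h vs = map (\<lambda>i. h (vs ! i)) [0..<length vs]"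
  by (rule nth_equalityI) auto

lemma encode_inst: "encode_instance (inst s \<phi>) = gstr s \<phi>"
proof -
  let ?vs = "vlist s \<phi>" and ?al = "set (alist s \<phi>)"
  let ?n = "length ?vs"
  have e: "{i, j} \<in> edges (fst (inst s \<phi>)) \<longleftrightarrow> (?vs ! i, ?vs ! j) \<in> ?al \<or> (?vs ! j, ?vs ! i) \<in> ?al"
    if "i < ?n" "j < ?n" for i j
    using that unfolding inst_def fst_conv snd_conv mem_Collect_eq by (auto simp: doubleton_eq_iff)
  have "encode_instance (inst s \<phi>) = encode_unary ?n @
     concat (map (\<lambda>i. map (\<lambda>j. {i, j} \<in> edges (fst (inst s \<phi>))) [0..<?n]) [0..<?n]) @ encode_binary (9 * length (occs \<phi>))"
    by (simp add: inst_def Let_def)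
  also have "concat (map (\<lambda>i. map (\<lambda>j. {i, j} \<in> edges (fst (inst s \<phi>))) [0..<?n]) [0..<?n]) =
     concat (map (\<lambda>i. map (\<lambda>j. (?vs ! i, ?vs ! j) \<in> ?al \<or> (?vs ! j, ?vs ! i) \<in> ?al) [0..<?n]) [0..<?n])"
    by (intro arg_cong[where f = concat] map_cong refl) (use e in auto)
  finally show ?thesis unfolding gstr_def by (simp only: map_nth_upt[of _ ?vs])
qed

lemma length_concat_le: "(\<And>x. x \<in> set xs \<Longrightarrow> length (f x) \<le> k) \<Longrightarrow> length (concat (map f xs)) \<le> k * length xs"
proof (induction xs)
  case (Cons x xs)
  then show ?case using Cons.prems[of x] by (simp add: add_mono)
qed simp

text \<open>Satisfiability gives a deletion set, which is also an editing set, and an editing set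
  gives satisfiability. Hence the same instance serves both problems.\<close>

theorem reduction:
  assumes three: "\<forall>C\<in>set \<phi>. length C \<le> 3" and s: "s \<ge> 1"
  shows "inst s \<phi> \<in> K4_free_instances"
    and "fsat \<phi> \<Longrightarrow> diamond_free_edge_deletion s (inst s \<phi>)"
    and "diamond_free_edge_editing s (inst s \<phi>) \<Longrightarrow> fsat \<phi>"
    and "card (verts (fst (inst s \<phi>))) \<le> (57 + 55 * s) * length \<phi>"
    and "snd (inst s \<phi>) \<le> 27 * length \<phi>"
proof -
  define O' where "O' = set (occs \<phi>)"
  define sg where "sg c = snd (lit \<phi> c)" for c
  interpret strips O' "nxc \<phi>" "\<lambda>c. fst (lit \<phi> c)" sg "length \<phi>" s
    unfolding O'_def by (rule strips_formula[OF three s])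
  let ?vs = "vlist s \<phi>"
  let ?n = "length ?vs"
  have A: "set (alist s \<phi>) = arcs" and Vs: "set ?vs = V"
    using concrete_strips[OF three s] unfolding O'_def[symmetric] sg_def[symmetric] by simp_all
  have dist: "distinct ?vs" by (simp add: vlist_def dedup)
  let ?G = "fst (inst s \<phi>)"
  let ?f = "\<lambda>i. ?vs ! i"
  have inj: "inj_on ?f {..<?n}" using dist by (auto simp: inj_on_def nth_eq_iff_index_eq)
  have fV: "?f ` {..<?n} = V" using Vs by (auto simp: set_conv_nth)
  have vG: "verts ?G = {..<?n}" by (simp add: inst_def)
  have EG: "edges ?G = {{a, b} | a b. a < ?n \<and> b < ?n \<and> adj (?vs ! a) (?vs ! b)}"
    by (simp add: inst_def A adj_def)
  have fE: "(`) ?f ` edges ?G = E"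
  proof
    show "(`) ?f ` edges ?G \<subseteq> E" unfolding EG by (auto simp: adj_E)
    show "E \<subseteq> (`) ?f ` edges ?G"
    proof
      fix h assume "h \<in> E"
      then obtain x y where h: "h = {x, y}" "adj x y" unfolding E_def adj_def by auto
      then obtain a b where "a < ?n" "b < ?n" "x = ?vs ! a" "y = ?vs ! b"
        using adj_V[OF h(2)] Vs by (metis in_set_conv_nth)
      then show "h \<in> (`) ?f ` edges ?G" unfolding EG using h by (intro image_eqI[of _ _ "{a, b}"]) auto
    qed
  qed
  have mG: "map_graph ?f ?G = (V, E)" by (simp add: map_graph_def vG fV fE)
  have simpleG: "simple_graph ?G"
    unfolding simple_graph_def vG EG using adj_V by (force simp: vertex_pairs_def card_2_iff)
  \<comment> \<open>The deletion set is carried from the named graph to the numbered one by the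
    inverse, the editing set in the opposite direction by \<open>?f\<close>.\<close>
  let ?g = "inv_into {..<?n} ?f"
  have injg: "inj_on ?g V" using inj_on_inv_into[of V ?f "{..<?n}"] fV by simp
  have mgG: "map_graph ?g (V, E) = ?G"
  proof -
    have id: "?g ` ?f ` S = S" if "S \<subseteq> {..<?n}" for S
      using that inj by (force simp: image_image inv_into_f_f cong: image_cong)
    have "?g ` V = {..<?n}" using id[of "{..<?n}"] fV by simp
    moreover have "(`) ?g ` E = edges ?G"
    proof -
      have "edges ?G \<subseteq> Pow {..<?n}" unfolding EG by auto
      then have "(\<lambda>S. ?g ` ?f ` S) ` edges ?G = (\<lambda>S. S) ` edges ?G" using id by (intro image_cong[OF refl]) blast
      then show ?thesis unfolding fE[symmetric] image_image by simp
    qed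
    ultimately show ?thesis by (simp add: map_graph_def vG[symmetric])
  qed
  have "\<not> has_induced ?G (complete_graph 4)"
    using has_induced_map[OF injg, of E "complete_graph 4"] K4_free E_pairs mgG
    unfolding map_graph_def by (auto simp: vertex_pairs_def)
  then show "inst s \<phi> \<in> K4_free_instances"
    using simpleG vG unfolding K4_free_instances_def by (cases "inst s \<phi>") auto
  have k: "snd (inst s \<phi>) = kk"
    using distinct_occs unfolding kk_def by (simp add: inst_def O'_def distinct_card)
  have inst: "inst s \<phi> = (?G, kk)" using k by (metis prod.collapse)
  show "diamond_free_edge_deletion s (inst s \<phi>)" if sat: "fsat \<phi>"
  proof -
    obtain \<alpha> where \<alpha>: "\<And>C. C \<in> set \<phi> \<Longrightarrow> \<exists>l\<in>set C. \<alpha> (fst l) = snd l" using sat by (auto simp: fsat_def)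
    have "\<exists>c\<in>O'. fst c = i \<and> \<alpha> (fst (lit \<phi> c)) = sg c" if "i < length \<phi>" for i
    proof -
      from \<alpha>[OF nth_mem[OF that]] obtain j where "j < length (\<phi> ! i)" "\<alpha> (fst (\<phi> ! i ! j)) = snd (\<phi> ! i ! j)"
        by (metis in_set_conv_nth)
      then show ?thesis using \<open>i < length \<phi>\<close>
        by (intro bexI[of _ "(i, j)"]) (auto simp: O'_def set_occs sg_def fst_lit_default)
    qed
    from sat_imp_deletion[OF this] have "diamond_free_edge_deletion s ((V, E), kk)"
      by (auto simp: diamond_free_edge_deletion_def)
    from deletion_map[OF _ simple this, of ?g] injg mgG
    have "diamond_free_edge_deletion s (?G, kk)" by simp
    then show ?thesis using inst by metis
  qed
  show "fsat \<phi>" if ed: "diamond_free_edge_editing s (inst s \<phi>)"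
  proof -
    have "diamond_free_edge_editing s (?G, kk)" using ed inst by metis
    with editing_map[of ?f ?G s kk] inj vG simpleG mG
    have "diamond_free_edge_editing s ((V, E), kk)" by simp
    then obtain F where "F \<subseteq> vertex_pairs V" "card F \<le> kk" "\<not> has_induced (V, (E - F) \<union> (F - E)) (diamond s)"
      by (auto simp: diamond_free_edge_editing_def)
    from edit_imp_sat[OF this] obtain \<alpha> where \<alpha>: "\<And>i. i < length \<phi> \<Longrightarrow> \<exists>c\<in>O'. fst c = i \<and> \<alpha> (fst (lit \<phi> c)) = sg c"
      by blast
    have "\<exists>l\<in>set C. \<alpha> (fst l) = snd l" if C: "C \<in> set \<phi>" for C
    proof -
      obtain i where i: "i < length \<phi>" "C = \<phi> ! i" using C by (auto simp: in_set_conv_nth)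
      obtain j where "j < length (\<phi> ! i)" "\<alpha> (fst (lit \<phi> (i, j))) = snd (lit \<phi> (i, j))"
        using \<alpha>[OF i(1)] by (auto simp: O'_def set_occs sg_def)
      then show ?thesis using i by (intro bexI[of _ "\<phi> ! i ! j"]) (auto simp: fst_lit_default)
    qed
    then show ?thesis unfolding fsat_def by blast
  qed
  have occs_le: "length (occs \<phi>) \<le> 3 * length \<phi>"
  proof -
    have "length (concat (map (\<lambda>i. map (\<lambda>j. (i, j)) [0..<length (nth_or [] \<phi> i)]) [0..<length \<phi>])) \<le> 3 * length [0..<length \<phi>]"
      using three by (intro length_concat_le) (auto simp: nth_or_nth)
    then show ?thesis unfolding occs_def using dedup(3) le_trans by fastforce
  qed
  then show "snd (inst s \<phi>) \<le> 27 * length \<phi>" by (simp add: inst_def)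
  have "length (poss \<phi>) \<le> 18 * length (occs \<phi>)"
    unfolding poss_def by (rule length_concat_le) simp
  then have poss_le: "length (poss \<phi>) \<le> 54 * length \<phi>" using occs_le by simp
  have "?n \<le> length (concat (map (\<lambda>i. [VA i 0, VA i 1, VA i 2] @ map (\<lambda>t. VR i t) [0..<s]) [0..<length \<phi>]) @
     concat (map (\<lambda>p. VP (fst p) (snd p) # map (\<lambda>t. VQ (fst p) (snd p) t) [0..<s]) (poss \<phi>)))"
    unfolding vlist_def by (rule dedup(3))
  \<comment> \<open>A clause has at most three occurrences with 18 positions each, every position
    with a \<open>VP\<close> and \<open>s\<close> pendant vertices, besides its own
    \<open>3 + s\<close> vertices: \<open>3 + s + 54 * (1 + s) = 57 + 55 * s\<close>.\<close>
  also have "\<dots> \<le> (3 + s) * length [0..<length \<phi>] + (1 + s) * length (poss \<phi>)"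
    unfolding length_append by (intro add_mono length_concat_le) auto
  also have "\<dots> \<le> (3 + s) * length \<phi> + (1 + s) * (54 * length \<phi>)"
    using poss_le by (intro add_mono mult_le_mono) auto
  also have "\<dots> = (57 + 55 * s) * length \<phi>" by (simp add: algebra_simps)
  finally show "card (verts (fst (inst s \<phi>))) \<le> (57 + 55 * s) * length \<phi>" by (simp add: vG)
qed

section \<open>The tableau formula of a verifier\<close>

text \<open>The first entry tags the kind of fact at time \<open>t\<close>: state, head position,
  cell content, symbol read by head \<open>i\<close>, state together with an initial part of the
  symbols read, symbol to be written, and direction to be taken.\<close>

abbreviation (input) Qv :: "nat \<Rightarrow> nat \<Rightarrow> nat list" where "Qv t q \<equiv> [0, t, q]"
abbreviation (input) Hv :: "nat \<Rightarrow> nat \<Rightarrow> nat \<Rightarrow> nat list" where "Hv t i p \<equiv> [1, t, i, p]"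
abbreviation (input) Cv :: "nat \<Rightarrow> nat \<Rightarrow> nat \<Rightarrow> nat \<Rightarrow> nat list" where "Cv t i p a \<equiv> [2, t, i, p, a]"
abbreviation (input) Rv :: "nat \<Rightarrow> nat \<Rightarrow> nat \<Rightarrow> nat list" where "Rv t i a \<equiv> [3, t, i, a]"
abbreviation (input) Av :: "nat \<Rightarrow> nat \<Rightarrow> nat list \<Rightarrow> nat list" where "Av t q as \<equiv> 4 # t # q # as"
abbreviation (input) Wv :: "nat \<Rightarrow> nat \<Rightarrow> nat \<Rightarrow> nat list" where "Wv t i b \<equiv> [5, t, i, b]"
abbreviation (input) Dv :: "nat \<Rightarrow> nat \<Rightarrow> nat \<Rightarrow> nat list" where "Dv t i d \<equiv> [6, t, i, d]"

abbreviation (input) fact1 :: "nat list \<Rightarrow> (nat list \<times> bool) list" where "fact1 a \<equiv> [(a, True)]"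
abbreviation (input) imp1 :: "nat list \<Rightarrow> nat list \<Rightarrow> (nat list \<times> bool) list" where
  "imp1 a b \<equiv> [(a, False), (b, True)]"
abbreviation (input) imp2 :: "nat list \<Rightarrow> nat list \<Rightarrow> nat list \<Rightarrow> (nat list \<times> bool) list" where
  "imp2 a b c \<equiv> [(a, False), (b, False), (c, True)]"

fun mcode :: "move \<Rightarrow> nat" where
  "mcode MoveLeft = 0" | "mcode MoveStay = 1" | "mcode MoveRight = 2"

lemma move_offset_mcode: "move_offset d = int (mcode d) - 1" by (cases d) auto

text \<open>\<open>M\<close> is fixed, so its transition function becomes a constant list that a
  \<open>pt\<close> function can consult. Halting states have no entries.\<close>

definition trans_table :: "tm \<Rightarrow> (nat \<times> nat list \<times> nat \<times> (nat \<times> nat \<times> nat) list) list" where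
  "trans_table M = concat (map (\<lambda>q. map (\<lambda>rs. (q, rs, fst (tm_delta M q rs),
      map (\<lambda>i. (i, fst (snd (tm_delta M q rs) ! i), mcode (snd (snd (tm_delta M q rs) ! i)))) [0..<tm_tapes M]))
    (List.n_lists (tm_tapes M) [0..<tm_symbols M])) (filter (\<lambda>q. q \<noteq> 1 \<and> q \<noteq> 2) [0..<tm_states M]))"

text \<open>A clause that mentions the symbols on all tapes at once would be too long.
  \<open>Av\<close> collects them one tape at a time, by clauses with three literals.\<close>

definition partial_reads :: "tm \<Rightarrow> nat list list" where
  "partial_reads M = concat (map (\<lambda>j. List.n_lists j [0..<tm_symbols M]) [0..<tm_tapes M])"

definition prefix_bits :: "bool list \<Rightarrow> bool list" where
  "prefix_bits x = concat (map (\<lambda>b. [True, b]) x) @ [False]"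

text \<open>The formula is Horn apart from the guess of the certificate, so a satisfying assignment need
  only contain the facts of the actual run; uniqueness of states and symbols is never required.
  Position \<open>p\<close> stands for the cell \<open>p - T\<close>.\<close>

definition step_clauses :: "tm \<Rightarrow> nat \<Rightarrow> nat \<Rightarrow> form" where
  "step_clauses M T t =
     map (\<lambda>q. imp1 (Qv t q) (Av t q [])) (filter (\<lambda>q. q \<noteq> 1 \<and> q \<noteq> 2) [0..<tm_states M]) @
     map (\<lambda>q. imp1 (Qv t q) (Qv (Suc t) q)) [1, 2] @
     concat (map (\<lambda>q. concat (map (\<lambda>as. map (\<lambda>a. imp2 (Av t q as) (Rv t (length as) a) (Av t q (as @ [a])))
        [0..<tm_symbols M]) (partial_reads M))) [0..<tm_states M]) @
     concat (map (\<lambda>e. imp1 (Av t (fst e) (fst (snd e))) (Qv (Suc t) (fst (snd (snd e)))) #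
        concat (map (\<lambda>w. [imp1 (Av t (fst e) (fst (snd e))) (Wv t (fst w) (fst (snd w))),
           imp1 (Av t (fst e) (fst (snd e))) (Dv t (fst w) (snd (snd w)))]) (snd (snd (snd e))))) (trans_table M)) @
     concat (map (\<lambda>i. concat (map (\<lambda>p.
        concat (map (\<lambda>a. [imp2 (Hv t i p) (Cv t i p a) (Rv t i a), imp2 (Hv t i p) (Wv t i a) (Cv (Suc t) i p a)] @
           map (\<lambda>p'. imp2 (Hv t i p') (Cv t i p a) (Cv (Suc t) i p a)) (filter (\<lambda>p'. p' \<noteq> p) [0..<2 * T + 1]))
          [0..<tm_symbols M]) @
        map (\<lambda>d. imp2 (Hv t i (Suc p)) (Dv t i d) (Hv (Suc t) i (p + d))) [0, 1, 2])
       [0..<2 * T + 1])) [0..<tm_tapes M])"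

text \<open>The certificate may be shorter than \<open>m\<close>: each of its cells holds a bit or a
  blank, and blanks propagate to the right. Acceptance is expressed by forbidding the rejecting
  state at time \<open>T\<close>, when the machine has halted.\<close>

definition tableau :: "tm \<Rightarrow> nat \<Rightarrow> nat \<Rightarrow> bool list \<Rightarrow> form" where
  "tableau M T m x =
     [fact1 (Qv 0 0), [(Qv T 2, False)]] @
     map (\<lambda>i. fact1 (Hv 0 i T)) [0..<tm_tapes M] @
     concat (map (\<lambda>i. map (\<lambda>p. fact1 (Cv 0 i p 0)) [0..<2 * T + 1]) (tl [0..<tm_tapes M])) @
     map (\<lambda>p. fact1 (Cv 0 0 p 0)) [0..<T] @
     map (\<lambda>j. fact1 (Cv 0 0 (T + j) (if nth_or False (prefix_bits x) j then 2 else 1))) [0..<length (prefix_bits x)] @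
     concat (map (\<lambda>j. [[(Cv 0 0 (T + length (prefix_bits x) + j) 0, True), (Cv 0 0 (T + length (prefix_bits x) + j) 1, True),
          (Cv 0 0 (T + length (prefix_bits x) + j) 2, True)],
        imp1 (Cv 0 0 (T + length (prefix_bits x) + j) 0) (Cv 0 0 (T + length (prefix_bits x) + Suc j) 0)]) [0..<m]) @
     map (\<lambda>p. fact1 (Cv 0 0 (T + length (prefix_bits x) + m + p) 0)) [0..<T + 1] @
     concat (map (\<lambda>t. step_clauses M T t) [0..<T])"

lemma pt_prefix_bits [pt_intros]: "pt f \<Longrightarrow> pt (\<lambda>x. prefix_bits (f x))"
  unfolding prefix_bits_def by (intro pt_intros)

lemma pt_step_clauses [pt_intros]: assumes "pt T" "pt t" shows "pt (\<lambda>x. step_clauses M (T x) (t x))"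
  unfolding step_clauses_def by (intro pt_intros pt_comp[OF assms(1)] pt_comp[OF assms(2)])

lemma pt_tableau [pt_intros]: assumes "pt T" "pt m" "pt f" shows "pt (\<lambda>x. tableau M (T x) (m x) (f x))"
  unfolding tableau_def by (intro pt_intros pt_comp[OF assms(1)] pt_comp[OF assms(2)] pt_comp[OF assms(3)])

lemma tableau_three: "C \<in> set (tableau M T m x) \<Longrightarrow> length C \<le> 3"
  by (auto simp: tableau_def step_clauses_def)

definition csat :: "(nat list \<Rightarrow> bool) \<Rightarrow> (nat list \<times> bool) list \<Rightarrow> bool" where
  "csat \<alpha> C \<longleftrightarrow> (\<exists>l\<in>set C. \<alpha> (fst l) = snd l)"

lemma csat_simps [simp]: "csat \<alpha> [] = False" "csat \<alpha> (l # C) \<longleftrightarrow> \<alpha> (fst l) = snd l \<or> csat \<alpha> C"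
  by (auto simp: csat_def)

lemma fsat_csat: "fsat \<phi> \<longleftrightarrow> (\<exists>\<alpha>. \<forall>C\<in>set \<phi>. csat \<alpha> C)" by (simp add: fsat_def csat_def)

lemma delta_valid:
  assumes "turing_machine M" "q < tm_states M" "length rs = tm_tapes M" "set rs \<subseteq> {..<tm_symbols M}"
  shows "fst (tm_delta M q rs) < tm_states M" "length (snd (tm_delta M q rs)) = tm_tapes M"
    "fst ` set (snd (tm_delta M q rs)) \<subseteq> {..<tm_symbols M}"
  using assms unfolding turing_machine_def case_prod_beta by blast+

section \<open>Runs of a machine and the facts they produce\<close>

locale machine_run =
  fixes M :: tm and z :: "bool list"
  assumes M: "turing_machine M"
begin

definition st :: "nat \<Rightarrow> nat" where "st t = fst (tm_run M z t)"
definition tps :: "nat \<Rightarrow> tape list" where "tps t = snd (tm_run M z t)"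
definition rd :: "nat \<Rightarrow> nat list" where "rd t = reads (tps t)"
definition cell :: "nat \<Rightarrow> nat \<Rightarrow> int \<Rightarrow> nat" where "cell t i = fst (tps t ! i)"
definition pos :: "nat \<Rightarrow> nat \<Rightarrow> int" where "pos t i = snd (tps t ! i)"
definition act :: "nat \<Rightarrow> nat \<Rightarrow> nat \<times> move" where "act t i = snd (tm_delta M (st t) (rd t)) ! i"
abbreviation halted :: "nat \<Rightarrow> bool" where "halted t \<equiv> st t = 1 \<or> st t = 2"

lemma run_Suc: "tm_run M z (Suc t) = tm_step M (tm_run M z t)" by (simp add: tm_run_def)

lemma halted_Suc: "halted t \<Longrightarrow> st (Suc t) = st t \<and> tps (Suc t) = tps t"
  by (cases "tm_run M z t") (auto simp: st_def tps_def run_Suc tm_step_def)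

lemma running_Suc: "\<not> halted t \<Longrightarrow> st (Suc t) = fst (tm_delta M (st t) (rd t)) \<and>
    tps (Suc t) = map2 tape_act (tps t) (snd (tm_delta M (st t) (rd t)))"
  by (cases "tm_run M z t") (auto simp: st_def tps_def rd_def reads_def run_Suc tm_step_def split: prod.split)

text \<open>The bound on the head positions is the reason why a window of \<open>2 * T + 1\<close>
  cells suffices for \<open>T\<close> steps.\<close>

lemma invariant: "st t < tm_states M \<and> length (tps t) = tm_tapes M \<and>
    (\<forall>i<tm_tapes M. \<forall>p. cell t i p < tm_symbols M) \<and> (\<forall>i<tm_tapes M. \<bar>pos t i\<bar> \<le> int t)"
proof (induction t)
  case 0
  have len: "length (tps 0) = tm_tapes M" using M by (simp add: tps_def tm_run_def tm_init_def turing_machine_def)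
  have "tps 0 ! i = (if i = 0 then string_tape z else (\<lambda>_. 0), 0)" if "i < tm_tapes M" for i
    using that by (auto simp: tps_def tm_run_def tm_init_def nth_Cons')
  then show ?case using len M by (auto simp: st_def tm_run_def tm_init_def turing_machine_def cell_def pos_def string_tape_def)
next
  case (Suc t)
  show ?case
  proof (cases "halted t")
    case True
    then show ?thesis using halted_Suc[OF True] Suc by (auto simp: cell_def pos_def)
  next
    case False
    have rd: "length (rd t) = tm_tapes M" "set (rd t) \<subseteq> {..<tm_symbols M}"
      using Suc by (auto simp: rd_def reads_def cell_def set_conv_nth split: prod.splits) (metis fst_conv)
    then have d: "fst (tm_delta M (st t) (rd t)) < tm_states M" "length (snd (tm_delta M (st t) (rd t))) = tm_tapes M"
      "fst ` set (snd (tm_delta M (st t) (rd t))) \<subseteq> {..<tm_symbols M}"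
      using delta_valid[OF M, of "st t" "rd t"] Suc by blast+
    have nth: "tps (Suc t) ! i = tape_act (tps t ! i) (act t i)" if "i < tm_tapes M" for i
      using that running_Suc[OF False] Suc d by (simp add: act_def)
    have a: "fst (act t i) < tm_symbols M" if "i < tm_tapes M" for i
      using d(2,3) that by (metis act_def imageI lessThan_iff nth_mem subsetD)
    have off: "\<bar>move_offset d\<bar> \<le> 1" for d by (cases d) auto
    have "(\<forall>p. cell (Suc t) i p < tm_symbols M) \<and> \<bar>pos (Suc t) i\<bar> \<le> int (Suc t)" if i: "i < tm_tapes M" for i
    proof -
      have "cell (Suc t) i = (cell t i)(pos t i := fst (act t i))" "pos (Suc t) i = pos t i + move_offset (snd (act t i))"
        using nth[OF i] by (simp_all add: cell_def pos_def tape_act_def case_prod_beta)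
      moreover have "\<bar>pos t i\<bar> \<le> int t" "\<And>p. cell t i p < tm_symbols M" using Suc i by auto
      ultimately show ?thesis using a[OF i] off[of "snd (act t i)"] by auto
    qed
    moreover have "length (tps (Suc t)) = tm_tapes M" using running_Suc[OF False] d(2) Suc by simp
    ultimately show ?thesis using running_Suc[OF False] d(1) by simp
  qed
qed

lemmas inv_st = invariant[THEN conjunct1]
lemmas inv_len = invariant[THEN conjunct2, THEN conjunct1]

lemma inv_cell: "i < tm_tapes M \<Longrightarrow> cell t i p < tm_symbols M" using invariant by blast
lemma inv_pos: "i < tm_tapes M \<Longrightarrow> \<bar>pos t i\<bar> \<le> int t" using invariant by blast

lemma rd_nth: "i < tm_tapes M \<Longrightarrow> rd t ! i = cell t i (pos t i)"
  using inv_len by (simp add: rd_def reads_nth cell_def pos_def)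

lemma len_rd: "length (rd t) = tm_tapes M" using inv_len by (simp add: rd_def reads_def)

lemma rd_sym: "set (rd t) \<subseteq> {..<tm_symbols M}"
  using inv_cell rd_nth len_rd by (auto simp: set_conv_nth)

lemma step_facts:
  assumes "\<not> halted t" "i < tm_tapes M"
  shows "cell (Suc t) i = (cell t i)(pos t i := fst (act t i))"
    "pos (Suc t) i = pos t i + int (mcode (snd (act t i))) - 1"
proof -
  have "length (snd (tm_delta M (st t) (rd t))) = tm_tapes M"
    using delta_valid(2)[OF M inv_st len_rd rd_sym] .
  then have "tps (Suc t) ! i = tape_act (tps t ! i) (act t i)"
    using assms running_Suc[OF assms(1)] inv_len[of t] by (simp add: act_def)
  then show "cell (Suc t) i = (cell t i)(pos t i := fst (act t i))"
    "pos (Suc t) i = pos t i + int (mcode (snd (act t i))) - 1"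
    by (auto simp: cell_def pos_def tape_act_def move_offset_mcode split: prod.splits)
qed

lemma halted_mono: "halted t \<Longrightarrow> t \<le> t' \<Longrightarrow> st t' = st t"
proof -
  assume h: "halted t" and "t \<le> t'"
  have "st (t + k) = st t" for k
    by (induction k) (use h halted_Suc in auto)
  from this[of "t' - t"] \<open>t \<le> t'\<close> show ?thesis by simp
qed

end

lemma n_lists_mem: "as \<in> set (List.n_lists n xs) \<longleftrightarrow> length as = n \<and> set as \<subseteq> set xs"
  by (simp add: set_n_lists)

lemma trans_table_mem: "e \<in> set (trans_table M) \<longleftrightarrow> (\<exists>q rs. q < tm_states M \<and> q \<noteq> 1 \<and> q \<noteq> 2 \<and> length rs = tm_tapes M \<and>
    set rs \<subseteq> {..<tm_symbols M} \<and> e = (q, rs, fst (tm_delta M q rs),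
      map (\<lambda>i. (i, fst (snd (tm_delta M q rs) ! i), mcode (snd (snd (tm_delta M q rs) ! i)))) [0..<tm_tapes M]))"
  by (auto simp: trans_table_def n_lists_mem image_iff lessThan_atLeast0)

lemma partial_reads_mem: "as \<in> set (partial_reads M) \<longleftrightarrow> length as < tm_tapes M \<and> set as \<subseteq> {..<tm_symbols M}"
  by (auto simp: partial_reads_def n_lists_mem lessThan_atLeast0)

lemma csat_clauses:
  "csat \<alpha> (fact1 a) \<longleftrightarrow> \<alpha> a" "csat \<alpha> [(a, False)] \<longleftrightarrow> \<not> \<alpha> a" "csat \<alpha> (imp1 a b) \<longleftrightarrow> (\<alpha> a \<longrightarrow> \<alpha> b)"
  "csat \<alpha> (imp2 a b c) \<longleftrightarrow> (\<alpha> a \<longrightarrow> \<alpha> b \<longrightarrow> \<alpha> c)"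
  by auto

lemma ball_concat_map: "(\<forall>C\<in>set (concat (map f xs)). P C) \<longleftrightarrow> (\<forall>x\<in>set xs. \<forall>C\<in>set (f x). P C)"
  by auto

lemma ball_map: "(\<forall>C\<in>set (map f xs). P C) \<longleftrightarrow> (\<forall>x\<in>set xs. P (f x))"
  by auto

lemma ball_Cons: "(\<forall>C\<in>set (x # xs). P C) \<longleftrightarrow> P x \<and> (\<forall>C\<in>set xs. P C)" "(\<forall>C\<in>set []. P C) \<longleftrightarrow> True"
  by auto

lemma ball_append: "(\<forall>C\<in>set (xs @ ys). P C) \<longleftrightarrow> (\<forall>C\<in>set xs. P C) \<and> (\<forall>C\<in>set ys. P C)"
  by auto

lemma ball_filter: "(\<forall>C\<in>set (filter Q xs). P C) \<longleftrightarrow> (\<forall>C\<in>set xs. Q C \<longrightarrow> P C)"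
  by auto

lemma ball_upt: "(\<forall>C\<in>set [0..<n]. P C) \<longleftrightarrow> (\<forall>C<n. P C)"
  by auto

lemmas clause_simps = ball_append ball_concat_map ball_map ball_Cons ball_filter ball_upt csat_clauses

lemma step_clauses_sat:
  "(\<forall>C\<in>set (step_clauses M T t). csat \<alpha> C) \<longleftrightarrow>
   (\<forall>q<tm_states M. q \<noteq> 1 \<and> q \<noteq> 2 \<longrightarrow> \<alpha> (Qv t q) \<longrightarrow> \<alpha> (Av t q [])) \<and>
   (\<alpha> (Qv t 1) \<longrightarrow> \<alpha> (Qv (Suc t) 1)) \<and> (\<alpha> (Qv t 2) \<longrightarrow> \<alpha> (Qv (Suc t) 2)) \<and>
   (\<forall>q<tm_states M. \<forall>as\<in>set (partial_reads M). \<forall>a<tm_symbols M.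
      \<alpha> (Av t q as) \<longrightarrow> \<alpha> (Rv t (length as) a) \<longrightarrow> \<alpha> (Av t q (as @ [a]))) \<and>
   (\<forall>e\<in>set (trans_table M). (\<alpha> (Av t (fst e) (fst (snd e))) \<longrightarrow> \<alpha> (Qv (Suc t) (fst (snd (snd e))))) \<and>
      (\<forall>w\<in>set (snd (snd (snd e))). (\<alpha> (Av t (fst e) (fst (snd e))) \<longrightarrow> \<alpha> (Wv t (fst w) (fst (snd w)))) \<and>
         (\<alpha> (Av t (fst e) (fst (snd e))) \<longrightarrow> \<alpha> (Dv t (fst w) (snd (snd w)))))) \<and>
   (\<forall>i<tm_tapes M. \<forall>p<2 * T + 1. (\<forall>a<tm_symbols M. (\<alpha> (Hv t i p) \<longrightarrow> \<alpha> (Cv t i p a) \<longrightarrow> \<alpha> (Rv t i a)) \<and>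
       (\<alpha> (Hv t i p) \<longrightarrow> \<alpha> (Wv t i a) \<longrightarrow> \<alpha> (Cv (Suc t) i p a)) \<and>
       (\<forall>p'<2 * T + 1. p' \<noteq> p \<longrightarrow> \<alpha> (Hv t i p') \<longrightarrow> \<alpha> (Cv t i p a) \<longrightarrow> \<alpha> (Cv (Suc t) i p a))) \<and>
     (\<alpha> (Hv t i (Suc p)) \<longrightarrow> \<alpha> (Dv t i 0) \<longrightarrow> \<alpha> (Hv (Suc t) i (p + 0))) \<and>
     (\<alpha> (Hv t i (Suc p)) \<longrightarrow> \<alpha> (Dv t i 1) \<longrightarrow> \<alpha> (Hv (Suc t) i (p + 1))) \<and>
     (\<alpha> (Hv t i (Suc p)) \<longrightarrow> \<alpha> (Dv t i 2) \<longrightarrow> \<alpha> (Hv (Suc t) i (p + 2))))"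
  unfolding step_clauses_def by (simp only: clause_simps simp_thms conj_assoc)

lemma tableau_sat:
  "(\<forall>C\<in>set (tableau M T m x). csat \<alpha> C) \<longleftrightarrow>
   \<alpha> (Qv 0 0) \<and> \<not> \<alpha> (Qv T 2) \<and> (\<forall>i<tm_tapes M. \<alpha> (Hv 0 i T)) \<and>
   (\<forall>i\<in>set (tl [0..<tm_tapes M]). \<forall>p<2 * T + 1. \<alpha> (Cv 0 i p 0)) \<and> (\<forall>p<T. \<alpha> (Cv 0 0 p 0)) \<and>
   (\<forall>j<length (prefix_bits x). \<alpha> (Cv 0 0 (T + j) (if nth_or False (prefix_bits x) j then 2 else 1))) \<and>
   (\<forall>j<m. csat \<alpha> [(Cv 0 0 (T + length (prefix_bits x) + j) 0, True), (Cv 0 0 (T + length (prefix_bits x) + j) 1, True),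
          (Cv 0 0 (T + length (prefix_bits x) + j) 2, True)] \<and>
      (\<alpha> (Cv 0 0 (T + length (prefix_bits x) + j) 0) \<longrightarrow> \<alpha> (Cv 0 0 (T + length (prefix_bits x) + Suc j) 0))) \<and>
   (\<forall>p<T + 1. \<alpha> (Cv 0 0 (T + length (prefix_bits x) + m + p) 0)) \<and>
   (\<forall>t<T. \<forall>C\<in>set (step_clauses M T t). csat \<alpha> C)"
  unfolding tableau_def by (simp only: clause_simps simp_thms conj_assoc)

context machine_run
begin

text \<open>The facts about transitions are false after halting, when no transition is
  taken.\<close>

definition run_assignment :: "nat \<Rightarrow> nat list \<Rightarrow> bool" where
  "run_assignment T v = (let t = v ! 1; i = v ! 2; p = int (v ! 3) - int T in
     if v ! 0 = 0 then st t = i else if v ! 0 = 1 then pos t i = p else if v ! 0 = 2 then cell t i p = v ! 4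
     else if v ! 0 = 3 then rd t ! i = v ! 3
     else if v ! 0 = 4 then \<not> halted t \<and> st t = i \<and> drop 3 v = take (length v - 3) (rd t)
     else if v ! 0 = 5 then \<not> halted t \<and> fst (act t i) = v ! 3 else \<not> halted t \<and> mcode (snd (act t i)) = v ! 3)"

lemma run_assignment_simps:
  "run_assignment T (Qv t q) \<longleftrightarrow> st t = q" "run_assignment T (Hv t i p) \<longleftrightarrow> pos t i = int p - int T"
  "run_assignment T (Cv t i p a) \<longleftrightarrow> cell t i (int p - int T) = a" "run_assignment T (Rv t i a) \<longleftrightarrow> rd t ! i = a"
  "run_assignment T (Av t q as) \<longleftrightarrow> \<not> halted t \<and> st t = q \<and> as = take (length as) (rd t)"
  "run_assignment T (Wv t i a) \<longleftrightarrow> \<not> halted t \<and> fst (act t i) = a"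
  "run_assignment T (Dv t i a) \<longleftrightarrow> \<not> halted t \<and> mcode (snd (act t i)) = a"
  by (simp_all add: run_assignment_def Let_def)

lemma run_step_clauses: "\<forall>C\<in>set (step_clauses M T t). csat (run_assignment T) C"
  unfolding step_clauses_sat run_assignment_simps
proof (intro conjI allI impI ballI; (elim conjE)?)
  fix q as a
  assume "as \<in> set (partial_reads M)" "\<not> halted t" "as = take (length as) (rd t)" "rd t ! length as = a"
  then show "as @ [a] = take (length (as @ [a])) (rd t)"
    using len_rd[of t] by (simp add: partial_reads_mem take_Suc_conv_app_nth)
next
  fix e assume e: "e \<in> set (trans_table M)" "\<not> halted t" "st t = fst e" "fst (snd e) = take (length (fst (snd e))) (rd t)"
  then have ee: "fst (snd e) = rd t" using len_rd[of t] by (auto simp: trans_table_mem)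
  then show "st (Suc t) = fst (snd (snd e))" using running_Suc[OF e(2)] e by (auto simp: trans_table_mem)
  fix w assume w: "w \<in> set (snd (snd (snd e)))"
  then show "fst (act t (fst w)) = fst (snd w)" "mcode (snd (act t (fst w))) = snd (snd w)"
    using e ee by (auto simp: trans_table_mem act_def)
next
  fix i p a assume "i < tm_tapes M" "pos t i = int p - int T" "cell t i (int p - int T) = a"
  then show "rd t ! i = a" using rd_nth by simp
next
  fix i p a assume "i < tm_tapes M" "pos t i = int p - int T" "\<not> halted t" "fst (act t i) = a"
  then show "cell (Suc t) i (int p - int T) = a" using step_facts by simp
next
  fix i p a p' assume "i < tm_tapes M" "p' \<noteq> p" "pos t i = int p' - int T" "cell t i (int p - int T) = a"
  then show "cell (Suc t) i (int p - int T) = a" using step_facts halted_Suc[of t]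
    by (cases "halted t") (auto simp: cell_def)
qed (use halted_Suc[of t] step_facts(2)[of t] in auto)

lemma init_facts: "st 0 = 0" "i < tm_tapes M \<Longrightarrow> pos 0 i = 0"
    "i < tm_tapes M \<Longrightarrow> cell 0 i = (if i = 0 then string_tape z else (\<lambda>_. 0))"
  by (auto simp: st_def pos_def cell_def tps_def tm_run_def tm_init_def nth_Cons')

lemma tapes_pos: "0 < tm_tapes M" using M by (simp add: turing_machine_def)

lemma run_tableau:
  assumes z: "z = prefix_bits x @ w" and w: "length w \<le> m" and acc: "st T = 1"
  shows "\<forall>C\<in>set (tableau M T m x). csat (run_assignment T) C"
proof -
  let ?L = "length (prefix_bits x)"
  have c: "cell 0 0 = string_tape z" using init_facts(3)[of 0] tapes_pos by simp
  have p0: "cell 0 0 (int (T + j) - int T) = string_tape z (int j)" for j using c by simp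
  show ?thesis
    unfolding tableau_sat
  proof (intro conjI allI impI ballI)
    fix j assume j: "j < m"
    let ?p = "T + ?L + j"
    have v: "cell 0 0 (int ?p - int T) = (if j < length w then if w ! j then 2 else 1 else 0)"
      using p0[of "?L + j"] by (auto simp: z string_tape_def nth_append add.assoc nat_add_distrib)
    then show "csat (run_assignment T) [(Cv 0 0 ?p 0, True), (Cv 0 0 ?p 1, True), (Cv 0 0 ?p 2, True)]"
      by (simp add: run_assignment_simps)
    have v': "cell 0 0 (int (T + ?L + Suc j) - int T) = (if Suc j < length w then if w ! Suc j then 2 else 1 else 0)"
      using p0[of "?L + Suc j"] by (auto simp: z string_tape_def nth_append add.assoc nat_add_distrib)
    assume "run_assignment T (Cv 0 0 ?p 0)"
    then have "\<not> j < length w" using v by (auto simp: run_assignment_simps split: if_splits)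
    then show "run_assignment T (Cv 0 0 (T + ?L + Suc j) 0)" using v' by (simp add: run_assignment_simps)
  next
    fix j
    show "j < ?L \<Longrightarrow> run_assignment T (Cv 0 0 (T + j) (if nth_or False (prefix_bits x) j then 2 else 1))"
    proof -
      assume j: "j < ?L"
      then have "string_tape z (int j) = (if prefix_bits x ! j then 2 else 1)"
        by (simp add: z string_tape_def nth_append)
      then show ?thesis using p0[of j] j by (simp add: run_assignment_simps nth_or_nth)
    qed
  next
    fix p
    have "string_tape z (int (?L + m + p)) = 0" using w by (simp add: string_tape_def z)
    then show "run_assignment T (Cv 0 0 (T + ?L + m + p) 0)"
      using p0[of "?L + m + p"] by (simp add: run_assignment_simps add.assoc)
  next
    fix t C assume "C \<in> set (step_clauses M T t)"
    then show "csat (run_assignment T) C" using run_step_clauses by blast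
  next
    fix i assume "i < tm_tapes M"
    then show "run_assignment T (Hv 0 i T)" unfolding run_assignment_simps using init_facts by simp
  qed (use init_facts acc c in \<open>auto simp: run_assignment_simps string_tape_def\<close>)
qed

text \<open>Once the initial tapes are fixed, all clauses used are implications with a single
  conclusion, so the facts of the run are forced one step at a time. The assignment may make other
  facts true as well. After halting only the state is traced.\<close>

lemma tableau_run:
  assumes sat: "\<forall>C\<in>set (tableau M T m x). csat \<alpha> C" and t: "t \<le> T"
    and init: "\<And>p. p \<le> 2 * T \<Longrightarrow> \<alpha> (Cv 0 0 p (string_tape z (int p - int T)))"
  shows "\<alpha> (Qv t (st t))"
proof -
  note tab = sat[unfolded tableau_sat]
  have "\<alpha> (Qv t (st t)) \<and> (\<not> halted t \<longrightarrow> (\<forall>i<tm_tapes M. \<alpha> (Hv t i (nat (pos t i + int T))) \<and>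
      (\<forall>p\<le>2 * T. \<alpha> (Cv t i p (cell t i (int p - int T))))))"
    using t
  proof (induction t)
    case 0
    have "\<alpha> (Cv 0 i p (cell 0 i (int p - int T)))" if "i < tm_tapes M" "p \<le> 2 * T" for i p
      using tab init[OF that(2)] init_facts(3)[OF that(1)] that by (cases "i = 0") auto
    then show ?case using tab init_facts by auto
  next
    case (Suc t)
    then have lt: "t < T" by simp
    then have "\<forall>C\<in>set (step_clauses M T t). csat \<alpha> C" using tab by blast
    note sc = this[unfolded step_clauses_sat]
    have Q: "\<alpha> (Qv t (st t))" using Suc by simp
    show ?case
    proof (cases "halted t")
      case True
      then show ?thesis using halted_Suc[OF True] Q sc by auto
    next
      case nh: False
      have H: "\<alpha> (Hv t i (nat (pos t i + int T)))" and C: "\<And>p. p \<le> 2 * T \<Longrightarrow> \<alpha> (Cv t i p (cell t i (int p - int T)))"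
        if "i < tm_tapes M" for i
        using Suc nh that by auto
      \<comment> \<open>Strictly before time \<open>T\<close> the head is off the ends of the
        window, as the clause for moves needs a cell to its left.\<close>
      have P: "1 \<le> nat (pos t i + int T)" "nat (pos t i + int T) < 2 * T" "int (nat (pos t i + int T)) = pos t i + int T"
        if "i < tm_tapes M" for i
        using inv_pos[OF that, of t] lt by auto
      have R: "\<alpha> (Rv t i (rd t ! i))" if i: "i < tm_tapes M" for i
      proof -
        have "\<alpha> (Cv t i (nat (pos t i + int T)) (rd t ! i))"
          using C[OF i, of "nat (pos t i + int T)"] P[OF i] rd_nth[OF i] by simp
        moreover have "rd t ! i < tm_symbols M" using inv_cell[OF i] rd_nth[OF i] by simp
        moreover have "nat (pos t i + int T) < 2 * T + 1" using P(2)[OF i] by simp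
        ultimately show ?thesis using H[OF i] sc i by blast
      qed
      \<comment> \<open>The symbols read are added one tape at a time until \<open>Av\<close> names
        the whole left side of a transition.\<close>
      have A: "\<alpha> (Av t (st t) (take j (rd t)))" if "j \<le> tm_tapes M" for j
        using that
      proof (induction j)
        case 0
        then show ?case using sc Q nh inv_st[of t] by auto
      next
        case (Suc j)
        then have j: "j < tm_tapes M" by simp
        have "take j (rd t) \<in> set (partial_reads M)"
          using j rd_sym[of t] len_rd[of t] set_take_subset[of j "rd t"] by (auto simp: partial_reads_mem)
        moreover have "rd t ! j < tm_symbols M" using inv_cell[OF j] rd_nth[OF j] by simp
        moreover have "length (take j (rd t)) = j" using j len_rd[of t] by simp
        ultimately have "\<alpha> (Av t (st t) (take j (rd t) @ [rd t ! j]))"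
          using sc Suc.IH j R[OF j] inv_st[of t] by (metis less_imp_le)
        then show ?case using j len_rd[of t] by (simp add: take_Suc_conv_app_nth)
      qed
      have Af: "\<alpha> (Av t (st t) (rd t))" using A[OF order_refl] len_rd[of t] by simp
      define e where "e = (st t, rd t, fst (tm_delta M (st t) (rd t)),
        map (\<lambda>i. (i, fst (snd (tm_delta M (st t) (rd t)) ! i), mcode (snd (snd (tm_delta M (st t) (rd t)) ! i)))) [0..<tm_tapes M])"
      have e: "e \<in> set (trans_table M)"
        using nh inv_st[of t] len_rd[of t] rd_sym[of t] by (auto simp: trans_table_mem e_def)
      have e_sel: "fst e = st t" "fst (snd e) = rd t" "fst (snd (snd e)) = st (Suc t)"
        using running_Suc[OF nh] by (auto simp: e_def)
      have Q': "\<alpha> (Qv (Suc t) (st (Suc t)))" using sc e Af e_sel by metis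
      have WD: "\<alpha> (Wv t i (fst (act t i)))" "\<alpha> (Dv t i (mcode (snd (act t i))))" if "i < tm_tapes M" for i
      proof -
        have "(i, fst (act t i), mcode (snd (act t i))) \<in> set (snd (snd (snd e)))"
          using that by (auto simp: e_def act_def)
        then have "\<alpha> (Wv t (fst (i, fst (act t i), mcode (snd (act t i)))) (fst (snd (i, fst (act t i), mcode (snd (act t i)))))) \<and>
          \<alpha> (Dv t (fst (i, fst (act t i), mcode (snd (act t i)))) (snd (snd (i, fst (act t i), mcode (snd (act t i))))))"
          using sc e Af e_sel by metis
        then show "\<alpha> (Wv t i (fst (act t i)))" "\<alpha> (Dv t i (mcode (snd (act t i))))" by simp_all
      qed
      have "\<alpha> (Hv (Suc t) i (nat (pos (Suc t) i + int T))) \<and>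
        (\<forall>p\<le>2 * T. \<alpha> (Cv (Suc t) i p (cell (Suc t) i (int p - int T))))" if i: "i < tm_tapes M" for i
      proof (intro conjI allI impI)
        let ?P = "nat (pos t i + int T)"
        obtain p where p: "?P = Suc p" using P(1)[OF i] by (cases ?P) auto
        have pl: "p < 2 * T + 1" using P(2)[OF i] p by simp
        have Hp: "\<alpha> (Hv t i (Suc p))" using H[OF i] p by simp
        have e3: "nat (pos (Suc t) i + int T) = p + mcode (snd (act t i))"
          using step_facts(2)[OF nh i] P(3)[OF i] p by simp
        have "mcode (snd (act t i)) \<in> {0, 1, 2}" by (cases "snd (act t i)") auto
        moreover have "\<alpha> (Dv t i d) \<longrightarrow> d \<in> {0, 1, 2} \<longrightarrow> \<alpha> (Hv (Suc t) i (p + d))" for d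
          using sc i pl Hp by blast
        ultimately show "\<alpha> (Hv (Suc t) i (nat (pos (Suc t) i + int T)))" using WD(2)[OF i] e3 by metis
        fix p' assume p': "p' \<le> 2 * T"
        have bound: "?P < 2 * T + 1" "p' < 2 * T + 1" using P(2)[OF i] p' by auto
        show "\<alpha> (Cv (Suc t) i p' (cell (Suc t) i (int p' - int T)))"
        proof (cases "p' = ?P")
          case True
          have "cell (Suc t) i (int p' - int T) = fst (act t i)"
            using step_facts(1)[OF nh i] True P(3)[OF i] by simp
          moreover have "fst (act t i) < tm_symbols M" using inv_cell[OF i, of "Suc t" "int p' - int T"] calculation by simp
          ultimately show ?thesis using sc i bound H[OF i] WD(1)[OF i] True by metis
        next
          case False
          have "cell (Suc t) i (int p' - int T) = cell t i (int p' - int T)"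
            using step_facts(1)[OF nh i] False P(3)[OF i] by auto
          then show ?thesis using sc i bound H[OF i] C[OF i p'] False inv_cell[OF i, of t "int p' - int T"] by metis
        qed
      qed
      then show ?thesis using Q' by blast
    qed
  qed
  then show ?thesis by blast
qed

end

text \<open>The certificate is what the assignment writes before the first guessed blank. An
  assignment may put several symbols into a cell; it is enough that the chosen one is among
  them.\<close>

lemma tableau_certificate:
  assumes sat: "\<forall>C\<in>set (tableau M T m x). csat \<alpha> C"
  shows "\<exists>w. length w \<le> m \<and> (\<forall>p\<le>2 * T. \<alpha> (Cv 0 0 p (string_tape (prefix_bits x @ w) (int p - int T))))"
proof -
  note tab = sat[unfolded tableau_sat]
  let ?L = "length (prefix_bits x)"
  let ?c = "\<lambda>j a. \<alpha> (Cv 0 0 (T + ?L + j) a)"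
  \<comment> \<open>The disjunct \<open>j \<ge> m\<close> covers certificates of full
    length.\<close>
  define l where "l = (LEAST j. j \<ge> m \<or> ?c j 0)"
  have l: "l \<ge> m \<or> ?c l 0" unfolding l_def by (rule LeastI[of _ m]) simp
  have lm: "l \<le> m" unfolding l_def by (rule Least_le) simp
  have before: "j < m \<and> \<not> ?c j 0" if "j < l" for j using not_less_Least[of j "\<lambda>j. j \<ge> m \<or> ?c j 0"] that by (auto simp: l_def)
  have after: "?c j 0" if "l \<le> j" "j < m" for j
    using that
  proof (induction j rule: dec_induct)
    case base
    then show ?case using l by auto
  next
    case (step j)
    then have "?c j 0" "j < m" by auto
    then show ?case using tab by blast
  qed
  \<comment> \<open>A cell before the first blank that does not admit symbol 2 admits symbol 1, so
    each bit is justified.\<close>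
  define w where "w = map (\<lambda>j. ?c j 2) [0..<l]"
  have "\<alpha> (Cv 0 0 p (string_tape (prefix_bits x @ w) (int p - int T)))" if "p \<le> 2 * T" for p
  proof (cases "p < T")
    case True
    then show ?thesis using tab by (simp add: string_tape_def)
  next
    case False
    then obtain j where j: "p = T + j" by (metis le_add_diff_inverse not_less)
    consider "j < ?L" | k where "j = ?L + k" "k < l" | k where "j = ?L + k" "l \<le> k" "k < m" | k where "j = ?L + m + k"
      by (metis add.assoc le_add_diff_inverse not_less)
    then show ?thesis
    proof cases
      case 1
      then have "\<alpha> (Cv 0 0 (T + j) (if nth_or False (prefix_bits x) j then 2 else 1))" using tab by blast
      then show ?thesis using 1 by (simp add: j string_tape_def nth_append nth_or_nth)
    next
      case 2
      have "csat \<alpha> [(Cv 0 0 (T + ?L + k) 0, True), (Cv 0 0 (T + ?L + k) 1, True), (Cv 0 0 (T + ?L + k) 2, True)]"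
        using tab before[OF 2(2)] by blast
      then have "?c k (if ?c k 2 then 2 else 1)" using before[OF 2(2)] by auto
      then show ?thesis using 2 by (simp add: j string_tape_def nth_append w_def add.assoc nat_int_add)
    next
      case 3
      then show ?thesis using after[OF 3(2,3)] by (simp add: j string_tape_def w_def add.assoc)
    next
      case 4
      then have "k < T + 1" using that j by simp
      then have "\<alpha> (Cv 0 0 (T + ?L + m + k) 0)" using tab by blast
      then show ?thesis using 4 lm by (simp add: j string_tape_def w_def add.assoc)
    qed
  qed
  then show ?thesis using lm by (intro exI[of _ w]) (auto simp: w_def)
qed

lemma string_pair_prefix: "string_pair x w = prefix_bits x @ w"
  by (simp add: string_pair_def prefix_bits_def)

lemma length_prefix_bits: "length (prefix_bits x) = 2 * length x + 1"
  by (induction x) (auto simp: prefix_bits_def)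

theorem np_formula:
  assumes "in_NP A"
  shows "\<exists>f. pt f \<and> (\<forall>x. (\<forall>C\<in>set (f x). length C \<le> 3) \<and> (x \<in> A \<longleftrightarrow> fsat (f x)))"
proof -
  from assms obtain V c where V: "polytime_decidable V"
    and A: "\<And>x. x \<in> A \<longleftrightarrow> (\<exists>w. length w \<le> length x ^ c + c \<and> string_pair x w \<in> V)"
    unfolding in_NP_def by blast
  from V obtain d M where M: "turing_machine M"
    and run: "\<And>y. \<exists>t. real t \<le> real (length y ^ d + d) \<and> fst (tm_run M y t) = (if y \<in> V then 1 else 2)"
    unfolding polytime_decidable_def solvable_within_def by auto
  \<comment> \<open>The running time on the longest admissible pair: \<open>string_pair\<close>
    spends \<open>2 * length x + 1\<close> bits on \<open>x\<close>.\<close>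
  define T where "T x = (2 * length x + 1 + (length x ^ c + c)) ^ d + d" for x :: "bool list"
  define f where "f x = tableau M (T x) (length x ^ c + c) x" for x
  have "pt f" unfolding f_def T_def by (intro pt_intros)
  moreover have "\<forall>C\<in>set (f x). length C \<le> 3" for x unfolding f_def using tableau_three by blast
  moreover have "x \<in> A \<longleftrightarrow> fsat (f x)" for x
  proof -
    have final: "fst (tm_run M (string_pair x w) (T x)) = (if string_pair x w \<in> V then 1 else 2)"
      if w: "length w \<le> length x ^ c + c" for w
    proof -
      interpret machine_run M "string_pair x w" by unfold_locales (rule M)
      obtain t where t: "t \<le> length (string_pair x w) ^ d + d" "st t = (if string_pair x w \<in> V then 1 else 2)"
        using run[of "string_pair x w"] by (auto simp: st_def simp flip: of_nat_power of_nat_add)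
      have "length (string_pair x w) \<le> 2 * length x + 1 + (length x ^ c + c)"
        using w by (simp add: string_pair_prefix length_prefix_bits)
      then have "t \<le> T x" using t(1) unfolding T_def by (meson add_le_mono1 le_trans power_mono zero_le)
      moreover have "halted t" using t by auto
      ultimately show ?thesis using halted_mono[of t "T x"] t by (simp add: st_def)
    qed
    show ?thesis
    proof
      assume "x \<in> A"
      then obtain w where w: "length w \<le> length x ^ c + c" "string_pair x w \<in> V" using A by blast
      interpret machine_run M "string_pair x w" by unfold_locales (rule M)
      have "st (T x) = 1" using final[OF w(1)] w(2) by (simp add: st_def)
      from run_tableau[OF string_pair_prefix w(1) this] show "fsat (f x)"
        unfolding fsat_csat f_def by blast
    next
      assume "fsat (f x)"
      then obtain \<alpha> where sat: "\<forall>C\<in>set (tableau M (T x) (length x ^ c + c) x). csat \<alpha> C"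
        unfolding fsat_csat f_def by blast
      from tableau_certificate[OF sat] obtain w where w: "length w \<le> length x ^ c + c"
        "\<And>p. p \<le> 2 * T x \<Longrightarrow> \<alpha> (Cv 0 0 p (string_tape (string_pair x w) (int p - int (T x))))"
        unfolding string_pair_prefix by blast
      interpret machine_run M "string_pair x w" by unfold_locales (rule M)
      have "\<alpha> (Qv (T x) (st (T x)))" using tableau_run[OF sat order_refl w(2)] by blast
      moreover have "\<not> \<alpha> (Qv (T x) 2)" using sat[unfolded tableau_sat] by blast
      ultimately have "string_pair x w \<in> V" using final[OF w(1)] by (auto simp: st_def split: if_splits)
      then show "x \<in> A" using A w(1) by blast
    qed
  qed
  ultimately show ?thesis by blast
qed

section \<open>Instances as strings\<close>

lemma encode_unary_inject: "encode_unary n @ r = encode_unary n' @ r' \<Longrightarrow> n = n' \<and> r = r'"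
proof (induction n arbitrary: n')
  case 0
  then show ?case by (cases n') (auto simp: encode_unary_def)
next
  case (Suc n)
  then show ?case by (cases n') (auto simp: encode_unary_def)
qed

definition bin_val :: "bool list \<Rightarrow> nat" where
  "bin_val bs = foldr (\<lambda>b v. 2 * v + of_bool b) bs 0"

lemma bin_val_encode: "bin_val (encode_binary k) = k"
proof (induction k rule: less_induct)
  case (less k)
  show ?case
  proof (cases "k = 0")
    case True
    then show ?thesis by (simp add: encode_binary.simps[of 0] bin_val_def)
  next
    case False
    then have "bin_val (encode_binary (k div 2)) = k div 2" using less by simp
    then show ?thesis using False by (subst encode_binary.simps) (auto simp: bin_val_def elim: oddE)
  qed
qed

text \<open>The least significant bit comes first, so the codes of numbers are exactly the strings
  that do not end in \<open>False\<close>.\<close>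

definition canonical :: "bool list \<Rightarrow> bool" where
  "canonical bs \<longleftrightarrow> (case rev bs of [] \<Rightarrow> True | b # _ \<Rightarrow> b)"

lemma canonical_Cons: "canonical (b # bs) \<longleftrightarrow> (if bs = [] then b else canonical bs)"
  by (cases "rev bs") (auto simp: canonical_def)

lemma canonical_encode: "canonical (encode_binary k)"
proof (induction k rule: less_induct)
  case (less k)
  show ?case
  proof (cases "k = 0")
    case True
    then show ?thesis by (simp add: encode_binary.simps[of 0] canonical_def)
  next
    case False
    then have "canonical (encode_binary (k div 2))" using less by simp
    moreover have "odd k" if "encode_binary (k div 2) = []"
      using that bin_val_encode[of "k div 2"] False by (cases "odd k") (auto simp: bin_val_def)
    ultimately show ?thesis using False by (subst encode_binary.simps) (auto simp: canonical_Cons)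
  qed
qed

lemma encode_bin_val: "canonical bs \<Longrightarrow> encode_binary (bin_val bs) = bs"
proof (induction bs)
  case Nil
  then show ?case by (simp add: encode_binary.simps[of 0] bin_val_def)
next
  case (Cons b bs)
  have v: "bin_val (b # bs) = 2 * bin_val bs + of_bool b" by (simp add: bin_val_def)
  have "encode_binary (bin_val bs) = bs"
  proof (cases "bs = []")
    case True
    then show ?thesis by (simp add: encode_binary.simps[of 0] bin_val_def)
  next
    case False
    then show ?thesis using Cons by (simp add: canonical_Cons)
  qed
  moreover have "bin_val (b # bs) \<noteq> 0"
  proof (cases "bs = []")
    case True
    then show ?thesis using Cons.prems by (simp add: canonical_Cons bin_val_def)
  next
    case False
    then have "bin_val bs \<noteq> 0" using calculation encode_binary.simps[of 0] by (cases "bin_val bs = 0") auto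
    then show ?thesis by (simp add: v)
  qed
  ultimately show ?case by (subst encode_binary.simps) (simp add: v)
qed

lemma encode_binary_inject: "encode_binary k = encode_binary k' \<Longrightarrow> k = k'"
  using bin_val_encode by metis

lemma concat_matrix_nth:
  assumes "i < a" "j < n"
  shows "concat (map (\<lambda>i. map (f i) [0..<n]) [0..<a]) ! (i * n + j) = f i j"
  using assms
proof (induction a)
  case (Suc a)
  let ?c = "concat (map (\<lambda>i. map (f i) [0..<n]) [0..<a])"
  have len: "length ?c = a * n" by (induction a) auto
  show ?case
  proof (cases "i = a")
    case True
    then show ?thesis using Suc.prems len by (simp add: nth_append)
  next
    case False
    then have "i < a" using Suc.prems by simp
    then have "i * n + j < a * n"
      using Suc.prems by (metis add_lessD1 less_le_trans mult_Suc add.commute nat_add_left_cancel_less Suc_leI mult_le_mono1)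
    then show ?thesis using Suc \<open>i < a\<close> len by (simp add: nth_append)
  qed
qed simp

lemma length_matrix: "length (concat (map (\<lambda>i. map (f i) [0..<n]) [0..<a])) = a * n"
  by (induction a) auto

lemma encode_instance_alt:
  "verts G = {..<n} \<Longrightarrow> encode_instance (G, k) =
    encode_unary n @ concat (map (\<lambda>i. map (\<lambda>j. {i, j} \<in> edges G) [0..<n]) [0..<n]) @ encode_binary k"
  by (simp add: Let_def)

lemma simple_edges_ext:
  assumes "simple_graph G" "simple_graph G'" "verts G = {..<n}" "verts G' = {..<n}"
    "\<And>i j. i < n \<Longrightarrow> j < n \<Longrightarrow> {i, j} \<in> edges G \<longleftrightarrow> {i, j} \<in> edges G'"
  shows "G = G'"
proof -
  have "e \<in> edges G \<longleftrightarrow> e \<in> edges G'" if "e \<in> vertex_pairs {..<n}" for e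
  proof -
    note t = that
    obtain i j where "e = {i, j}" "i < n" "j < n"
      using t by (auto simp: vertex_pairs_def card_2_iff)
    then show ?thesis using assms(5) by simp
  qed
  then have "edges G = edges G'" using assms(1-4) by (auto simp: simple_graph_def)
  then show ?thesis using assms(3,4) by (simp add: prod_eq_iff)
qed

lemma encode_instance_inject:
  assumes "(G, k) \<in> K4_free_instances" "(G', k') \<in> K4_free_instances"
    "encode_instance (G, k) = encode_instance (G', k')"
  shows "G = G' \<and> k = k'"
proof -
  obtain n n' where n: "verts G = {..<n}" "simple_graph G" "verts G' = {..<n'}" "simple_graph G'"
    using assms by (auto simp: K4_free_instances_def)
  let ?m = "\<lambda>G n. concat (map (\<lambda>i. map (\<lambda>j. {i, j} \<in> edges G) [0..<n]) [0..<n])"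
  have e: "n = n'" "?m G n @ encode_binary k = ?m G' n' @ encode_binary k'"
    using assms(3) encode_unary_inject unfolding encode_instance_alt[OF n(1)] encode_instance_alt[OF n(3)] by blast+
  then have "?m G n = ?m G' n" "encode_binary k = encode_binary k'"
    by (auto simp: append_eq_append_conv length_matrix)
  moreover from this(1) have "{i, j} \<in> edges G \<longleftrightarrow> {i, j} \<in> edges G'" if "i < n" "j < n" for i j
    using concat_matrix_nth[OF that, of "\<lambda>i j. {i, j} \<in> edges G"] concat_matrix_nth[OF that, of "\<lambda>i j. {i, j} \<in> edges G'"] by simp
  ultimately show ?thesis using encode_binary_inject simple_edges_ext[OF n(2,4,1)] n e by blast
qed

lemma language_mem:
  assumes "y \<in> K4_free_instances"
  shows "encode_instance y \<in> K4_free_language Y \<longleftrightarrow> Y y"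
proof -
  have "y = y'" if "y' \<in> K4_free_instances" "encode_instance y = encode_instance y'" for y'
    using encode_instance_inject[of "fst y" "snd y" "fst y'" "snd y'"] assms that by (auto simp: prod_eq_iff)
  then show ?thesis unfolding K4_free_language_def using assms by auto
qed

text \<open>Any problem between deletion and editing on these instances agrees with satisfiability
  on the gadget graphs, which settles both problems at once.\<close>

theorem NP_hard_K4_free:
  assumes s: "s \<ge> 1"
    and Y: "\<And>y. y \<in> K4_free_instances \<Longrightarrow> diamond_free_edge_deletion s y \<Longrightarrow> Y y"
      "\<And>y. y \<in> K4_free_instances \<Longrightarrow> Y y \<Longrightarrow> diamond_free_edge_editing s y"
  shows "NP_hard (K4_free_language Y)"
  unfolding NP_hard_def
proof (intro allI impI)
  fix A assume "in_NP A"
  then obtain f where f: "pt f" "\<And>x. \<forall>C\<in>set (f x). length C \<le> 3" "\<And>x. x \<in> A \<longleftrightarrow> fsat (f x)"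
    using np_formula by blast
  have "pt (\<lambda>x. gstr s (f x))" by (rule pt_comp[OF pt_gstr f(1)])
  moreover have "x \<in> A \<longleftrightarrow> gstr s (f x) \<in> K4_free_language Y" for x
  proof -
    note r = reduction[OF f(2)[of x] s]
    have "Y (inst s (f x)) \<longleftrightarrow> fsat (f x)" using r(2,3) Y[OF r(1)] by blast
    then show ?thesis using f(3) language_mem[OF r(1)] by (simp add: encode_inst)
  qed
  ultimately show "polytime_reducible A (K4_free_language Y)"
    unfolding polytime_reducible_def using pt_polytime_computable by blast
qed

section \<open>Membership in NP\<close>

lemma pt_polytime_decidable:
  assumes "pt P" shows "polytime_decidable {x. P x}"
proof -
  \<comment> \<open>The flag is set at once, so the search ends at parameter 0 and only delivers the
    answer.\<close>
  have "pt (\<lambda>p :: bool list \<times> nat. (True, P (fst p)))"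
    by (intro pt_Pair pt_const pt_comp[OF assms] pt_fst pt_id)
  from pt_search_machine[OF this] obtain M q where M: "turing_machine M"
    "\<forall>x n. fst (True, P (fst (x, n :: nat))) \<and> (\<forall>j<n. \<not> fst (True, P (fst (x, j)))) \<longrightarrow>
      (\<exists>t\<le>(length x + n + 2) ^ q. fst (tm_run M x t) = (if snd (True, P (fst (x, n))) then 1 else 2))"
    by blast
  obtain e where e: "\<And>n. (1 * n + 2) ^ q + 0 \<le> n ^ e + e" using poly_bound_form by blast
  have "\<exists>t. real t \<le> real (length x ^ e + e) \<and> fst (tm_run M x t) = (if x \<in> {x. P x} then 1 else 2)" for x
  proof -
    obtain t where "t \<le> (length x + 2) ^ q" "fst (tm_run M x t) = (if P x then 1 else 2)"
      using M(2)[rule_format, of x 0] by auto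
    moreover from this(1) have "t \<le> length x ^ e + e" using e[of "length x"] by simp
    ultimately show ?thesis by (intro exI[of _ t]) (simp flip: of_nat_power of_nat_add)
  qed
  then show ?thesis unfolding polytime_decidable_def solvable_within_def using M(1) by blast
qed

section \<open>A polynomial time verifier\<close>

definition first_false :: "bool list \<Rightarrow> nat" where
  "first_false x = (case filter (\<lambda>i. \<not> nth_or True x i) [0..<length x] of [] \<Rightarrow> 0 | i # _ \<Rightarrow> i)"

lemma pt_first_false [pt_intros]: assumes "pt f" shows "pt (\<lambda>x. first_false (f x))"
  unfolding first_false_def by (intro pt_intros assms pt_comp[OF assms])

lemma filter_upt_first:
  assumes "P k" "k < n" "\<And>j. j < k \<Longrightarrow> \<not> P j"
  shows "\<exists>r. filter P [0..<n] = k # r"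
proof -
  have "[0..<n] = [0..<k] @ k # [Suc k..<n]"
    using assms(2) by (metis append_self_conv2 le_add_diff_inverse less_imp_le upt_add_eq_append upt_conv_Cons zero_le)
  then show ?thesis using assms by (auto simp: filter_empty_conv)
qed

lemma first_false_encode: "first_false (encode_unary n @ r) = n"
proof -
  have "\<exists>r'. filter (\<lambda>i. \<not> nth_or True (encode_unary n @ r) i) [0..<length (encode_unary n @ r)] = n # r'"
    by (rule filter_upt_first) (auto simp: nth_or_nth encode_unary_def nth_append)
  then show ?thesis by (auto simp: first_false_def)
qed

text \<open>In \<open>string_pair\<close> the even places hold \<open>True\<close> as long as bits
  of the first string follow, so the first \<open>False\<close> at an even place marks its
  end.\<close>

definition pair_split :: "bool list \<Rightarrow> nat" where
  "pair_split z = (case filter (\<lambda>j. \<not> nth_or True z (2 * j)) [0..<length z] of [] \<Rightarrow> 0 | j # _ \<Rightarrow> j)"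

definition pair_fst :: "bool list \<Rightarrow> bool list" where
  "pair_fst z = map (\<lambda>i. nth_or False z (2 * i + 1)) [0..<pair_split z]"

definition pair_snd :: "bool list \<Rightarrow> bool list" where
  "pair_snd z = drop (2 * pair_split z + 1) z"

lemma pair_bits_nth:
  "i < length x \<Longrightarrow> concat (map (\<lambda>b. [True, b]) x) ! (2 * i) = True \<and> concat (map (\<lambda>b. [True, b]) x) ! (2 * i + 1) = x ! i"
proof (induction x arbitrary: i)
  case (Cons b x)
  then show ?case by (cases i) auto
qed simp

lemma pair_proj: "pair_fst (string_pair x w) = x" "pair_snd (string_pair x w) = w"
proof -
  let ?c = "concat (map (\<lambda>b. [True, b]) x)"
  have len: "length ?c = 2 * length x" by (induction x) auto
  have nth: "string_pair x w ! (2 * i) = True" "string_pair x w ! (2 * i + 1) = x ! i" if "i < length x" for i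
    using that pair_bits_nth[OF that] len unfolding string_pair_def by (simp_all add: nth_append)
  have mid: "string_pair x w ! (2 * length x) = False" using len by (simp add: string_pair_def nth_append)
  have L: "length (string_pair x w) = 2 * length x + 1 + length w" using len by (simp add: string_pair_def)
  have "\<exists>r. filter (\<lambda>j. \<not> nth_or True (string_pair x w) (2 * j)) [0..<length (string_pair x w)] = length x # r"
    using nth(1) mid L by (intro filter_upt_first) (auto simp: nth_or_nth)
  then have s: "pair_split (string_pair x w) = length x" by (auto simp: pair_split_def)
  show "pair_fst (string_pair x w) = x"
    unfolding pair_fst_def s using nth(2) L by (intro nth_equalityI) (auto simp: nth_or_nth)
  show "pair_snd (string_pair x w) = w" unfolding pair_snd_def s using len by (simp add: string_pair_def)
qed

definition mat :: "bool list \<Rightarrow> nat \<Rightarrow> nat \<Rightarrow> bool" where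
  "mat x i j = nth_or False x (first_false x + 1 + (i * first_false x + j))"

definition kbits :: "bool list \<Rightarrow> bool list" where
  "kbits x = drop (first_false x + 1 + first_false x * first_false x) x"

text \<open>The certificate is read as a square bit matrix. Only entries above the diagonal are
  consulted, so any string describes a set of unordered pairs.\<close>

definition flip :: "bool list \<Rightarrow> bool list \<Rightarrow> nat \<Rightarrow> nat \<Rightarrow> bool" where
  "flip x w i j = (if i < j then nth_or False w (i * first_false x + j)
     else if j < i then nth_or False w (j * first_false x + i) else False)"

text \<open>All \<open>n ^ d\<close> tuples are tried, which is polynomial because the order
  \<open>d\<close> of the forbidden graph is fixed.\<close>

definition ind_check :: "nat \<Rightarrow> (nat \<times> nat) list \<Rightarrow> (nat \<Rightarrow> nat \<Rightarrow> bool) \<Rightarrow> nat \<Rightarrow> bool" where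
  "ind_check d H P n \<longleftrightarrow> (\<exists>xs\<in>set (List.n_lists d [0..<n]). \<forall>u\<in>set [0..<d]. \<forall>v\<in>set [0..<d].
     (u \<noteq> v \<longrightarrow> nth_or 0 xs u \<noteq> nth_or 0 xs v) \<and> (P (nth_or 0 xs u) (nth_or 0 xs v) \<longleftrightarrow> (u, v) \<in> set H))"

definition edge_table :: "nat graph \<Rightarrow> nat \<Rightarrow> (nat \<times> nat) list" where
  "edge_table H d = filter (\<lambda>(u, v). {u, v} \<in> edges H) (List.product [0..<d] [0..<d])"

text \<open>The string must be reproduced from its parts, the number must be canonical, and the
  matrix must be that of a simple \<open>K\<^sub>4\<close>-free graph, since the language contains
  codes of such graphs only.\<close>

definition wf_check :: "bool list \<Rightarrow> bool" where
  "wf_check x \<longleftrightarrow>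
     x = encode_unary (first_false x) @
         concat (map (\<lambda>i. map (\<lambda>j. mat x i j) [0..<first_false x]) [0..<first_false x]) @ kbits x \<and>
     canonical (kbits x) \<and>
     (\<forall>i\<in>set [0..<first_false x]. \<not> mat x i i \<and> (\<forall>j\<in>set [0..<first_false x]. mat x i j \<longrightarrow> mat x j i)) \<and>
     \<not> ind_check 4 (edge_table (complete_graph 4) 4) (\<lambda>i j. mat x i j) (first_false x)"

definition flips :: "bool list \<Rightarrow> bool list \<Rightarrow> (nat \<times> nat) list" where
  "flips x w = filter (\<lambda>p. fst p < snd p \<and> flip x w (fst p) (snd p)) (List.product [0..<first_false x] [0..<first_false x])"

text \<open>The budget is written in binary and may be exponentially large, while numbers are unary
  in \<open>pt\<close>. Truncating at \<open>B\<close> after each bit keeps the value small and does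
  not affect comparison with numbers up to \<open>B\<close>.\<close>

definition capped :: "nat \<Rightarrow> bool list \<Rightarrow> nat" where
  "capped B bs = fold (\<lambda>b v. if 2 * v + (if b then 1 else 0) < B then 2 * v + (if b then 1 else 0) else B) (rev bs) 0"

definition cert_check :: "bool \<Rightarrow> nat \<Rightarrow> bool list \<Rightarrow> bool list \<Rightarrow> bool" where
  "cert_check del s x w \<longleftrightarrow> wf_check x \<and>
     (del \<longrightarrow> (\<forall>p\<in>set (flips x w). mat x (fst p) (snd p))) \<and>
     length (flips x w) \<le> capped (length (flips x w)) (kbits x) \<and>
     \<not> ind_check (s + 3) (edge_table (diamond s) (s + 3)) (\<lambda>i j. mat x i j \<noteq> flip x w i j) (first_false x)"

lemma pt_n_lists [pt_intros]: "pt l \<Longrightarrow> pt (\<lambda>x. List.n_lists d (l x))"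
proof (induction d)
  case 0
  show ?case by (simp add: pt_const)
next
  case (Suc d)
  have "pt (\<lambda>x. concat (map (\<lambda>ys. map (\<lambda>y. y # ys) (l x)) (List.n_lists d (l x))))"
    by (intro pt_intros Suc pt_comp[OF Suc.prems])
  then show ?case by simp
qed

lemma pt_product [pt_intros]: assumes "pt l" "pt m" shows "pt (\<lambda>x. List.product (l x) (m x))"
  unfolding product_concat_map by (intro pt_intros assms pt_comp[OF assms(2)])

lemma pt_mat [pt_intros]: "pt x \<Longrightarrow> pt i \<Longrightarrow> pt j \<Longrightarrow> pt (\<lambda>z. mat (x z) (i z) (j z))"
  unfolding mat_def by (intro pt_intros)

lemma pt_kbits [pt_intros]: "pt x \<Longrightarrow> pt (\<lambda>z. kbits (x z))"
  unfolding kbits_def by (intro pt_intros)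

lemma pt_flip [pt_intros]: "pt x \<Longrightarrow> pt w \<Longrightarrow> pt i \<Longrightarrow> pt j \<Longrightarrow> pt (\<lambda>z. flip (x z) (w z) (i z) (j z))"
  unfolding flip_def by (intro pt_intros)

lemma pt_ind_check [pt_intros]:
  assumes n: "pt n" and P: "pt (\<lambda>p. P (fst p) (fst (snd p)) (snd (snd p)))"
  shows "pt (\<lambda>x. ind_check d H (P x) (n x))"
proof -
  have P': "pt (\<lambda>z. P (a z) (b z) (c z))" if "pt a" "pt b" "pt c" for a :: "'b::enc \<Rightarrow> 'a" and b c
    using pt_comp[OF P pt_Pair[OF that(1) pt_Pair[OF that(2,3)]]] by simp
  show ?thesis unfolding ind_check_def by (intro pt_intros n P')
qed

lemma pt_canonical [pt_intros]: "pt f \<Longrightarrow> pt (\<lambda>x. canonical (f x))"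
  unfolding canonical_def by (intro pt_intros)

lemma pt_wf_check [pt_intros]: assumes "pt f" shows "pt (\<lambda>x. wf_check (f x))"
  unfolding wf_check_def by (intro pt_intros assms pt_comp[OF assms])

lemma pt_flips [pt_intros]: assumes "pt f" "pt g" shows "pt (\<lambda>x. flips (f x) (g x))"
  unfolding flips_def by (intro pt_intros assms pt_comp[OF assms(1)] pt_comp[OF assms(2)])

lemma capped_min: "capped B bs = min (bin_val bs) B"
proof -
  have "fold (\<lambda>b v. if 2 * v + (if b then 1 else 0) < B then 2 * v + (if b then 1 else 0) else B) (rev bs) 0 = min (bin_val bs) B"
    by (induction bs) (auto simp: bin_val_def)
  then show ?thesis by (simp add: capped_def)
qed

lemma pt_capped [pt_intros]: assumes B: "pt B" and f: "pt f" shows "pt (\<lambda>x. capped (B x) (f x))"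
  unfolding capped_def
proof (rule pt_fold)
  show "pb (\<lambda>x. sz (B x))" by (rule pt_sz[OF B])
  show "sz (fold (\<lambda>b v. if 2 * v + (if b then 1 else 0) < B x then 2 * v + (if b then 1 else 0) else B x) ys 0) \<le> sz (B x)" for x ys
    using capped_min[of "B x" "rev ys"] by (simp add: capped_def)
qed (intro pt_intros f pt_comp[OF B])+

lemma pt_cert_check [pt_intros]:
  assumes "pt f" "pt g" shows "pt (\<lambda>x. cert_check del s (f x) (g x))"
  unfolding cert_check_def by (intro pt_intros assms pt_comp[OF assms(1)] pt_comp[OF assms(2)])

lemma pt_pair_split [pt_intros]: assumes "pt f" shows "pt (\<lambda>x. pair_split (f x))"
  unfolding pair_split_def by (intro pt_intros assms pt_comp[OF assms])

lemma pt_pair_fst [pt_intros]: assumes "pt f" shows "pt (\<lambda>x. pair_fst (f x))"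
  unfolding pair_fst_def by (intro pt_intros assms pt_comp[OF assms])

lemma pt_pair_snd [pt_intros]: assumes "pt f" shows "pt (\<lambda>x. pair_snd (f x))"
  unfolding pair_snd_def by (intro pt_intros assms)


lemma ind_check_iff:
  assumes H: "verts H = {..<d}" and P: "\<And>i j. i < n \<Longrightarrow> j < n \<Longrightarrow> P i j \<Longrightarrow> P j i"
    and X: "\<And>i j. i < n \<Longrightarrow> j < n \<Longrightarrow> {i, j} \<in> X \<longleftrightarrow> P i j"
  shows "ind_check d (edge_table H d) P n \<longleftrightarrow> has_induced ({..<n}, X) H"
proof -
  have T: "(u, v) \<in> set (edge_table H d) \<longleftrightarrow> {u, v} \<in> edges H" if "u < d" "v < d" for u v
    using that by (simp add: edge_table_def)
  show ?thesis
  proof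
    assume "ind_check d (edge_table H d) P n"
    then obtain xs where xs: "length xs = d" "set xs \<subseteq> {..<n}"
      "\<And>u v. u < d \<Longrightarrow> v < d \<Longrightarrow> (u \<noteq> v \<longrightarrow> xs ! u \<noteq> xs ! v) \<and> (P (xs ! u) (xs ! v) \<longleftrightarrow> {u, v} \<in> edges H)"
      unfolding ind_check_def by (auto simp: n_lists_mem lessThan_atLeast0 nth_or_nth T)
    have lt: "xs ! u < n" if "u < d" for u using xs(1,2) that nth_mem by (metis lessThan_iff subsetD)
    show "has_induced ({..<n}, X) H" unfolding has_induced_def H
      using xs(3) lt X by (intro exI[of _ "\<lambda>u. xs ! u"]) (auto simp: inj_on_def)
  next
    assume "has_induced ({..<n}, X) H"
    then obtain g where g: "inj_on g {..<d}" "g ` {..<d} \<subseteq> {..<n}"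
      "\<And>u v. u < d \<Longrightarrow> v < d \<Longrightarrow> {g u, g v} \<in> X \<longleftrightarrow> {u, v} \<in> edges H"
      unfolding has_induced_def H by auto
    have lt: "g u < n" if "u < d" for u using g(2) that by auto
    show "ind_check d (edge_table H d) P n" unfolding ind_check_def
    proof (rule bexI)
      show "map g [0..<d] \<in> set (List.n_lists d [0..<n])" using lt by (auto simp: n_lists_mem)
      show "\<forall>u\<in>set [0..<d]. \<forall>v\<in>set [0..<d]. (u \<noteq> v \<longrightarrow> nth_or 0 (map g [0..<d]) u \<noteq> nth_or 0 (map g [0..<d]) v) \<and>
        (P (nth_or 0 (map g [0..<d]) u) (nth_or 0 (map g [0..<d]) v) \<longleftrightarrow> (u, v) \<in> set (edge_table H d))"
        using g(1,3) lt X by (auto simp: nth_or_nth T inj_on_def)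
    qed
  qed
qed

definition graph_of :: "bool list \<Rightarrow> nat graph" where
  "graph_of x = ({..<first_false x}, {{i, j} | i j. i < first_false x \<and> j < first_false x \<and> mat x i j})"

lemma wf_check_instance:
  assumes "wf_check x"
  shows "(graph_of x, bin_val (kbits x)) \<in> K4_free_instances" "encode_instance (graph_of x, bin_val (kbits x)) = x"
proof -
  let ?n = "first_false x"
  have irr: "\<not> mat x i i" and sym: "mat x i j \<Longrightarrow> mat x j i" if "i < ?n" "j < ?n" for i j
    using assms that by (auto simp: wf_check_def)
  have X: "{i, j} \<in> edges (graph_of x) \<longleftrightarrow> mat x i j" if "i < ?n" "j < ?n" for i j
    using that sym by (auto simp: graph_of_def doubleton_eq_iff)
  have v: "verts (graph_of x) = {..<?n}" by (simp add: graph_of_def)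
  have "card {i, j} = 2" if "i < ?n" "j < ?n" "mat x i j" for i j
    using irr that by (cases "i = j") auto
  then have "simple_graph (graph_of x)"
    by (auto simp: simple_graph_def graph_of_def vertex_pairs_def)
  moreover have "\<not> has_induced (graph_of x) (complete_graph 4)"
  proof -
    have "ind_check 4 (edge_table (complete_graph 4) 4) (mat x) ?n \<longleftrightarrow>
        has_induced ({..<?n}, edges (graph_of x)) (complete_graph 4)"
    proof (rule ind_check_iff)
      show "verts (complete_graph 4) = {..<4}" by (simp add: complete_graph_def)
    qed (use sym X in blast)+
    moreover have "({..<?n}, edges (graph_of x)) = graph_of x" by (simp add: graph_of_def)
    moreover have "\<not> ind_check 4 (edge_table (complete_graph 4) 4) (mat x) ?n"
      using assms unfolding wf_check_def by blast
    ultimately show ?thesis by metis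
  qed
  ultimately show "(graph_of x, bin_val (kbits x)) \<in> K4_free_instances" using v by (auto simp: K4_free_instances_def)
  have "concat (map (\<lambda>i. map (\<lambda>j. {i, j} \<in> edges (graph_of x)) [0..<?n]) [0..<?n]) =
    concat (map (\<lambda>i. map (\<lambda>j. mat x i j) [0..<?n]) [0..<?n])"
    by (intro arg_cong[where f = concat] map_cong refl) (use X in auto)
  then show "encode_instance (graph_of x, bin_val (kbits x)) = x"
    using assms by (simp only: encode_instance_alt[OF v] wf_check_def encode_bin_val)
qed

lemma instance_wf_check:
  assumes "(G, k) \<in> K4_free_instances"
  defines "x \<equiv> encode_instance (G, k)"
  shows "wf_check x" "graph_of x = G" "bin_val (kbits x) = k" "first_false x * first_false x \<le> length x"
proof -
  obtain n where n: "verts G = {..<n}" "simple_graph G" "\<not> has_induced G (complete_graph 4)"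
    using assms by (auto simp: K4_free_instances_def)
  let ?m = "concat (map (\<lambda>i. map (\<lambda>j. {i, j} \<in> edges G) [0..<n]) [0..<n])"
  have x: "x = encode_unary n @ ?m @ encode_binary k" unfolding x_def by (rule encode_instance_alt[OF n(1)])
  have f: "first_false x = n" unfolding x by (rule first_false_encode)
  have len: "length (encode_unary n) = Suc n" by (simp add: encode_unary_def)
  have m: "mat x i j \<longleftrightarrow> {i, j} \<in> edges G" if "i < n" "j < n" for i j
  proof -
    have "i * n + j < n * n"
      using that by (metis add_less_le_mono add.commute mult_Suc Suc_leI mult_le_mono1 less_le_trans nat_add_left_cancel_less)
    then have "n + 1 + (i * n + j) < length x" "x ! (n + 1 + (i * n + j)) = ?m ! (i * n + j)"
      unfolding x using len by (simp_all add: nth_append length_matrix)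
    moreover have "mat x i j = nth_or False x (n + 1 + (i * n + j))" by (simp only: mat_def f)
    ultimately show ?thesis using concat_matrix_nth[OF that, of "\<lambda>i j. {i, j} \<in> edges G"]
      by (simp add: nth_or_nth)
  qed
  have kb: "kbits x = encode_binary k" unfolding kbits_def f unfolding x using len by (simp add: length_matrix)
  then show "bin_val (kbits x) = k" by (simp add: bin_val_encode)
  have irr: "{i} \<notin> edges G" for i using n(2) by (auto simp: simple_graph_def vertex_pairs_def)
  show "graph_of x = G"
  proof (rule simple_edges_ext)
    have "card {i, j} = 2" if "i < n" "j < n" "mat x i j" for i j
      using m[OF that(1,2)] irr that by (cases "i = j") auto
    then show "simple_graph (graph_of x)"
      by (auto simp: simple_graph_def graph_of_def vertex_pairs_def f)
    show "{i, j} \<in> edges (graph_of x) \<longleftrightarrow> {i, j} \<in> edges G" if "i < n" "j < n" for i j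
      using that m by (auto simp: graph_of_def f doubleton_eq_iff insert_commute)
  qed (use n f in \<open>auto simp: graph_of_def\<close>)
  have "concat (map (\<lambda>i. map (\<lambda>j. mat x i j) [0..<n]) [0..<n]) = ?m"
    by (intro arg_cong[where f = concat] map_cong refl) (use m in auto)
  moreover have "\<not> ind_check 4 (edge_table (complete_graph 4) 4) (\<lambda>i j. mat x i j) n"
  proof -
    have "ind_check 4 (edge_table (complete_graph 4) 4) (mat x) n \<longleftrightarrow> has_induced ({..<n}, edges G) (complete_graph 4)"
    proof (rule ind_check_iff)
      show "verts (complete_graph 4) = {..<4}" by (simp add: complete_graph_def)
      show "mat x j i" if "i < n" "j < n" "mat x i j" for i j
        using m[OF that(1,2)] m[OF that(2,1)] that(3) by (simp add: insert_commute)
    qed (use m in blast)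
    moreover have "({..<n}, edges G) = G" using n(1) by (simp add: prod_eq_iff)
    ultimately show ?thesis using n(3) by metis
  qed
  ultimately show "wf_check x" unfolding wf_check_def f kb
    using m irr canonical_encode x by (auto simp: insert_commute)
  show "first_false x * first_false x \<le> length x" unfolding f by (subst x) (simp add: length_matrix)
qed

text \<open>Both problems in one form, so that one verifier serves them; under the condition for
  deletion the symmetric difference is a set difference.\<close>

definition modifiable :: "bool \<Rightarrow> nat \<Rightarrow> nat graph \<times> nat \<Rightarrow> bool" where
  "modifiable del s = (\<lambda>(G, k). \<exists>F. F \<subseteq> vertex_pairs (verts G) \<and> (del \<longrightarrow> F \<subseteq> edges G) \<and> card F \<le> k \<and>
     \<not> has_induced (verts G, (edges G - F) \<union> (F - edges G)) (diamond s))"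

lemma modifiable_deletion: "simple_graph G \<Longrightarrow> modifiable True s (G, k) \<longleftrightarrow> diamond_free_edge_deletion s (G, k)"
proof -
  assume G: "simple_graph G"
  have "(edges G - F) \<union> (F - edges G) = edges G - F \<and> F \<subseteq> vertex_pairs (verts G)" if "F \<subseteq> edges G" for F
    using that G by (auto simp: simple_graph_def)
  then show ?thesis unfolding modifiable_def diamond_free_edge_deletion_def prod.case by metis
qed

lemma modifiable_editing: "modifiable False s y \<longleftrightarrow> diamond_free_edge_editing s y"
  by (cases y) (simp add: modifiable_def diamond_free_edge_editing_def)

lemma flip_sym: "flip x w i j = flip x w j i" by (auto simp: flip_def)

lemma cert_check_iff:
  assumes I: "(G, k) \<in> K4_free_instances"
  defines "x \<equiv> encode_instance (G, k)"
  shows "(\<exists>w. length w \<le> length x ^ 1 + 1 \<and> cert_check del s x w) \<longleftrightarrow> modifiable del s (G, k)"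
proof -
  note x = instance_wf_check[OF I, folded x_def]
  let ?n = "first_false x"
  have v: "verts G = {..<?n}" using x(2) by (auto simp: graph_of_def)
  have sym: "mat x i j \<Longrightarrow> mat x j i" if "i < ?n" "j < ?n" for i j using x(1) that by (auto simp: wf_check_def)
  have E: "{i, j} \<in> edges G \<longleftrightarrow> mat x i j" if "i < ?n" "j < ?n" for i j
    using that sym unfolding x(2)[symmetric] by (auto simp: graph_of_def doubleton_eq_iff)
  have dv: "verts (diamond s) = {..<s + 3}" by (simp add: diamond_def)
  have ind: "ind_check (s + 3) (edge_table (diamond s) (s + 3)) (\<lambda>i j. mat x i j \<noteq> flip x w i j) ?n \<longleftrightarrow>
      has_induced (verts G, (edges G - F) \<union> (F - edges G)) (diamond s)"
    if F: "\<And>i j. i < ?n \<Longrightarrow> j < ?n \<Longrightarrow> {i, j} \<in> F \<longleftrightarrow> flip x w i j" for F w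
    unfolding v
  proof (rule ind_check_iff[OF dv])
    fix i j assume ij: "i < ?n" "j < ?n"
    show "mat x i j \<noteq> flip x w i j \<Longrightarrow> mat x j i \<noteq> flip x w j i"
      using sym[OF ij] sym[OF ij(2,1)] flip_sym[of x w i j] by metis
    show "{i, j} \<in> (edges G - F) \<union> (F - edges G) \<longleftrightarrow> mat x i j \<noteq> flip x w i j"
      using F[OF ij] E[OF ij] by blast
  qed
  have fl: "(i, j) \<in> set (flips x w) \<longleftrightarrow> i < j \<and> j < ?n \<and> flip x w i j" for i j w
    by (auto simp: flips_def)
  show ?thesis
  proof
    assume "\<exists>w. length w \<le> length x ^ 1 + 1 \<and> cert_check del s x w"
    then obtain w where w: "cert_check del s x w" by blast
    define F where "F = (\<lambda>p. {fst p, snd p}) ` set (flips x w)"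
    have F: "{i, j} \<in> F \<longleftrightarrow> flip x w i j" if "i < ?n" "j < ?n" for i j
    proof
      assume "{i, j} \<in> F"
      then obtain a b where "(a, b) \<in> set (flips x w)" "{i, j} = {a, b}" unfolding F_def by auto
      then show "flip x w i j" using fl[of a b w] flip_sym[of x w] by (auto simp: doubleton_eq_iff)
    next
      assume f: "flip x w i j"
      then have "i \<noteq> j" by (auto simp: flip_def)
      then have "(i, j) \<in> set (flips x w) \<or> (j, i) \<in> set (flips x w)"
        using f that fl[of i j w] fl[of j i w] flip_sym[of x w i j] by (cases "i < j") auto
      then show "{i, j} \<in> F" unfolding F_def by (auto intro: rev_image_eqI)
    qed
    have "F \<subseteq> vertex_pairs (verts G)"
      unfolding F_def v vertex_pairs_def using fl by auto
    moreover have "del \<longrightarrow> F \<subseteq> edges G"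
    proof (intro impI subsetI)
      fix e assume "del" "e \<in> F"
      then obtain a b where ab: "(a, b) \<in> set (flips x w)" "e = {a, b}" unfolding F_def by auto
      then have "mat x a b" using w \<open>del\<close> by (auto simp: cert_check_def)
      then show "e \<in> edges G" using ab E[of a b] fl[of a b w] by auto
    qed
    moreover have "card F \<le> k"
    proof -
      have "card F \<le> length (flips x w)" unfolding F_def
        by (rule order_trans[OF card_image_le card_length]) simp
      also have "\<dots> \<le> bin_val (kbits x)" using w by (simp add: cert_check_def capped_min)
      finally show ?thesis using x(3) by simp
    qed
    moreover have "\<not> has_induced (verts G, (edges G - F) \<union> (F - edges G)) (diamond s)"
      using ind[OF F] w by (simp add: cert_check_def)
    ultimately show "modifiable del s (G, k)" unfolding modifiable_def by blast
  next
    assume "modifiable del s (G, k)"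
    then obtain F where F: "F \<subseteq> vertex_pairs (verts G)" "del \<longrightarrow> F \<subseteq> edges G" "card F \<le> k"
      "\<not> has_induced (verts G, (edges G - F) \<union> (F - edges G)) (diamond s)"
      unfolding modifiable_def by blast
    \<comment> \<open>The certificate of a solution is the adjacency matrix of
      \<open>F\<close>.\<close>
    define w where "w = concat (map (\<lambda>i. map (\<lambda>j. {i, j} \<in> F) [0..<?n]) [0..<?n])"
    have lw: "length w = ?n * ?n" by (simp add: w_def length_matrix)
    have nth: "nth_or False w (i * ?n + j) \<longleftrightarrow> {i, j} \<in> F" if "i < ?n" "j < ?n" for i j
    proof -
      have "i * ?n + j < ?n * ?n"
        using that by (metis add_less_le_mono add.commute mult_Suc Suc_leI mult_le_mono1 less_le_trans nat_add_left_cancel_less)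
      then show ?thesis using concat_matrix_nth[OF that, of "\<lambda>i j. {i, j} \<in> F"] lw
        by (simp add: nth_or_nth w_def)
    qed
    have irr: "{i} \<notin> F" for i using F(1) by (auto simp: vertex_pairs_def)
    have Fl: "{i, j} \<in> F \<longleftrightarrow> flip x w i j" if "i < ?n" "j < ?n" for i j
      using nth[OF that] nth[OF that(2,1)] irr by (auto simp: flip_def insert_commute)
    have "inj_on (\<lambda>p. {fst p, snd p}) (set (flips x w))"
      using fl by (auto simp: inj_on_def doubleton_eq_iff)
    moreover have "(\<lambda>p. {fst p, snd p}) ` set (flips x w) = F"
    proof
      show "(\<lambda>p. {fst p, snd p}) ` set (flips x w) \<subseteq> F" using fl Fl by auto
      show "F \<subseteq> (\<lambda>p. {fst p, snd p}) ` set (flips x w)"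
      proof
        fix e assume e: "e \<in> F"
        then obtain i j where ij: "e = {i, j}" "i \<noteq> j" "i < ?n" "j < ?n"
          using F(1) v by (auto simp: vertex_pairs_def card_2_iff)
        then have "(i, j) \<in> set (flips x w) \<or> (j, i) \<in> set (flips x w)"
          using fl[of i j w] fl[of j i w] Fl[of i j] e flip_sym[of x w i j] by (cases "i < j") auto
        then show "e \<in> (\<lambda>p. {fst p, snd p}) ` set (flips x w)" using ij by (auto intro: rev_image_eqI)
      qed
    qed
    ultimately have "card F = card (set (flips x w))" by (metis card_image)
    also have "\<dots> = length (flips x w)" by (rule distinct_card) (simp add: flips_def distinct_product)
    finally have "length (flips x w) \<le> bin_val (kbits x)" using F(3) x(3) by simp
    moreover have "del \<longrightarrow> (\<forall>p\<in>set (flips x w). mat x (fst p) (snd p))"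
    proof (intro impI ballI)
      fix p assume "del" "p \<in> set (flips x w)"
      then have p: "fst p < snd p" "snd p < ?n" "flip x w (fst p) (snd p)" using fl[of "fst p" "snd p" w] by auto
      then have "{fst p, snd p} \<in> edges G" using Fl[of "fst p" "snd p"] F(2) \<open>del\<close> by auto
      then show "mat x (fst p) (snd p)" using E[of "fst p" "snd p"] p by auto
    qed
    ultimately have "cert_check del s x w"
      using ind[OF Fl] F(4) x(1) by (simp add: cert_check_def capped_min)
    moreover have "length w \<le> length x ^ 1 + 1" using lw x(4) by simp
    ultimately show "\<exists>w. length w \<le> length x ^ 1 + 1 \<and> cert_check del s x w" by blast
  qed
qed

theorem in_NP_K4_free:
  assumes Y: "\<And>y. y \<in> K4_free_instances \<Longrightarrow> Y y \<longleftrightarrow> modifiable del s y"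
  shows "in_NP (K4_free_language Y)"
  unfolding in_NP_def
proof (intro exI conjI allI)
  show "polytime_decidable {z. cert_check del s (pair_fst z) (pair_snd z)}"
    by (rule pt_polytime_decidable) (intro pt_intros)
  show "x \<in> K4_free_language Y \<longleftrightarrow>
    (\<exists>w. length w \<le> length x ^ 1 + 1 \<and> string_pair x w \<in> {z. cert_check del s (pair_fst z) (pair_snd z)})" for x
  proof
    assume "x \<in> K4_free_language Y"
    then obtain G k where "(G, k) \<in> K4_free_instances" "Y (G, k)" "x = encode_instance (G, k)"
      unfolding K4_free_language_def by auto
    then show "\<exists>w. length w \<le> length x ^ 1 + 1 \<and> string_pair x w \<in> {z. cert_check del s (pair_fst z) (pair_snd z)}"
      using cert_check_iff Y by (simp only: mem_Collect_eq pair_proj)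
  next
    assume "\<exists>w. length w \<le> length x ^ 1 + 1 \<and> string_pair x w \<in> {z. cert_check del s (pair_fst z) (pair_snd z)}"
    then obtain w where w: "length w \<le> length x ^ 1 + 1" "cert_check del s x w"
      by (auto simp: pair_proj)
    then have "wf_check x" by (simp add: cert_check_def)
    note I = wf_check_instance[OF this]
    have "modifiable del s (graph_of x, bin_val (kbits x))" using cert_check_iff[OF I(1)] w unfolding I(2) by blast
    then have "Y (graph_of x, bin_val (kbits x))" using Y[OF I(1)] by simp
    then show "x \<in> K4_free_language Y" using language_mem[OF I(1)] I(2) by metis
  qed
qed

lemma instance_deletion_imp_editing:
  assumes "y \<in> K4_free_instances" "diamond_free_edge_deletion s y"
  shows "diamond_free_edge_editing s y"
proof -
  have "simple_graph (fst y)" using assms(1) by (simp add: K4_free_instances_def case_prod_beta)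
  then show ?thesis using deletion_imp_editing[of "fst y" s "snd y"] assms(2) by simp
qed

lemma NP_complete_deletion:
  assumes "s \<ge> 1" shows "NP_complete (K4_free_language (diamond_free_edge_deletion s))"
  unfolding NP_complete_def
proof
  show "in_NP (K4_free_language (diamond_free_edge_deletion s))"
  proof (rule in_NP_K4_free)
    fix y assume "y \<in> K4_free_instances"
    then have "simple_graph (fst y)" by (simp add: K4_free_instances_def case_prod_beta)
    then show "diamond_free_edge_deletion s y \<longleftrightarrow> modifiable True s y"
      using modifiable_deletion[of "fst y" s "snd y"] by simp
  qed
  show "NP_hard (K4_free_language (diamond_free_edge_deletion s))"
    by (rule NP_hard_K4_free[OF assms]; use instance_deletion_imp_editing in blast)
qed

lemma NP_complete_editing:
  assumes "s \<ge> 1" shows "NP_complete (K4_free_language (diamond_free_edge_editing s))"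
  unfolding NP_complete_def
proof
  show "in_NP (K4_free_language (diamond_free_edge_editing s))"
    by (rule in_NP_K4_free[of _ False s]) (simp add: modifiable_editing)
  show "NP_hard (K4_free_language (diamond_free_edge_editing s))"
    by (rule NP_hard_K4_free[OF assms]; use instance_deletion_imp_editing in blast)
qed

section \<open>Sparsification\<close>

type_synonym lit = "nat list \<times> bool"
type_synonym bstate = "lit list \<times> (lit \<times> lit) list"

definition holds :: "(nat list \<Rightarrow> bool) \<Rightarrow> lit \<Rightarrow> bool" where "holds \<alpha> l \<longleftrightarrow> \<alpha> (fst l) = snd l"

definition inB :: "bstate \<Rightarrow> lit \<Rightarrow> lit \<Rightarrow> bool" where
  "inB st a b \<longleftrightarrow> (a, b) \<in> set (snd st) \<or> (b, a) \<in> set (snd st)"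

text \<open>Clauses are matched as sets, since they may repeat literals or list them in any
  order.\<close>

definition cl1 :: "form \<Rightarrow> lit \<Rightarrow> bool" where
  "cl1 \<phi> a \<longleftrightarrow> (\<exists>C\<in>set \<phi>. (\<forall>l\<in>set C. l = a) \<and> a \<in> set C)"

definition cl2 :: "form \<Rightarrow> lit \<Rightarrow> lit \<Rightarrow> bool" where
  "cl2 \<phi> a b \<longleftrightarrow> (\<exists>C\<in>set \<phi>. (\<forall>l\<in>set C. l = a \<or> l = b) \<and> a \<in> set C \<and> b \<in> set C)"

definition cl3 :: "form \<Rightarrow> lit \<Rightarrow> lit \<Rightarrow> lit \<Rightarrow> bool" where
  "cl3 \<phi> a b c \<longleftrightarrow> (\<exists>C\<in>set \<phi>. (\<forall>l\<in>set C. l = a \<or> l = b \<or> l = c) \<and> a \<in> set C \<and> b \<in> set C \<and> c \<in> set C)"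

definition live2 :: "form \<Rightarrow> bstate \<Rightarrow> lit \<Rightarrow> lit \<Rightarrow> bool" where
  "live2 \<phi> st a b \<longleftrightarrow> a \<noteq> b \<and> a \<notin> set (fst st) \<and> b \<notin> set (fst st) \<and> (inB st a b \<or> cl2 \<phi> a b)"

definition live3 :: "form \<Rightarrow> bstate \<Rightarrow> lit \<Rightarrow> lit \<Rightarrow> lit \<Rightarrow> bool" where
  "live3 \<phi> st a b c \<longleftrightarrow> a \<noteq> b \<and> a \<noteq> c \<and> b \<noteq> c \<and> a \<notin> set (fst st) \<and> b \<notin> set (fst st) \<and> c \<notin> set (fst st) \<and>
     \<not> inB st a b \<and> \<not> inB st a c \<and> \<not> inB st b c \<and> cl3 \<phi> a b c"

text \<open>Three kinds of sunflowers among the live clauses: a literal as heart with single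
  literals as petals, a pair as heart with single literals, and a literal as heart with pairs. Pairs
  are counted in both orders.\<close>

definition petals1 :: "form \<Rightarrow> lit list \<Rightarrow> bstate \<Rightarrow> lit \<Rightarrow> lit list" where
  "petals1 \<phi> Ls st a = filter (\<lambda>b. live2 \<phi> st a b) Ls"

definition petals2 :: "form \<Rightarrow> lit list \<Rightarrow> bstate \<Rightarrow> lit \<times> lit \<Rightarrow> lit list" where
  "petals2 \<phi> Ls st p = filter (\<lambda>c. live3 \<phi> st (fst p) (snd p) c) Ls"

definition petals3 :: "form \<Rightarrow> lit list \<Rightarrow> bstate \<Rightarrow> lit \<Rightarrow> (lit \<times> lit) list" where
  "petals3 \<phi> Ls st a = filter (\<lambda>p. live3 \<phi> st a (fst p) (snd p)) (List.product Ls Ls)"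

text \<open>Either the heart of a sunflower is satisfied or all its petals are. The order of the
  rules guarantees that no literal is in many live 2-clauses when new ones are added; the thresholds
  make the child that receives the petals gain potential \<open>4 * \<theta> ^ 2\<close> in each
  case.\<close>

definition branch :: "form \<Rightarrow> lit list \<Rightarrow> nat \<Rightarrow> bstate \<Rightarrow> bstate list" where
  "branch \<phi> Ls \<theta> st = (case filter (\<lambda>a. \<theta> \<le> length (petals1 \<phi> Ls st a)) Ls of
     a # _ \<Rightarrow> [(a # fst st, snd st), (petals1 \<phi> Ls st a @ fst st, snd st)]
   | [] \<Rightarrow> (case filter (\<lambda>p. \<theta> \<le> length (petals2 \<phi> Ls st p)) (List.product Ls Ls) of
       p # _ \<Rightarrow> [(fst st, p # snd st), (petals2 \<phi> Ls st p @ fst st, snd st)]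
     | [] \<Rightarrow> (case filter (\<lambda>a. 4 * \<theta> ^ 2 \<le> length (petals3 \<phi> Ls st a)) Ls of
         a # _ \<Rightarrow> [(a # fst st, snd st), (fst st, petals3 \<phi> Ls st a @ snd st)]
       | [] \<Rightarrow> [])))"

definition leaf_form :: "form \<Rightarrow> lit list \<Rightarrow> bstate \<Rightarrow> form" where
  "leaf_form \<phi> Ls st = (if [] \<in> set \<phi> then [[]] else []) @
     map (\<lambda>a. [a]) (filter (\<lambda>a. a \<in> set (fst st) \<or> cl1 \<phi> a) Ls) @
     map (\<lambda>p. [fst p, snd p]) (filter (\<lambda>p. live2 \<phi> st (fst p) (snd p)) (List.product Ls Ls)) @
     map (\<lambda>p. [fst p, fst (snd p), snd (snd p)])
       (filter (\<lambda>p. live3 \<phi> st (fst p) (fst (snd p)) (snd (snd p))) (List.product Ls (List.product Ls Ls)))"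

text \<open>The formula of a node is \<open>\<phi>\<close> with the unit clauses and 2-clauses of the node added; clauses
  of \<open>\<phi>\<close> and added 2-clauses that become redundant are not removed but no longer \<open>live\<close>.\<close>

definition node_sat :: "form \<Rightarrow> bstate \<Rightarrow> bool" where
  "node_sat \<phi> st \<longleftrightarrow> (\<exists>\<alpha>. (\<forall>C\<in>set \<phi>. \<exists>l\<in>set C. holds \<alpha> l) \<and> (\<forall>l\<in>set (fst st). holds \<alpha> l) \<and>
     (\<forall>p\<in>set (snd st). holds \<alpha> (fst p) \<or> holds \<alpha> (snd p)))"

definition wf_node :: "lit list \<Rightarrow> bstate \<Rightarrow> bool" where
  "wf_node Ls st \<longleftrightarrow> set (fst st) \<subseteq> set Ls \<and> (\<forall>p\<in>set (snd st). fst p \<in> set Ls \<and> snd p \<in> set Ls \<and> fst p \<noteq> snd p)"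

lemma fsat_holds: "fsat \<phi> \<longleftrightarrow> (\<exists>\<alpha>. \<forall>C\<in>set \<phi>. \<exists>l\<in>set C. holds \<alpha> l)"
  by (simp add: fsat_def holds_def)

lemma leaf_form_three: "C \<in> set (leaf_form \<phi> Ls st) \<Longrightarrow> length C \<le> 3"
  by (auto simp: leaf_form_def split: if_splits)

lemma inB_holds:
  "\<forall>p\<in>set (snd st). holds \<alpha> (fst p) \<or> holds \<alpha> (snd p) \<Longrightarrow> inB st a b \<Longrightarrow> holds \<alpha> a \<or> holds \<alpha> b"
  by (auto simp: inB_def)

text \<open>A clause is left out only if it contains a unit literal of the node or an added
  2-clause, and these are enforced by the clauses that are kept.\<close>

lemma leaf_form_sat:
  assumes Ls: "\<forall>C\<in>set \<phi>. length C \<le> 3 \<and> set C \<subseteq> set Ls" and st: "wf_node Ls st"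
  shows "fsat (leaf_form \<phi> Ls st) \<longleftrightarrow> node_sat \<phi> st"
proof
  assume "node_sat \<phi> st"
  then obtain \<alpha> where \<alpha>: "\<forall>C\<in>set \<phi>. \<exists>l\<in>set C. holds \<alpha> l" "\<forall>l\<in>set (fst st). holds \<alpha> l"
    "\<forall>p\<in>set (snd st). holds \<alpha> (fst p) \<or> holds \<alpha> (snd p)" unfolding node_sat_def by blast
  have n: "[] \<notin> set \<phi>" using \<alpha>(1) by force
  have 1: "holds \<alpha> a" if "a \<in> set (fst st) \<or> cl1 \<phi> a" for a
    using that \<alpha>(1,2) unfolding cl1_def by metis
  have 2: "holds \<alpha> a \<or> holds \<alpha> b" if "live2 \<phi> st a b" for a b
    using that inB_holds[OF \<alpha>(3)] \<alpha>(1) unfolding live2_def cl2_def by metis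
  have 3: "holds \<alpha> a \<or> holds \<alpha> b \<or> holds \<alpha> c" if "live3 \<phi> st a b c" for a b c
    using that \<alpha>(1) unfolding live3_def cl3_def by metis
  show "fsat (leaf_form \<phi> Ls st)" unfolding fsat_holds leaf_form_def
    by (intro exI[of _ \<alpha>]) (use n 1 2 3 in auto)
next
  assume "fsat (leaf_form \<phi> Ls st)"
  then obtain \<alpha> where \<alpha>: "\<forall>C\<in>set (leaf_form \<phi> Ls st). \<exists>l\<in>set C. holds \<alpha> l" unfolding fsat_holds by blast
  have n: "[] \<notin> set \<phi>" using \<alpha> by (auto simp: leaf_form_def split: if_splits)
  have h1: "holds \<alpha> a" if "a \<in> set (fst st) \<or> cl1 \<phi> a" "a \<in> set Ls" for a
  proof -
    have "[a] \<in> set (leaf_form \<phi> Ls st)" using that unfolding leaf_form_def by auto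
    then show ?thesis using \<alpha> by force
  qed
  have h2: "holds \<alpha> a \<or> holds \<alpha> b" if "live2 \<phi> st a b" "a \<in> set Ls" "b \<in> set Ls" for a b
  proof -
    have "[a, b] \<in> set (map (\<lambda>p. [fst p, snd p]) (filter (\<lambda>p. live2 \<phi> st (fst p) (snd p)) (List.product Ls Ls)))"
      unfolding set_map by (rule image_eqI[of _ _ "(a, b)"]) (use that in auto)
    then have "[a, b] \<in> set (leaf_form \<phi> Ls st)" unfolding leaf_form_def set_append by blast
    then show ?thesis using \<alpha> by force
  qed
  have h3: "holds \<alpha> a \<or> holds \<alpha> b \<or> holds \<alpha> c" if "live3 \<phi> st a b c" "a \<in> set Ls" "b \<in> set Ls" "c \<in> set Ls" for a b c
  proof -
    have "[a, b, c] \<in> set (map (\<lambda>p. [fst p, fst (snd p), snd (snd p)])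
       (filter (\<lambda>p. live3 \<phi> st (fst p) (fst (snd p)) (snd (snd p))) (List.product Ls (List.product Ls Ls))))"
      unfolding set_map by (rule image_eqI[of _ _ "(a, b, c)"]) (use that in auto)
    then have "[a, b, c] \<in> set (leaf_form \<phi> Ls st)" unfolding leaf_form_def set_append by blast
    then show ?thesis using \<alpha> by force
  qed
  have U: "\<forall>l\<in>set (fst st). holds \<alpha> l" using h1 st by (auto simp: wf_node_def)
  have B: "holds \<alpha> (fst p) \<or> holds \<alpha> (snd p)" if p: "p \<in> set (snd st)" for p
  proof -
    have ls: "fst p \<in> set Ls" "snd p \<in> set Ls" "fst p \<noteq> snd p" using st p by (auto simp: wf_node_def)
    have "inB st (fst p) (snd p)" using p by (simp add: inB_def)
    then show ?thesis using h2[OF _ ls(1,2)] U ls(3) by (cases "live2 \<phi> st (fst p) (snd p)") (auto simp: live2_def)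
  qed
  have "\<exists>l\<in>set C. holds \<alpha> l" if C: "C \<in> set \<phi>" for C
  proof -
    have len: "length C \<le> 3" "set C \<subseteq> set Ls" using Ls C by auto
    have iB: "holds \<alpha> a \<or> holds \<alpha> b" if "inB st a b" for a b using inB_holds B that by blast
    have ne: "C \<noteq> []" using C n by auto
    have "card (set C) \<le> 3" using card_length[of C] len by simp
    moreover have "card (set C) \<noteq> 0" using ne by simp
    ultimately consider "card (set C) = 1" | "card (set C) = 2" | "card (set C) = 3" by linarith
    then show ?thesis
    proof cases
      case 1
      then obtain a where a: "set C = {a}" by (auto simp: card_1_singleton_iff)
      then have "cl1 \<phi> a" using C unfolding cl1_def by auto
      then show ?thesis using h1[of a] a len by auto
    next
      case 2
      obtain a b where a: "set C = {a, b}" "a \<noteq> b" using card_2_iff[THEN iffD1, OF 2] by metis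
      then have cl: "cl2 \<phi> a b" using C unfolding cl2_def by auto
      have ls: "a \<in> set Ls" "b \<in> set Ls" using a len by auto
      have "holds \<alpha> a \<or> holds \<alpha> b"
        using h2[OF _ ls] cl a(2) U unfolding live2_def by blast
      then show ?thesis using a by auto
    next
      case 3
      obtain a b c where a: "set C = {a, b, c}" "a \<noteq> b" "b \<noteq> c" "a \<noteq> c" using card_3_iff[THEN iffD1, OF 3] by metis
      then have cl: "cl3 \<phi> a b c" using C unfolding cl3_def by auto
      have ls: "a \<in> set Ls" "b \<in> set Ls" "c \<in> set Ls" using a len by auto
      have "holds \<alpha> a \<or> holds \<alpha> b \<or> holds \<alpha> c"
      proof (cases "live3 \<phi> st a b c")
        case True
        then show ?thesis using h3[OF _ ls] by blast
      next
        case False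
        then have "a \<in> set (fst st) \<or> b \<in> set (fst st) \<or> c \<in> set (fst st) \<or> inB st a b \<or> inB st a c \<or> inB st b c"
          using a(2-4) cl unfolding live3_def by blast
        then show ?thesis using U iB by blast
      qed
      then show ?thesis using a by auto
    qed
  qed
  then show "node_sat \<phi> st" unfolding node_sat_def using U B by blast
qed

lemma filter_ConsD: "filter P xs = y # ys \<Longrightarrow> P y \<and> y \<in> set xs"
  by (metis (mono_tags, lifting) filter_eq_ConsD in_set_conv_decomp)

lemma branch_cases:
  obtains (leaf) "branch \<phi> Ls \<theta> st = []" "\<forall>a\<in>set Ls. length (petals1 \<phi> Ls st a) < \<theta>"
      "\<forall>p\<in>set (List.product Ls Ls). length (petals2 \<phi> Ls st p) < \<theta>"
      "\<forall>a\<in>set Ls. length (petals3 \<phi> Ls st a) < 4 * \<theta> ^ 2"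
  | (r1) a where "branch \<phi> Ls \<theta> st = [(a # fst st, snd st), (petals1 \<phi> Ls st a @ fst st, snd st)]"
      "a \<in> set Ls" "\<theta> \<le> length (petals1 \<phi> Ls st a)"
  | (r2) p where "branch \<phi> Ls \<theta> st = [(fst st, p # snd st), (petals2 \<phi> Ls st p @ fst st, snd st)]"
      "fst p \<in> set Ls" "snd p \<in> set Ls" "\<theta> \<le> length (petals2 \<phi> Ls st p)" "\<forall>a\<in>set Ls. length (petals1 \<phi> Ls st a) < \<theta>"
  | (r3) a where "branch \<phi> Ls \<theta> st = [(a # fst st, snd st), (fst st, petals3 \<phi> Ls st a @ snd st)]"
      "a \<in> set Ls" "4 * \<theta> ^ 2 \<le> length (petals3 \<phi> Ls st a)" "\<forall>a\<in>set Ls. length (petals1 \<phi> Ls st a) < \<theta>"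
      "\<forall>p\<in>set (List.product Ls Ls). length (petals2 \<phi> Ls st p) < \<theta>"
proof -
  let ?f1 = "filter (\<lambda>a. \<theta> \<le> length (petals1 \<phi> Ls st a)) Ls"
  let ?f2 = "filter (\<lambda>p. \<theta> \<le> length (petals2 \<phi> Ls st p)) (List.product Ls Ls)"
  let ?f3 = "filter (\<lambda>a. 4 * \<theta> ^ 2 \<le> length (petals3 \<phi> Ls st a)) Ls"
  show thesis
  proof (cases ?f1)
    case (Cons a r)
    show thesis by (rule r1[of a]) (use filter_ConsD[OF Cons] Cons in \<open>auto simp: branch_def\<close>)
  next
    case f1: Nil
    then have n1: "\<forall>a\<in>set Ls. length (petals1 \<phi> Ls st a) < \<theta>" by (auto simp: filter_empty_conv)
    show thesis
    proof (cases ?f2)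
      case (Cons p r)
      then show thesis using filter_ConsD[OF Cons] f1 by (intro r2[of p] n1) (auto simp: branch_def)
    next
      case f2: Nil
      then have n2: "\<forall>p\<in>set (List.product Ls Ls). length (petals2 \<phi> Ls st p) < \<theta>"
        unfolding filter_empty_conv not_le by blast
      show thesis
      proof (cases ?f3)
        case (Cons a r)
        then show thesis using filter_ConsD[OF Cons] f1 f2 by (intro r3[of a] n1 n2) (auto simp: branch_def)
      next
        case f3: Nil
        then have n3: "\<forall>a\<in>set Ls. length (petals3 \<phi> Ls st a) < 4 * \<theta> ^ 2" by (auto simp: filter_empty_conv)
        show thesis using f1 f2 f3 by (intro leaf n1 n2 n3) (auto simp: branch_def)
      qed
    qed
  qed
qed

lemma node_sat_mono:
  "node_sat \<phi> st' \<Longrightarrow> set (fst st) \<subseteq> set (fst st') \<Longrightarrow> set (snd st) \<subseteq> set (snd st') \<Longrightarrow> node_sat \<phi> st"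
  unfolding node_sat_def by blast

lemma branch_sat:
  assumes "branch \<phi> Ls \<theta> st \<noteq> []"
  shows "node_sat \<phi> st \<longleftrightarrow> (\<exists>st'\<in>set (branch \<phi> Ls \<theta> st). node_sat \<phi> st')"
proof
  assume "\<exists>st'\<in>set (branch \<phi> Ls \<theta> st). node_sat \<phi> st'"
  then obtain st' where st': "st' \<in> set (branch \<phi> Ls \<theta> st)" "node_sat \<phi> st'" by blast
  then have "set (fst st) \<subseteq> set (fst st') \<and> set (snd st) \<subseteq> set (snd st')"
    by (cases rule: branch_cases[of \<phi> Ls \<theta> st]) auto
  then show "node_sat \<phi> st" using st'(2) node_sat_mono by blast
next
  assume "node_sat \<phi> st"
  then obtain \<alpha> where \<alpha>: "\<forall>C\<in>set \<phi>. \<exists>l\<in>set C. holds \<alpha> l" "\<forall>l\<in>set (fst st). holds \<alpha> l"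
    "\<forall>p\<in>set (snd st). holds \<alpha> (fst p) \<or> holds \<alpha> (snd p)" unfolding node_sat_def by blast
  have 2: "holds \<alpha> a \<or> holds \<alpha> b" if "live2 \<phi> st a b" for a b
    using that inB_holds[OF \<alpha>(3)] \<alpha>(1) unfolding live2_def cl2_def by metis
  have 3: "holds \<alpha> a \<or> holds \<alpha> b \<or> holds \<alpha> c" if "live3 \<phi> st a b c" for a b c
    using that \<alpha>(1) unfolding live3_def cl3_def by metis
  show "\<exists>st'\<in>set (branch \<phi> Ls \<theta> st). node_sat \<phi> st'"
  proof (cases rule: branch_cases[of \<phi> Ls \<theta> st])
    case leaf
    then show ?thesis using assms by simp
  next
    case (r1 a)
    have "node_sat \<phi> (a # fst st, snd st) \<or> node_sat \<phi> (petals1 \<phi> Ls st a @ fst st, snd st)"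
    proof (cases "holds \<alpha> a")
      case True
      then show ?thesis using \<alpha> unfolding node_sat_def by auto
    next
      case False
      then have "\<forall>l\<in>set (petals1 \<phi> Ls st a). holds \<alpha> l" using 2 unfolding petals1_def set_filter by blast
      then have "node_sat \<phi> (petals1 \<phi> Ls st a @ fst st, snd st)"
        unfolding node_sat_def by (intro exI[of _ \<alpha>]) (use \<alpha> in auto)
      then show ?thesis by simp
    qed
    then show ?thesis using r1 by simp
  next
    case (r2 p)
    have "node_sat \<phi> (fst st, p # snd st) \<or> node_sat \<phi> (petals2 \<phi> Ls st p @ fst st, snd st)"
    proof (cases "holds \<alpha> (fst p) \<or> holds \<alpha> (snd p)")
      case True
      then have "node_sat \<phi> (fst st, p # snd st)"
        unfolding node_sat_def by (intro exI[of _ \<alpha>]) (use \<alpha> in auto)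
      then show ?thesis by simp
    next
      case False
      then have "\<forall>l\<in>set (petals2 \<phi> Ls st p). holds \<alpha> l" using 3 unfolding petals2_def set_filter by blast
      then have "node_sat \<phi> (petals2 \<phi> Ls st p @ fst st, snd st)"
        unfolding node_sat_def by (intro exI[of _ \<alpha>]) (use \<alpha> in auto)
      then show ?thesis by simp
    qed
    then show ?thesis using r2 by simp
  next
    case (r3 a)
    have "node_sat \<phi> (a # fst st, snd st) \<or> node_sat \<phi> (fst st, petals3 \<phi> Ls st a @ snd st)"
    proof (cases "holds \<alpha> a")
      case True
      then show ?thesis using \<alpha> unfolding node_sat_def by auto
    next
      case False
      then have "\<forall>p\<in>set (petals3 \<phi> Ls st a). holds \<alpha> (fst p) \<or> holds \<alpha> (snd p)" using 3 unfolding petals3_def set_filter by blast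
      then have "node_sat \<phi> (fst st, petals3 \<phi> Ls st a @ snd st)"
        unfolding node_sat_def by (intro exI[of _ \<alpha>]) (use \<alpha> in auto)
      then show ?thesis by simp
    qed
    then show ?thesis using r3 by simp
  qed
qed

lemma branch_wf:
  assumes "wf_node Ls st" "st' \<in> set (branch \<phi> Ls \<theta> st)" "\<theta> \<ge> 1"
  shows "wf_node Ls st'"
proof (cases rule: branch_cases[of \<phi> Ls \<theta> st])
  case (r2 p)
  then have "petals2 \<phi> Ls st p \<noteq> []" using assms(3) by auto
  then have "fst p \<noteq> snd p" by (auto simp: petals2_def filter_empty_conv live3_def)
  then show ?thesis using r2 assms by (auto simp: wf_node_def petals2_def)
next
  case (r3 a)
  have "fst p \<in> set Ls \<and> snd p \<in> set Ls \<and> fst p \<noteq> snd p" if "p \<in> set (petals3 \<phi> Ls st a)" for p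
    using that by (auto simp: petals3_def live3_def)
  moreover have "st' = (a # fst st, snd st) \<or> st' = (fst st, petals3 \<phi> Ls st a @ snd st)"
    using r3(1) assms(2) by simp
  ultimately show ?thesis using r3(2) assms(1) unfolding wf_node_def
    by (elim disjE) (simp_all only: fst_conv snd_conv set_append set_simps ball_Un, blast+)
qed (use assms in \<open>auto simp: wf_node_def petals1_def\<close>)

section \<open>The size of the branching tree\<close>

text \<open>Contains each live added 2-clause in both orders, so that the number of such clauses at
  a literal is the size of a fibre.\<close>

definition LB :: "bstate \<Rightarrow> (lit \<times> lit) set" where
  "LB st = {p. inB st (fst p) (snd p) \<and> fst p \<notin> set (fst st) \<and> snd p \<notin> set (fst st)}"

definition sparse :: "lit list \<Rightarrow> nat \<Rightarrow> bstate \<Rightarrow> bool" where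
  "sparse Ls \<theta> st \<longleftrightarrow> wf_node Ls st \<and> (\<forall>a. card {b. (a, b) \<in> LB st} \<le> 2 * \<theta>)"

text \<open>A new unit clause satisfies at most \<open>2 * \<theta>\<close> of the live 2-clauses, which \<open>LB\<close> counts in both
  orders, so the weight \<open>8 * \<theta>\<close> still leaves a gain of \<open>4 * \<theta>\<close>.\<close>

definition potential :: "nat \<Rightarrow> bstate \<Rightarrow> nat" where
  "potential \<theta> st = 8 * \<theta> * card (set (fst st)) + card (LB st)"

lemma LB_sub: "wf_node Ls st \<Longrightarrow> LB st \<subseteq> set Ls \<times> set Ls"
  by (auto simp: LB_def inB_def wf_node_def)

lemma finite_LB: "wf_node Ls st \<Longrightarrow> finite (LB st)"
  using LB_sub finite_subset by blast

lemma LB_sym: "(a, b) \<in> LB st \<longleftrightarrow> (b, a) \<in> LB st" by (auto simp: LB_def inB_def)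

lemma card_fibres_le:
  assumes "finite A" "R \<subseteq> A \<times> B" "\<And>a. a \<in> A \<Longrightarrow> card {b. (a, b) \<in> R} \<le> k" "finite R"
  shows "card R \<le> card A * k"
proof -
  have "R = Sigma A (\<lambda>a. {b. (a, b) \<in> R})" using assms(2) by auto
  moreover have "finite {b. (a, b) \<in> R}" for a
    using finite_subset[of "{b. (a, b) \<in> R}" "snd ` R"] assms(4) by force
  ultimately have "card R = (\<Sum>a\<in>A. card {b. (a, b) \<in> R})"
    using card_SigmaI[OF assms(1), of "\<lambda>a. {b. (a, b) \<in> R}"] by simp
  also have "\<dots> \<le> (\<Sum>a\<in>A. k)" using assms(3) by (rule sum_mono)
  finally show ?thesis by simp
qed

text \<open>Limits the progress along a branch: \<open>8 * \<theta>\<close> for each possible unit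
  and at most \<open>2 * \<theta>\<close> ordered pairs starting at each literal.\<close>

lemma potential_max:
  assumes "sparse Ls \<theta> st" shows "potential \<theta> st \<le> 10 * \<theta> * card (set Ls)"
proof -
  have wf: "wf_node Ls st" using assms by (simp add: sparse_def)
  have "card (set (fst st)) \<le> card (set Ls)" using wf by (intro card_mono) (auto simp: wf_node_def)
  moreover have "card (LB st) \<le> card (set Ls) * (2 * \<theta>)"
    by (rule card_fibres_le[OF _ LB_sub[OF wf]]) (use assms finite_LB[OF wf] in \<open>auto simp: sparse_def\<close>)
  moreover have "8 * \<theta> * card (set (fst st)) \<le> 8 * \<theta> * card (set Ls)" using calculation(1) by simp
  moreover have "10 * \<theta> * card (set Ls) = 8 * \<theta> * card (set Ls) + card (set Ls) * (2 * \<theta>)" by (simp add: algebra_simps)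
  ultimately show ?thesis unfolding potential_def by linarith
qed

lemma unit_child:
  assumes sp: "sparse Ls \<theta> st" and X: "set X \<subseteq> set Ls" "set X \<inter> set (fst st) = {}" "distinct X"
  shows "sparse Ls \<theta> (X @ fst st, snd st)"
    "potential \<theta> st + 4 * \<theta> * length X \<le> potential \<theta> (X @ fst st, snd st)"
proof -
  let ?st = "(X @ fst st, snd st)"
  have wf: "wf_node Ls st" using sp by (simp add: sparse_def)
  have wf': "wf_node Ls ?st" using wf X by (auto simp: wf_node_def)
  have sub: "LB ?st \<subseteq> LB st" by (auto simp: LB_def inB_def)
  have fin: "finite {b. (a, b) \<in> LB st}" for a
    using finite_subset[of "{b. (a, b) \<in> LB st}" "snd ` LB st"] finite_LB[OF wf] by force
  have "card {b. (a, b) \<in> LB ?st} \<le> 2 * \<theta>" for a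
  proof -
    have "card {b. (a, b) \<in> LB ?st} \<le> card {b. (a, b) \<in> LB st}" by (rule card_mono[OF fin]) (use sub in auto)
    also have "\<dots> \<le> 2 * \<theta>" using sp unfolding sparse_def by blast
    finally show ?thesis .
  qed
  then show "sparse Ls \<theta> ?st" using wf' by (simp add: sparse_def)
  \<comment> \<open>A pair that is no longer live has a new unit as its first or as its second
    component.\<close>
  have "LB st \<subseteq> LB ?st \<union> (Sigma (set X) (\<lambda>a. {b. (a, b) \<in> LB st}) \<union> prod.swap ` Sigma (set X) (\<lambda>a. {b. (a, b) \<in> LB st}))"
    (is "_ \<subseteq> _ \<union> (?A \<union> ?B)")
  proof
    fix p assume p: "p \<in> LB st"
    obtain a b where ab: "p = (a, b)" by (rule prod.exhaust)
    have "(b, a) \<in> LB st" using p ab LB_sym by blast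
    then show "p \<in> LB ?st \<union> (?A \<union> ?B)" using p ab by (auto simp: LB_def inB_def image_iff)
  qed
  moreover have finA: "finite ?A" using fin by auto
  ultimately have "card (LB st) \<le> card (LB ?st \<union> (?A \<union> ?B))"
    using finite_LB[OF wf'] by (intro card_mono) auto
  also have "\<dots> \<le> card (LB ?st) + (card ?A + card ?B)"
    by (meson add_left_mono card_Un_le le_trans)
  also have "card ?B \<le> card ?A" by (rule card_image_le[OF finA])
  also have "card ?A = (\<Sum>a\<in>set X. card {b. (a, b) \<in> LB st})" using fin by simp
  also have "\<dots> \<le> (\<Sum>a\<in>set X. 2 * \<theta>)" using sp unfolding sparse_def by (intro sum_mono) blast
  also have "\<dots> = 2 * \<theta> * length X" using X(3) by (simp add: distinct_card)
  finally have "card (LB st) \<le> card (LB ?st) + 4 * \<theta> * length X" by simp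
  moreover have "card (set (fst ?st)) = length X + card (set (fst st))"
    using X by (simp add: card_Un_disjoint distinct_card)
  ultimately show "potential \<theta> st + 4 * \<theta> * length X \<le> potential \<theta> ?st"
    unfolding potential_def by (simp add: algebra_simps)
qed

lemma pair_child:
  assumes sp: "sparse Ls \<theta> st" and X: "\<And>p. p \<in> set X \<Longrightarrow> fst p \<in> set Ls \<and> snd p \<in> set Ls \<and> fst p \<noteq> snd p \<and>
      fst p \<notin> set (fst st) \<and> snd p \<notin> set (fst st) \<and> \<not> inB st (fst p) (snd p)" "distinct X"
    and deg: "\<And>a. card {b. (a, b) \<in> LB st} + card {b. (a, b) \<in> set X \<or> (b, a) \<in> set X} \<le> 2 * \<theta>"
  shows "sparse Ls \<theta> (fst st, X @ snd st)" "potential \<theta> st + length X \<le> potential \<theta> (fst st, X @ snd st)"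
proof -
  let ?st = "(fst st, X @ snd st)"
  have wf: "wf_node Ls st" using sp by (simp add: sparse_def)
  have wf': "wf_node Ls ?st" using wf X by (auto simp: wf_node_def)
  have LB': "LB ?st = LB st \<union> {p. p \<in> set X \<or> prod.swap p \<in> set X}"
  proof -
    have "inB ?st a b \<longleftrightarrow> inB st a b \<or> (a, b) \<in> set X \<or> (b, a) \<in> set X" for a b by (auto simp: inB_def)
    then show ?thesis using X(1) by (auto simp: LB_def)
  qed
  have "card {b. (a, b) \<in> LB ?st} \<le> 2 * \<theta>" for a
  proof -
    have "{b. (a, b) \<in> LB ?st} = {b. (a, b) \<in> LB st} \<union> {b. (a, b) \<in> set X \<or> (b, a) \<in> set X}" unfolding LB' by auto
    then show ?thesis using card_Un_le[of "{b. (a, b) \<in> LB st}" "{b. (a, b) \<in> set X \<or> (b, a) \<in> set X}"] deg[of a] by simp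
  qed
  then show "sparse Ls \<theta> ?st" using wf' by (simp add: sparse_def)
  have "card (LB st) + length X = card (LB st \<union> set X)"
  proof -
    have "LB st \<inter> set X = {}" using X(1) by (auto simp: LB_def)
    then show ?thesis using finite_LB[OF wf] X(2) by (simp add: card_Un_disjoint distinct_card)
  qed
  also have "\<dots> \<le> card (LB ?st)" by (rule card_mono[OF finite_LB[OF wf']]) (auto simp: LB')
  finally show "potential \<theta> st + length X \<le> potential \<theta> ?st" by (simp add: potential_def)
qed

lemma live3_perm: "live3 \<phi> st a b c \<longleftrightarrow> live3 \<phi> st b a c" "live3 \<phi> st a b c \<longleftrightarrow> live3 \<phi> st a c b"
proof -
  have "cl3 \<phi> a b c \<longleftrightarrow> cl3 \<phi> b a c" "cl3 \<phi> a b c \<longleftrightarrow> cl3 \<phi> a c b" unfolding cl3_def by blast+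
  moreover have "inB st a b = inB st b a" for a b unfolding inB_def by blast
  ultimately show "live3 \<phi> st a b c \<longleftrightarrow> live3 \<phi> st b a c" "live3 \<phi> st a b c \<longleftrightarrow> live3 \<phi> st a c b"
    unfolding live3_def by metis+
qed

text \<open>When 2-clauses are added, the first rule does not apply, so each literal is in fewer
  than \<open>\<theta>\<close> live ones. The second rule adds at most one at a literal, and the
  third adds fewer than \<open>\<theta>\<close>, as otherwise the second would have applied. So the
  degrees stay within \<open>2 * \<theta>\<close>.\<close>

lemma branch_potential:
  assumes sp: "sparse Ls \<theta> st" and \<theta>: "\<theta> \<ge> 1" and Ls: "distinct Ls" and b: "branch \<phi> Ls \<theta> st \<noteq> []"
  obtains c1 c2 where "branch \<phi> Ls \<theta> st = [c1, c2]" "sparse Ls \<theta> c1" "sparse Ls \<theta> c2"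
    "potential \<theta> st + 1 \<le> potential \<theta> c1" "potential \<theta> st + 4 * \<theta> ^ 2 \<le> potential \<theta> c2"
proof -
  have wf: "wf_node Ls st" using sp by (simp add: sparse_def)
  have deg_small: "card {b. (a, b) \<in> LB st} < \<theta>" if "\<forall>a\<in>set Ls. length (petals1 \<phi> Ls st a) < \<theta>" for a
  proof (cases "a \<in> set Ls")
    case True
    have "{b. (a, b) \<in> LB st} \<subseteq> set (petals1 \<phi> Ls st a)"
      using LB_sub[OF wf] wf by (auto simp: petals1_def live2_def LB_def inB_def wf_node_def)
    then have "card {b. (a, b) \<in> LB st} \<le> length (petals1 \<phi> Ls st a)"
      by (meson List.finite_set card_length card_mono le_trans)
    then show ?thesis using that True by (meson le_less_trans)
  next
    case False
    then have "{b. (a, b) \<in> LB st} = {}" using LB_sub[OF wf] by auto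
    then show ?thesis using \<theta> by (simp only: card.empty)
  qed
  \<comment> \<open>Each new unit gains \<open>4 * \<theta>\<close> and there are at least
    \<open>\<theta>\<close> petals.\<close>
  have sq: "4 * \<theta> * n \<ge> 4 * \<theta> ^ 2" if "n \<ge> \<theta>" for n using that by (simp add: power2_eq_square)
  have un: "4 * \<theta> * 1 \<ge> 1" using \<theta> by simp
  show thesis
  proof (cases rule: branch_cases[of \<phi> Ls \<theta> st])
    case leaf
    then show thesis using b by simp
  next
    case (r1 a)
    then have "petals1 \<phi> Ls st a \<noteq> []" using \<theta> by auto
    then have "a \<notin> set (fst st)" by (auto simp: petals1_def filter_empty_conv live2_def)
    note u = unit_child[OF sp, of "[a]"]
    have w: "sparse Ls \<theta> (petals1 \<phi> Ls st a @ fst st, snd st)"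
      "potential \<theta> st + 4 * \<theta> * length (petals1 \<phi> Ls st a) \<le> potential \<theta> (petals1 \<phi> Ls st a @ fst st, snd st)"
      by (rule unit_child[OF sp]; use Ls in \<open>auto simp: petals1_def live2_def\<close>)+
    show thesis
      by (rule that[OF r1(1)])
         (use u w r1 sq[of "length (petals1 \<phi> Ls st a)"] un \<open>a \<notin> set (fst st)\<close> in auto)
  next
    case (r2 p)
    then have "petals2 \<phi> Ls st p \<noteq> []" using \<theta> by auto
    then obtain c where c: "live3 \<phi> st (fst p) (snd p) c" by (auto simp: petals2_def filter_empty_conv)
    have w: "sparse Ls \<theta> (petals2 \<phi> Ls st p @ fst st, snd st)"
      "potential \<theta> st + 4 * \<theta> * length (petals2 \<phi> Ls st p) \<le> potential \<theta> (petals2 \<phi> Ls st p @ fst st, snd st)"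
      by (rule unit_child[OF sp]; use Ls in \<open>auto simp: petals2_def live3_def\<close>)+
    have deg: "card {b. (a, b) \<in> LB st} + card {b. (a, b) \<in> set [p] \<or> (b, a) \<in> set [p]} \<le> 2 * \<theta>" for a
    proof -
      have "{b. (a, b) \<in> set [p] \<or> (b, a) \<in> set [p]} \<subseteq> (if a = fst p then {snd p} else {fst p})"
        using c by (cases p) (auto simp: live3_def)
      then have "card {b. (a, b) \<in> set [p] \<or> (b, a) \<in> set [p]} \<le> card (if a = fst p then {snd p} else {fst p})"
        by (rule card_mono[rotated]) auto
      then have "card {b. (a, b) \<in> set [p] \<or> (b, a) \<in> set [p]} \<le> 1" by (auto split: if_splits)
      then show ?thesis using deg_small[OF r2(5), of a] \<theta> by linarith
    qed
    have u: "sparse Ls \<theta> (fst st, [p] @ snd st)" "potential \<theta> st + length [p] \<le> potential \<theta> (fst st, [p] @ snd st)"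
      by (rule pair_child[OF sp]; use deg r2 c in \<open>auto simp: live3_def\<close>)+
    show thesis
      by (rule that[OF r2(1)]) (use u w r2 sq[of "length (petals2 \<phi> Ls st p)"] in auto)
  next
    case (r3 a)
    have "4 * \<theta> ^ 2 \<ge> 1" using \<theta> by simp
    then have "petals3 \<phi> Ls st a \<noteq> []" using r3(3) by auto
    then have "a \<notin> set (fst st)" by (auto simp: petals3_def filter_empty_conv live3_def)
    note u = unit_child[OF sp, of "[a]"]
    have deg: "card {c. (b, c) \<in> LB st} + card {c. (b, c) \<in> set (petals3 \<phi> Ls st a) \<or> (c, b) \<in> set (petals3 \<phi> Ls st a)} \<le> 2 * \<theta>" for b
    proof (cases "b \<in> set Ls")
      case True
      \<comment> \<open>The pairs that the third rule adds at \<open>b\<close> are given by petals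
        of the heart formed by \<open>a\<close> and \<open>b\<close>.\<close>
      have "{c. (b, c) \<in> set (petals3 \<phi> Ls st a) \<or> (c, b) \<in> set (petals3 \<phi> Ls st a)} \<subseteq> set (petals2 \<phi> Ls st (a, b))"
        using live3_perm(2) by (auto simp: petals3_def petals2_def)
      then have "card {c. (b, c) \<in> set (petals3 \<phi> Ls st a) \<or> (c, b) \<in> set (petals3 \<phi> Ls st a)} \<le> length (petals2 \<phi> Ls st (a, b))"
        by (meson List.finite_set card_length card_mono le_trans)
      moreover have "length (petals2 \<phi> Ls st (a, b)) < \<theta>" using r3(2,5) True by auto
      ultimately show ?thesis using deg_small[OF r3(4), of b] by linarith
    next
      case False
      then have "{c. (b, c) \<in> set (petals3 \<phi> Ls st a) \<or> (c, b) \<in> set (petals3 \<phi> Ls st a)} = {}" by (auto simp: petals3_def)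
      then show ?thesis using deg_small[OF r3(4), of b] by (simp only: card.empty)
    qed
    have w: "sparse Ls \<theta> (fst st, petals3 \<phi> Ls st a @ snd st)"
      "potential \<theta> st + length (petals3 \<phi> Ls st a) \<le> potential \<theta> (fst st, petals3 \<phi> Ls st a @ snd st)"
      by (rule pair_child[OF sp]; use deg Ls in \<open>auto simp: petals3_def live3_def distinct_product\<close>)+
    show thesis
      by (rule that[OF r3(1)]) (use u w r3 un \<open>a \<notin> set (fst st)\<close> in auto)
  qed
qed

lemma length_filter_product:
  assumes "\<And>x. x \<in> set xs \<Longrightarrow> length (filter (\<lambda>y. P (x, y)) ys) \<le> k"
  shows "length (filter P (List.product xs ys)) \<le> k * length xs"
proof -
  have "filter P (List.product xs ys) = concat (map (\<lambda>x. map (Pair x) (filter (\<lambda>y. P (x, y)) ys)) xs)"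
    by (simp add: product_concat_map filter_concat comp_def filter_map)
  then show ?thesis using length_concat_le[of xs "\<lambda>x. map (Pair x) (filter (\<lambda>y. P (x, y)) ys)" k] assms by simp
qed

lemma leaf_form_length:
  assumes "branch \<phi> Ls \<theta> st = []"
  shows "length (leaf_form \<phi> Ls st) \<le> 1 + length Ls * (1 + \<theta> + 4 * \<theta> ^ 2)"
proof (cases rule: branch_cases[of \<phi> Ls \<theta> st])
  case leaf
  have "length (filter (\<lambda>p. live2 \<phi> st (fst p) (snd p)) (List.product Ls Ls)) \<le> \<theta> * length Ls"
    by (rule length_filter_product) (use leaf(2) in \<open>auto simp: petals1_def less_imp_le\<close>)
  moreover have "length (filter (\<lambda>p. live3 \<phi> st (fst p) (fst (snd p)) (snd (snd p))) (List.product Ls (List.product Ls Ls))) \<le> 4 * \<theta> ^ 2 * length Ls"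
    by (rule length_filter_product) (use leaf(4) in \<open>auto simp: petals3_def less_imp_le\<close>)
  ultimately have "length (leaf_form \<phi> Ls st) \<le> 1 + (length Ls + (\<theta> * length Ls + 4 * \<theta> ^ 2 * length Ls))"
    unfolding leaf_form_def length_append length_map by (intro add_mono) auto
  then show ?thesis by (simp add: algebra_simps)
qed (use assms in auto)

text \<open>Inner nodes are counted too, because the worklist spends one step on every node.\<close>

inductive tree :: "form \<Rightarrow> lit list \<Rightarrow> nat \<Rightarrow> bstate \<Rightarrow> nat \<Rightarrow> bool" for \<phi> Ls \<theta> where
  "branch \<phi> Ls \<theta> st = [] \<Longrightarrow> tree \<phi> Ls \<theta> st 1"
| "branch \<phi> Ls \<theta> st = [c1, c2] \<Longrightarrow> tree \<phi> Ls \<theta> c1 k1 \<Longrightarrow> tree \<phi> Ls \<theta> c2 k2 \<Longrightarrow> tree \<phi> Ls \<theta> st (1 + k1 + k2)"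

text \<open>With \<open>d\<close> the potential still missing, the number of nodes obeys the
  recurrence \<open>1 + N (d - 1) + N (d - 4 * \<theta> ^ 2)\<close>. The condition on
  \<open>y\<close> makes \<open>y ^ d\<close> grow at least as fast; the factor 2 and the subtracted
  1 account for the inner nodes.\<close>

lemma tree_bound:
  fixes y :: real
  assumes sp: "sparse Ls \<theta> st" and \<theta>: "\<theta> \<ge> 1" and Ls: "distinct Ls"
    and y: "y \<ge> 1" "y ^ (4 * \<theta> ^ 2) \<ge> y ^ (4 * \<theta> ^ 2 - 1) + 1"
  shows "\<exists>k. tree \<phi> Ls \<theta> st k \<and> real k \<le> 2 * y ^ (10 * \<theta> * card (set Ls) - potential \<theta> st) - 1"
  using sp
proof (induction "10 * \<theta> * card (set Ls) - potential \<theta> st" arbitrary: st rule: less_induct)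
  case less
  let ?M = "10 * \<theta> * card (set Ls)"
  show ?case
  proof (cases "branch \<phi> Ls \<theta> st = []")
    case True
    have "1 \<le> y ^ (?M - potential \<theta> st)" using y(1) by (rule one_le_power)
    then show ?thesis using tree.intros(1)[OF True] by (intro exI[of _ 1]) auto
  next
    case False
    obtain c1 c2 where c: "branch \<phi> Ls \<theta> st = [c1, c2]" "sparse Ls \<theta> c1" "sparse Ls \<theta> c2"
      "potential \<theta> st + 1 \<le> potential \<theta> c1" "potential \<theta> st + 4 * \<theta> ^ 2 \<le> potential \<theta> c2"
      using branch_potential[OF less.prems \<theta> Ls False] by blast
    have m: "potential \<theta> c1 \<le> ?M" "potential \<theta> c2 \<le> ?M" using potential_max c by auto
    have "4 * \<theta> ^ 2 \<ge> 1" using \<theta> by simp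
    then have lt: "?M - potential \<theta> c1 < ?M - potential \<theta> st" "?M - potential \<theta> c2 < ?M - potential \<theta> st"
      using c m by linarith+
    obtain k1 k2 where k: "tree \<phi> Ls \<theta> c1 k1" "real k1 \<le> 2 * y ^ (?M - potential \<theta> c1) - 1"
      "tree \<phi> Ls \<theta> c2 k2" "real k2 \<le> 2 * y ^ (?M - potential \<theta> c2) - 1"
      using less.hyps[OF lt(1) c(2)] less.hyps[OF lt(2) c(3)] by blast
    define d where "d = ?M - potential \<theta> st"
    define G where "G = 4 * \<theta> ^ 2"
    have d: "d \<ge> G" using c m by (simp add: d_def G_def)
    have "y ^ (?M - potential \<theta> c1) \<le> y ^ (d - 1)" "y ^ (?M - potential \<theta> c2) \<le> y ^ (d - G)"
      using c m y(1) by (auto intro!: power_increasing simp: d_def G_def)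
    \<comment> \<open>This is the condition on \<open>y\<close> multiplied by
      \<open>y ^ (d - G)\<close>.\<close>
    moreover have "y ^ (d - 1) + y ^ (d - G) \<le> y ^ d"
    proof -
      have G1: "G \<ge> 1" using \<theta> by (simp add: G_def)
      have "y ^ (d - G) * (y ^ (G - 1) + 1) \<le> y ^ (d - G) * y ^ G"
        using y by (intro mult_left_mono) (auto simp: G_def)
      moreover have "y ^ (d - G) * y ^ G = y ^ d" "y ^ (d - G) * y ^ (G - 1) = y ^ (d - 1)"
        using d G1 by (simp_all flip: power_add)
      ultimately show ?thesis by (simp add: algebra_simps)
    qed
    ultimately have "real (1 + k1 + k2) \<le> 2 * y ^ d - 1" using k by simp
    then show ?thesis using tree.intros(2)[OF c(1) k(1,3)] unfolding d_def by blast
  qed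
qed

section \<open>Simulating a machine with a time budget\<close>

text \<open>A tape is a triple of the cells left of the head in reverse order, the scanned cell, and
  the cells to its right; cells beyond the lists are blank.\<close>

definition tape_upd :: "nat list \<times> nat \<times> nat list \<Rightarrow> nat \<Rightarrow> nat \<Rightarrow> nat list \<times> nat \<times> nat list" where
  "tape_upd tp b d = (if d = 0 then (tl (fst tp), nth_or 0 (fst tp) 0, b # snd (snd tp))
     else if d = 1 then (fst tp, b, snd (snd tp))
     else (b # fst tp, nth_or 0 (snd (snd tp)) 0, tl (snd (snd tp))))"

text \<open>Halting states match no entry of the table, so a halted simulation idles.\<close>

definition sim_step :: "tm \<Rightarrow> nat \<times> (nat list \<times> nat \<times> nat list) list \<Rightarrow> nat \<times> (nat list \<times> nat \<times> nat list) list" where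
  "sim_step M cfg = (case filter (\<lambda>e. fst e = fst cfg \<and> fst (snd e) = map (\<lambda>tp. fst (snd tp)) (snd cfg)) (trans_table M) of
     [] \<Rightarrow> cfg
   | e # _ \<Rightarrow> (fst (snd (snd e)), map (\<lambda>w. tape_upd (nth_or ([], 0, []) (snd cfg) (fst w)) (fst (snd w)) (snd (snd w)))
       (snd (snd (snd e)))))"

definition sim_init :: "tm \<Rightarrow> bool list \<Rightarrow> nat \<times> (nat list \<times> nat \<times> nat list) list" where
  "sim_init M y = (0, ([], nth_or 0 (map (\<lambda>b. if b then 2 else 1) y) 0, tl (map (\<lambda>b. if b then 2 else 1) y)) #
     replicate (tm_tapes M - 1) ([], 0, []))"

definition sim :: "tm \<Rightarrow> bool list \<Rightarrow> nat \<Rightarrow> nat" where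
  "sim M y T = fst (fold (\<lambda>_ c. sim_step M c) (units T) (sim_init M y))"

lemma fold_units: "fold (\<lambda>_ c. g c) ys c = (g ^^ length ys) c"
  by (induction ys arbitrary: c) (auto simp: funpow_swap1)

fun trep :: "nat list \<times> nat \<times> nat list \<Rightarrow> tape \<Rightarrow> bool" where
  "trep (l, h, r) (c, p) \<longleftrightarrow> c p = h \<and> (\<forall>j. c (p - 1 - int j) = nth_or 0 l j) \<and> (\<forall>j. c (p + 1 + int j) = nth_or 0 r j)"

lemma nth_or_Cons: "nth_or d (b # l) j = (case j of 0 \<Rightarrow> b | Suc j \<Rightarrow> nth_or d l j)"
  by (cases j) (auto simp: nth_or_def)

lemma nth_or_tl: "nth_or d (tl l) j = nth_or d l (Suc j)"
  by (cases l) (auto simp: nth_or_def)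

lemma trep_upd:
  assumes "trep tp t" shows "trep (tape_upd tp b (mcode d)) (tape_act t (b, d))"
proof -
  obtain l h r where tp: "tp = (l, h, r)" by (cases tp)
  obtain c p where t: "t = (c, p)" by (cases t)
  have c: "c p = h" "\<And>j. c (p - 1 - int j) = nth_or 0 l j" "\<And>j. c (p + 1 + int j) = nth_or 0 r j"
    using assms by (auto simp: tp t)
  show ?thesis
  proof (cases d)
    case MoveLeft
    have "(c(p := b)) (p - 1 + 1 + int j) = nth_or 0 (b # r) j" for j
      using c(3)[of "j - 1"] by (cases j) (auto simp: nth_or_Cons algebra_simps)
    moreover have "(c(p := b)) (p - 1 - 1 - int j) = nth_or 0 (tl l) j" for j
      using c(2)[of "Suc j"] by (simp add: nth_or_tl algebra_simps)
    moreover have "(c(p := b)) (p - 1) = nth_or 0 l 0" using c(2)[of 0] by simp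
    ultimately show ?thesis using MoveLeft by (simp add: tp t tape_upd_def tape_act_def)
  next
    case MoveStay
    then show ?thesis using c by (simp add: tp t tape_upd_def tape_act_def)
  next
    case MoveRight
    have "(c(p := b)) (p + 1 - 1 - int j) = nth_or 0 (b # l) j" for j
      using c(2)[of "j - 1"] by (cases j) (auto simp: nth_or_Cons algebra_simps)
    moreover have "(c(p := b)) (p + 1 + 1 + int j) = nth_or 0 (tl r) j" for j
      using c(3)[of "Suc j"] by (simp add: nth_or_tl algebra_simps)
    moreover have "(c(p := b)) (p + 1) = nth_or 0 r 0" using c(3)[of 0] by simp
    ultimately show ?thesis using MoveRight by (simp add: tp t tape_upd_def tape_act_def)
  qed
qed

context machine_run
begin

lemma sim_rel:
  "fst ((sim_step M ^^ t) (sim_init M z)) = st t \<and> length (snd ((sim_step M ^^ t) (sim_init M z))) = tm_tapes M \<and>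
   (\<forall>i<tm_tapes M. trep (snd ((sim_step M ^^ t) (sim_init M z)) ! i) (tps t ! i))"
proof (induction t)
  case 0
  let ?y = "map (\<lambda>b. if b then 2 else 1) z :: nat list"
  have blank: "trep ([], 0, []) (\<lambda>_. 0, 0)" by (simp add: nth_or_def)
  have inp: "trep ([], nth_or 0 ?y 0, tl ?y) (string_tape z, 0)"
    by (auto simp: nth_or_nth string_tape_def nth_tl nat_add_distrib)
  have len: "length (tps 0) = tm_tapes M" by (rule inv_len)
  have "trep (snd (sim_init M z) ! i) (tps 0 ! i)" if "i < tm_tapes M" for i
    using that blank inp by (cases i) (auto simp: sim_init_def tps_def tm_run_def tm_init_def)
  then show ?case using init_facts(1) tapes_pos by (simp add: sim_init_def)
next
  case (Suc t)
  define cfg where "cfg = (sim_step M ^^ t) (sim_init M z)"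
  have IH: "fst cfg = st t" "length (snd cfg) = tm_tapes M" "\<And>i. i < tm_tapes M \<Longrightarrow> trep (snd cfg ! i) (tps t ! i)"
    using Suc by (auto simp: cfg_def)
  have rd': "map (\<lambda>tp. fst (snd tp)) (snd cfg) = rd t"
  proof (rule nth_equalityI)
    show "length (map (\<lambda>tp. fst (snd tp)) (snd cfg)) = length (rd t)" using IH len_rd by simp
    fix i assume i: "i < length (map (\<lambda>tp. fst (snd tp)) (snd cfg))"
    then have "trep (snd cfg ! i) (tps t ! i)" using IH by simp
    then show "map (\<lambda>tp. fst (snd tp)) (snd cfg) ! i = rd t ! i"
      using i IH(2) rd_nth[of i t] by (cases "snd cfg ! i"; cases "tps t ! i") (auto simp: cell_def pos_def)
  qed
  let ?F = "filter (\<lambda>e. fst e = fst cfg \<and> fst (snd e) = map (\<lambda>tp. fst (snd tp)) (snd cfg)) (trans_table M)"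
  have step: "(sim_step M ^^ Suc t) (sim_init M z) = sim_step M cfg" by (simp add: cfg_def)
  show ?case
  proof (cases "halted t")
    case True
    then have "?F = []" using IH(1) by (auto simp: filter_empty_conv trans_table_mem)
    then have "sim_step M cfg = cfg" by (simp add: sim_step_def)
    then show ?thesis using step IH halted_Suc[OF True] by simp
  next
    case nh: False
    define e where "e = (st t, rd t, fst (tm_delta M (st t) (rd t)),
        map (\<lambda>i. (i, fst (snd (tm_delta M (st t) (rd t)) ! i), mcode (snd (snd (tm_delta M (st t) (rd t)) ! i)))) [0..<tm_tapes M])"
    have "e \<in> set (trans_table M)"
      using nh inv_st[of t] len_rd[of t] rd_sym[of t] by (auto simp: trans_table_mem e_def)
    then have "e \<in> set ?F" using IH(1) rd' by (simp add: e_def)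
    then obtain e' r where F: "?F = e' # r" by (cases ?F) auto
    then have "e' \<in> set (trans_table M)" "fst e' = st t" "fst (snd e') = rd t"
      using filter_ConsD[OF F] IH(1) rd' by auto
    then have "e' = e" by (auto simp: trans_table_mem e_def)
    then have s: "sim_step M cfg = (fst (snd (snd e)), map (\<lambda>w. tape_upd (nth_or ([], 0, []) (snd cfg) (fst w)) (fst (snd w)) (snd (snd w)))
       (snd (snd (snd e))))" using F by (simp add: sim_step_def)
    have len: "length (snd (tm_delta M (st t) (rd t))) = tm_tapes M" using delta_valid(2)[OF M inv_st len_rd rd_sym] .
    have "trep (snd (sim_step M cfg) ! i) (tps (Suc t) ! i)" if i: "i < tm_tapes M" for i
    proof -
      have "snd (sim_step M cfg) ! i = tape_upd (snd cfg ! i) (fst (act t i)) (mcode (snd (act t i)))"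
        using i IH(2) by (simp add: s e_def act_def nth_or_nth)
      moreover have "tps (Suc t) ! i = tape_act (tps t ! i) (fst (act t i), snd (act t i))"
        using running_Suc[OF nh] i inv_len[of t] len by (simp add: act_def)
      ultimately show ?thesis using trep_upd[OF IH(3)[OF i], of "fst (act t i)" "snd (act t i)"] by (simp only:)
    qed
    moreover have "fst (sim_step M cfg) = st (Suc t)" using running_Suc[OF nh] by (simp add: s e_def)
    moreover have "length (snd (sim_step M cfg)) = tm_tapes M" by (simp add: s e_def)
    ultimately show ?thesis using step by simp
  qed
qed

lemma sim_st: "sim M z t = st t"
  using sim_rel[of t] by (simp add: sim_def fold_units)

end

lemma sim_run: "turing_machine M \<Longrightarrow> sim M y t = fst (tm_run M y t)"
  using machine_run.sim_st[of M y t] machine_run.intro[of M] machine_run.st_def[of M y t] by simp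

lemma sz_tape_upd: "sz (tape_upd tp b d) \<le> sz tp + sz b + 5"
proof -
  obtain l h r where tp: "tp = (l, h, r)" by (cases tp)
  have t: "sz (tl xs) + sz (nth_or 0 xs 0) \<le> sz xs + 1" for xs :: "nat list"
    by (cases xs) (auto simp: nth_or_def)
  show ?thesis using t[of l] t[of r] by (auto simp: tape_upd_def tp)
qed

lemma pt_tape_upd [pt_intros]: "pt tp \<Longrightarrow> pt b \<Longrightarrow> pt d \<Longrightarrow> pt (\<lambda>x. tape_upd (tp x) (b x) (d x))"
  unfolding tape_upd_def by (intro pt_intros)

lemma pt_sim_step [pt_intros]: assumes "pt f" shows "pt (\<lambda>x. sim_step M (f x))"
  unfolding sim_step_def by (intro pt_intros assms pt_comp[OF assms])

lemma pt_sim_init [pt_intros]: assumes "pt f" shows "pt (\<lambda>x. sim_init M (f x))"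
  unfolding sim_init_def by (intro pt_intros assms)

text \<open>A step enlarges a tape by at most a constant, so the simulated configuration remains
  polynomial in input and number of steps.\<close>

lemma sim_step_bound:
  assumes "sz (fst cfg) \<le> E" "length (snd cfg) \<le> E" "\<forall>tp\<in>set (snd cfg). sz tp \<le> B" "sz (trans_table M) \<le> E" "5 \<le> B"
  shows "sz (fst (sim_step M cfg)) \<le> E \<and> length (snd (sim_step M cfg)) \<le> E \<and> (\<forall>tp\<in>set (snd (sim_step M cfg)). sz tp \<le> B + (E + 5))"
proof (cases "filter (\<lambda>e. fst e = fst cfg \<and> fst (snd e) = map (\<lambda>tp. fst (snd tp)) (snd cfg)) (trans_table M)")
  case Nil
  then show ?thesis using assms by (auto simp: sim_step_def)
next
  case (Cons e r)
  have e: "e \<in> set (trans_table M)" using filter_ConsD[OF Cons] by blast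
  have sze: "sz e \<le> E" using sz_elem_le[OF e] assms(4) by simp
  have comp: "sz (fst (snd (snd e))) \<le> E" "sz (snd (snd (snd e))) \<le> E" using sze by (cases e; auto)+
  have len: "length (snd (snd (snd e))) \<le> E" using length_le_sz[of "snd (snd (snd e))"] comp by simp
  have w: "sz (fst (snd w)) \<le> E" if "w \<in> set (snd (snd (snd e)))" for w
    using sz_elem_le[OF that] comp(2) by (cases w) auto
  have tp: "sz (nth_or ([], 0, []) (snd cfg) i) \<le> B" for i
    using assms(3,5) by (auto simp: nth_or_nth)
  have "sz (tape_upd (nth_or ([], 0, []) (snd cfg) (fst w)) (fst (snd w)) (snd (snd w))) \<le> B + (E + 5)"
    if "w \<in> set (snd (snd (snd e)))" for w
    using sz_tape_upd[of "nth_or ([], 0, []) (snd cfg) (fst w)" "fst (snd w)" "snd (snd w)"] tp[of "fst w"] w[OF that] by linarith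
  then show ?thesis using Cons comp(1) len by (auto simp: sim_step_def)
qed

lemma pt_sim [pt_intros]: assumes y: "pt y" and T: "pt T" shows "pt (\<lambda>x. sim M (y x) (T x))"
proof -
  define E where "E = sz (trans_table M) + tm_tapes M + 1"
  define I where "I x = sim_init M (y x)" for x
  define b0 where "b0 x = sz (I x) + 5" for x
  have I: "pt I" unfolding I_def by (intro pt_intros y)
  have inv: "sz (fst ((sim_step M ^^ j) (I x))) \<le> E \<and> length (snd ((sim_step M ^^ j) (I x))) \<le> E \<and>
      (\<forall>tp\<in>set (snd ((sim_step M ^^ j) (I x))). sz tp \<le> b0 x + j * (E + 5))" for j x
  proof (induction j)
    case 0
    have "sz tp \<le> b0 x" if "tp \<in> set (snd (I x))" for tp
      using sz_elem_le[OF that] by (cases "I x") (auto simp: b0_def)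
    then show ?case by (auto simp: E_def I_def sim_init_def)
  next
    case (Suc j)
    have "5 \<le> b0 x + j * (E + 5)" by (simp add: b0_def)
    from sim_step_bound[OF _ _ _ _ this, of "(sim_step M ^^ j) (I x)" E M] Suc
    have "sz (fst (sim_step M ((sim_step M ^^ j) (I x)))) \<le> E \<and> length (snd (sim_step M ((sim_step M ^^ j) (I x)))) \<le> E \<and>
      (\<forall>tp\<in>set (snd (sim_step M ((sim_step M ^^ j) (I x)))). sz tp \<le> b0 x + j * (E + 5) + (E + 5))"
      by (simp add: E_def)
    then show ?case by (simp add: algebra_simps)
  qed
  have "pt (\<lambda>x. fold (\<lambda>_ c. sim_step M c) (units (T x)) (I x))"
  proof (rule pt_fold)
    show "pb (\<lambda>x. E + (E * (b0 x + sz (T x) * (E + 5) + 1) + 1) + 1)"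
      unfolding b0_def by (intro pb_intros pt_sz I T)
    show "sz (fold (\<lambda>_ c. sim_step M c) ys (I x)) \<le> E + (E * (b0 x + sz (T x) * (E + 5) + 1) + 1) + 1"
      if "units (T x) = ys @ zs" for x ys zs
    proof -
      define j where "j = length ys"
      have "j \<le> T x" using arg_cong[OF that, of length] by (simp add: j_def)
      then have j: "j \<le> sz (T x)" by simp
      define cfg where "cfg = (sim_step M ^^ j) (I x)"
      note iv = inv[of j x, folded cfg_def]
      have "\<forall>tp\<in>set (snd cfg). sz tp \<le> b0 x + sz (T x) * (E + 5)"
        using iv mult_le_mono1[OF j, of "E + 5"] by (meson add_left_mono le_trans)
      then have "sz (snd cfg) \<le> length (snd cfg) * (b0 x + sz (T x) * (E + 5) + 1) + 1" by (rule sz_list_le)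
      also have "\<dots> \<le> E * (b0 x + sz (T x) * (E + 5) + 1) + 1" using iv by (intro add_mono mult_le_mono1) auto
      finally have "sz cfg \<le> E + (E * (b0 x + sz (T x) * (E + 5) + 1) + 1) + 1"
        using iv by (cases cfg) simp
      then show ?thesis by (simp add: fold_units j_def cfg_def)
    qed
  qed (intro pt_intros I T)+
  then show ?thesis unfolding sim_def I_def by (intro pt_intros)
qed

section \<open>Reading a formula\<close>

type_synonym pstate = "nat \<times> nat \<times> nat \<times> bool \<times> lit list \<times> form"

abbreviation (input) "p_mode (s :: pstate) \<equiv> fst s"
abbreviation (input) "p_num (s :: pstate) \<equiv> fst (snd s)"
abbreviation (input) "p_var (s :: pstate) \<equiv> fst (snd (snd s))"
abbreviation (input) "p_sign (s :: pstate) \<equiv> fst (snd (snd (snd s)))"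
abbreviation (input) "p_clause (s :: pstate) \<equiv> fst (snd (snd (snd (snd s))))"
abbreviation (input) "p_form (s :: pstate) \<equiv> snd (snd (snd (snd (snd s))))"

text \<open>Mode 0 reads the number of variables, mode 1 expects a literal or the end of a clause,
  mode 2 reads the sign, and mode 3 counts the unary index of the variable.\<close>

definition pstep :: "bool \<Rightarrow> pstate \<Rightarrow> pstate" where
  "pstep b s = (if p_mode s = 0 then
       (if b then (0, Suc (p_num s), p_var s, p_sign s, p_clause s, p_form s)
        else (1, p_num s, p_var s, p_sign s, p_clause s, p_form s))
     else if p_mode s = 1 then
       (if b then (2, p_num s, p_var s, p_sign s, p_clause s, p_form s)
        else (1, p_num s, p_var s, p_sign s, [], p_form s @ [p_clause s]))
     else if p_mode s = 2 then (3, p_num s, 0, b, p_clause s, p_form s)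
     else
       (if b then (3, p_num s, Suc (p_var s), p_sign s, p_clause s, p_form s)
        else (1, p_num s, 0, p_sign s, p_clause s @ [([p_var s], p_sign s)], p_form s)))"

definition parse :: "bool list \<Rightarrow> pstate" where
  "parse x = fold pstep x (0, 0, 0, False, [], [])"

lemma sz_snoc: "sz (xs @ [y]) = sz xs + sz y + 1"
  using sz_append[of xs "[y]"] by simp

lemma pstep_size: "sz (pstep b s) \<le> sz s + 20"
proof -
  obtain md n v sg cl f where s: "s = (md, n, v, sg, cl, f)" by (cases s) auto
  show ?thesis using sz_bool_le[of b] sz_bool_le[of sg] by (auto simp: pstep_def s sz_snoc)
qed

lemma pt_parse [pt_intros]: assumes x: "pt x" shows "pt (\<lambda>z. parse (x z))"
  unfolding parse_def
proof (rule pt_fold[OF x])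
  show "pb (\<lambda>z. 20 * sz (x z) + 20)" by (intro pb_intros pt_sz x)
  have "sz (fold pstep ys s) \<le> sz s + 20 * length ys" for ys s
  proof (induction ys arbitrary: s)
    case (Cons y ys)
    show ?case using Cons[of "pstep y s"] pstep_size[of y s] by simp
  qed simp
  from this[of _ "(0, 0, 0, False, [], [])"]
  have *: "sz (fold pstep ys (0, 0, 0, False, [], [])) \<le> 20 + 20 * length ys" for ys
    by (rule order_trans) simp
  show "sz (fold pstep ys (0, 0, 0, False, [], [])) \<le> 20 * sz (x z) + 20" if "x z = ys @ zs" for z ys zs
    using *[of ys] length_le_sz[of "x z"] that by simp
qed (unfold pstep_def, (intro pt_intros)+)

definition conv_clause :: "(nat \<times> bool) list \<Rightarrow> lit list" where
  "conv_clause C = map (\<lambda>l. ([fst l], snd l)) C"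

lemma pstep_ones:
  "(pstep True ^^ k) (0, n, v, sg, cl, f) = (0, n + k, v, sg, cl, f)"
  "(pstep True ^^ k) (3, n, v, sg, cl, f) = (3, n, v + k, sg, cl, f)"
  by (induction k) (auto simp: pstep_def)

lemma fold_pstep_clause:
  "\<exists>sg'. fold pstep (encode_clause C) (1, n, 0, sg, cl, f) = (1, n, 0, sg', [], f @ [cl @ conv_clause C])"
proof (induction C arbitrary: sg cl)
  case Nil
  then show ?case by (simp add: encode_clause_def pstep_def conv_clause_def)
next
  case (Cons l C)
  obtain v b where l: "l = (v, b)" by fastforce
  have "encode_clause (l # C) = True # b # replicate v True @ False # encode_clause C"
    by (simp add: encode_clause_def encode_unary_def l)
  then have "fold pstep (encode_clause (l # C)) (1, n, 0, sg, cl, f) =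
     fold pstep (encode_clause C) (1, n, 0, b, cl @ [([v], b)], f)"
    by (simp add: pstep_def[of _ "(Suc 0, _)"] pstep_def[of _ "(2, _)"] pstep_ones) (simp add: pstep_def)
  then show ?case using Cons[of b "cl @ [([v], b)]"] by (simp add: conv_clause_def l)
qed

lemma parse_encode: "\<exists>sg. parse (encode_cnf (n, \<phi>)) = (1, n, 0, sg, [], map conv_clause \<phi>)"
proof -
  have *: "\<exists>sg'. fold pstep (concat (map encode_clause \<psi>)) (1, n, 0, sg, [], f) = (1, n, 0, sg', [], f @ map conv_clause \<psi>)" for \<psi> sg f
  proof (induction \<psi> arbitrary: sg f)
    case (Cons C \<psi>)
    obtain sg' where "fold pstep (encode_clause C) (1, n, 0, sg, [], f) = (1, n, 0, sg', [], f @ [[] @ conv_clause C])"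
      using fold_pstep_clause by blast
    then show ?case using Cons[of sg' "f @ [conv_clause C]"] by simp
  qed simp
  have "fold pstep (encode_unary n) (0, 0, 0, False, [], []) = (1, n, 0, False, [], [])"
    by (simp add: encode_unary_def pstep_ones) (simp add: pstep_def)
  then show ?thesis using *[of \<phi> False "[]"] by (simp add: parse_def)
qed

lemma fsat_conv: "fsat (map conv_clause \<phi>) \<longleftrightarrow> satisfiable \<phi>"
proof
  assume "fsat (map conv_clause \<phi>)"
  then obtain \<alpha> where "\<forall>C\<in>set \<phi>. \<exists>l\<in>set C. \<alpha> [fst l] = snd l" by (auto simp: fsat_def conv_clause_def)
  then show "satisfiable \<phi>" unfolding satisfiable_def by (intro exI[of _ "\<lambda>v. \<alpha> [v]"]) (auto simp: case_prod_beta)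
next
  assume "satisfiable \<phi>"
  then obtain \<alpha> where "\<forall>C\<in>set \<phi>. \<exists>(v, b)\<in>set C. \<alpha> v = b" by (auto simp: satisfiable_def)
  then have "\<forall>C\<in>set \<phi>. \<exists>l\<in>set C. \<alpha> (fst l) = snd l" by (simp add: case_prod_beta)
  then show "fsat (map conv_clause \<phi>)" unfolding fsat_def conv_clause_def
    by (intro exI[of _ "\<lambda>x. \<alpha> (hd x)"]) auto
qed

definition all_lits :: "nat \<Rightarrow> lit list" where
  "all_lits n = concat (map (\<lambda>v. [([v], True), ([v], False)]) [0..<n])"

lemma all_lits: "distinct (all_lits n)" "length (all_lits n) = 2 * n" "([v], b) \<in> set (all_lits n) \<longleftrightarrow> v < n"
proof -
  show "([v], b) \<in> set (all_lits n) \<longleftrightarrow> v < n" for v b by (cases b) (auto simp: all_lits_def)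
  show "length (all_lits n) = 2 * n" by (induction n) (auto simp: all_lits_def)
  show "distinct (all_lits n)" by (induction n) (auto simp: all_lits_def)
qed

lemma pt_all_lits [pt_intros]: "pt n \<Longrightarrow> pt (\<lambda>x. all_lits (n x))"
  unfolding all_lits_def by (intro pt_intros)

section \<open>Deciding a formula through its branching tree\<close>

lemma pt_inB [pt_intros]: "pt st \<Longrightarrow> pt a \<Longrightarrow> pt b \<Longrightarrow> pt (\<lambda>x. inB (st x) (a x) (b x))"
  unfolding inB_def by (intro pt_intros)

lemma pt_cl1 [pt_intros]: assumes p: "pt \<phi>" and a: "pt a" shows "pt (\<lambda>x. cl1 (\<phi> x) (a x))"
  unfolding cl1_def by (intro pt_intros p a pt_comp[OF a])

lemma pt_cl2 [pt_intros]: assumes p: "pt \<phi>" and a: "pt a" and b: "pt b" shows "pt (\<lambda>x. cl2 (\<phi> x) (a x) (b x))"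
  unfolding cl2_def by (intro pt_intros p pt_comp[OF a] pt_comp[OF b])

lemma pt_cl3 [pt_intros]: assumes p: "pt \<phi>" and a: "pt a" and b: "pt b" and c: "pt c"
  shows "pt (\<lambda>x. cl3 (\<phi> x) (a x) (b x) (c x))"
  unfolding cl3_def by (intro pt_intros p pt_comp[OF a] pt_comp[OF b] pt_comp[OF c])

lemma pt_live2 [pt_intros]: "pt \<phi> \<Longrightarrow> pt st \<Longrightarrow> pt a \<Longrightarrow> pt b \<Longrightarrow> pt (\<lambda>x. live2 (\<phi> x) (st x) (a x) (b x))"
  unfolding live2_def by (intro pt_intros)

lemma pt_live3 [pt_intros]:
  "pt \<phi> \<Longrightarrow> pt st \<Longrightarrow> pt a \<Longrightarrow> pt b \<Longrightarrow> pt c \<Longrightarrow> pt (\<lambda>x. live3 (\<phi> x) (st x) (a x) (b x) (c x))"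
  unfolding live3_def by (intro pt_intros)

lemma pt_petals [pt_intros]:
  assumes p: "pt \<phi>" and L: "pt Ls" and s: "pt st"
  shows "pt a \<Longrightarrow> pt (\<lambda>x. petals1 (\<phi> x) (Ls x) (st x) (a x))"
    "pt q \<Longrightarrow> pt (\<lambda>x. petals2 (\<phi> x) (Ls x) (st x) (q x))"
    "pt a \<Longrightarrow> pt (\<lambda>x. petals3 (\<phi> x) (Ls x) (st x) (a x))"
  unfolding petals1_def petals2_def petals3_def
  by (intro pt_intros p L s pt_comp[OF p] pt_comp[OF s]; erule pt_comp; intro pt_intros)+

lemma pt_branch [pt_intros]:
  assumes p: "pt \<phi>" and L: "pt Ls" and t: "pt \<theta>" and s: "pt st"
  shows "pt (\<lambda>x. branch (\<phi> x) (Ls x) (\<theta> x) (st x))"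
  unfolding branch_def
  by (intro pt_intros p L s t pt_comp[OF p] pt_comp[OF s] pt_comp[OF L] pt_comp[OF t])

lemma pt_leaf_form [pt_intros]:
  assumes p: "pt \<phi>" and L: "pt Ls" and s: "pt st"
  shows "pt (\<lambda>x. leaf_form (\<phi> x) (Ls x) (st x))"
  unfolding leaf_form_def
  by (intro pt_intros p L s pt_comp[OF p] pt_comp[OF s] pt_comp[OF L])

type_synonym wstate = "bstate list \<times> bool \<times> bool"

text \<open>Depth-first search with a worklist of nodes. The first flag reports an accepted leaf,
  the second that some simulation was not finished within \<open>T\<close> steps, in which case the
  outcome must not be trusted.\<close>

definition wstep :: "tm \<Rightarrow> nat \<Rightarrow> form \<Rightarrow> lit list \<Rightarrow> nat \<Rightarrow> nat \<Rightarrow> wstate \<Rightarrow> wstate" where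
  "wstep M s \<phi> Ls \<theta> T w = (case fst w of [] \<Rightarrow> w
     | st # r \<Rightarrow> (if branch \<phi> Ls \<theta> st = [] then
           (r, fst (snd w) \<or> sim M (gstr s (leaf_form \<phi> Ls st)) T = 1,
             snd (snd w) \<or> (sim M (gstr s (leaf_form \<phi> Ls st)) T \<noteq> 1 \<and> sim M (gstr s (leaf_form \<phi> Ls st)) T \<noteq> 2))
         else (branch \<phi> Ls \<theta> st @ r, snd w)))"

text \<open>The same budget \<open>T\<close> limits the number of visited nodes and the length of
  each simulation.\<close>

definition wl :: "tm \<Rightarrow> nat \<Rightarrow> form \<Rightarrow> lit list \<Rightarrow> nat \<Rightarrow> nat \<Rightarrow> wstate" where
  "wl M s \<phi> Ls \<theta> T = fold (\<lambda>_ w. wstep M s \<phi> Ls \<theta> T w) (units T) ([([], [])], False, False)"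

lemmas pt_gstr' [pt_intros] = pt_comp[OF pt_gstr]

lemma pt_wstep [pt_intros]:
  assumes p: "pt \<phi>" and L: "pt Ls" and t: "pt \<theta>" and T: "pt T" and w: "pt w"
  shows "pt (\<lambda>x. wstep M s (\<phi> x) (Ls x) (\<theta> x) (T x) (w x))"
  unfolding wstep_def
  by (intro pt_intros p L t T w pt_comp[OF p] pt_comp[OF L] pt_comp[OF t] pt_comp[OF T] pt_comp[OF w])

lemma sz_filter: "sz (filter P xs) \<le> sz xs"
  by (induction xs) auto

lemma branch_sz:
  assumes c: "c \<in> set (branch \<phi> Ls \<theta> st)"
  shows "sz c \<le> sz st + (sz Ls + sz (List.product Ls Ls) + 10)"
proof -
  obtain u b where st: "st = (u, b)" by (cases st)
  have a: "sz (xs @ ys) \<le> sz xs + sz ys" for xs ys :: "'x::enc list" using sz_append[of xs ys] by simp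
  have el: "sz x \<le> sz xs" if "x \<in> set xs" for x :: "'x::enc" and xs using sz_elem_le[OF that] by simp
  show ?thesis
  proof (cases rule: branch_cases[of \<phi> Ls \<theta> st])
    case leaf then show ?thesis using c by simp
  next
    case (r1 x)
    have "sz (petals1 \<phi> Ls st x) \<le> sz Ls" by (simp add: petals1_def sz_filter)
    then show ?thesis using c r1(1) el[OF r1(2)] a[of "petals1 \<phi> Ls st x" u] by (auto simp: st)
  next
    case (r2 p)
    have "sz (petals2 \<phi> Ls st p) \<le> sz Ls" by (simp add: petals2_def sz_filter)
    moreover have "p \<in> set (List.product Ls Ls)" using r2(2,3) by (cases p) auto
    ultimately show ?thesis using c r2(1) el[of p "List.product Ls Ls"] a[of "petals2 \<phi> Ls st p" u] by (auto simp: st)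
  next
    case (r3 x)
    have "sz (petals3 \<phi> Ls st x) \<le> sz (List.product Ls Ls)" by (simp add: petals3_def sz_filter)
    then show ?thesis using c r3(1) el[OF r3(2)] a[of "petals3 \<phi> Ls st x" b] by (auto simp: st)
  qed
qed

lemma branch_length: "branch \<phi> Ls \<theta> st = [] \<or> length (branch \<phi> Ls \<theta> st) = 2"
  by (cases rule: branch_cases[of \<phi> Ls \<theta> st]) auto

text \<open>A step puts at most two nodes in place of one, each larger by a polynomial amount. So
  the work for a given \<open>T\<close> is polynomial in \<open>T\<close>, although \<open>T\<close>
  itself becomes exponential.\<close>

lemma wstep_size:
  "length (fst ((wstep M s \<phi> Ls \<theta> T ^^ j) ([([], [])], False, False))) \<le> 1 + j \<and>
   (\<forall>st\<in>set (fst ((wstep M s \<phi> Ls \<theta> T ^^ j) ([([], [])], False, False))).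
      sz st \<le> 3 + j * (sz Ls + sz (List.product Ls Ls) + 10))"
proof (induction j)
  case (Suc j)
  define w where "w = (wstep M s \<phi> Ls \<theta> T ^^ j) ([([], [])], False, False)"
  let ?K = "sz Ls + sz (List.product Ls Ls) + 10"
  have IH: "length (fst w) \<le> 1 + j" "\<forall>st\<in>set (fst w). sz st \<le> 3 + j * ?K" using Suc by (auto simp: w_def)
  have "length (fst (wstep M s \<phi> Ls \<theta> T w)) \<le> 1 + Suc j \<and> (\<forall>st\<in>set (fst (wstep M s \<phi> Ls \<theta> T w)). sz st \<le> 3 + j * ?K + ?K)"
  proof (cases "fst w")
    case Nil
    then show ?thesis by (simp add: wstep_def)
  next
    case (Cons st r)
    have l: "length r \<le> j" "sz st \<le> 3 + j * ?K" "\<forall>st\<in>set r. sz st \<le> 3 + j * ?K" using IH Cons by auto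
    have b: "\<forall>c\<in>set (branch \<phi> Ls \<theta> st). sz c \<le> 3 + j * ?K + ?K"
    proof
      fix c assume "c \<in> set (branch \<phi> Ls \<theta> st)"
      from branch_sz[OF this] l(2) show "sz c \<le> 3 + j * ?K + ?K" by linarith
    qed
    have r: "\<forall>c\<in>set r. sz c \<le> 3 + j * ?K + ?K" using l(3) trans_le_add1 by blast
    show ?thesis using Cons branch_length[of \<phi> Ls \<theta> st] l(1) b r by (auto simp: wstep_def)
  qed
  then show ?case by (simp add: w_def algebra_simps)
qed simp

lemma pt_wl [pt_intros]:
  assumes p: "pt \<phi>" and L: "pt Ls" and t: "pt \<theta>" and T: "pt T"
  shows "pt (\<lambda>x. wl M s (\<phi> x) (Ls x) (\<theta> x) (T x))"
  unfolding wl_def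
proof (rule pt_fold)
  let ?B = "\<lambda>x. 3 + sz (T x) * (sz (Ls x) + sz (List.product (Ls x) (Ls x)) + 10)"
  show "pb (\<lambda>x. (1 + sz (T x)) * (?B x + 1) + 10)"
    by (intro pb_intros pt_sz T L pt_product)
  show "sz (fold (\<lambda>_ w. wstep M s (\<phi> x) (Ls x) (\<theta> x) (T x) w) ys ([([], [])], False, False)) \<le> (1 + sz (T x)) * (?B x + 1) + 10"
    if "units (T x) = ys @ zs" for x ys zs
  proof -
    define j where "j = length ys"
    have "j \<le> T x" using arg_cong[OF that, of length] by (simp add: j_def)
    then have j: "j \<le> sz (T x)" by simp
    define w where "w = (wstep M s (\<phi> x) (Ls x) (\<theta> x) (T x) ^^ j) ([([], [])], False, False)"
    note iv = wstep_size[where M = M and s = s and \<phi> = "\<phi> x" and Ls = "Ls x" and \<theta> = "\<theta> x" and T = "T x" and j = j, folded w_def]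
    have "\<forall>st\<in>set (fst w). sz st \<le> ?B x"
      using iv mult_le_mono1[OF j, of "sz (Ls x) + sz (List.product (Ls x) (Ls x)) + 10"] by (meson add_left_mono le_trans)
    then have "sz (fst w) \<le> length (fst w) * (?B x + 1) + 1" by (rule sz_list_le)
    also have "\<dots> \<le> (1 + sz (T x)) * (?B x + 1) + 1" using iv j by (intro add_mono mult_le_mono1) auto
    finally have "sz w \<le> (1 + sz (T x)) * (?B x + 1) + 10"
      using sz_bool_le[of "fst (snd w)"] sz_bool_le[of "snd (snd w)"] by (cases w) (auto simp del: mult_Suc)
    then show ?thesis by (simp add: fold_units j_def w_def)
  qed
  show "pt (\<lambda>pa. wstep M s (\<phi> (fst pa)) (Ls (fst pa)) (\<theta> (fst pa)) (T (fst pa)) (snd (snd pa)))"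
    by (intro pt_intros pt_comp[OF p] pt_comp[OF L] pt_comp[OF t] pt_comp[OF T])
qed (intro pt_intros T)+

text \<open>The rate at which the assumed running time is subexponential need not be computable. Trying all
  thresholds up to the budget \<open>T\<close> makes a single machine good enough for every rate at once.\<close>

definition solve :: "tm \<Rightarrow> nat \<Rightarrow> bool list \<times> nat \<Rightarrow> bool \<times> bool" where
  "solve M s xT = (case filter (\<lambda>\<theta>. 1 \<le> \<theta> \<and> fst (wl M s (p_form (parse (fst xT))) (all_lits (p_num (parse (fst xT)))) \<theta> (snd xT)) = [] \<and>
        \<not> snd (snd (wl M s (p_form (parse (fst xT))) (all_lits (p_num (parse (fst xT)))) \<theta> (snd xT)))) [0..<Suc (snd xT)] of
     [] \<Rightarrow> (False, False)
   | \<theta> # _ \<Rightarrow> (True, fst (snd (wl M s (p_form (parse (fst xT))) (all_lits (p_num (parse (fst xT)))) \<theta> (snd xT)))))"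

lemma pt_solve: "pt (solve M s)"
proof -
  have "pt (\<lambda>xT. solve M s xT)" unfolding solve_def by (intro pt_intros)
  then show ?thesis by simp
qed

lemma solve_encode:
  "solve M s (encode_cnf (n, \<phi>), T) = (case filter (\<lambda>\<theta>. 1 \<le> \<theta> \<and> fst (wl M s (map conv_clause \<phi>) (all_lits n) \<theta> T) = [] \<and>
        \<not> snd (snd (wl M s (map conv_clause \<phi>) (all_lits n) \<theta> T))) [0..<Suc T] of
     [] \<Rightarrow> (False, False) | \<theta> # _ \<Rightarrow> (True, fst (snd (wl M s (map conv_clause \<phi>) (all_lits n) \<theta> T))))"
proof -
  obtain sg where p: "parse (encode_cnf (n, \<phi>)) = (1, n, 0, sg, [], map conv_clause \<phi>)" using parse_encode by blast
  show ?thesis by (simp only: solve_def p fst_conv snd_conv)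
qed

text \<open>\<open>Y\<close> is any problem between deletion and editing, so deletion and editing
  are both covered. Termination alone is enough for the correctness of the search.\<close>

locale decider =
  fixes M s Y
  assumes M: "turing_machine M" and s: "s \<ge> 1"
    and halts: "\<And>x. x \<in> K4_free_instances \<Longrightarrow> \<exists>t. fst (tm_run M (encode_instance x) t) = (if Y x then accept_state else reject_state)"
    and above: "\<And>x. x \<in> K4_free_instances \<Longrightarrow> diamond_free_edge_deletion s x \<Longrightarrow> Y x"
    and below: "\<And>x. x \<in> K4_free_instances \<Longrightarrow> Y x \<Longrightarrow> diamond_free_edge_editing s x"
begin

lemma final_mono:
  assumes "fst (tm_run M x t) = q" "q = 1 \<or> q = 2" "t \<le> t'" shows "fst (tm_run M x t') = q"
proof -
  interpret machine_run M x using M by unfold_locales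
  have "st t = q" "halted t" using assms by (auto simp: st_def)
  then show ?thesis using halted_mono[of t t'] assms(3) by (simp add: st_def)
qed

text \<open>A halted machine keeps its state, so a verdict reached within \<open>T\<close> steps
  agrees with the eventual one.\<close>

lemma verdict:
  assumes \<phi>: "\<forall>C\<in>set \<phi>. length C \<le> 3" and q: "sim M (gstr s \<phi>) T = q" "q = 1 \<or> q = 2"
  shows "q = 1 \<longleftrightarrow> fsat \<phi>"
proof -
  note r = reduction[OF \<phi> s]
  have "Y (inst s \<phi>) \<longleftrightarrow> fsat \<phi>" using r above below by blast
  moreover obtain t where t: "fst (tm_run M (gstr s \<phi>) t) = (if Y (inst s \<phi>) then 1 else 2)"
    using halts[OF r(1)] by (auto simp: encode_inst)
  have "q = (if Y (inst s \<phi>) then 1 else 2)"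
    using final_mono[OF t, of "max t T"] final_mono[OF q(1)[unfolded sim_run[OF M]] q(2), of "max t T"] by simp
  ultimately show ?thesis by auto
qed

text \<open>Invariant, as long as no simulation was cut off: the formula is satisfiable iff a
  satisfiable leaf was found or a pending node is satisfiable. It holds for every threshold, so a
  poor choice of \<open>\<theta>\<close> can only cost time.\<close>

lemma wl_sound:
  assumes \<phi>: "\<forall>C\<in>set \<phi>. length C \<le> 3 \<and> set C \<subseteq> set Ls" and \<theta>: "\<theta> \<ge> 1"
    and w: "fst (wl M s \<phi> Ls \<theta> T) = []" "\<not> snd (snd (wl M s \<phi> Ls \<theta> T))"
  shows "fst (snd (wl M s \<phi> Ls \<theta> T)) \<longleftrightarrow> fsat \<phi>"
proof -
  have inv: "(\<forall>st\<in>set (fst w). wf_node Ls st) \<and> (\<not> snd (snd w) \<longrightarrow> (fst (snd w) \<or> (\<exists>st\<in>set (fst w). node_sat \<phi> st)) = fsat \<phi>)"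
    if "w = (wstep M s \<phi> Ls \<theta> T ^^ j) ([([], [])], False, False)" for j w
    using that
  proof (induction j arbitrary: w)
    case 0
    then show ?case by (simp add: wf_node_def node_sat_def fsat_holds)
  next
    case (Suc j)
    define v where "v = (wstep M s \<phi> Ls \<theta> T ^^ j) ([([], [])], False, False)"
    note IH = Suc.IH[OF v_def]
    have w: "w = wstep M s \<phi> Ls \<theta> T v" using Suc.prems by (simp add: v_def)
    show ?case
    proof (cases "fst v")
      case Nil
      then show ?thesis using IH w by (simp add: wstep_def)
    next
      case (Cons st r)
      have wf: "wf_node Ls st" "\<forall>st\<in>set r. wf_node Ls st" using IH Cons by auto
      show ?thesis
      proof (cases "branch \<phi> Ls \<theta> st = []")
        case True
        define q where "q = sim M (gstr s (leaf_form \<phi> Ls st)) T"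
        have w': "w = (r, fst (snd v) \<or> q = 1, snd (snd v) \<or> (q \<noteq> 1 \<and> q \<noteq> 2))"
          using w Cons True by (simp add: wstep_def q_def)
        have "q = 1 \<longleftrightarrow> node_sat \<phi> st" if "q = 1 \<or> q = 2"
          using verdict[OF _ q_def[symmetric] that] leaf_form_three leaf_form_sat[OF \<phi> wf(1)] by blast
        then show ?thesis using IH Cons wf(2) by (simp add: w') blast
      next
        case False
        have w': "w = (branch \<phi> Ls \<theta> st @ r, snd v)" using w Cons False by (simp add: wstep_def)
        have "\<forall>c\<in>set (branch \<phi> Ls \<theta> st). wf_node Ls c" using branch_wf[OF wf(1) _ \<theta>] by blast
        then show ?thesis using IH Cons wf(2) branch_sat[OF False] by (simp add: w' ball_Un bex_Un)
      qed
    qed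
  qed
  have "wl M s \<phi> Ls \<theta> T = (wstep M s \<phi> Ls \<theta> T ^^ T) ([([], [])], False, False)" by (simp add: wl_def fold_units)
  from inv[OF this] w show ?thesis by simp
qed

text \<open>The search finishes a subtree before touching the rest of the worklist, after as many
  steps as the subtree has nodes.\<close>

lemma wl_complete:
  assumes tr: "tree \<phi> Ls \<theta> st k"
    and T: "\<And>st. branch \<phi> Ls \<theta> st = [] \<Longrightarrow> sim M (gstr s (leaf_form \<phi> Ls st)) T \<in> {1, 2}"
  shows "\<exists>f'. (wstep M s \<phi> Ls \<theta> T ^^ k) (st # r, f, e) = (r, f', e)"
  using tr
proof (induction arbitrary: r f)
  case (1 st)
  then show ?case using T[OF 1] by (auto simp: wstep_def)
next
  case (2 st c1 c2 k1 k2)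
  obtain f1 where 1: "(wstep M s \<phi> Ls \<theta> T ^^ k1) (c1 # c2 # r, f, e) = (c2 # r, f1, e)" using 2 by blast
  obtain f2 where 2: "(wstep M s \<phi> Ls \<theta> T ^^ k2) (c2 # r, f1, e) = (r, f2, e)" using 2 by blast
  have 0: "wstep M s \<phi> Ls \<theta> T (st # r, f, e) = (c1 # c2 # r, f, e)" using "2.hyps" by (simp add: wstep_def)
  have "1 + k1 + k2 = k2 + (k1 + 1)" by simp
  then have "(wstep M s \<phi> Ls \<theta> T ^^ (1 + k1 + k2)) (st # r, f, e) = (r, f2, e)"
    using 0 1 2 by (simp only: funpow_add o_apply) simp
  then show ?case by blast
qed

lemma wl_finishes:
  assumes tr: "tree \<phi> Ls \<theta> ([], []) k" and k: "k \<le> T"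
    and T: "\<And>st. branch \<phi> Ls \<theta> st = [] \<Longrightarrow> sim M (gstr s (leaf_form \<phi> Ls st)) T \<in> {1, 2}"
  shows "fst (wl M s \<phi> Ls \<theta> T) = [] \<and> \<not> snd (snd (wl M s \<phi> Ls \<theta> T))"
proof -
  obtain f where f: "(wstep M s \<phi> Ls \<theta> T ^^ k) ([([], [])], False, False) = ([], f, False)"
    using wl_complete[OF tr T] by blast
  have idle: "(wstep M s \<phi> Ls \<theta> T ^^ j) ([], f, False) = ([], f, False)" for j
    by (induction j) (auto simp: wstep_def)
  have "T = (T - k) + k" using k by simp
  then have "(wstep M s \<phi> Ls \<theta> T ^^ T) ([([], [])], False, False) = ([], f, False)"
    using f idle by (metis funpow_add o_apply)
  then show ?thesis by (simp add: wl_def fold_units)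
qed

lemma solve_correct:
  assumes i: "(n, \<phi>) \<in> three_sat_instances" and f: "fst (solve M s (encode_cnf (n, \<phi>), T))"
  shows "snd (solve M s (encode_cnf (n, \<phi>), T)) \<longleftrightarrow> satisfiable \<phi>"
proof -
  let ?f = "map conv_clause \<phi>" and ?L = "all_lits n"
  have wf: "\<forall>C\<in>set ?f. length C \<le> 3 \<and> set C \<subseteq> set ?L"
    using i by (fastforce simp: three_sat_instances_def conv_clause_def all_lits)
  let ?P = "\<lambda>\<theta>. 1 \<le> \<theta> \<and> fst (wl M s ?f ?L \<theta> T) = [] \<and> \<not> snd (snd (wl M s ?f ?L \<theta> T))"
  obtain \<theta> r where F: "filter ?P [0..<Suc T] = \<theta> # r"
    using f by (cases "filter ?P [0..<Suc T]") (simp_all only: solve_encode list.case fst_conv simp_thms)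
  then have "?P \<theta>" by (rule filter_ConsD[THEN conjunct1])
  then have "fst (snd (wl M s ?f ?L \<theta> T)) \<longleftrightarrow> satisfiable \<phi>" using wl_sound[OF wf, of \<theta> T] fsat_conv by blast
  then show ?thesis by (simp only: solve_encode F list.case snd_conv)
qed

lemma solve_finishes:
  assumes \<theta>: "1 \<le> \<theta>" "\<theta> \<le> T" and tr: "tree (map conv_clause \<phi>) (all_lits n) \<theta> ([], []) k" and k: "k \<le> T"
    and T: "\<And>st. branch (map conv_clause \<phi>) (all_lits n) \<theta> st = [] \<Longrightarrow>
       \<exists>t\<le>T. fst (tm_run M (gstr s (leaf_form (map conv_clause \<phi>) (all_lits n) st)) t) \<in> {1, 2}"
  shows "fst (solve M s (encode_cnf (n, \<phi>), T))"
proof -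
  let ?f = "map conv_clause \<phi>" and ?L = "all_lits n"
  let ?P = "\<lambda>\<theta>. 1 \<le> \<theta> \<and> fst (wl M s ?f ?L \<theta> T) = [] \<and> \<not> snd (snd (wl M s ?f ?L \<theta> T))"
  have "sim M (gstr s (leaf_form ?f ?L st)) T \<in> {1, 2}" if st: "branch ?f ?L \<theta> st = []" for st
  proof -
    obtain t where t: "t \<le> T" "fst (tm_run M (gstr s (leaf_form ?f ?L st)) t) \<in> {1, 2}" using T[OF st] by blast
    then have "fst (tm_run M (gstr s (leaf_form ?f ?L st)) T) = fst (tm_run M (gstr s (leaf_form ?f ?L st)) t)"
      by (intro final_mono[OF refl _ t(1)]) blast
    then show ?thesis using t(2) by (simp only: sim_run[OF M])
  qed
  then have "?P \<theta>" using wl_finishes[OF tr k] \<theta>(1) by blast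
  then have "\<theta> \<in> set (filter ?P [0..<Suc T])" using \<theta>(2) by (simp only: set_filter set_upt mem_Collect_eq atLeastLessThan_iff) simp
  then obtain t r where "filter ?P [0..<Suc T] = t # r" by (rule list.set_cases) (rule that, assumption)+
  then show ?thesis by (simp only: solve_encode list.case fst_conv)
qed

end

section \<open>Subexponential running times\<close>

text \<open>The finitely many exceptions to the asymptotic inequality are absorbed by the additive
  constant.\<close>

lemma smallo_linear_bound:
  fixes f :: "nat \<Rightarrow> real" and \<delta> :: real
  assumes "f \<in> o(\<lambda>n. real n)" "\<delta> > 0"
  shows "\<exists>C\<ge>0. \<forall>n. f n \<le> \<delta> * real n + C"
proof -
  have "eventually (\<lambda>n. norm (f n) \<le> \<delta> * norm (real n)) at_top" using landau_o.smallD[OF assms] .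
  then obtain N where N: "\<And>n. n \<ge> N \<Longrightarrow> \<bar>f n\<bar> \<le> \<delta> * n" by (auto simp: eventually_at_top_linorder)
  let ?C = "\<Sum>n<N. \<bar>f n\<bar>"
  have "f n \<le> \<delta> * n + ?C" for n
  proof (cases "n < N")
    case True
    then have "\<bar>f n\<bar> \<le> ?C" by (intro member_le_sum) auto
    then show ?thesis using assms(2) by (simp add: add_increasing abs_le_iff)
  next
    case False
    then have "f n \<le> \<delta> * n" using N[of n] by simp
    moreover have "0 \<le> ?C" by (simp add: sum_nonneg)
    ultimately show ?thesis by linarith
  qed
  then show ?thesis by (intro exI[of _ ?C]) (simp add: sum_nonneg)
qed

lemma half_le_ln2: "(1 / 2 :: real) \<le> ln 2"
  using exp_half_le2 ln_ge_iff[of 2 "1 / 2"] by linarith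

lemma exp_le_powr: "x \<ge> 0 \<Longrightarrow> exp (x / 2) \<le> 2 powr (x :: real)"
proof -
  assume "x \<ge> 0"
  then have "x * (1 / 2) \<le> x * ln 2" by (intro mult_left_mono half_le_ln2)
  then show ?thesis by (simp add: powr_def)
qed

lemma power_le_powr:
  assumes \<epsilon>: "\<epsilon> > 0" shows "\<exists>C\<ge>0. \<forall>n. real (n + 1) ^ c \<le> 2 powr (\<epsilon> * real n + C)"
proof -
  \<comment> \<open>The 2 in the denominator pays for the passage from \<open>exp\<close> to powers
    of 2 in \<open>exp_le_powr\<close>.\<close>
  define b where "b = \<epsilon> / (2 * (real c + 1))"
  have b: "b > 0" "real c * b \<le> \<epsilon> / 2" using \<epsilon> by (auto simp: b_def field_simps)
  define A where "A = (1 + 1 / b) ^ c"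
  have A: "A \<ge> 1" using b by (simp add: A_def)
  have "real (n + 1) ^ c \<le> 2 powr (\<epsilon> * real n + log 2 A)" for n
  proof -
    have "real (n + 1) \<le> (1 + 1 / b) * (1 + b * n)" using b by (simp add: field_simps)
    also have "\<dots> \<le> (1 + 1 / b) * exp (b * n)" using b exp_ge_add_one_self[of "b * n"] by (intro mult_left_mono) auto
    finally have "real (n + 1) ^ c \<le> ((1 + 1 / b) * exp (b * n)) ^ c" by (intro power_mono) auto
    also have "\<dots> = A * exp (c * b * n)" by (simp add: A_def power_mult_distrib mult.assoc flip: exp_of_nat_mult)
    also have "\<dots> \<le> A * exp (\<epsilon> * n / 2)"
      using A mult_right_mono[OF b(2), of "real n"] by simp
    also have "\<dots> \<le> A * 2 powr (\<epsilon> * n)" using A \<epsilon> by (intro mult_left_mono exp_le_powr) auto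
    also have "\<dots> = 2 powr (\<epsilon> * real n + log 2 A)" using A by (simp add: powr_add)
    finally show ?thesis .
  qed
  moreover have "log 2 A \<ge> 0" using A by simp
  ultimately show ?thesis by blast
qed

text \<open>With \<open>y = 1 + d\<close>, the condition says that
  \<open>y ^ (4 * \<theta> ^ 2 - 1) * d\<close> is at least 1. Bernoulli's inequality gives
  \<open>y ^ (\<theta> ^ 2) \<ge> \<theta> ^ 2 * d\<close>, and its third power has degree high
  enough in \<open>\<theta>\<close> to outweigh the small factor \<open>d\<close>. The exponent
  \<open>20 * \<theta>\<close> is the maximal potential per variable, as there are two literals for
  each.\<close>

lemma branching_rate:
  fixes \<epsilon> :: real assumes \<epsilon>: "\<epsilon> > 0"
  shows "\<exists>(\<theta>::nat) (y::real). \<theta> \<ge> 1 \<and> y \<ge> 1 \<and> y ^ (4 * \<theta> ^ 2) \<ge> y ^ (4 * \<theta> ^ 2 - 1) + 1 \<and> y ^ (20 * \<theta>) \<le> 2 powr \<epsilon>"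
proof -
  \<comment> \<open>The 40 comes from \<open>20 * \<theta> * d = 20 * e = \<epsilon> / 2\<close>,
    which is what \<open>exp_le_powr\<close> requires.\<close>
  define e where "e = \<epsilon> / 40"
  have e: "e > 0" using \<epsilon> by (simp add: e_def)
  obtain \<theta> where "real \<theta> > 1 / e ^ 2 + 1" using reals_Archimedean2 by blast
  then have \<theta>: "real \<theta> \<ge> 1 / e ^ 2" "real \<theta> > 1" using e by (smt (verit) zero_less_power divide_pos_pos)+
  have \<theta>e: "real \<theta> * e ^ 2 \<ge> 1" using \<theta>(1) e by (simp add: field_simps)
  define d where "d = e / real \<theta>"
  have d: "d > 0" using e \<theta> by (simp add: d_def)
  let ?y = "1 + d"
  have "real (\<theta> ^ 2) * d = \<theta> * e" using \<theta> by (simp add: d_def power2_eq_square)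
  then have "real \<theta> * e \<le> ?y ^ (\<theta> ^ 2)" using linear_plus_1_le_power[of d "\<theta> ^ 2"] d by (simp add: add.commute)
  then have "(real \<theta> * e) ^ 3 \<le> (?y ^ (\<theta> ^ 2)) ^ 3" using e by (intro power_mono) auto
  also have "(?y ^ (\<theta> ^ 2)) ^ 3 = ?y ^ (3 * \<theta> ^ 2)" by (simp add: mult.commute flip: power_mult)
  also have "\<dots> \<le> ?y ^ (4 * \<theta> ^ 2 - 1)"
  proof (rule power_increasing)
    have "\<theta> ^ 2 \<ge> 1" using \<theta>(2) by simp
    then show "3 * \<theta> ^ 2 \<le> 4 * \<theta> ^ 2 - 1" by linarith
  qed (use d in simp)
  finally have "(real \<theta> * e) ^ 3 * d \<le> ?y ^ (4 * \<theta> ^ 2 - 1) * d" using d by simp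
  \<comment> \<open>As \<open>d = e / \<theta>\<close>, the product is
    \<open>\<theta> ^ 2 * e ^ 4\<close>; hence the requirement
    \<open>\<theta> * e ^ 2 \<ge> 1\<close> in the choice of \<open>\<theta>\<close>.\<close>
  moreover have "(real \<theta> * e) ^ 3 * d = (real \<theta> * e ^ 2) ^ 2" using \<theta> by (simp add: d_def power_mult_distrib power2_eq_square power3_eq_cube)
  moreover have "1 \<le> (real \<theta> * e ^ 2) ^ 2" using \<theta>e by (rule one_le_power)
  ultimately have 1: "1 \<le> ?y ^ (4 * \<theta> ^ 2 - 1) * d" by linarith
  have "4 * \<theta> ^ 2 = Suc (4 * \<theta> ^ 2 - 1)" using \<theta>(2) by simp
  then have "?y ^ (4 * \<theta> ^ 2) = ?y ^ (4 * \<theta> ^ 2 - 1) * ?y" by (metis power_Suc2)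
  then have 2: "?y ^ (4 * \<theta> ^ 2) \<ge> ?y ^ (4 * \<theta> ^ 2 - 1) + 1" using 1 by (simp add: algebra_simps)
  have "?y ^ (20 * \<theta>) \<le> exp d ^ (20 * \<theta>)" using d exp_ge_add_one_self[of d] by (intro power_mono) auto
  also have "\<dots> = exp (\<epsilon> / 2)" using \<theta> by (simp add: d_def e_def flip: exp_of_nat_mult)
  also have "\<dots> \<le> 2 powr \<epsilon>" using \<epsilon> by (intro exp_le_powr) simp
  finally show ?thesis using 2 d \<theta>(2) by (intro exI[of _ \<theta>] exI[of _ ?y]) auto
qed

text \<open>There are only cubically many clauses on \<open>n\<close> variables and none is
  repeated, so the input length is polynomial in \<open>n\<close> and reading the input does not
  spoil the time bound.\<close>

lemma encode_cnf_length:
  assumes "(n, \<phi>) \<in> three_sat_instances"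
  shows "length (encode_cnf (n, \<phi>)) \<le> 321 * (n + 1) ^ 4"
proof -
  have \<phi>: "distinct \<phi>" "\<And>C. C \<in> set \<phi> \<Longrightarrow> length C \<le> 3 \<and> set C \<subseteq> {..<n} \<times> UNIV"
    using assms by (auto simp: three_sat_instances_def)
  have cl: "length (encode_clause C) \<le> 10 * (n + 1)" if "C \<in> set \<phi>" for C
  proof -
    have "length (concat (map (\<lambda>(v, b). True # b # encode_unary v) C)) \<le> (n + 3) * length C"
      by (rule length_concat_le) (use \<phi>(2)[OF that] in \<open>auto simp: encode_unary_def\<close>)
    also have "\<dots> \<le> (n + 3) * 3" using \<phi>(2)[OF that] by (intro mult_le_mono2) simp
    finally show ?thesis by (simp add: encode_clause_def)
  qed
  let ?S = "{C. set C \<subseteq> {..<n} \<times> (UNIV :: bool set) \<and> length C \<le> 3}"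
  have fin: "finite ?S" by (rule finite_lists_length_le) simp
  have "card ({..<n} \<times> (UNIV :: bool set)) = 2 * n" by (simp add: card_cartesian_product)
  then have "card ?S = (\<Sum>i\<le>3. (2 * n) ^ i)" using card_lists_length_le[of "{..<n} \<times> (UNIV :: bool set)" 3] by (simp add: mult.commute)
  \<comment> \<open>All four summands are bounded by the largest, which gives
    \<open>4 * 8 = 32\<close> as leading constant.\<close>
  also have "\<dots> \<le> (\<Sum>i\<le>(3::nat). (2 * (n + 1)) ^ 3)"
  proof (rule sum_mono)
    fix i :: nat assume "i \<in> {..3}"
    then have "(2 * (n + 1)) ^ i \<le> (2 * (n + 1)) ^ 3" by (intro power_increasing) auto
    moreover have "(2 * n) ^ i \<le> (2 * (n + 1)) ^ i" by (rule power_mono) auto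
    ultimately show "(2 * n) ^ i \<le> (2 * (n + 1)) ^ 3" by (rule order_trans[rotated])
  qed
  also have "\<dots> = 32 * (n + 1) ^ 3" unfolding power_mult_distrib by simp
  finally have cS: "card ?S \<le> 32 * (n + 1) ^ 3" .
  have "length \<phi> = card (set \<phi>)" using \<phi>(1) by (simp add: distinct_card)
  also have "\<dots> \<le> card ?S" by (rule card_mono[OF fin]) (use \<phi>(2) in blast)
  finally have len: "length \<phi> \<le> 32 * (n + 1) ^ 3" using cS by simp
  have "length (concat (map encode_clause \<phi>)) \<le> 10 * (n + 1) * length \<phi>" by (rule length_concat_le) (rule cl)
  also have "\<dots> \<le> 10 * (n + 1) * (32 * (n + 1) ^ 3)" by (rule mult_le_mono2[OF len])
  also have "\<dots> = 320 * (n + 1) ^ 4"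
  proof -
    have "10 * N * (32 * N ^ 3) = 320 * N ^ 4" for N :: nat by (simp add: power_numeral_reduce)
    then show ?thesis .
  qed
  finally have "length (concat (map encode_clause \<phi>)) \<le> 320 * (n + 1) ^ 4" .
  moreover have "n + 1 \<le> (n + 1) ^ 4" using self_le_power[of "n + 1" 4] by simp
  ultimately show ?thesis by (simp add: encode_unary_def)
qed

text \<open>Running times subexponential in the number of vertices, or in the budget up to a
  polynomial factor, both satisfy \<open>fast\<close>. One machine meets the bound for every rate
  \<delta>; only the constant depends on the rate.\<close>

locale fast_decider =
  fixes M s Y
  assumes M: "turing_machine M" and s: "s \<ge> 1"
    and fast: "\<And>\<delta>. \<delta> > 0 \<Longrightarrow> \<exists>C\<ge>0. \<forall>x\<in>K4_free_instances. \<exists>t. real t \<le> 2 powr (\<delta> * (real (card (verts (fst x))) + real (snd x)) + C) \<and>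
      fst (tm_run M (encode_instance x) t) = (if Y x then accept_state else reject_state)"
    and above: "\<And>x. x \<in> K4_free_instances \<Longrightarrow> diamond_free_edge_deletion s x \<Longrightarrow> Y x"
    and below: "\<And>x. x \<in> K4_free_instances \<Longrightarrow> Y x \<Longrightarrow> diamond_free_edge_editing s x"

sublocale fast_decider \<subseteq> decider
proof
  show "\<exists>t. fst (tm_run M (encode_instance x) t) = (if Y x then accept_state else reject_state)"
    if "x \<in> K4_free_instances" for x using fast[OF zero_less_one] that by blast
qed (fact M s above below)+

context fast_decider
begin

lemma fast_formula:
  assumes \<delta>: "\<delta> > 0"
  shows "\<exists>C\<ge>0. \<forall>\<psi>. (\<forall>c\<in>set \<psi>. length c \<le> 3) \<longrightarrow>
    (\<exists>t. real t \<le> 2 powr (\<delta> * real (length \<psi>) + C) \<and> fst (tm_run M (gstr s \<psi>) t) \<in> {1, 2})"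
proof -
  \<comment> \<open>Vertices and budget of the gadget graph together:
    \<open>57 + 55 * s + 27\<close> for each clause.\<close>
  define K where "K = real (84 + 55 * s)"
  have K: "K > 0" by (simp add: K_def)
  obtain C where C: "C \<ge> 0" and t: "\<And>x. x \<in> K4_free_instances \<Longrightarrow> \<exists>t. real t \<le> 2 powr (\<delta> / K * (real (card (verts (fst x))) + real (snd x)) + C) \<and>
      fst (tm_run M (encode_instance x) t) = (if Y x then accept_state else reject_state)"
    using fast[of "\<delta> / K"] \<delta> K by auto
  have "\<exists>t. real t \<le> 2 powr (\<delta> * real (length \<psi>) + C) \<and> fst (tm_run M (gstr s \<psi>) t) \<in> {1, 2}"
    if \<psi>: "\<forall>c\<in>set \<psi>. length c \<le> 3" for \<psi>
  proof -
    note r = reduction[OF \<psi> s]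
    obtain t where t: "real t \<le> 2 powr (\<delta> / K * (real (card (verts (fst (inst s \<psi>)))) + real (snd (inst s \<psi>))) + C)"
      "fst (tm_run M (gstr s \<psi>) t) = (if Y (inst s \<psi>) then accept_state else reject_state)"
      using t[OF r(1)] by (auto simp: encode_inst)
    have "card (verts (fst (inst s \<psi>))) + snd (inst s \<psi>) \<le> (84 + 55 * s) * length \<psi>"
      using r(4,5) by (simp add: algebra_simps)
    then have "real (card (verts (fst (inst s \<psi>)))) + real (snd (inst s \<psi>)) \<le> K * real (length \<psi>)"
      unfolding K_def by (metis of_nat_add of_nat_le_iff of_nat_mult)
    then have "\<delta> / K * (real (card (verts (fst (inst s \<psi>)))) + real (snd (inst s \<psi>))) \<le> \<delta> / K * (K * real (length \<psi>))"
      using \<delta> K by (intro mult_left_mono) auto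
    also have "\<dots> = \<delta> * real (length \<psi>)" using K by simp
    finally have "real t \<le> 2 powr (\<delta> * real (length \<psi>) + C)"
      by (intro order_trans[OF t(1)] powr_mono) auto
    then show ?thesis using t(2) by (intro exI[of _ t]) auto
  qed
  then show ?thesis using C by blast
qed

text \<open>The threshold is chosen for \<open>\<epsilon>\<close> first and fixes the density of the
  leaf formulas; only then is the rate of the assumed algorithm taken so small that a run on a leaf
  fits into the same budget as the tree.\<close>

lemma solve_time:
  assumes \<epsilon>: "\<epsilon> > 0"
  shows "\<exists>C\<ge>0. \<forall>n \<phi>. (n, \<phi>) \<in> three_sat_instances \<longrightarrow>
    (\<exists>T. real T \<le> 2 powr (\<epsilon> * real n + C) \<and> fst (solve M s (encode_cnf (n, \<phi>), T)))"
proof -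
  obtain \<theta> :: nat and y :: real where \<theta>: "\<theta> \<ge> 1" and y: "y \<ge> 1" "y ^ (4 * \<theta> ^ 2) \<ge> y ^ (4 * \<theta> ^ 2 - 1) + 1" "y ^ (20 * \<theta>) \<le> 2 powr \<epsilon>"
    using branching_rate[OF \<epsilon>] by blast
  define K where "K = real (1 + \<theta> + 4 * \<theta> ^ 2)"
  have K: "K > 0" unfolding K_def by (simp only: of_nat_0_less_iff)
  \<comment> \<open>A leaf formula has at most \<open>1 + 2 * n * K\<close> clauses.\<close>
  define \<delta> where "\<delta> = \<epsilon> / (2 * K)"
  have \<delta>: "\<delta> > 0" "\<delta> * (2 * K) = \<epsilon>" using \<epsilon> K by (auto simp: \<delta>_def)
  obtain C where C: "C \<ge> 0" and run: "\<And>\<psi>. \<forall>c\<in>set \<psi>. length c \<le> 3 \<Longrightarrow>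
    \<exists>t. real t \<le> 2 powr (\<delta> * real (length \<psi>) + C) \<and> fst (tm_run M (gstr s \<psi>) t) \<in> {1, 2}"
    using fast_formula[OF \<delta>(1)] by blast
  \<comment> \<open>\<delta> and \<open>C\<close> come from the run on a leaf, 1 from the factor 2
    in the size of the tree, and \<open>\<theta>\<close> makes sure that the threshold is among
    those tried.\<close>
  define C1 where "C1 = \<delta> + C + 1 + real \<theta>"
  have "\<exists>T. real T \<le> 2 powr (\<epsilon> * real n + C1) \<and> fst (solve M s (encode_cnf (n, \<phi>), T))" for n \<phi>
  proof -
    let ?f = "map conv_clause \<phi>" and ?L = "all_lits n"
    define T where "T = nat \<lfloor>2 powr (\<epsilon> * real n + C1)\<rfloor>"
    have T: "real T \<le> 2 powr (\<epsilon> * real n + C1)" by (simp add: T_def)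
    have below: "k \<le> T" if "real k \<le> 2 powr (\<epsilon> * real n + C1)" for k
      using that by (simp add: T_def le_nat_floor)
    have \<epsilon>n: "\<epsilon> * real n \<ge> 0" using \<epsilon> by simp
    have "real \<theta> \<le> 2 powr (real \<theta>)" using of_nat_le_iff[of \<theta> "2 ^ \<theta>", where 'a = real] less_exp[of \<theta>] by (simp add: powr_realpow)
    also have "\<dots> \<le> 2 powr (\<epsilon> * real n + C1)" using \<epsilon>n \<delta> C by (intro powr_mono) (auto simp: C1_def)
    finally have \<theta>T: "\<theta> \<le> T" by (rule below)
    have "sparse ?L \<theta> ([], [])" by (simp add: sparse_def wf_node_def LB_def inB_def)
    from tree_bound[OF this \<theta> all_lits(1) y(1,2)]
    obtain k where k: "tree ?f ?L \<theta> ([], []) k"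
      "real k \<le> 2 * y ^ (10 * \<theta> * card (set ?L) - potential \<theta> ([], [])) - 1" by blast
    have card: "card (set ?L) = 2 * n" using all_lits by (simp add: distinct_card)
    have "y ^ (10 * \<theta> * card (set ?L) - potential \<theta> ([], [])) \<le> y ^ (20 * \<theta> * n)"
      using y(1) by (intro power_increasing) (auto simp: card)
    also have "\<dots> = (y ^ (20 * \<theta>)) ^ n" by (simp add: power_mult)
    also have "\<dots> \<le> (2 powr \<epsilon>) ^ n" using y by (intro power_mono) auto
    also have "\<dots> = 2 powr (\<epsilon> * n)" by (simp add: powr_power mult.commute)
    finally have "real k \<le> 2 * 2 powr (\<epsilon> * n)" using k(2) by linarith
    also have "\<dots> = 2 powr (\<epsilon> * n + 1)" by (simp add: powr_add)
    also have "\<dots> \<le> 2 powr (\<epsilon> * real n + C1)" using \<delta> C by (intro powr_mono) (auto simp: C1_def)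
    finally have kT: "k \<le> T" by (rule below)
    have "\<exists>t\<le>T. fst (tm_run M (gstr s (leaf_form ?f ?L st)) t) \<in> {1, 2}" if st: "branch ?f ?L \<theta> st = []" for st
    proof -
      obtain t where t: "real t \<le> 2 powr (\<delta> * real (length (leaf_form ?f ?L st)) + C)"
        "fst (tm_run M (gstr s (leaf_form ?f ?L st)) t) \<in> {1, 2}"
        using run[of "leaf_form ?f ?L st"] leaf_form_three by blast
      have "length (leaf_form ?f ?L st) \<le> 1 + 2 * n * (1 + \<theta> + 4 * \<theta> ^ 2)"
        using leaf_form_length[OF st] by (simp add: all_lits)
      then have "real (length (leaf_form ?f ?L st)) \<le> real (1 + 2 * n * (1 + \<theta> + 4 * \<theta> ^ 2))" by (simp only: of_nat_le_iff)
      also have "\<dots> = 1 + 2 * real n * K" unfolding K_def by (simp add: algebra_simps)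
      finally have "\<delta> * real (length (leaf_form ?f ?L st)) \<le> \<delta> * (1 + 2 * real n * K)" using \<delta>(1) by simp
      also have "\<dots> = \<delta> + (\<delta> * (2 * K)) * n" by (simp add: algebra_simps)
      finally have "\<delta> * real (length (leaf_form ?f ?L st)) + C \<le> \<epsilon> * real n + C1" unfolding \<delta>(2) by (simp add: C1_def)
      then have "real t \<le> 2 powr (\<epsilon> * real n + C1)" by (intro order_trans[OF t(1)] powr_mono) auto
      then show ?thesis using below t(2) by blast
    qed
    from solve_finishes[OF \<theta> \<theta>T k(1) kT this] show ?thesis using T by blast
  qed
  moreover have "C1 \<ge> 0" using \<delta> C by (simp add: C1_def)
  ultimately show ?thesis by blast
qed

text \<open>The machine knows no rate and tries the budgets 0, 1, 2 and so on; it stops at the first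
  that works, which is at most the one that the analysis provides. Its time is polynomial in that
  budget and in the input length.\<close>

lemma three_sat_machine:
  "\<exists>M'. turing_machine M' \<and> (\<forall>\<epsilon>>0. \<exists>C\<ge>0. \<forall>n \<phi>. (n, \<phi>) \<in> three_sat_instances \<longrightarrow>
     (\<exists>t. real t \<le> 2 powr (\<epsilon> * real n + C) \<and>
       fst (tm_run M' (encode_cnf (n, \<phi>)) t) = (if satisfiable \<phi> then accept_state else reject_state)))"
proof -
  obtain M' q where M': "turing_machine M'" and run: "\<And>x n. fst (solve M s (x, n)) \<Longrightarrow> (\<forall>j<n. \<not> fst (solve M s (x, j))) \<Longrightarrow>
     \<exists>t \<le> (length x + n + 2) ^ q. fst (tm_run M' x t) = (if snd (solve M s (x, n)) then accept_state else reject_state)"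
    using pt_search_machine[OF pt_solve[of M s]] by blast
  have "\<exists>C\<ge>0. \<forall>n \<phi>. (n, \<phi>) \<in> three_sat_instances \<longrightarrow>
     (\<exists>t. real t \<le> 2 powr (\<epsilon> * real n + C) \<and>
       fst (tm_run M' (encode_cnf (n, \<phi>)) t) = (if satisfiable \<phi> then accept_state else reject_state))" if \<epsilon>: "\<epsilon> > 0" for \<epsilon>
  proof -
    \<comment> \<open>The exponent of the search machine multiplies the rate by
      \<open>q\<close>.\<close>
    define e where "e = \<epsilon> / (real q + 1)"
    have e: "e > 0" "real q * e \<le> \<epsilon>" using \<epsilon> by (auto simp: e_def field_simps)
    obtain C1 where C1: "C1 \<ge> 0" "\<And>n \<phi>. (n, \<phi>) \<in> three_sat_instances \<Longrightarrow>
      \<exists>T. real T \<le> 2 powr (e * real n + C1) \<and> fst (solve M s (encode_cnf (n, \<phi>), T))" using solve_time[OF e(1)] by blast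
    obtain C2 where C2: "C2 \<ge> 0" "\<And>n. real (n + 1) ^ 4 \<le> 2 powr (e * real n + C2)" using power_le_powr[OF e(1), of 4] by blast
    define C where "C = C1 + C2 + 10"
    have "\<exists>t. real t \<le> 2 powr (\<epsilon> * real n + real q * C) \<and>
       fst (tm_run M' (encode_cnf (n, \<phi>)) t) = (if satisfiable \<phi> then accept_state else reject_state)"
      if i: "(n, \<phi>) \<in> three_sat_instances" for n \<phi>
    proof -
      define x where "x = encode_cnf (n, \<phi>)"
      obtain T0 where T0: "real T0 \<le> 2 powr (e * real n + C1)" "fst (solve M s (x, T0))" using C1(2)[OF i] unfolding x_def by blast
      define T where "T = (LEAST T. fst (solve M s (x, T)))"
      have T: "fst (solve M s (x, T))" "\<forall>j<T. \<not> fst (solve M s (x, j))" "T \<le> T0"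
        unfolding T_def using LeastI[of "\<lambda>T. fst (solve M s (x, T))", OF T0(2)]
          not_less_Least Least_le[of "\<lambda>T. fst (solve M s (x, T))", OF T0(2)] by auto
      obtain t where t: "t \<le> (length x + T + 2) ^ q"
        "fst (tm_run M' x t) = (if snd (solve M s (x, T)) then accept_state else reject_state)"
        using run[OF T(1,2)] by blast
      let ?B = "2 powr (e * real n + (C1 + C2))"
      have B: "2 powr (e * real n + C1) \<le> ?B" "2 powr (e * real n + C2) \<le> ?B" "1 \<le> ?B"
        using e C1(1) C2(1) by (auto intro!: powr_mono ge_one_powr_ge_zero)
      have "real (length x) \<le> real (321 * (n + 1) ^ 4)" unfolding x_def using encode_cnf_length[OF i] by (simp only: of_nat_le_iff)
      also have "\<dots> = 321 * real (n + 1) ^ 4" by simp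
      also have "\<dots> \<le> 321 * ?B" using order_trans[OF C2(2)[of n] B(2)] by (rule mult_left_mono) simp
      finally have "real (length x + T + 2) \<le> 321 * ?B + ?B + 2 * ?B"
        using T0(1) of_nat_mono[OF T(3), where 'a = real] B(1,3) by (simp only: of_nat_add of_nat_numeral)
      \<comment> \<open>The constants add up to 324, below \<open>2 ^ 10\<close>, which explains the
        10 in \<open>C\<close>.\<close>
      also have "\<dots> \<le> 2 ^ 10 * ?B" using B(3) by simp
      also have "\<dots> = 2 powr (e * real n + C)" by (simp add: C_def powr_add)
      finally have "real (length x + T + 2) ^ q \<le> (2 powr (e * real n + C)) ^ q" by (rule power_mono) simp
      also have "\<dots> = 2 powr ((e * real n + C) * q)" by (simp add: powr_power mult.commute)
      also have "\<dots> \<le> 2 powr (\<epsilon> * real n + real q * C)"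
        using mult_right_mono[OF e(2), of "real n"] by (intro powr_mono) (auto simp: algebra_simps)
      finally have "real t \<le> 2 powr (\<epsilon> * real n + real q * C)" using t(1) by (metis of_nat_le_iff of_nat_power order_trans)
      moreover have "snd (solve M s (x, T)) \<longleftrightarrow> satisfiable \<phi>" using solve_correct[OF i] T(1) unfolding x_def by blast
      ultimately show ?thesis using t(2) unfolding x_def by auto
    qed
    moreover have "real q * C \<ge> 0" using C1(1) C2(1) by (simp add: C_def)
    ultimately show ?thesis by blast
  qed
  then show ?thesis using M' by blast
qed

text \<open>Bounds for every \<epsilon> have to be merged into one function in \<open>o(n)\<close>.
  It is the logarithm of the worst halting time on \<open>n\<close> variables, which is below every
  linear function with positive slope up to an additive constant, and hence sublinear. It need not
  be computable.\<close>

lemma not_ETH: "\<not> ETH"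
proof -
  obtain M' where M': "turing_machine M'" and fast': "\<And>\<epsilon>. \<epsilon> > 0 \<Longrightarrow> \<exists>C\<ge>0. \<forall>n \<phi>. (n, \<phi>) \<in> three_sat_instances \<longrightarrow>
     (\<exists>t. real t \<le> 2 powr (\<epsilon> * real n + C) \<and>
       fst (tm_run M' (encode_cnf (n, \<phi>)) t) = (if satisfiable \<phi> then accept_state else reject_state))"
    using three_sat_machine by blast
  define ok where "ok n \<phi> t \<longleftrightarrow> fst (tm_run M' (encode_cnf (n, \<phi>)) t) = (if satisfiable \<phi> then accept_state else reject_state)" for n \<phi> t
  define \<tau> where "\<tau> n \<phi> = (LEAST t. ok n \<phi> t)" for n \<phi>
  define S where "S n = \<tau> n ` {\<phi>. (n, \<phi>) \<in> three_sat_instances}" for n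
  \<comment> \<open>Adding 1 keeps the logarithm nonnegative, so an upper bound on \<open>f\<close>
    also bounds its absolute value.\<close>
  define f where "f n = log 2 (real (Max (S n)) + 1)" for n
  have bound: "\<exists>C\<ge>0. \<forall>n \<phi>. (n, \<phi>) \<in> three_sat_instances \<longrightarrow> real (\<tau> n \<phi>) \<le> 2 powr (\<epsilon> * real n + C) \<and> ok n \<phi> (\<tau> n \<phi>)"
    if \<epsilon>: "\<epsilon> > 0" for \<epsilon>
  proof -
    obtain C where C: "C \<ge> 0" "\<And>n \<phi>. (n, \<phi>) \<in> three_sat_instances \<Longrightarrow> \<exists>t. real t \<le> 2 powr (\<epsilon> * real n + C) \<and> ok n \<phi> t"
      using fast'[OF \<epsilon>] unfolding ok_def by blast
    have "real (\<tau> n \<phi>) \<le> 2 powr (\<epsilon> * real n + C) \<and> ok n \<phi> (\<tau> n \<phi>)" if i: "(n, \<phi>) \<in> three_sat_instances" for n \<phi>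
    proof -
      obtain t where t: "real t \<le> 2 powr (\<epsilon> * real n + C)" "ok n \<phi> t" using C(2)[OF i] by blast
      have "\<tau> n \<phi> \<le> t" "ok n \<phi> (\<tau> n \<phi>)" unfolding \<tau>_def using t(2) by (auto intro: Least_le LeastI)
      then show ?thesis using t(1) by linarith
    qed
    then show ?thesis using C(1) by blast
  qed
  \<comment> \<open>There may be infinitely many formulas, since empty-tailed lists aside,
    finiteness here comes from the uniform time bound; it guarantees that the maximum
    exists.\<close>
  have fin: "finite (S n)" for n
  proof -
    obtain C where C: "\<And>n \<phi>. (n, \<phi>) \<in> three_sat_instances \<Longrightarrow> real (\<tau> n \<phi>) \<le> 2 powr (1 * real n + C)"
      using bound[of 1] by auto
    have "S n \<subseteq> {..nat \<lfloor>2 powr (1 * real n + C)\<rfloor>}" unfolding S_def using C by (auto intro!: le_nat_floor)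
    then show ?thesis using finite_subset by blast
  qed
  have ne: "S n \<noteq> {}" for n
  proof -
    have "(n, []) \<in> three_sat_instances" by (simp add: three_sat_instances_def)
    then show ?thesis by (auto simp: S_def)
  qed
  have f0: "f n \<ge> 0" for n by (simp add: f_def)
  have "f \<in> o(\<lambda>n. real n)"
  proof (rule landau_o.smallI)
    fix c :: real assume c: "c > 0"
    \<comment> \<open>Half of the slope is kept in reserve to swallow the additive constant for
      large \<open>n\<close>.\<close>
    obtain C where C: "C \<ge> 0" "\<And>n \<phi>. (n, \<phi>) \<in> three_sat_instances \<Longrightarrow> real (\<tau> n \<phi>) \<le> 2 powr (c / 2 * real n + C)"
      using bound[of "c / 2"] c by auto
    have fn: "f n \<le> c / 2 * real n + (C + 1)" for n
    proof -
      have "Max (S n) \<in> S n" using fin ne by simp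
      then have "real (Max (S n)) \<le> 2 powr (c / 2 * real n + C)" using C(2) by (auto simp: S_def)
      moreover have "1 \<le> 2 powr (c / 2 * real n + C)" using C(1) c by (intro ge_one_powr_ge_zero) auto
      ultimately have "real (Max (S n)) + 1 \<le> 2 powr (c / 2 * real n + (C + 1))" by (simp add: powr_add)
      then have "f n \<le> log 2 (2 powr (c / 2 * real n + (C + 1)))" unfolding f_def by (intro log_mono) auto
      then show ?thesis by simp
    qed
    have "norm (f n) \<le> c * norm (real n)" if "n \<ge> nat \<lceil>2 * (C + 1) / c\<rceil>" for n
    proof -
      have "2 * (C + 1) / c \<le> real n" using that by linarith
      then have "C + 1 \<le> c / 2 * real n" using c by (simp add: field_simps)
      then show ?thesis using fn[of n] f0[of n] by simp
    qed
    then show "eventually (\<lambda>n. norm (f n) \<le> c * norm (real n)) at_top" unfolding eventually_at_top_linorder by blast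
  qed
  moreover have "solvable_within encode_cnf three_sat_instances (\<lambda>(n, \<phi>). satisfiable \<phi>) (\<lambda>(n, \<phi>). 2 powr f n)"
    unfolding solvable_within_def
  proof (intro exI[of _ M'] conjI M' ballI)
    fix x assume x: "x \<in> three_sat_instances"
    obtain n \<phi> where x': "x = (n, \<phi>)" by (cases x)
    have i: "(n, \<phi>) \<in> three_sat_instances" using x x' by simp
    have "\<tau> n \<phi> \<le> Max (S n)" using i fin by (intro Max_ge) (auto simp: S_def)
    then have "real (\<tau> n \<phi>) \<le> 2 powr f n" by (simp add: f_def)
    moreover have "ok n \<phi> (\<tau> n \<phi>)" using bound[of 1] i by auto
    ultimately show "\<exists>t. real t \<le> (case x of (n, \<phi>) \<Rightarrow> 2 powr f n) \<and>
      fst (tm_run M' (encode_cnf x) t) = (if case x of (n, \<phi>) \<Rightarrow> satisfiable \<phi> then accept_state else reject_state)"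
      unfolding x' ok_def by (intro exI[of _ "\<tau> n \<phi>"]) simp
  qed
  ultimately show ?thesis unfolding ETH_def by blast
qed

end

section \<open>The two running times of the theorem\<close>

lemma subexp_size_fast:
  assumes s: "s \<ge> 1" and Y: "subexp_size_solvable Y"
    and above: "\<And>x. x \<in> K4_free_instances \<Longrightarrow> diamond_free_edge_deletion s x \<Longrightarrow> Y x"
    and below: "\<And>x. x \<in> K4_free_instances \<Longrightarrow> Y x \<Longrightarrow> diamond_free_edge_editing s x"
  shows "\<not> ETH"
proof -
  obtain f M where f: "f \<in> o(\<lambda>n. real n)" and M: "turing_machine M"
    and run: "\<And>G k. (G, k) \<in> K4_free_instances \<Longrightarrow> \<exists>t. real t \<le> 2 powr f (card (verts G)) \<and>
      fst (tm_run M (encode_instance (G, k)) t) = (if Y (G, k) then accept_state else reject_state)"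
    using Y unfolding subexp_size_solvable_def solvable_within_def by fastforce
  have "fast_decider M s Y"
  proof (unfold_locales)
    fix \<delta> :: real assume \<delta>: "\<delta> > 0"
    obtain C where C: "C \<ge> 0" "\<And>n. f n \<le> \<delta> * real n + C" using smallo_linear_bound[OF f \<delta>] by blast
    have "\<exists>t. real t \<le> 2 powr (\<delta> * (real (card (verts G)) + real k) + C) \<and>
      fst (tm_run M (encode_instance (G, k)) t) = (if Y (G, k) then accept_state else reject_state)"
      if "(G, k) \<in> K4_free_instances" for G k
    proof -
      have "0 \<le> \<delta> * real k" using \<delta> by simp
      then have "f (card (verts G)) \<le> \<delta> * (real (card (verts G)) + real k) + C"
        using C(2)[of "card (verts G)"] by (simp add: distrib_left)
      then have "2 powr f (card (verts G)) \<le> 2 powr (\<delta> * (real (card (verts G)) + real k) + C)" by (intro powr_mono) auto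
      then show ?thesis using run[OF that] order_trans by blast
    qed
    then show "\<exists>C\<ge>0. \<forall>x\<in>K4_free_instances. \<exists>t. real t \<le> 2 powr (\<delta> * (real (card (verts (fst x))) + real (snd x)) + C) \<and>
      fst (tm_run M (encode_instance x) t) = (if Y x then accept_state else reject_state)"
      using C(1) by (intro exI[of _ C]) force
  qed (use M s above below in blast)+
  then show ?thesis by (rule fast_decider.not_ETH)
qed

text \<open>The polynomial factor is itself subexponential in the number of vertices, and
  \<open>fast_decider\<close> measures vertices and budget together.\<close>

lemma subexp_param_fast:
  assumes s: "s \<ge> 1" and Y: "subexp_param_solvable Y"
    and above: "\<And>x. x \<in> K4_free_instances \<Longrightarrow> diamond_free_edge_deletion s x \<Longrightarrow> Y x"
    and below: "\<And>x. x \<in> K4_free_instances \<Longrightarrow> Y x \<Longrightarrow> diamond_free_edge_editing s x"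
  shows "\<not> ETH"
proof -
  obtain f c M where f: "f \<in> o(\<lambda>n. real n)" and M: "turing_machine M"
    and run: "\<And>G k. (G, k) \<in> K4_free_instances \<Longrightarrow> \<exists>t. real t \<le> 2 powr f k * real (card (verts G) + 1) ^ c \<and>
      fst (tm_run M (encode_instance (G, k)) t) = (if Y (G, k) then accept_state else reject_state)"
    using Y unfolding subexp_param_solvable_def solvable_within_def by fastforce
  have "fast_decider M s Y"
  proof (unfold_locales)
    fix \<delta> :: real assume \<delta>: "\<delta> > 0"
    obtain C where C: "C \<ge> 0" "\<And>n. f n \<le> \<delta> * real n + C" using smallo_linear_bound[OF f \<delta>] by blast
    obtain D where D: "D \<ge> 0" "\<And>n. real (n + 1) ^ c \<le> 2 powr (\<delta> * real n + D)" using power_le_powr[OF \<delta>] by blast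
    have "\<exists>t. real t \<le> 2 powr (\<delta> * (real (card (verts G)) + real k) + (C + D)) \<and>
      fst (tm_run M (encode_instance (G, k)) t) = (if Y (G, k) then accept_state else reject_state)"
      if "(G, k) \<in> K4_free_instances" for G k
    proof -
      have "2 powr f k * real (card (verts G) + 1) ^ c \<le> 2 powr (\<delta> * k + C) * 2 powr (\<delta> * card (verts G) + D)"
        using C(2)[of k] D(2)[of "card (verts G)"] by (intro mult_mono powr_mono) auto
      also have "\<dots> = 2 powr (\<delta> * (real (card (verts G)) + real k) + (C + D))"
        by (simp add: algebra_simps flip: powr_add)
      finally show ?thesis using run[OF that] order_trans by blast
    qed
    then show "\<exists>C\<ge>0. \<forall>x\<in>K4_free_instances. \<exists>t. real t \<le> 2 powr (\<delta> * (real (card (verts (fst x))) + real (snd x)) + C) \<and>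
      fst (tm_run M (encode_instance x) t) = (if Y x then accept_state else reject_state)"
      using C(1) D(1) by (intro exI[of _ "C + D"]) force
  qed (use M s above below in blast)+
  then show ?thesis by (rule fast_decider.not_ETH)
qed

theorem theorem2:
  fixes s :: nat
  assumes "s \<ge> 1"
  shows "NP_complete (K4_free_language (diamond_free_edge_deletion s)) \<and>
         NP_complete (K4_free_language (diamond_free_edge_editing s)) \<and>
         (ETH \<longrightarrow>
            \<not> subexp_size_solvable (diamond_free_edge_deletion s) \<and>
            \<not> subexp_param_solvable (diamond_free_edge_deletion s) \<and>
            \<not> subexp_size_solvable (diamond_free_edge_editing s) \<and>
            \<not> subexp_param_solvable (diamond_free_edge_editing s))"
  using NP_complete_deletion[OF assms] NP_complete_editing[OF assms] instance_deletion_imp_editing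
    subexp_size_fast[OF assms] subexp_param_fast[OF assms] by blast

end
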